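(* In the setting of the context (reducible case $\rho_1=\mu_{q-1}$, $\rho_2=\mu_q$), for $1\le i\le p$, $1\le k\le r_i$, $1\le h\le\ell_{i,k}$ one has, for $x\in\mathcal S_i^{\pm}$, $$U''_{t_i,k,h}(x)=\sum_{\tilde k=1}^{q-2}\sum_{\tilde h=1}^{m_{\tilde k}}C^{\prime\prime\pm}_{t_{p+1},\tilde k,\tilde h;t_i,k,h}\,U''_{t_{p+1},\tilde k,\tilde h}(x)+\mathrm{hol}(x-t_{p+1})$$ with $$C^{\prime\prime\pm}_{t_{p+1},\tilde k,\tilde h;t_i,k,h}=e^{\pm\pi\sqrt{-1}\lambda_{i,k}}(t_i-t_{p+1})^{2\lambda_{i,k}-\mu_{q-1}-\mu_q}\frac{\Gamma(\mu_{\tilde k}+1)\Gamma(\mu_{\tilde k}-\mu_{q-1}-\mu_q)}{\Gamma(\mu_{\tilde k}-\mu_{q-1})\Gamma(\mu_{\tilde k}-\mu_q)}\,c_{\infty,\tilde k,\tilde h;t'_i,k,h}\quad(1\le\tilde k\le q-2,\ 1\le\tilde h\le m_{\tilde k}),$$ where the double signs correspond.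
   Context: **System.** Let $t_1,\dots,t_{p+1}\in\mathbb C$ be distinct, no three on a straight line; $T=\mathrm{diag}(t_1I_{n_1},\dots,t_pI_{n_p})$, $n=n_1+\dots+n_p$. Let $A\in M(n;\mathbb C)$, partitioned in blocks $A_{ij}$ like $T$, have diagonal blocks $A_{ii}=\mathrm{diag}(\lambda_{i,1}I_{\ell_{i,1}},\dots,\lambda_{i,r_i}I_{\ell_{i,r_i}})$ ($\lambda_{i,k}$ distinct for fixed $i$), and let $P\in GL(n;\mathbb C)$ be such that $A'=P^{-1}AP=\mathrm{diag}(\mu_1I_{m_1},\dots,\mu_qI_{m_q})$ ($\mu_k$ distinct, $q\ge2$). Let $\rho_1=\mu_{q-1}$, $\rho_2=\mu_q$. Put $$\mathcal A_P=\begin{pmatrix}A&P\\-(A'-\rho_1I_n)(A'-\rho_2I_n)P^{-1}&(\rho_1+\rho_2)I_n-A'\end{pmatrix}.$$ Then $\mathcal A_P=\begin{pmatrix}\mathcal A''_P&*\\O&\mathrm{diag}(\mu_qI_{m_{q-1}},\mu_{q-1}I_{m_q})\end{pmatrix}$ with $\mathcal A''_P\in M(N;\mathbb C)$, $N=2n-m_{q-1}-m_q$. The system considered is $$(xI_{N}-\mathcal T'')\frac{dU''}{dx}=\mathcal A''_PU'',\qquad \mathcal T''=\begin{pmatrix}T&\\&t_{p+1}I_{n-m_{q-1}-m_q}\end{pmatrix}.$$ **Assumptions.** None of the following is an integer: $\lambda_{i,k}$; $\lambda_{i,k}-\lambda_{i,h}$ ($k\ne h$); $\mu_k$; $\mu_k-\mu_h$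 ($k\neq h$); $\lambda_{i,k}-\mu_h$ (all admissible indices). **Sectors.** Arguments $\theta_i=\arg(t_i-t_{p+1})$ are fixed with $\theta_1<\dots<\theta_p<\theta_1+2\pi$, and $\theta_{p+1}$ is a fixed real number with $\theta_p<\theta_{p+1}<\theta_1+2\pi$; $\theta_0=\theta_{p+1}-2\pi$. With $\delta>0$ fixed and sufficiently small, $\mathcal S_i^+=\{\theta_i<\arg(x-t_{p+1})<\min(\theta_{i+1}-\delta,\theta_i+\pi)\}$, $\mathcal S_i^-=\{\max(\theta_{i-1}+\delta,\theta_i-\pi)<\arg(x-t_{p+1})<\theta_i\}$ ($1\le i\le p$). In $\mathcal S_i^\pm$ powers of $x-t_{p+1}$ use this argument; $\arg(x-t_i)\in(\theta_i,\theta_i+\pi)$ in $\mathcal S_i^+$ and $\in(\theta_i-\pi,\theta_i)$ in $\mathcal S_i^-$. Powers of $t_i-t_{p+1}$ use $\arg=\theta_i$. **Local solutions.** $\varepsilon_m(k)$ is the $k$-th unit $m$-vector. The following are the unique solutions of the system of the given form (convergent series), continued analytically in the sectors: $U''_{t_i,k,h}(x)=(x-t_i)^{\lambda_{i,k}}\{\varepsilon_{N}(n_1+\dots+n_{i-1}+\ell_{i,1}+\dots+\ell_{i,k-1}+h)+\sum_{m\ge1}G''(m)(x-t_i)^m\}$ ($1\le i\le p$); $U''_{t_{p+1},k,h}(x)=(x-t_{p+1})^{\mu_{q-1}+\mu_q-\mu_k}\{\varepsilon_{N}(n+m_1+\dots+m_{k-1}+h)+\sum_{m\ge1}G''(m)(x-t_{p+1})^m\}$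 ($1\le k\le q-2$, $1\le h\le m_k$). $\mathrm{hol}(x-a)$ denotes a vector function holomorphic in a neighbourhood of $x=a$. **Underlying system.** Fix $\eta_0\in\mathbb C$; $t'_i=\eta_0+\frac1{t_i-t_{p+1}}$, $T'=\mathrm{diag}(t'_1I_{n_1},\dots,t'_pI_{n_p})$, $\theta'_i=\arg(t'_i-\eta_0)=-\theta_i$, $\theta'_\infty=-\theta_{p+1}$. The underlying system is $(\zeta I_n-T')\frac{dw}{d\zeta}=(\rho I_n+A)w$. For $\rho=0$ it has the unique solutions $w_{t'_i,k,h}(0;\zeta)=(\zeta-t'_i)^{\lambda_{i,k}}\{\varepsilon_n(n_1+\dots+n_{i-1}+\ell_{i,1}+\dots+\ell_{i,k-1}+h)+O(\zeta-t'_i)\}$ near $t'_i$ and $w_{\infty,k,h}(0;\zeta)=(\zeta-\eta_0)^{\mu_k}\{P\varepsilon_n(m_1+\dots+m_{k-1}+h)+O((\zeta-\eta_0)^{-1})\}$ near $\infty$ ($O$-terms convergent power series). Let $$\check{\mathcal P}'=\mathbb C\setminus\Bigl(\bigcup_{i=1}^p\{\eta_0+(t'_i-\eta_0)s:0\le s\le1\}\cup\{\eta_0+se^{\sqrt{-1}\theta'_\infty}:s\ge0\}\Bigr),$$ with branches $\arg(\zeta-\eta_0)\in(\theta'_\infty,\theta'_\infty+2\pi)$ and, near $t'_i$, $\arg(\zeta-t'_i)\in(\theta'_i-\pi,\theta'_i+\pi)$. The constants $c_{\infty,\tilde k,\tilde h;t'_i,k,h}$ are the connection coefficients of the underlying system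 with $\rho=0$, defined in $\check{\mathcal P}'$ by $w_{t'_i,k,h}(0;\zeta)=\sum_{\tilde k=1}^q\sum_{\tilde h=1}^{m_{\tilde k}}c_{\infty,\tilde k,\tilde h;t'_i,k,h}\,w_{\infty,\tilde k,\tilde h}(0;\zeta)$.
   Formalization: The formal theorem also assumes that μ_{q-1}+μ_q−μ_k is not an integer for 1≤k≤q−2; otherwise either Γ(μ_k−μ_{q-1}−μ_q) is at a pole or the solution U'' at t_{p+1} of the given form does not exist. *)

theory Defs
  imports "HOL-Analysis.Analysis" "Jordan_Normal_Form.Matrix"
begin

text \<open>
  Dimensions are natural numbers that vary with the block sizes, so vectors and matrices are
  those of Jordan_Normal_Form, whose entries are numbered from 0.  All block indices (of the points
  \<open>t\<^sub>i\<close>, the eigenvalues, the multiplicities) run from 1, and \<open>eps m k\<close> translates.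
\<close>

definition eps :: "nat \<Rightarrow> nat \<Rightarrow> complex vec" where
  "eps m k = unit_vec m (k - 1)"

text \<open>\<open>diag(c\<^sub>1 I, \<dots>, c\<^sub>r I)\<close> with \<open>k\<close>-th block of size \<open>s k\<close>.\<close>

definition block_scalar :: "nat \<Rightarrow> (nat \<Rightarrow> nat) \<Rightarrow> (nat \<Rightarrow> complex) \<Rightarrow> complex mat" where
  "block_scalar r s c = diag_block_mat (map (\<lambda>k. c k \<cdot>\<^sub>m 1\<^sub>m (s k)) [1..<r+1])"

text \<open>The \<open>d \<times> d\<close> diagonal block of \<open>M\<close> whose upper left entry has (0-based) index \<open>(l, l)\<close>.\<close>

definition diag_subblock :: "complex mat \<Rightarrow> nat \<Rightarrow> nat \<Rightarrow> complex mat" where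
  "diag_subblock M l d = mat d d (\<lambda>(a, b). M $$ (l + a, l + b))"

text \<open>The \<open>\<mu>\<close>-th power of \<open>z \<noteq> 0\<close> for the value \<open>\<phi>\<close> of \<open>arg z\<close>; below, \<open>\<phi>\<close> is the value of
  \<open>arg z\<close> in \<open>[\<alpha>, \<alpha> + 2\<pi>)\<close>.\<close>

definition pow_arg :: "real \<Rightarrow> complex \<Rightarrow> complex \<Rightarrow> complex" where
  "pow_arg \<phi> z \<mu> = exp (\<mu> * (of_real (ln (norm z)) + \<i> * of_real \<phi>))"

definition arg_from :: "real \<Rightarrow> complex \<Rightarrow> real" where
  "arg_from \<alpha> z = \<alpha> + Arg2pi (z * cis (- \<alpha>))"

definition pow_from :: "real \<Rightarrow> complex \<Rightarrow> complex \<Rightarrow> complex" where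
  "pow_from \<alpha> z \<mu> = pow_arg (arg_from \<alpha> z) z \<mu>"

text \<open>\<open>{x. a < arg (x - c) < b}\<close>\<close>

definition sector :: "complex \<Rightarrow> real \<Rightarrow> real \<Rightarrow> complex set" where
  "sector c a b = {c + rcis r \<phi> | r \<phi>. 0 < r \<and> a < \<phi> \<and> \<phi> < b}"

text \<open>\<open>u\<close> is a solution of \<open>(x I - T) du/dx = A u\<close> on (the open set) \<open>D\<close>; in particular it is
  holomorphic there.\<close>

definition solves_system ::
    "complex mat \<Rightarrow> complex mat \<Rightarrow> complex set \<Rightarrow> (complex \<Rightarrow> complex vec) \<Rightarrow> bool" where
  "solves_system T A D u \<longleftrightarrow>
     (\<forall>x\<in>D. u x \<in> carrier_vec (dim_row A) \<and>
       (\<exists>u' \<in> carrier_vec (dim_row A).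
          (\<forall>j < dim_row A. ((\<lambda>y. u y $ j) has_field_derivative u' $ j) (at x)) \<and>
          (x \<cdot>\<^sub>m 1\<^sub>m (dim_row A) - T) *\<^sub>v u' = A *\<^sub>v u x))"

text \<open>\<open>u x = f x {v + \<Sum>\<^sub>m\<^sub>\<ge>\<^sub>1 G m (z x)\<^sup>m}\<close>, a convergent series, for all \<open>x \<in> D\<close> at which the local
  coordinate \<open>z x\<close> is small: \<open>z x = x - a\<close> near \<open>a\<close>, and \<open>z x = 1 / (x - a)\<close> near \<open>\<infinity>\<close>.
  The prefactor \<open>f\<close> is a branch of a power.\<close>

definition local_form :: "complex set \<Rightarrow> (complex \<Rightarrow> complex) \<Rightarrow> (complex \<Rightarrow> complex) \<Rightarrow> complex vec
    \<Rightarrow> (complex \<Rightarrow> complex vec) \<Rightarrow> bool" where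
  "local_form D z f v u \<longleftrightarrow>
     (\<exists>r > 0. \<exists>G :: nat \<Rightarrow> complex vec. G 0 = v \<and> (\<forall>m. G m \<in> carrier_vec (dim_vec v)) \<and>
       (\<forall>x\<in>D. norm (z x) < r \<longrightarrow>
          (\<forall>j < dim_vec v. (\<lambda>m. f x * (G m $ j * z x ^ m)) sums (u x $ j))))"

end

theory Submission
  imports Defs "HOL-Complex_Analysis.Complex_Analysis"
begin

text \<open>
  Put \<open>x = t\<^sub>p\<^sub>+\<^sub>1 + a z\<close> with \<open>a = t\<^sub>i - t\<^sub>p\<^sub>+\<^sub>1\<close>, so that \<open>t\<^sub>i\<close> and \<open>t\<^sub>p\<^sub>+\<^sub>1\<close> become \<open>1\<close> and \<open>0\<close>, and
  \<open>\<zeta> = \<eta>\<^sub>0 + 1/(a z)\<close>.  The underlying system turns into a first order system for \<open>y\<^sub>l = w\<^sub>l/\<sigma>\<^sub>l\<close> with the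
  singular points \<open>\<sigma>\<^sub>l\<close>.  Let \<open>I\<^sup>\<beta>\<close> be the fractional integral of order \<open>\<beta>\<close> based at \<open>z = 1\<close>.  Then
  \<open>u = I\<^sup>1\<^sup>+\<^sup>\<rho>\<^sup>2 z\<^sup>\<rho>\<^sup>1\<^sup>+\<^sup>1 I\<^sup>-\<^sup>1\<^sup>-\<^sup>\<rho>\<^sup>2 z\<^sup>\<rho>\<^sup>2 y\<close> satisfies the second order system that the first \<open>n\<close>
  components of \<open>U''\<close> satisfy after elimination of the others.  At \<open>1\<close> the solutions of this system of the
  form \<open>(1 - z)\<^sup>\<lambda> g(z)\<close> are determined by \<open>g(1)\<close>, so \<open>u\<close> is a multiple of \<open>U''\<close>.  At \<open>0\<close>, \<open>I\<^sup>\<beta>\<close> maps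
  \<open>z\<^sup>s\<close> to \<open>\<Gamma>(- s - \<beta>)/\<Gamma>(- s) z\<^sup>s\<^sup>+\<^sup>\<beta>\<close> up to a holomorphic function; the holomorphic function produced by
  the inner transform vanishes, since no \<open>\<mu>\<^sub>k\<close> is an integer.  Hence the expansion of \<open>y\<close> in the solutions
  at infinity of the underlying system becomes the asserted expansion of \<open>U''\<close>.  The terms belonging
  to \<open>\<mu>\<^sub>q\<^sub>-\<^sub>1 = \<rho>\<^sub>1\<close> and \<open>\<mu>\<^sub>q = \<rho>\<^sub>2\<close> drop out because \<open>1/\<Gamma>\<close> vanishes at \<open>0\<close>.
\<close>

section \<open>Fractional integrals of power series\<close>

text \<open>A fractional integral multiplies the coefficients of expansions at \<open>1\<close> and
  at \<open>0\<close> by Gamma quotients, and a power of \<open>z\<close> only shifts the constant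
  in \<open>\<theta> + p\<close>. So the differential equations are never checked under an integral
  sign: recursions of coefficients are compared, which also covers parameters for which the
  integrals diverge. Write \<open>a = t_i - t_(p+1)\<close>. Then
  \<open>x - t_i = a (z - 1)\<close>, \<open>\<zeta> - t'_i = (1 - z)/(a z)\<close> and
  \<open>\<zeta> - \<eta>0 = 1/(a z)\<close>. The normalisations at \<open>1\<close> contribute
  \<open>exp (+- \<pi> \<i> \<lambda>) a^(2 \<lambda>)\<close>, those at \<open>0\<close> contribute
  \<open>a^(- \<rho>1 - \<rho>2)\<close>. The Gamma factor is the product of the two multipliers and
  of \<open>\<mu> - \<rho>1 - \<rho>2 - 1\<close>, which ties the leading vector in the lower block
  to the next coefficient of the upper block. The work takes place in a thin convex neighbourhood of
  the segment from \<open>0\<close> to \<open>1\<close>. It is thin in order to avoid the other cuts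
  of the underlying system, and it reaches beyond \<open>1\<close> because the transforms need
  functions holomorphic at their base point. The full sectors are reached only at the end.\<close>

lemma continuous_on_of_real_powr:
  fixes w :: complex
  assumes "0 < Re w"
  shows "continuous_on {0..} (\<lambda>v::real. of_real v powr w)"
  using assms by (intro continuous_intros) auto

lemma sums_integral_M_test:
  fixes f :: "nat \<Rightarrow> real \<Rightarrow> complex"
  assumes cont: "\<And>k. continuous_on {a..b} (f k)"
    and M: "\<And>k v. v \<in> {a..b} \<Longrightarrow> norm (f k v) \<le> M k" "summable M"
    and g: "\<And>v. v \<in> {a..b} \<Longrightarrow> (\<lambda>k. f k v) sums g v"
  shows "(\<lambda>k. integral {a..b} (f k)) sums integral {a..b} g" "g integrable_on {a..b}"
proof -
  have "uniform_limit {a..b} (\<lambda>n x. \<Sum>k<n. f k x) (\<lambda>x. \<Sum>k. f k x) sequentially"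
    by (rule Weierstrass_m_test[where M = M]) (use M in auto)
  then have ul: "uniform_limit {a..b} (\<lambda>n x. \<Sum>k<n. f k x) g sequentially"
    by (rule uniform_limit_cong'[THEN iffD1, rotated -1])
      (use g in \<open>auto simp: sums_iff\<close>)
  have c: "continuous_on {a..b} (\<lambda>x. \<Sum>k<n. f k x)" for n
    by (intro continuous_intros cont)
  obtain I J where I: "\<And>n. ((\<lambda>x. \<Sum>k<n. f k x) has_integral I n) {a..b}"
    and J: "(g has_integral J) {a..b}" and lim: "I \<longlonglongrightarrow> J"
    using uniform_limit_integral[OF ul c] by (metis sequentially_bot)
  have In: "I n = (\<Sum>k<n. integral {a..b} (f k))" for n
    using I[of n] integral_sum[of "{..<n}" f "{a..b}"] cont
    by (metis (no_types, lifting) finite_lessThan integrable_continuous_real integral_unique)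
  have "(\<lambda>n. \<Sum>k<n. integral {a..b} (f k)) \<longlonglongrightarrow> J"
    using lim by (simp add: In[abs_def])
  with J show "(\<lambda>k. integral {a..b} (f k)) sums integral {a..b} g" "g integrable_on {a..b}"
    by (auto simp: sums_def integral_unique has_integral_integrable)
qed

lemma has_integral_of_real_powr:
  fixes e :: complex
  assumes "0 \<le> a" "a \<le> b" "e \<noteq> 0" "a > 0 \<or> Re e > 0"
  shows "((\<lambda>v::real. of_real v powr (e - 1)) has_integral (of_real b powr e - of_real a powr e) / e) {a..b}"
proof -
  have "((\<lambda>v::real. of_real v powr (e - 1)) has_integral
     of_real b powr e / e - of_real a powr e / e) {a..b}"
  \<comment> \<open>Differentiability is required only in the interior. This admits
    \<open>a = 0\<close>, where the power is continuous for \<open>Re e > 0\<close> but need not be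
    differentiable.\<close>
  proof (rule fundamental_theorem_of_calculus_interior)
    have "continuous_on {a..b} (\<lambda>v::real. of_real v powr e)"
    proof (cases "a > 0")
      case True
      then show ?thesis
        by (intro continuous_intros) (auto simp: complex_nonpos_Reals_iff)
    next
      case False
      then show ?thesis
        by (intro continuous_on_subset[OF continuous_on_of_real_powr]) (use assms in auto)
    qed
    then show "continuous_on {a..b} (\<lambda>v::real. of_real v powr e / e)"
      by (intro continuous_intros) (use assms in auto)
    show "((\<lambda>v. of_real v powr e / e) has_vector_derivative of_real x powr (e - 1)) (at x)"
      if "x \<in> {a<..<b}" for x
    proof -
      have "((\<lambda>z. z powr e / e) has_field_derivative of_real x powr (e - 1)) (at (of_real x))"
        by (rule derivative_eq_intros refl | use that assms in \<open>force simp: complex_nonpos_Reals_iff\<close>)+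
      then show ?thesis
        by (rule has_vector_derivative_real_field)
    qed
  qed (use assms in auto)
  then show ?thesis
    by (simp add: diff_divide_distrib)
qed

text \<open>The Taylor coefficients of \<open>(1 - u)^(b - 1)\<close>, with the sign moved into the
  coefficient.\<close>

definition binom_coeff :: "complex \<Rightarrow> nat \<Rightarrow> complex" where
  "binom_coeff b j = (- 1) ^ j * ((b - 1) gchoose j)"

lemma binom_coeff_Suc: "of_nat (Suc j) * binom_coeff b (Suc j) = (1 - b + of_nat j) * binom_coeff b j"
proof -
  have "of_nat (Suc j) * ((b - 1) gchoose Suc j) = (b - 1 - of_nat j) * ((b - 1) gchoose j)"
    using gbinomial_absorb_comp[of "b - 1" j] gbinomial_absorption[of j "b - 1"]
    by (simp add: gbinomial_absorption)
  then have "(- 1) ^ j * (of_nat (Suc j) * ((b - 1) gchoose Suc j)) = (- 1) ^ j * ((b - 1 - of_nat j) * ((b - 1) gchoose j))"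
    by (rule arg_cong)
  then show ?thesis
    by (simp add: binom_coeff_def algebra_simps)
qed

text \<open>The coefficients are of size \<open>n^(-Re b)\<close>, so absolute convergence up to the
  boundary point \<open>u = 1\<close> asks for \<open>Re b > 1\<close>. This is the origin of the
  bound on \<open>b\<close> in the series arguments that follow.\<close>

lemma summable_norm_binom_coeff:
  assumes "1 < Re b"
  shows "summable (\<lambda>j. norm (binom_coeff b j))"
proof -
  have "(\<lambda>n. norm (((b - 1) gchoose n) / ((-1)^n / exp ((b - 1 + 1) * of_real (ln (real n))))))
      \<longlonglongrightarrow> norm (inverse (Gamma (- (b - 1))))"
    by (intro tendsto_norm gbinomial_asymptotic)
  then have "Bseq (\<lambda>n. norm (((b - 1) gchoose n) / ((-1)^n / exp ((b - 1 + 1) * of_real (ln (real n))))))"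
    by (intro convergent_imp_Bseq convergentI)
  then obtain K where K: "\<And>n. norm (((b - 1) gchoose n) / ((-1)^n / exp (b * of_real (ln (real n))))) \<le> K"
    by (auto simp: Bseq_def)
  show ?thesis
  proof (rule summable_comparison_test_ev)
    show "summable (\<lambda>n. K * real n powr (- Re b))"
      using assms by (intro summable_mult) (simp add: summable_real_powr_iff)
    show "\<forall>\<^sub>F n in sequentially. norm (norm (binom_coeff b n)) \<le> K * real n powr - Re b"
      using eventually_gt_at_top[of 0]
    proof eventually_elim
      case (elim n)
      have "norm ((b - 1) gchoose n) * real n powr Re b \<le> K"
        using K[of n] elim by (simp add: norm_divide norm_mult powr_def norm_power)
      then show ?case
        using elim by (simp add: binom_coeff_def norm_mult norm_power powr_minus field_simps)
    qed
  qed
qed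

text \<open>For \<open>u < 1\<close> this is the binomial series. The sum converges uniformly on the
  closed interval, so both sides are continuous at \<open>u = 1\<close> and the equality passes to
  the endpoint.\<close>

lemma sums_binom_coeff:
  fixes u :: real
  assumes b: "1 < Re b" and u: "0 \<le> u" "u \<le> 1"
  shows "(\<lambda>j. binom_coeff b j * of_real u ^ j) sums (of_real (1 - u) powr (b - 1))"
proof -
  define F where "F = (\<lambda>u::real. \<Sum>j. binom_coeff b j * of_real u ^ j)"
  have le: "norm (binom_coeff b j * of_real v ^ j) \<le> norm (binom_coeff b j)"
    if "v \<in> {0..1}" for j and v :: real
    using that by (simp add: norm_mult norm_power mult_left_le power_le_one)
  have ul: "uniform_limit {0..1} (\<lambda>n v::real. \<Sum>j<n. binom_coeff b j * of_real v ^ j) F sequentially"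
    unfolding F_def
    by (rule Weierstrass_m_test[where M = "\<lambda>j. norm (binom_coeff b j)"])
      (use le summable_norm_binom_coeff[OF b] in auto)
  have cont: "continuous_on {0..1} F"
    by (rule uniform_limit_theorem[OF _ ul]) (auto intro!: always_eventually continuous_intros)
  have eq: "F v = of_real (1 - v) powr (b - 1)" if "0 \<le> v" "v < 1" for v
  proof -
    have "(\<lambda>n. ((b - 1) gchoose n) * (- of_real v) ^ n) sums (1 + (- of_real v)) powr (b - 1)"
      by (rule gen_binomial_complex) (use that in auto)
    moreover have "((b - 1) gchoose n) * (- of_real v) ^ n = binom_coeff b n * of_real v ^ n" for n
      by (subst power_minus) (simp add: binom_coeff_def)
    ultimately show ?thesis
      by (simp add: F_def sums_iff)
  qed
  have "F u = of_real (1 - u) powr (b - 1)"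
  proof (cases "u < 1")
    case False
    then have u1: "u = 1" using u by auto
    have c2: "continuous_on {0..1} (\<lambda>v::real. of_real (1 - v) powr (b - 1))"
      by (rule continuous_on_compose2[OF continuous_on_of_real_powr]) (use b in \<open>auto intro!: continuous_intros\<close>)
    have "F 1 - of_real (1 - 1) powr (b - 1) = 0"
      by (rule continuous_constant_on_closure[where S = "{0..<1::real}"])
        (use continuous_on_diff[OF cont c2] eq in auto)
    then show ?thesis using u1 by simp
  qed (use eq u in auto)
  moreover have "summable (\<lambda>j. binom_coeff b j * of_real u ^ j)"
    by (rule summable_comparison_test'[OF summable_norm_binom_coeff[OF b]]) (use le u in auto)
  ultimately show ?thesis
    by (simp add: F_def sums_iff)
qed


section \<open>The Beta integral as a partial fraction series\<close>

lemma beta_sum_integral: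
  assumes a: "1 < Re a" and b: "1 < Re b"
  shows "(\<lambda>j. binom_coeff b j / (a + of_nat j)) sums
    integral {0..1} (\<lambda>v::real. of_real v powr (a - 1) * of_real (1 - v) powr (b - 1))"
proof -
  let ?f = "\<lambda>j (v::real). binom_coeff b j * (of_real v powr (a + of_nat j - 1))"
  have pw: "of_real v powr (a - 1) * of_real v ^ j = of_real v powr (a + of_nat j - 1)" if "0 \<le> v" for v :: real and j
  proof (cases "v = 0")
    case False
    then show ?thesis
      by (simp add: powr_diff powr_add powr_nat')
  qed auto
  have "(\<lambda>j. integral {0..1} (?f j)) sums
      integral {0..1} (\<lambda>v::real. of_real v powr (a - 1) * of_real (1 - v) powr (b - 1))"
  proof (rule sums_integral_M_test)
    show "continuous_on {0..1} (?f j)" for j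
      by (intro continuous_intros continuous_on_subset[OF continuous_on_of_real_powr]) (use a in auto)
    show "summable (\<lambda>j. norm (binom_coeff b j))"
      by (rule summable_norm_binom_coeff[OF b])
    show "norm (?f j v) \<le> norm (binom_coeff b j)" if "v \<in> {0..1}" for j v
      using that a by (auto simp: norm_mult norm_powr_real_powr intro!: mult_left_le powr_le1)
    show "(\<lambda>j. ?f j v) sums (of_real v powr (a - 1) * of_real (1 - v) powr (b - 1))" if "v \<in> {0..1}" for v
    proof -
      have "(\<lambda>j. of_real v powr (a - 1) * (binom_coeff b j * of_real v ^ j)) sums
          (of_real v powr (a - 1) * of_real (1 - v) powr (b - 1))"
        by (intro sums_mult sums_binom_coeff b) (use that in auto)
      then show ?thesis
        using pw[of v] that by (simp add: mult.left_commute mult.assoc)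
    qed
  qed
  moreover have "integral {0..1} (?f j) = binom_coeff b j / (a + of_nat j)" for j
  proof -
    have "a + of_nat j \<noteq> 0"
      using a by (auto simp: complex_eq_iff)
    then have "((\<lambda>v::real. of_real v powr (a + of_nat j - 1)) has_integral 1 / (a + of_nat j)) {0..1}"
      using has_integral_of_real_powr[of 0 1 "a + of_nat j"] a by simp
    then show ?thesis
      by (auto dest!: has_integral_mult_right[of _ _ _ "binom_coeff b j"] simp: integral_unique)
  qed
  ultimately show ?thesis
    by simp
qed

text \<open>For \<open>Re a > 1\<close> every denominator has modulus at least 1, so the
  coefficients themselves form a majorant that does not depend on \<open>a\<close>.\<close>

lemma beta_sum_holomorphic:
  assumes b: "1 < Re b"
  shows "(\<lambda>a. \<Sum>j. binom_coeff b j / (a + of_nat j)) holomorphic_on {a. 1 < Re a}"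
proof (rule holomorphic_uniform_sequence)
  show "open {a. 1 < Re a}"
    by (simp add: open_halfspace_Re_gt)
  show "(\<lambda>a. \<Sum>j<n. binom_coeff b j / (a + of_nat j)) holomorphic_on {a. 1 < Re a}" for n
    by (intro holomorphic_intros) (auto simp: complex_eq_iff)
  have ul: "uniform_limit {a. 1 < Re a} (\<lambda>n a. \<Sum>j<n. binom_coeff b j / (a + of_nat j))
     (\<lambda>a. \<Sum>j. binom_coeff b j / (a + of_nat j)) sequentially"
  proof (rule Weierstrass_m_test[OF _ summable_norm_binom_coeff[OF b]])
    fix n and a :: complex assume "a \<in> {a. 1 < Re a}"
    then have "1 \<le> norm (a + of_nat n)"
      using complex_Re_le_cmod[of "a + of_nat n"] by simp
    then have "norm (binom_coeff b n) / norm (a + of_nat n) \<le> norm (binom_coeff b n) / 1"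
      by (intro divide_left_mono) auto
    then show "norm (binom_coeff b n / (a + of_nat n)) \<le> norm (binom_coeff b n)"
      by (simp add: norm_divide)
  qed
  show "\<exists>d>0. cball x d \<subseteq> {a. 1 < Re a} \<and> uniform_limit (cball x d)
      (\<lambda>n a. \<Sum>j<n. binom_coeff b j / (a + of_nat j)) (\<lambda>a. \<Sum>j. binom_coeff b j / (a + of_nat j)) sequentially"
    if x: "x \<in> {a. 1 < Re a}" for x
  proof -
    obtain d where "d > 0" "cball x d \<subseteq> {a. 1 < Re a}"
      using open_contains_cball[THEN iffD1, OF \<open>open {a. 1 < Re a}\<close>, rule_format, OF x]
      by auto
    then show ?thesis
      by (intro exI[of _ d] conjI uniform_limit_on_subset[OF ul])
  qed
qed

lemma islimpt_of_real_image:
  assumes "x islimpt S"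
  shows "(of_real x :: complex) islimpt of_real ` S"
  using assms unfolding islimpt_sequential
proof (elim exE conjE)
  fix h :: "nat \<Rightarrow> real" assume h: "\<forall>n. h n \<in> S - {x}" "h \<longlonglongrightarrow> x"
  have "of_real (h n) \<in> of_real ` S - {of_real x :: complex}" for n
    using h(1)[rule_format, of n] by auto
  then show "\<exists>f. (\<forall>n. f n \<in> of_real ` S - {of_real x :: complex}) \<and> f \<longlonglongrightarrow> of_real x"
    by (intro exI[of _ "\<lambda>n. of_real (h n)"] conjI allI tendsto_of_real h(2))
qed

lemma holomorphic_eq_from_real_interval:
  fixes a b :: real
  assumes "f holomorphic_on S" "g holomorphic_on S" "open S" "connected S" "a < b"
    and "\<And>x. a < x \<Longrightarrow> x < b \<Longrightarrow> of_real x \<in> S \<and> f (of_real x) = g (of_real x)" and "z \<in> S"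
  shows "f z = g z"
proof -
  have "f z - g z = 0"
  proof (rule analytic_continuation[of "\<lambda>a. f a - g a" S "of_real ` {a<..<b}" "of_real ((a + b) / 2)"])
    show "of_real ((a + b) / 2) islimpt complex_of_real ` {a<..<b}"
      by (intro islimpt_of_real_image interior_limit_point) (use assms(5) in \<open>auto simp: interior_open\<close>)
    show "of_real ((a + b) / 2) \<in> S"
      using assms(6)[of "(a + b) / 2"] assms(5) by auto
  qed (use assms in \<open>auto intro!: holomorphic_intros\<close>)
  then show ?thesis by simp
qed

lemma holomorphic_eq_of_real_line:
  assumes "f holomorphic_on {a. 1 < Re a}" "g holomorphic_on {a. 1 < Re a}"
    and "\<And>x::real. 1 < x \<Longrightarrow> f (of_real x) = g (of_real x)" and "1 < Re a"
  shows "f a = g a"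
  by (rule holomorphic_eq_from_real_interval[of f "{a. 1 < Re a}" g 1 2])
    (use assms in \<open>auto intro!: open_halfspace_Re_gt convex_connected convex_halfspace_Re_gt\<close>)

text \<open>The identity is known for real parameters. The identity theorem first frees
  \<open>a\<close> while \<open>b\<close> is real; the symmetry of the integral then exchanges the
  roles and frees \<open>b\<close>. Holomorphy in a parameter is read off from the partial fraction
  series. The bounds 1 instead of 0 make the integrand continuous on the closed interval.\<close>

lemma Beta_integral_complex:
  assumes "1 < Re a" "1 < Re b"
  shows "integral {0..1} (\<lambda>v::real. of_real v powr (a - 1) * of_real (1 - v) powr (b - 1)) = Beta a b"
proof -
  define I where "I = (\<lambda>a b :: complex.
    integral {0..1} (\<lambda>v::real. of_real v powr (a - 1) * of_real (1 - v) powr (b - 1)))"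
  have hol: "(\<lambda>a. I a b) holomorphic_on {a. 1 < Re a}" if "1 < Re b" for b
    using beta_sum_holomorphic[OF that]
    by (rule holomorphic_transform) (use beta_sum_integral[OF _ that] in \<open>auto simp: I_def sums_iff\<close>)
  have comm: "I a b = I b a" for a b
  proof -
    have "integral {0..1} (\<lambda>v::real. of_real (1 - v) powr (a - 1) * of_real v powr (b - 1)) =
        integral {-1..0} (\<lambda>v::real. of_real (1 + v) powr (a - 1) * of_real (- v) powr (b - 1) :: complex)"
      using Henstock_Kurzweil_Integration.integral_reflect_real[of 1 0 "\<lambda>v::real. of_real (1 - v) powr (a - 1) * of_real v powr (b - 1) :: complex"]
      by simp
    also have "\<dots> = integral {0..1} (\<lambda>v::real. of_real v powr (a - 1) * of_real (1 - v) powr (b - 1))"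
      using integral_shift_real_ivl[of 0 1 1 "\<lambda>v::real. of_real v powr (a - 1) * of_real (1 - v) powr (b - 1) :: complex"]
      by (simp add: add.commute)
    finally have "integral {0..1} (\<lambda>v::real. of_real (1 - v) powr (a - 1) * of_real v powr (b - 1)) =
        integral {0..1} (\<lambda>v::real. of_real v powr (a - 1) * of_real (1 - v) powr (b - 1) :: complex)" .
    then show ?thesis
      by (simp add: I_def mult.commute)
  qed
  have holB: "(\<lambda>a. Beta a b) holomorphic_on {a. 1 < Re a}" if "1 < Re b" for b :: complex
    by (intro holomorphic_intros) (use that in \<open>auto elim!: nonpos_Ints_cases\<close>)
  have real: "I (of_real x) (of_real y) = Beta (of_real x) (of_real y)" if "1 < x" "1 < y" for x y :: real
  proof -
    have "((\<lambda>t. t powr (x - 1) * (1 - t) powr (y - 1)) has_integral Beta x y) {0..1}"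
      by (rule has_integral_Beta_real) (use that in auto)
    then have "((\<lambda>t. of_real (t powr (x - 1) * (1 - t) powr (y - 1)) :: complex) has_integral of_real (Beta x y)) {0..1}"
      by (rule has_integral_of_real)
    then have "((\<lambda>v::real. of_real v powr (of_real x - 1) * of_real (1 - v) powr (of_real y - 1)) has_integral
       (of_real (Beta x y) :: complex)) {0..1}"
      by (rule has_integral_eq_rhs[OF has_integral_eq, rotated]) (auto simp: powr_of_real[symmetric])
    then show ?thesis
      by (simp add: I_def integral_unique Beta_def Gamma_complex_of_real flip: of_real_add)
  qed
  have 1: "I a (of_real y) = Beta a (of_real y)" if "1 < Re a" "1 < y" for a y
    by (rule holomorphic_eq_of_real_line[OF hol holB]) (use that real in auto)
  have "I b a = Beta b a"
    by (rule holomorphic_eq_of_real_line[OF hol holB])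
      (use assms 1 in \<open>auto simp: comm[of _ a] Beta_commute[of _ a]\<close>)
  then have "I a b = Beta a b"
    by (simp add: comm[of a b] Beta_commute[of a b])
  then show ?thesis
    unfolding I_def .
qed

lemma binom_coeff_tendsto_0: "1 < Re b \<Longrightarrow> binom_coeff b \<longlonglongrightarrow> 0"
  using summable_LIMSEQ_zero[OF summable_norm_cancel[OF summable_norm_binom_coeff]] by simp

text \<open>Continuation in \<open>a\<close> to the left by unit steps, with the series in place of
  the integral, which diverges there. The factor \<open>rGamma\<close> takes care of the values for
  which \<open>a + b\<close> is a pole of Gamma.\<close>

lemma beta_sum:
  assumes b: "1 < Re b" and a: "a \<notin> \<int>\<^sub>\<le>\<^sub>0"
  shows "(\<lambda>j. binom_coeff b j / (a + of_nat j)) sums (Gamma a * Gamma b * rGamma (a + b))"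
proof -
  have "\<forall>a. a \<notin> \<int>\<^sub>\<le>\<^sub>0 \<longrightarrow> 1 - of_nat N < Re a \<longrightarrow>
    (\<lambda>j. binom_coeff b j / (a + of_nat j)) sums (Gamma a * Gamma b * rGamma (a + b))" for N
  proof (induction N)
    case 0
    then show ?case
      using beta_sum_integral[OF _ b] Beta_integral_complex[OF _ b] by (simp add: Beta_altdef)
  next
    case (Suc N)
    show ?case
    proof (intro allI impI)
      fix a assume a: "a \<notin> \<int>\<^sub>\<le>\<^sub>0" "1 - of_nat (Suc N) < Re a"
      have nz: "a + of_nat j \<noteq> 0" for j
        using a(1) by (metis add_eq_0_iff2 minus_of_nat_in_nonpos_Ints)
      have a1: "a + 1 \<notin> \<int>\<^sub>\<le>\<^sub>0"
        using a(1) plus_one_in_nonpos_Ints_imp by blast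
      have S1: "(\<lambda>j. binom_coeff b j / (a + 1 + of_nat j)) sums (Gamma (a + 1) * Gamma b * rGamma (a + 1 + b))"
        using Suc.IH a1 a(2) by simp
      \<comment> \<open>With \<open>c_j = binom_coeff b j\<close>, the terms
        \<open>a c_j / (a + j)\<close> and \<open>(a + b) c_j / (a + 1 + j)\<close> differ by
        \<open>t j - t (Suc j)\<close>; the recursion of the coefficients is what gives
        \<open>t (Suc j)\<close> the numerator \<open>(1 - b + j) c_j\<close>. Since
        \<open>t 0 = 0\<close> and \<open>t\<close> tends to \<open>0\<close>, the telescoping sum
        vanishes.\<close>
      define t where "t = (\<lambda>j. of_nat j * binom_coeff b j / (a + of_nat j))"
      have "(\<lambda>j. of_nat j / (a + of_nat j)) \<longlonglongrightarrow> 1"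
      proof -
        have "(\<lambda>j. 1 - a * inverse (a + of_nat j)) \<longlonglongrightarrow> 1 - a * 0"
          by (intro tendsto_intros tendsto_inverse_0[THEN filterlim_compose]
              tendsto_add_filterlim_at_infinity[OF tendsto_const] tendsto_of_nat)
        moreover have "1 - a * inverse (a + of_nat j) = of_nat j / (a + of_nat j)" for j
          using nz[of j] by (simp add: field_simps)
        ultimately show ?thesis by simp
      qed
      then have "(\<lambda>j. of_nat j / (a + of_nat j) * binom_coeff b j) \<longlonglongrightarrow> 1 * 0"
        by (intro tendsto_mult binom_coeff_tendsto_0 b)
      then have "t \<longlonglongrightarrow> 0"
        by (simp add: t_def[abs_def] mult_ac)
      then have "(\<lambda>j. t j - t (Suc j)) sums (t 0 - 0)"
        by (rule telescope_sums')
      then have T: "(\<lambda>j. t j - t (Suc j)) sums 0"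
        by (simp add: t_def)
      have "binom_coeff b j / (a + of_nat j) * a =
         (a + b) * (binom_coeff b j / (a + 1 + of_nat j)) - (t j - t (Suc j))" for j
      proof -
        have n1: "a + of_nat j \<noteq> 0" "a + (1 + of_nat j) \<noteq> 0"
          using nz[of j] nz[of "Suc j"] by (auto simp: add_ac)
        have tS: "t (Suc j) = (1 - b + of_nat j) * binom_coeff b j / (a + 1 + of_nat j)"
          unfolding t_def by (subst binom_coeff_Suc) (simp add: add_ac)
        have "B / (a + k) * a = (a + b) * (B / (a + 1 + k)) - (k * B / (a + k) - (1 - b + k) * B / (a + 1 + k))"
          if "a + k \<noteq> 0" "a + (1 + k) \<noteq> 0" for B k :: complex
          using that by (simp add: divide_simps add.assoc) (simp add: algebra_simps)
        from this[OF n1] show ?thesis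
          unfolding tS by (simp add: t_def)
      qed
      then have "(\<lambda>j. binom_coeff b j / (a + of_nat j) * a) sums
          ((a + b) * (Gamma (a + 1) * Gamma b * rGamma (a + 1 + b)) - 0)"
        using sums_diff[OF sums_mult[OF S1] T, of "a + b"] by simp
      moreover have "(a + b) * rGamma (a + 1 + b) = rGamma (a + b)"
        using rGamma_plus1[of "a + b"] by (simp add: add_ac)
      then have "(a + b) * (Gamma (a + 1) * Gamma b * rGamma (a + 1 + b)) = a * (Gamma a * Gamma b * rGamma (a + b))"
        by (simp add: Gamma_plus1[OF a(1)] mult_ac) 
      ultimately have "(\<lambda>j. binom_coeff b j / (a + of_nat j) * a / a) sums
          (a * (Gamma a * Gamma b * rGamma (a + b)) / a)"
        by (intro sums_divide) simp
      then show "(\<lambda>j. binom_coeff b j / (a + of_nat j)) sums (Gamma a * Gamma b * rGamma (a + b))"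
        using nz[of 0] by (simp add: mult.assoc)
    qed
  qed
  moreover obtain N :: nat where "1 - Re a < of_nat N"
    using reals_Archimedean2 by blast
  ultimately show ?thesis
    using a by (metis diff_less_eq add.commute)
qed

lemma suminf_swap:
  fixes f :: "nat \<Rightarrow> nat \<Rightarrow> complex"
  assumes a: "summable (\<lambda>j. norm (a j))" and c: "summable (\<lambda>m. norm (c m))"
    and f: "\<And>j m. norm (f j m) \<le> norm (a j) * norm (c m)"
  shows "(\<Sum>j. \<Sum>m. f j m) = (\<Sum>m. \<Sum>j. f j m)"
    and "summable (\<lambda>j. f j m)" and "summable (\<lambda>m. f j m)"
    and "summable (\<lambda>j. \<Sum>m. f j m)" and "summable (\<lambda>m. \<Sum>j. f j m)"
proof -
  have sm: "summable (\<lambda>m. norm (f j m))" for j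
    by (rule summable_comparison_test'[OF summable_mult[OF c, of "norm (a j)"]]) (use f in auto)
  have sj: "summable (\<lambda>j. norm (f j m))" for m
    by (rule summable_comparison_test'[OF summable_mult2[OF a, of "norm (c m)"]]) (use f in auto)
  show "summable (\<lambda>j. f j m)" "summable (\<lambda>m. f j m)" for j m
    using sm sj by (auto intro: summable_norm_cancel)
  have bj: "norm (\<Sum>m. f j m) \<le> norm (a j) * (\<Sum>m. norm (c m))" for j
  proof -
    have "norm (\<Sum>m. f j m) \<le> (\<Sum>m. norm (f j m))"
      by (rule summable_norm[OF sm])
    also have "\<dots> \<le> (\<Sum>m. norm (a j) * norm (c m))"
      by (intro suminf_le sm summable_mult c f)
    finally show ?thesis
      by (simp add: suminf_mult c)
  qed
  have bm: "norm (\<Sum>j. f j m) \<le> (\<Sum>j. norm (a j)) * norm (c m)" for m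
  proof -
    have "norm (\<Sum>j. f j m) \<le> (\<Sum>j. norm (f j m))"
      by (rule summable_norm[OF sj])
    also have "\<dots> \<le> (\<Sum>j. norm (a j) * norm (c m))"
      by (intro suminf_le sj summable_mult2 a f)
    finally show ?thesis
      by (simp add: suminf_mult2 a)
  qed
  have Sj: "summable (\<lambda>j. norm (\<Sum>m. f j m))"
    by (rule summable_comparison_test'[OF summable_mult2[OF a, of "\<Sum>m. norm (c m)"]]) (use bj in auto)
  have Sm: "summable (\<lambda>m. norm (\<Sum>j. f j m))"
    by (rule summable_comparison_test'[OF summable_mult[OF c, of "\<Sum>j. norm (a j)"]]) (use bm in auto)
  show "summable (\<lambda>j. \<Sum>m. f j m)" "summable (\<lambda>m. \<Sum>j. f j m)"
    using Sj Sm by (auto intro: summable_norm_cancel)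
  have inf: "infsum g UNIV = suminf g" if "summable (\<lambda>n. norm (g n))" for g :: "nat \<Rightarrow> complex"
    using norm_summable_imp_has_sum[OF that summable_sums[OF summable_norm_cancel[OF that]]] by (rule infsumI)
  have "(\<lambda>p. norm ((\<lambda>(j, m). f j m) p)) summable_on (UNIV \<times> UNIV)"
    unfolding Infinite_Sum.abs_summable_on_Sigma_iff
  proof (intro conjI ballI)
    show "(\<lambda>m. norm ((\<lambda>(j, m). f j m) (j, m))) summable_on UNIV" for j
      using sm[of j] by (auto intro!: norm_summable_imp_summable_on)
    have "infsum (\<lambda>m. norm (f j m)) UNIV = (\<Sum>m. norm (f j m))" for j
      using norm_summable_imp_has_sum[of "\<lambda>m. norm (f j m)"] sm[of j] by (auto intro!: infsumI)
    moreover have "summable (\<lambda>j. \<Sum>m. norm (f j m))"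
    proof (rule summable_comparison_test'[OF summable_mult2[OF a, of "\<Sum>m. norm (c m)"]])
      fix j
      have "(\<Sum>m. norm (f j m)) \<le> (\<Sum>m. norm (a j) * norm (c m))"
        by (intro suminf_le sm summable_mult c f)
      then show "norm (\<Sum>m. norm (f j m)) \<le> norm (a j) * (\<Sum>m. norm (c m))"
        by (simp add: suminf_mult c suminf_nonneg sm)
    qed
    ultimately show "(\<lambda>j. norm (\<Sum>\<^sub>\<infinity>m. norm ((\<lambda>(j, m). f j m) (j, m)))) summable_on UNIV"
      by (auto intro!: norm_summable_imp_summable_on simp: suminf_nonneg sm)
  qed
  then have "(\<Sum>\<^sub>\<infinity>j. \<Sum>\<^sub>\<infinity>m. f j m) = (\<Sum>\<^sub>\<infinity>m. \<Sum>\<^sub>\<infinity>j. f j m)"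
    by (intro infsum_swap_banach) (rule Infinite_Sum.abs_summable_summable)
  then show "(\<Sum>j. \<Sum>m. f j m) = (\<Sum>m. \<Sum>j. f j m)"
    by (simp add: inf sm sj Sj Sm)
qed

section \<open>Fractional integrals of powers and of power series\<close>

lemma non_int_bounded_away:
  fixes a :: complex
  assumes "a \<notin> \<int>"
  shows "\<exists>d>0. \<forall>k\<in>\<int>. d \<le> norm (a + k)"
proof -
  have "open (- (\<int> :: complex set))"
    by (simp add: open_Compl)
  then obtain d where d: "d > 0" "ball a d \<subseteq> - \<int>"
    using assms unfolding open_contains_ball by blast
  have "d \<le> norm (a + k)" if "k \<in> \<int>" for k
  proof (rule ccontr)
    assume "\<not> ?thesis"
    then have "- k \<in> ball a d"
      by (simp add: dist_norm)
    then show False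
      using d(2) that by auto
  qed
  with d(1) show ?thesis
    by blast
qed

lemma not_Ints_add_of_nat_iff [simp]:
  "(a :: complex) + of_nat m \<in> \<int> \<longleftrightarrow> a \<in> \<int>" "of_nat m + a \<in> \<int> \<longleftrightarrow> a \<in> \<int>"
  "a - of_nat m \<in> \<int> \<longleftrightarrow> a \<in> \<int>"
  by (auto simp: add_in_Ints_iff_right add_in_Ints_iff_left diff_in_Ints_iff_left)

lemma neg_shift_not_nonpos_Ints:
  assumes "s + b \<notin> \<int>"
  shows "- s - b - of_nat m \<notin> (\<int>\<^sub>\<le>\<^sub>0 :: complex set)"
proof -
  have "- s - b - of_nat m \<notin> \<int>"
    using assms minus_in_Ints_iff[of "s + b"] by (simp add: minus_diff_commute)
  then show ?thesis
    using nonpos_Ints_subset_Ints by blast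
qed

text \<open>The factor with which the fractional integral of order \<open>b\<close> based at
  \<open>1\<close> takes \<open>z^(s + m)\<close> to \<open>z^(s + m + b)\<close>, up to a
  holomorphic function. Written with \<open>rGamma\<close> it vanishes when \<open>s + m\<close> is
  a natural number, that is, on holomorphic input.\<close>

definition rl_mult :: "complex \<Rightarrow> complex \<Rightarrow> nat \<Rightarrow> complex" where
  "rl_mult s b m = rGamma (- s - of_nat m) * Gamma (- s - b - of_nat m)"

text \<open>This is \<open>beta_sum\<close> at \<open>a = - s - b - m\<close>, for which
  \<open>a + b = - s - m\<close>. The assumption on \<open>s + b\<close> keeps this \<open>a\<close>
  away from the poles for all \<open>m\<close> at once.\<close>

lemma rl_mult_sums:
  assumes b: "1 < Re b" and sb: "s + b \<notin> \<int>"
  shows "(\<lambda>j. binom_coeff b j / (s + b + of_nat m - of_nat j)) sums (- (Gamma b * rl_mult s b m))"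
proof -
  from beta_sum[OF b neg_shift_not_nonpos_Ints[OF sb]] have "(\<lambda>j. - (binom_coeff b j / (- s - b - of_nat m + of_nat j))) sums
      (- (Gamma b * rl_mult s b m))"
    by (intro sums_minus) (simp add: rl_mult_def algebra_simps)
  moreover have "- (binom_coeff b j / (- s - b - of_nat m + of_nat j)) = binom_coeff b j / (s + b + of_nat m - of_nat j)" for j
    by (simp add: minus_divide_right algebra_simps)
  ultimately show ?thesis
    by simp
qed

lemma of_real_powr_add_of_nat:
  fixes s :: complex
  assumes "0 < x"
  shows "of_real x powr (s + of_nat m) = of_real x powr s * of_real x ^ m"
    and "of_real x powr (s - of_nat m) = of_real x powr s / of_real x ^ m"
  using assms by (simp_all add: powr_add powr_diff powr_nat')

text \<open>In the series of \<open>rl_mult_sums\<close> the denominators are \<open>s + b\<close>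
  plus an integer, hence bounded away from zero independently of \<open>m\<close>. Boundedness is
  enough to preserve convergence of a power series whose coefficients are multiplied by
  \<open>rl_mult\<close>.\<close>

lemma rl_mult_bound:
  assumes b: "1 < Re b" and sb: "s + b \<notin> \<int>"
  shows "\<exists>B. \<forall>m. norm (rl_mult s b m) \<le> B"
proof -
  obtain d where d: "d > 0" "\<forall>k\<in>\<int>. d \<le> norm (s + b + k)"
    using non_int_bounded_away[OF sb] by blast
  have Gb: "Gamma b \<noteq> 0"
    using b by (auto simp: Gamma_eq_zero_iff elim!: nonpos_Ints_cases)
  have "norm (rl_mult s b m) \<le> (\<Sum>j. norm (binom_coeff b j) / d) / norm (Gamma b)" for m
  proof -
    have le: "norm (binom_coeff b j / (s + b + of_nat m - of_nat j)) \<le> norm (binom_coeff b j) / d" for j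
      using d(2)[rule_format, of "of_nat m - of_nat j"] d(1)
      by (auto simp: norm_divide algebra_simps intro!: divide_left_mono mult_pos_pos)
    have sm: "summable (\<lambda>j. norm (binom_coeff b j) / d)"
      by (intro summable_divide summable_norm_binom_coeff b)
    have sn: "summable (\<lambda>j. norm (binom_coeff b j / (s + b + of_nat m - of_nat j)))"
      by (rule summable_comparison_test'[OF sm]) (use le in auto)
    have "norm (Gamma b * rl_mult s b m) = norm (\<Sum>j. binom_coeff b j / (s + b + of_nat m - of_nat j))"
      using rl_mult_sums[OF b sb, of m] by (simp add: sums_iff)
    also have "\<dots> \<le> (\<Sum>j. norm (binom_coeff b j / (s + b + of_nat m - of_nat j)))"
      by (rule summable_norm[OF sn])
    also have "\<dots> \<le> (\<Sum>j. norm (binom_coeff b j) / d)"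
      by (intro suminf_le le sn sm)
    finally show ?thesis
      using Gb by (simp add: norm_mult field_simps)
  qed
  then show ?thesis
    by blast
qed

text \<open>The contribution of the upper endpoint \<open>x0\<close> when the integral from
  \<open>z\<close> to \<open>x0\<close> is evaluated termwise. It depends on \<open>z\<close> only
  through the powers \<open>z^j\<close> and is therefore holomorphic at \<open>0\<close>.\<close>

definition rl_hol_coeff :: "complex \<Rightarrow> complex \<Rightarrow> real \<Rightarrow> (nat \<Rightarrow> complex) \<Rightarrow> nat \<Rightarrow> complex" where
  "rl_hol_coeff s b x0 H j = binom_coeff b j * of_real x0 powr (s + b) / of_real x0 ^ j *
     (\<Sum>m. H m * of_real x0 ^ m / (s + b + of_nat m - of_nat j))"

text \<open>Expand \<open>(\<xi> - z)^(b - 1)\<close> in powers of \<open>z/\<xi>\<close> and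
  integrate termwise. The endpoint \<open>x0\<close> gives the power series with coefficients
  \<open>rl_hol_coeff\<close>. At the endpoint \<open>z\<close> the factor \<open>z^j\<close> of the
  expansion cancels against the antiderivative, so for fixed \<open>m\<close> all indices
  \<open>j\<close> contribute to the same power \<open>z^(s + b + m)\<close>, and their sum is known
  from \<open>rl_mult_sums\<close>.\<close>

lemma rl_power_integral:
  fixes s b :: complex and x0 z :: real
  assumes b: "1 < Re b" and sb: "s + b \<notin> \<int>"
    and H: "summable (\<lambda>m. norm (H m) * x0 ^ m)" and z: "0 < z" "z < x0"
  shows "integral {z..x0} (\<lambda>\<xi>. of_real (\<xi> - z) powr (b - 1) * (of_real \<xi> powr s * (\<Sum>m. H m * of_real \<xi> ^ m))) =
    Gamma b * (of_real z powr (s + b) * (\<Sum>m. rl_mult s b m * H m * of_real z ^ m)) +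
    (\<Sum>j. rl_hol_coeff s b x0 H j * of_real z ^ j)"
    and "summable (\<lambda>m. rl_mult s b m * H m * of_real z ^ m)"
    and "summable (\<lambda>j. rl_hol_coeff s b x0 H j * of_real z ^ j)"
proof -
  obtain d where d: "d > 0" "\<forall>k\<in>\<int>. d \<le> norm (s + b + k)"
    using non_int_bounded_away[OF sb] by blast
  have dn: "d \<le> norm (s + b + of_nat m - of_nat j)" for m j
    using d(2)[rule_format, of "of_nat m - of_nat j"] by (simp add: algebra_simps)
  then have nz: "s + b + of_nat m - of_nat j \<noteq> 0" for m j
    using d(1) by (metis norm_zero not_le)
  define h where "h = (\<lambda>\<xi>::real. \<Sum>m. H m * of_real \<xi> ^ m)"
  have Hle: "norm (H m * of_real \<xi> ^ m) \<le> norm (H m) * x0 ^ m" if "\<xi> \<in> {0..x0}" for m \<xi>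
    using that by (auto simp: norm_mult norm_power intro!: mult_left_mono power_mono)
  have Hsums: "(\<lambda>m. H m * of_real \<xi> ^ m) sums h \<xi>" if "\<xi> \<in> {0..x0}" for \<xi>
    unfolding h_def
    by (rule summable_sums, rule summable_comparison_test'[OF H]) (use Hle[OF that] in auto)
  have hcont: "continuous_on {z..x0} h"
  proof (rule uniform_limit_theorem)
    show "uniform_limit {z..x0} (\<lambda>n \<xi>. \<Sum>m<n. H m * of_real \<xi> ^ m) h sequentially"
      unfolding h_def by (rule Weierstrass_m_test[OF _ H]) (use Hle z in auto)
  qed (auto intro!: always_eventually continuous_intros)
  have pcont: "continuous_on {z..x0} (\<lambda>\<xi>::real. of_real \<xi> powr e)" for e :: complex
    using z by (intro continuous_intros) (auto simp: complex_nonpos_Reals_iff)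
  define I where "I = (\<lambda>j. integral {z..x0} (\<lambda>\<xi>::real. of_real \<xi> powr (s + b - of_nat j - 1) * h \<xi>))"
  \<comment> \<open>Antiderivative of the integrand of \<open>I j\<close>, obtained by integrating
    the power series term by term.\<close>
  define Psi where "Psi = (\<lambda>j x::real. of_real x powr (s + b - of_nat j) *
      (\<Sum>m. H m * of_real x ^ m / (s + b + of_nat m - of_nat j)))"
  have Psi_summable: "summable (\<lambda>m. H m * of_real x ^ m / (s + b + of_nat m - of_nat j))"
    if "x \<in> {0..x0}" for x :: real and j
  proof (rule summable_comparison_test'[OF summable_divide[OF H, of d]])
    fix m
    show "norm (H m * of_real x ^ m / (s + b + of_nat m - of_nat j)) \<le> norm (H m) * x0 ^ m / d"
      unfolding norm_divide by (intro frac_le Hle that d(1) dn) (use z in auto)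
  qed
  have I: "I j = Psi j x0 - Psi j z" for j
  proof -
    let ?f = "\<lambda>m (\<xi>::real). of_real \<xi> powr (s + b - of_nat j - 1) * (H m * of_real \<xi> ^ m)"
    obtain B where B: "\<And>\<xi>. \<xi> \<in> {z..x0} \<Longrightarrow> norm (of_real \<xi> powr (s + b - of_nat j - 1) :: complex) \<le> B"
      using compact_imp_bounded[OF compact_continuous_image[OF pcont compact_Icc]]
      unfolding bounded_iff by (metis imageI)
    have "(\<lambda>m. integral {z..x0} (?f m)) sums I j"
      unfolding I_def
    proof (rule sums_integral_M_test(1))
      show "continuous_on {z..x0} (?f m)" for m
        by (intro continuous_intros pcont)
      show "summable (\<lambda>m. B * (norm (H m) * x0 ^ m))"
        by (intro summable_mult H)
      show "norm (?f m v) \<le> B * (norm (H m) * x0 ^ m)" if "v \<in> {z..x0}" for m v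
      proof -
        have "0 \<le> B" using B[OF that] norm_ge_zero order_trans by blast
        moreover have "v \<in> {0..x0}" using that z by auto
        ultimately show ?thesis
          unfolding norm_mult[of "of_real v powr _"] by (intro mult_mono B Hle that) auto
      qed
      show "(\<lambda>m. ?f m v) sums (of_real v powr (s + b - of_nat j - 1) * h v)" if "v \<in> {z..x0}" for v
        by (intro sums_mult Hsums) (use that z in auto)
    qed
    moreover have "integral {z..x0} (?f m) =
        of_real x0 powr (s + b - of_nat j) * (H m * of_real x0 ^ m / (s + b + of_nat m - of_nat j)) -
        of_real z powr (s + b - of_nat j) * (H m * of_real z ^ m / (s + b + of_nat m - of_nat j))" for m
    proof -
      let ?e = "s + b + of_nat m - of_nat j"
      have "((\<lambda>\<xi>::real. H m * of_real \<xi> powr (?e - 1)) has_integral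
          H m * ((of_real x0 powr ?e - of_real z powr ?e) / ?e)) {z..x0}"
        by (intro has_integral_mult_right has_integral_of_real_powr nz) (use z in auto)
      moreover have "H m * of_real \<xi> powr (?e - 1) = ?f m \<xi>" if "\<xi> \<in> {z..x0}" for \<xi> :: real
        using of_real_powr_add_of_nat(1)[of \<xi> "s + b - of_nat j - 1" m] that z
        by (simp add: algebra_simps)
      ultimately have hi: "(?f m has_integral H m * ((of_real x0 powr ?e - of_real z powr ?e) / ?e)) {z..x0}"
        using has_integral_eq by (metis (no_types, lifting))
      have pw: "of_real x powr ?e = of_real x powr (s + b - of_nat j) * of_real x ^ m" if "0 < x" for x :: real
        using of_real_powr_add_of_nat(1)[of x "s + b - of_nat j" m] that by (simp add: algebra_simps)
      show ?thesis
        unfolding integral_unique[OF hi] using z by (simp add: pw diff_divide_distrib right_diff_distrib mult_ac)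
    qed
    ultimately have "(\<lambda>m. of_real x0 powr (s + b - of_nat j) * (H m * of_real x0 ^ m / (s + b + of_nat m - of_nat j)) -
        of_real z powr (s + b - of_nat j) * (H m * of_real z ^ m / (s + b + of_nat m - of_nat j))) sums I j"
      by simp
    moreover have "(\<lambda>m. of_real x0 powr (s + b - of_nat j) * (H m * of_real x0 ^ m / (s + b + of_nat m - of_nat j)) -
        of_real z powr (s + b - of_nat j) * (H m * of_real z ^ m / (s + b + of_nat m - of_nat j))) sums (Psi j x0 - Psi j z)"
      unfolding Psi_def by (intro sums_diff sums_mult summable_sums Psi_summable) (use z in auto)
    ultimately show ?thesis
      by (rule sums_unique2)
  qed
  let ?g = "\<lambda>j (\<xi>::real). binom_coeff b j * of_real z ^ j * (of_real \<xi> powr (s + b - of_nat j - 1) * h \<xi>)"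
  have expand: "binom_coeff b j * of_real z ^ j * (of_real \<xi> powr (s + b - of_nat j - 1) * h \<xi>) =
      of_real \<xi> powr (s + b - 1) * h \<xi> * (binom_coeff b j * of_real (z / \<xi>) ^ j)" if "0 < \<xi>" for j and \<xi> :: real
    using of_real_powr_add_of_nat(2)[OF that, of "s + b - 1" j]
    by (simp add: algebra_simps power_divide)
  have "bounded ((\<lambda>\<xi>. of_real \<xi> powr (s + b - 1) * h \<xi>) ` {z..x0})"
    by (intro compact_imp_bounded compact_continuous_image continuous_on_mult pcont hcont compact_Icc)
  then obtain B where B: "\<And>\<xi>. \<xi> \<in> {z..x0} \<Longrightarrow> norm (of_real \<xi> powr (s + b - 1) * h \<xi>) \<le> B"
    unfolding bounded_iff by fast
  have "(\<lambda>j. integral {z..x0} (?g j)) sums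
     integral {z..x0} (\<lambda>\<xi>. of_real (\<xi> - z) powr (b - 1) * (of_real \<xi> powr s * h \<xi>))"
  proof (rule sums_integral_M_test(1))
    show "continuous_on {z..x0} (?g m)" for m
      by (intro continuous_intros pcont hcont)
    show "summable (\<lambda>j. B * norm (binom_coeff b j))"
      by (intro summable_mult summable_norm_binom_coeff b)
    show "norm (?g j v) \<le> B * norm (binom_coeff b j)" if v: "v \<in> {z..x0}" for j v
    proof -
      have "0 < v" "0 \<le> z / v" "z / v \<le> 1" using v z by auto
      then have "norm (of_real (z / v) ^ j :: complex) \<le> 1"
        using z by (simp only: norm_power norm_of_real) (auto intro!: power_le_one)
      then have "norm (binom_coeff b j * of_real (z / v) ^ j) \<le> norm (binom_coeff b j)"
        by (simp add: norm_mult mult_left_le del: of_real_divide)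
      moreover have "0 \<le> B" using B[OF v] norm_ge_zero order_trans by blast
      ultimately show ?thesis
        unfolding expand[OF \<open>0 < v\<close>] norm_mult[of "_ * h v"]
        by (intro mult_mono B v) auto
    qed
    show "(\<lambda>j. ?g j v) sums (of_real (v - z) powr (b - 1) * (of_real v powr s * h v))" if v: "v \<in> {z..x0}" for v
    proof -
      have v0: "0 < v" using v z by auto
      have "(\<lambda>j. ?g j v) sums (of_real v powr (s + b - 1) * h v * of_real (1 - z / v) powr (b - 1))"
        unfolding expand[OF v0] by (intro sums_mult sums_binom_coeff b) (use v z in auto)
      moreover have "of_real (v - z) powr (b - 1) = (of_real v powr (b - 1) * of_real (1 - z / v) powr (b - 1) :: complex)"
      proof -
        have "complex_of_real (v - z) = of_real v * of_real (1 - z / v)"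
          using v0 by (simp add: field_simps)
        then show ?thesis
          using v0 v z by (simp add: powr_times_real del: of_real_diff)
      qed
      moreover have "of_real v powr (s + b - 1) = (of_real v powr s * of_real v powr (b - 1) :: complex)"
        using v0 by (simp add: powr_add[symmetric] algebra_simps)
      ultimately show ?thesis
        by (simp add: mult_ac)
    qed
  qed
  moreover have "integral {z..x0} (?g j) = binom_coeff b j * of_real z ^ j * I j" for j
    by (simp add: I_def integral_mult_right)
  moreover have "binom_coeff b j * of_real z ^ j * I j = rl_hol_coeff s b x0 H j * of_real z ^ j -
      of_real z powr (s + b) * (\<Sum>m. binom_coeff b j * (H m * of_real z ^ m) / (s + b + of_nat m - of_nat j))" for j
  proof -
    have "(\<Sum>m. binom_coeff b j * (H m * of_real z ^ m / (s + b + of_nat m - of_nat j))) =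
        binom_coeff b j * (\<Sum>m. H m * of_real z ^ m / (s + b + of_nat m - of_nat j))"
      by (rule suminf_mult) (use Psi_summable z in auto)
    then show ?thesis
      using z by (simp add: I Psi_def rl_hol_coeff_def of_real_powr_add_of_nat(2) algebra_simps)
  qed
  ultimately have 1: "(\<lambda>j. rl_hol_coeff s b x0 H j * of_real z ^ j -
      of_real z powr (s + b) * (\<Sum>m. binom_coeff b j * (H m * of_real z ^ m) / (s + b + of_nat m - of_nat j))) sums
     integral {z..x0} (\<lambda>\<xi>. of_real (\<xi> - z) powr (b - 1) * (of_real \<xi> powr s * h \<xi>))"
    by simp
  let ?F = "\<lambda>j m. binom_coeff b j * (H m * of_real z ^ m) / (s + b + of_nat m - of_nat j)"
  have Hz: "summable (\<lambda>m. norm (H m * of_real z ^ m / of_real d))"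
    by (rule summable_comparison_test'[OF summable_divide[OF H, of d]])
      (use Hle[of z] z d(1) in \<open>auto simp: norm_divide intro!: divide_right_mono\<close>)
  have Fle: "norm (?F j m) \<le> norm (binom_coeff b j) * norm (H m * of_real z ^ m / of_real d)" for j m
    using dn[of m j] d(1) unfolding norm_divide norm_mult[of "binom_coeff b j"]
    by (auto simp: intro!: divide_left_mono mult_pos_pos)
  \<comment> \<open>The antiderivative produces the sum over \<open>m\<close> inside the sum over
    \<open>j\<close>, whereas the evaluation by a Beta value needs the sum over \<open>j\<close>
    inside.\<close>
  note swap = suminf_swap[OF summable_norm_binom_coeff[OF b] Hz Fle]
  have "(\<Sum>j. ?F j m) = - (Gamma b * (rl_mult s b m * H m * of_real z ^ m))" for m
  proof -
    have "(\<lambda>j. (H m * of_real z ^ m) * (binom_coeff b j / (s + b + of_nat m - of_nat j))) sums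
       (H m * of_real z ^ m * - (Gamma b * rl_mult s b m))"
      by (intro sums_mult rl_mult_sums b sb)
    then show ?thesis
      by (simp add: sums_iff mult_ac)
  qed
  with swap(1) have 2: "(\<Sum>j. \<Sum>m. ?F j m) = (\<Sum>m. - (Gamma b * (rl_mult s b m * H m * of_real z ^ m)))"
    by simp
  have Sm: "summable (\<lambda>m. rl_mult s b m * H m * of_real z ^ m)"
  proof -
    obtain B where B: "\<And>m. norm (rl_mult s b m) \<le> B"
      using rl_mult_bound[OF b sb] by blast
    have "0 \<le> B" using B[of 0] norm_ge_zero order_trans by blast
    show ?thesis
    proof (rule summable_comparison_test'[OF summable_mult[OF H, of B]])
      show "norm (rl_mult s b m * H m * of_real z ^ m) \<le> B * (norm (H m) * x0 ^ m)" for m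
        unfolding mult.assoc norm_mult[of "rl_mult s b m"]
        by (intro mult_mono B Hle) (use z \<open>0 \<le> B\<close> in auto)
    qed
  qed
  have "(\<Sum>m. - (Gamma b * (rl_mult s b m * H m * of_real z ^ m))) = - (Gamma b * (\<Sum>m. rl_mult s b m * H m * of_real z ^ m))"
    using Sm by (simp add: suminf_minus suminf_mult summable_mult)
  with 2 have 3: "(\<lambda>j. of_real z powr (s + b) * (\<Sum>m. ?F j m)) sums
      (of_real z powr (s + b) * - (Gamma b * (\<Sum>m. rl_mult s b m * H m * of_real z ^ m)))"
    using sums_mult[OF summable_sums[OF swap(4)]] by simp
  have "(\<lambda>j. rl_hol_coeff s b x0 H j * of_real z ^ j) sums
     (integral {z..x0} (\<lambda>\<xi>. of_real (\<xi> - z) powr (b - 1) * (of_real \<xi> powr s * h \<xi>)) +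
      of_real z powr (s + b) * - (Gamma b * (\<Sum>m. rl_mult s b m * H m * of_real z ^ m)))"
    using sums_add[OF 1 3] by simp
  then show "integral {z..x0} (\<lambda>\<xi>. of_real (\<xi> - z) powr (b - 1) * (of_real \<xi> powr s * (\<Sum>m. H m * of_real \<xi> ^ m))) =
      Gamma b * (of_real z powr (s + b) * (\<Sum>m. rl_mult s b m * H m * of_real z ^ m)) +
      (\<Sum>j. rl_hol_coeff s b x0 H j * of_real z ^ j)"
    and "summable (\<lambda>j. rl_hol_coeff s b x0 H j * of_real z ^ j)"
    by (simp_all add: sums_iff h_def algebra_simps)
  show "summable (\<lambda>m. rl_mult s b m * H m * of_real z ^ m)"
    by (rule Sm)
qed

section \<open>The Riemann--Liouville transform\<close>

text \<open>The operator \<open>x d/dx\<close> conjugated by \<open>x^e\<close>: the derivative of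
  \<open>x^e h\<close> is \<open>x^(e - 1) euler e h\<close>, so branch factors can be carried along
  without being differentiated.\<close>

definition euler :: "complex \<Rightarrow> (complex \<Rightarrow> complex) \<Rightarrow> complex \<Rightarrow> complex" where
  "euler e h x = e * h x + x * deriv h x"

text \<open>The Taylor series \<open>H k\<close> are part of the relation because the transforms are
  described by their action on them. The functions behind them and the holomorphic rest are only
  asserted to exist.\<close>

definition expands_mod_hol ::
    "complex set \<Rightarrow> (complex \<Rightarrow> complex) \<Rightarrow> 'k set \<Rightarrow> ('k \<Rightarrow> complex) \<Rightarrow> ('k \<Rightarrow> complex fps) \<Rightarrow> bool" where
  "expands_mod_hol D f K s H \<longleftrightarrow>
     (\<exists>h h0. (\<forall>k\<in>K. h k has_fps_expansion H k) \<and> h0 analytic_on {0} \<and>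
       (\<forall>\<^sub>F z in at 0 within D. f z = (\<Sum>k\<in>K. z powr s k * h k z) + h0 z))"

lemma has_fps_expansion_differentiable_near:
  fixes h :: "complex \<Rightarrow> complex"
  assumes "h has_fps_expansion H"
  shows "\<forall>\<^sub>F z in nhds 0. h field_differentiable at z"
proof -
  obtain S where "open S" "0 \<in> S" "h holomorphic_on S"
    using has_fps_expansion_imp_holomorphic[OF assms] by metis
  then show ?thesis
    by (auto simp: eventually_nhds holomorphic_on_imp_differentiable_at intro!: exI[of _ S])
qed

text \<open>Positive real parts keep the principal powers of \<open>z\<close> holomorphic, convexity
  keeps the path of integration from a point to the base point \<open>1\<close> inside the domain,
  and the interval makes \<open>0\<close> a boundary point that is approached along the
  reals.\<close>

locale rl_domain =
  fixes D :: "complex set"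
  assumes open_D: "open D" and convex_D: "convex D" and one_in_D: "1 \<in> D"
    and Re_pos: "\<And>z. z \<in> D \<Longrightarrow> 0 < Re z"
    and unit_interval_subset: "\<And>x::real. 0 < x \<Longrightarrow> x \<le> 1 \<Longrightarrow> of_real x \<in> D"
begin

lemma not_nonpos_Reals [simp]: "z \<in> D \<Longrightarrow> z \<notin> \<real>\<^sub>\<le>\<^sub>0"
  using Re_pos[of z] by (auto simp: complex_nonpos_Reals_iff)

lemma segment_in_D:
  assumes "z \<in> D" "v \<in> {0..1::real}"
  shows "z + of_real v * (1 - z) \<in> D"
proof -
  have "(1 - v) *\<^sub>R z + v *\<^sub>R 1 \<in> D"
    by (rule convexD[OF convex_D]) (use assms one_in_D in auto)
  then show ?thesis
    by (simp add: scaleR_conv_of_real algebra_simps)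
qed

text \<open>By \<open>\<xi> = z + v (1 - z)\<close> the integral of
  \<open>(\<xi> - z)^(\<beta> - 1) (1 - \<xi>)^(a - 1) g(\<xi>)\<close> from \<open>z\<close> to
  \<open>1\<close> is \<open>(1 - z)^(a + \<beta> - 1)\<close> times this expression. That power
  carries the whole branching at \<open>1\<close>; what remains is holomorphic on all of
  \<open>D\<close>.\<close>

definition rl_integral :: "complex \<Rightarrow> complex \<Rightarrow> (complex \<Rightarrow> complex) \<Rightarrow> complex \<Rightarrow> complex" where
  "rl_integral a \<beta> g z = integral {0..1}
     (\<lambda>v. of_real v powr (\<beta> - 1) * of_real (1 - v) powr (a - 1) * g (z + of_real v * (1 - z)))"

lemma continuous_rl_weight:
  assumes "1 < Re a" "1 < Re \<beta>"
  shows "continuous_on {0..1} (\<lambda>v::real. of_real v powr (\<beta> - 1) * of_real (1 - v) powr (a - 1) :: complex)"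
  by (intro continuous_intros continuous_on_subset[OF continuous_on_of_real_powr]
        continuous_on_compose2[OF continuous_on_of_real_powr]) (use assms in auto)

lemma rl_integral_holomorphic:
  assumes ab: "1 < Re a" "1 < Re \<beta>" and g: "g holomorphic_on D"
  shows "rl_integral a \<beta> g holomorphic_on D"
proof -
  let ?w = "\<lambda>v::real. of_real v powr (\<beta> - 1) * of_real (1 - v) powr (a - 1) :: complex"
  have "(\<lambda>z. integral (cbox 0 1) (\<lambda>v. ?w v * g (z + of_real v * (1 - z)))) holomorphic_on D"
  proof (rule leibniz_rule_holomorphic[where fx = "\<lambda>z v. ?w v * (of_real (1 - v) * deriv g (z + of_real v * (1 - z)))"])
    show "((\<lambda>z. ?w v * g (z + of_real v * (1 - z))) has_field_derivative
        ?w v * (of_real (1 - v) * deriv g (z + of_real v * (1 - z)))) (at z within D)"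
      if "z \<in> D" "v \<in> cbox 0 1" for z and v :: real
    proof -
      have "(g has_field_derivative deriv g (z + of_real v * (1 - z))) (at (z + of_real v * (1 - z)))"
        by (rule holomorphic_derivI[OF g open_D segment_in_D]) (use that in auto)
      then have "((\<lambda>z. g (z + of_real v * (1 - z))) has_field_derivative
          deriv g (z + of_real v * (1 - z)) * of_real (1 - v)) (at z)"
        by (rule DERIV_chain2) (auto intro!: derivative_eq_intros simp: algebra_simps)
      then have "((\<lambda>z. g (z + of_real v * (1 - z))) has_field_derivative
          deriv g (z + of_real v * (1 - z)) * of_real (1 - v)) (at z within D)"
        by (rule has_field_derivative_at_within)
      from DERIV_cmult[OF this, of "?w v"] show ?thesis
        by (simp only: mult.commute[of "of_real (1 - v)"])
    qed
    show "(\<lambda>v. ?w v * g (z + of_real v * (1 - z))) integrable_on cbox 0 1" if "z \<in> D" for z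
      unfolding cbox_interval
      by (intro integrable_continuous_real continuous_on_mult[OF continuous_rl_weight[OF ab]]
          continuous_on_compose2[OF holomorphic_on_imp_continuous_on[OF g]] continuous_intros)
        (use segment_in_D that in auto)
    show "continuous_on (D \<times> cbox 0 1)
       (\<lambda>(z, v). ?w v * (of_real (1 - v) * deriv g (z + of_real v * (1 - z))))"
      unfolding cbox_interval case_prod_unfold
      by (intro continuous_on_mult[OF continuous_on_compose2[OF continuous_rl_weight[OF ab]]] continuous_intros
          continuous_on_compose2[OF holomorphic_on_imp_continuous_on[OF holomorphic_deriv[OF g open_D]]])
        (use segment_in_D in auto)
  qed (rule convex_D)
  then show ?thesis
    by (simp add: rl_integral_def[abs_def] cbox_interval)
qed

text \<open>On \<open>(1 - z)^m\<close> the integral over \<open>v\<close> is a Beta value. The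
  factor \<open>Gamma \<beta>\<close> remains because the integral has not been normalised
  yet.\<close>

lemma rl_integral_has_fps_expansion:
  assumes ab: "1 < Re a" "1 < Re \<beta>" and g: "g holomorphic_on D"
    and G: "(\<lambda>x. g (1 - x)) has_fps_expansion G"
  shows "(\<lambda>x. rl_integral a \<beta> g (1 - x)) has_fps_expansion
    Abs_fps (\<lambda>m. Gamma \<beta> * (Gamma (a + of_nat m) * rGamma (a + \<beta> + of_nat m)) * fps_nth G m)"
proof (rule has_fps_expansionI)
  let ?w = "\<lambda>v::real. of_real v powr (\<beta> - 1) * of_real (1 - v) powr (a - 1) :: complex"
  obtain r where r: "r > 0" "ball 1 r \<subseteq> D"
    using open_D one_in_D open_contains_ball by blast
  have hol: "(\<lambda>x. g (1 - x)) holomorphic_on ball 0 r"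
  proof -
    have "g \<circ> (\<lambda>x. 1 - x) holomorphic_on ball 0 r"
      by (intro holomorphic_on_compose_gen[OF _ g] holomorphic_intros) (use r in \<open>auto simp: dist_norm\<close>)
    then show ?thesis by (simp add: o_def)
  qed
  have "bounded (?w ` {0..1})"
    by (intro compact_imp_bounded compact_continuous_image continuous_rl_weight ab compact_Icc)
  then obtain B where B: "\<And>v. v \<in> {0..1} \<Longrightarrow> norm (?w v) \<le> B"
    unfolding bounded_iff by fast
  have "B \<ge> 0"
    using B[of 0] norm_ge_zero order_trans by force
  have "\<forall>\<^sub>F x in nhds 0. x \<in> ball 0 r"
    using r(1) by (intro eventually_nhds_in_open) auto
  then show "\<forall>\<^sub>F x in nhds 0. (\<lambda>m. fps_nth (Abs_fps (\<lambda>m. Gamma \<beta> * (Gamma (a + of_nat m) * rGamma (a + \<beta> + of_nat m)) * fps_nth G m)) m * x ^ m)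
      sums rl_integral a \<beta> g (1 - x)"
  proof eventually_elim
    case (elim x)
    have x: "norm x < r" using elim by simp
    have sums: "(\<lambda>m. fps_nth G m * y ^ m) sums g (1 - y)" if "norm y < r" for y
      by (rule has_fps_expansion_imp_sums_complex[OF G, of r]) (use hol that in auto)
    have summ: "summable (\<lambda>m. norm (fps_nth G m * x ^ m))"
    proof (rule norm_summable_fps)
      have "ereal r \<le> fps_conv_radius G"
        by (rule holomorphic_on_imp_fps_conv_radius_ge[OF G]) (use hol in simp)
      then show "ereal (norm x) < fps_conv_radius G"
        by (rule less_le_trans[rotated]) (use x in simp)
    qed
    let ?f = "\<lambda>m (v::real). ?w v * (fps_nth G m * (of_real (1 - v) * x) ^ m)"
    have le1: "norm (of_real (1 - v) * x) \<le> norm x" if "v \<in> {0..1}" for v :: real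
      unfolding norm_mult norm_of_real using that by (intro mult_left_le_one_le) auto
    have "(\<lambda>m. integral {0..1} (?f m)) sums rl_integral a \<beta> g (1 - x)"
      unfolding rl_integral_def
    proof (rule sums_integral_M_test(1))
      show "continuous_on {0..1} (?f m)" for m
        by (intro continuous_on_mult[OF continuous_rl_weight[OF ab]] continuous_intros)
      show "summable (\<lambda>m. B * norm (fps_nth G m * x ^ m))"
        by (intro summable_mult summ)
      show "norm (?f m v) \<le> B * norm (fps_nth G m * x ^ m)" if v: "v \<in> {0..1}" for m v
      proof -
        have "norm (fps_nth G m * (of_real (1 - v) * x) ^ m) \<le> norm (fps_nth G m * x ^ m)"
          unfolding norm_mult[of "fps_nth G m"] norm_power
          by (intro mult_left_mono power_mono le1 v norm_ge_zero)
        then show ?thesis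
          unfolding norm_mult[of "?w v"] using B[OF v] \<open>B \<ge> 0\<close> by (intro mult_mono) auto
      qed
      show "(\<lambda>m. ?f m v) sums (?w v * g (1 - x + of_real v * (1 - (1 - x))))" if v: "v \<in> {0..1}" for v
      proof -
        have "(\<lambda>m. fps_nth G m * (of_real (1 - v) * x) ^ m) sums g (1 - of_real (1 - v) * x)"
          by (rule sums) (use le1[OF v] x in linarith)
        from sums_mult[OF this, of "?w v"] show ?thesis
          by (simp add: algebra_simps)
      qed
    qed
    moreover have "integral {0..1} (?f m) = Gamma \<beta> * (Gamma (a + of_nat m) * rGamma (a + \<beta> + of_nat m)) * fps_nth G m * x ^ m" for m
    proof -
      have "integral {0..1} (?f m) = integral {0..1} (\<lambda>v::real. (fps_nth G m * x ^ m) *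
          (of_real v powr (\<beta> - 1) * of_real (1 - v) powr (a + of_nat m - 1)))"
      proof (rule integral_cong)
        fix v :: real assume v: "v \<in> {0..1}"
        have "of_real (1 - v) powr (a - 1) * of_real (1 - v) ^ m = (of_real (1 - v) powr (a + of_nat m - 1) :: complex)"
        proof (cases "v = 1")
          case False
          then have "0 < 1 - v" using v by auto
          from of_real_powr_add_of_nat(1)[OF this, of "a - 1" m] show ?thesis
            by (simp only: add_diff_eq diff_add_eq)
        qed auto
        moreover have "?f m v = (fps_nth G m * x ^ m) * (of_real v powr (\<beta> - 1) * (of_real (1 - v) powr (a - 1) * of_real (1 - v) ^ m))"
          by (simp only: power_mult_distrib mult_ac)
        ultimately show "?f m v = (fps_nth G m * x ^ m) * (of_real v powr (\<beta> - 1) * of_real (1 - v) powr (a + of_nat m - 1))"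
          by simp
      qed
      also have "\<dots> = fps_nth G m * x ^ m * Beta \<beta> (a + of_nat m)"
        using Beta_integral_complex[of \<beta> "a + of_nat m"] ab by (simp add: integral_mult_right)
      finally show ?thesis
        by (simp add: Beta_altdef add_ac mult_ac)
    qed
    ultimately show ?case
      by simp
  qed
qed

lemma rl_integral_real:
  assumes ab: "1 < Re a" "1 < Re \<beta>" and g: "g holomorphic_on D" and z: "0 < z" "z < 1"
  shows "of_real (1 - z) powr (a + \<beta> - 1) * rl_integral a \<beta> g (of_real z) =
    integral {z..1} (\<lambda>\<xi>. of_real (\<xi> - z) powr (\<beta> - 1) * (of_real (1 - \<xi>) powr (a - 1) * g (of_real \<xi>)))"
    (is "_ = integral _ ?F")
proof -
  have "continuous_on {z..1} ?F"
    by (intro continuous_intros continuous_on_compose2[OF continuous_on_of_real_powr]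
        continuous_on_compose2[OF holomorphic_on_imp_continuous_on[OF g]])
      (use ab z unit_interval_subset in auto)
  then have "(?F has_integral integral {z..1} ?F) (cbox z 1)"
    by (simp add: cbox_interval integrable_continuous_real integrable_integral)
  from has_integral_affinity'[OF this, of "1 - z" z] z
  have "((\<lambda>v. ?F ((1 - z) * v + z)) has_integral integral {z..1} ?F /\<^sub>R (1 - z)) {0..1}"
    by (simp add: cbox_interval)
  then have 1: "((\<lambda>v. of_real (1 - z) * ?F ((1 - z) * v + z)) has_integral
      of_real (1 - z) * (integral {z..1} ?F /\<^sub>R (1 - z))) {0..1}"
    by (rule has_integral_mult_right)
  have 2: "of_real (1 - z) * ?F ((1 - z) * v + z) = of_real (1 - z) powr (a + \<beta> - 1) *
     (of_real v powr (\<beta> - 1) * of_real (1 - v) powr (a - 1) * g (of_real z + of_real v * (1 - of_real z)))"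
    if v: "v \<in> {0..1}" for v
  proof -
    have e1: "(1 - z) * v + z - z = (1 - z) * v" "1 - ((1 - z) * v + z) = (1 - z) * (1 - v)"
      by (simp_all add: algebra_simps)
    have p1: "of_real ((1 - z) * v) powr (\<beta> - 1) = (of_real (1 - z) powr (\<beta> - 1) * of_real v powr (\<beta> - 1) :: complex)"
      unfolding of_real_mult by (rule powr_times_real) (use v z in auto)
    have p2: "of_real ((1 - z) * (1 - v)) powr (a - 1) = (of_real (1 - z) powr (a - 1) * of_real (1 - v) powr (a - 1) :: complex)"
      unfolding of_real_mult by (rule powr_times_real) (use v z in auto)
    have "complex_of_real (1 - z) \<noteq> 0"
      using z by (metis diff_gt_0_iff_gt less_irrefl of_real_eq_0_iff)
    then have p3: "of_real (1 - z) * (of_real (1 - z) powr (\<beta> - 1) * of_real (1 - z) powr (a - 1)) =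
        (of_real (1 - z) powr (a + \<beta> - 1) :: complex)"
    proof -
      have "of_real (1 - z) powr (a + \<beta> - 1) = (of_real (1 - z) powr (1 + ((\<beta> - 1) + (a - 1))) :: complex)"
        by (simp add: algebra_simps)
      also have "\<dots> = of_real (1 - z) powr 1 * (of_real (1 - z) powr (\<beta> - 1) * of_real (1 - z) powr (a - 1))"
        by (simp only: powr_add)
      finally show ?thesis
        using \<open>complex_of_real (1 - z) \<noteq> 0\<close> by simp
    qed
    have e2: "complex_of_real ((1 - z) * v + z) = of_real z + of_real v * (1 - of_real z)"
      by (simp add: algebra_simps)
    show ?thesis
      unfolding e1 e2 p1 p2 p3[symmetric] by (simp only: mult_ac)
  qed
  have "((\<lambda>v. of_real (1 - z) powr (a + \<beta> - 1) *
     (of_real v powr (\<beta> - 1) * of_real (1 - v) powr (a - 1) * g (of_real z + of_real v * (1 - of_real z)))) has_integral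
      of_real (1 - z) * (integral {z..1} ?F /\<^sub>R (1 - z))) {0..1}"
    by (rule has_integral_eq[OF 2 1])
  moreover have "of_real (1 - z) * (integral {z..1} ?F /\<^sub>R (1 - z)) = integral {z..1} ?F"
    using z by (simp add: scaleR_conv_of_real)
  ultimately have "((\<lambda>v. of_real (1 - z) powr (a + \<beta> - 1) *
     (of_real v powr (\<beta> - 1) * of_real (1 - v) powr (a - 1) * g (of_real z + of_real v * (1 - of_real z)))) has_integral
      integral {z..1} ?F) {0..1}"
    by simp
  then show ?thesis
    unfolding rl_integral_def integral_mult_right[symmetric] by (rule integral_unique)
qed

text \<open>The path is cut at a point \<open>x0\<close> inside all discs of convergence. The piece
  from \<open>x0\<close> to \<open>1\<close> is holomorphic in \<open>z\<close> near
  \<open>0\<close>; the piece from \<open>z\<close> to \<open>x0\<close> is evaluated by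
  \<open>rl_power_integral\<close>, one exponent at a time. All this happens for real
  \<open>z\<close>, and the identity theorem extends the outcome to complex
  \<open>z\<close>.\<close>

lemma rl_integral_expands:
  assumes ab: "1 < Re a" "1 < Re \<beta>" and g: "g holomorphic_on D" and K: "finite K"
    and int: "\<beta> \<notin> \<int>" "\<And>k. k \<in> K \<Longrightarrow> s k + \<beta> \<notin> \<int>"
    and ex: "expands_mod_hol D (\<lambda>z. (1 - z) powr (a - 1) * g z) K s H"
  shows "expands_mod_hol D (\<lambda>z. (1 - z) powr (a + \<beta> - 1) * rl_integral a \<beta> g z) K (\<lambda>k. s k + \<beta>)
    (\<lambda>k. Abs_fps (\<lambda>m. Gamma \<beta> * (rl_mult (s k) \<beta> m * fps_nth (H k) m)))"
proof -
  obtain h h0 where h: "\<And>k. k \<in> K \<Longrightarrow> h k has_fps_expansion H k" and h0: "h0 analytic_on {0}"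
    and ev: "\<forall>\<^sub>F z in at 0 within D. (1 - z) powr (a - 1) * g z = (\<Sum>k\<in>K. z powr s k * h k z) + h0 z"
    using ex unfolding expands_mod_hol_def by blast
  obtain H0 where H0: "h0 has_fps_expansion H0"
    using h0 analytic_at_imp_has_fps_expansion_0 by blast
  have radius: "\<forall>\<^sub>F z in nhds 0. ereal (norm z) < fps_conv_radius F \<and> eval_fps F z = f z"
    if "f has_fps_expansion F" for f :: "complex \<Rightarrow> complex" and F
  proof -
    have "\<forall>\<^sub>F z in nhds 0. z \<in> eball 0 (fps_conv_radius F)"
      using that by (intro eventually_nhds_in_open) (auto simp: has_fps_expansion_def zero_ereal_def)
    moreover have "\<forall>\<^sub>F z in nhds 0. eval_fps F z = f z"
      using that by (simp add: has_fps_expansion_def)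
    ultimately show ?thesis
      by eventually_elim auto
  qed
  have "\<forall>\<^sub>F z in nhds 0. \<forall>k\<in>K. ereal (norm z) < fps_conv_radius (H k) \<and> eval_fps (H k) z = h k z"
    by (intro eventually_ball_finite K ballI radius h)
  then have "\<forall>\<^sub>F z in at 0 within D. \<forall>k\<in>K. ereal (norm z) < fps_conv_radius (H k) \<and> eval_fps (H k) z = h k z"
    by (rule filter_leD[OF at_within_le_nhds])
  moreover have "\<forall>\<^sub>F z in at 0 within D. ereal (norm z) < fps_conv_radius H0 \<and> eval_fps H0 z = h0 z"
    by (rule filter_leD[OF at_within_le_nhds radius[OF H0]])
  ultimately have "\<forall>\<^sub>F z in at 0 within D. (\<forall>k\<in>K. ereal (norm z) < fps_conv_radius (H k)) \<and>
      ereal (norm z) < fps_conv_radius H0 \<and>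
      (1 - z) powr (a - 1) * g z = (\<Sum>k\<in>K. z powr s k * eval_fps (H k) z) + eval_fps H0 z"
    using ev by eventually_elim auto
  then obtain e where e: "e > 0" "\<And>z. z \<in> D \<Longrightarrow> z \<noteq> 0 \<Longrightarrow> norm z < e \<Longrightarrow> (\<forall>k\<in>K. ereal (norm z) < fps_conv_radius (H k)) \<and>
      ereal (norm z) < fps_conv_radius H0 \<and>
      (1 - z) powr (a - 1) * g z = (\<Sum>k\<in>K. z powr s k * eval_fps (H k) z) + eval_fps H0 z"
    unfolding eventually_at by (auto simp: dist_norm)
  \<comment> \<open>Halving puts \<open>x0\<close> strictly inside the region where the expansion is
    valid and strictly below \<open>1\<close>. The transformed series are known to converge at every
    real point below \<open>x0\<close>; the smaller \<open>x1\<close> provides a disc on which they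
    are holomorphic.\<close>
  define x0 where "x0 = min e 1 / 2"
  define x1 where "x1 = x0 / 2"
  have x0: "0 < x0" "x0 < e" "x0 < 1" and x1: "0 < x1" "x1 < x0"
    using e(1) by (auto simp: x0_def x1_def)
  have x0D: "of_real x \<in> D" "complex_of_real x \<noteq> 0" "norm (complex_of_real x) < e" if "0 < x" "x \<le> x0" for x
    using that x0 unit_interval_subset by auto
  have rad: "ereal x0 < fps_conv_radius (H k)" if "k \<in> K" for k
    using e(2)[OF x0D[OF x0(1)]] that x0 by auto
  have rad0: "ereal x0 < fps_conv_radius H0"
    using e(2)[OF x0D[OF x0(1)]] x0 by auto

  \<comment> \<open>\<open>T\<close> is the integral near \<open>0\<close> for one exponent,
    \<open>M\<close> the series of its singular part and \<open>R\<close> that of its holomorphic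
    part.\<close>
  define T where "T = (\<lambda>s H z. integral {z..x0} (\<lambda>\<xi>. of_real (\<xi> - z) powr (\<beta> - 1) *
      (of_real \<xi> powr s * (\<Sum>m. fps_nth H m * of_real \<xi> ^ m))))"
  define M where "M = (\<lambda>s H. Abs_fps (\<lambda>m. rl_mult s \<beta> m * fps_nth H m))"
  define R where "R = (\<lambda>s H. Abs_fps (rl_hol_coeff s \<beta> x0 (fps_nth H)))"
  have T: "T s H z = Gamma \<beta> * (of_real z powr (s + \<beta>) * eval_fps (M s H) (of_real z)) + eval_fps (R s H) (of_real z)"
    and conv: "ereal z \<le> fps_conv_radius (M s H)" "ereal z \<le> fps_conv_radius (R s H)"
    if "s + \<beta> \<notin> \<int>" "ereal x0 < fps_conv_radius H" "0 < z" "z < x0" for s H z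
  proof -
    have "summable (\<lambda>m. norm (fps_nth H m) * x0 ^ m)"
      using norm_summable_fps[of "of_real x0" H] that x0 by (simp add: norm_mult norm_power)
    note * = rl_power_integral[OF ab(2) that(1) this that(3,4)]
    show "T s H z = Gamma \<beta> * (of_real z powr (s + \<beta>) * eval_fps (M s H) (of_real z)) + eval_fps (R s H) (of_real z)"
      unfolding T_def *(1) by (simp add: eval_fps_def M_def R_def)
    show "ereal z \<le> fps_conv_radius (M s H)"
      using conv_radius_geI[of "fps_nth (M s H)" "of_real z"] *(2) that by (simp add: M_def fps_conv_radius_def)
    show "ereal z \<le> fps_conv_radius (R s H)"
      using conv_radius_geI[of "fps_nth (R s H)" "of_real z"] *(3) that by (simp add: R_def fps_conv_radius_def)
  qed
  have hol: "eval_fps (M s H) holomorphic_on ball 0 x1" "eval_fps (R s H) holomorphic_on ball 0 x1"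
     and pos: "0 < fps_conv_radius (M s H)" "0 < fps_conv_radius (R s H)"
    if "s + \<beta> \<notin> \<int>" "ereal x0 < fps_conv_radius H" for s H
  proof -
    have *: "eval_fps F holomorphic_on ball 0 x1" if "ereal x1 \<le> fps_conv_radius F" for F :: "complex fps"
      by (rule holomorphic_on_eval_fps, rule ball_eball_mono[OF that])
    show "eval_fps (M s H) holomorphic_on ball 0 x1" "eval_fps (R s H) holomorphic_on ball 0 x1"
      by (intro * conv[OF that x1])+
    have "0 < ereal x1" using x1(1) by simp
    then show "0 < fps_conv_radius (M s H)" "0 < fps_conv_radius (R s H)"
      by (rule less_le_trans[OF _ conv(1)[OF that x1]], rule less_le_trans[OF _ conv(2)[OF that x1]])
  qed
  \<comment> \<open>The holomorphic part of the expansion is treated as exponent \<open>0\<close>.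
    There \<open>rGamma\<close> annihilates every multiplier, so no new power
    \<open>z^\<beta>\<close> appears.\<close>
  have M0: "M 0 H0 = 0"
  proof -
    have "- complex_of_nat m \<in> \<int>\<^sub>\<le>\<^sub>0" for m
      by simp
    then show ?thesis
      by (simp add: M_def rl_mult_def fps_eq_iff rGamma_eq_zero_iff)
  qed

  \<comment> \<open>The piece of the path away from \<open>0\<close>. For \<open>z\<close> in the
    disc of radius \<open>x0\<close> the difference \<open>\<xi> - z\<close> has positive real part,
    so its principal power is holomorphic in \<open>z\<close>.\<close>
  define Q where "Q = (\<lambda>z. integral {x0..1} (\<lambda>\<xi>::real. (of_real \<xi> - z) powr (\<beta> - 1) *
      (of_real (1 - \<xi>) powr (a - 1) * g (of_real \<xi>))))"
  have wcont: "continuous_on {x0..1} (\<lambda>\<xi>::real. of_real (1 - \<xi>) powr (a - 1) * g (of_real \<xi>))"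
    by (intro continuous_intros continuous_on_compose2[OF continuous_on_of_real_powr]
        continuous_on_compose2[OF holomorphic_on_imp_continuous_on[OF g]])
      (use ab x0 unit_interval_subset in auto)
  have Re_diff: "0 < Re (of_real \<xi> - z)" if "z \<in> ball 0 x0" "\<xi> \<in> {x0..1}" for z and \<xi> :: real
    using that complex_Re_le_cmod[of z] by auto
  have Q: "Q holomorphic_on ball 0 x0"
  proof -
    have "(\<lambda>z. integral (cbox x0 1) (\<lambda>\<xi>::real. (of_real \<xi> - z) powr (\<beta> - 1) *
      (of_real (1 - \<xi>) powr (a - 1) * g (of_real \<xi>)))) holomorphic_on ball 0 x0"
    proof (rule leibniz_rule_holomorphic[where fx = "\<lambda>z \<xi>. - ((\<beta> - 1) * (of_real \<xi> - z) powr (\<beta> - 2)) *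
        (of_real (1 - \<xi>) powr (a - 1) * g (of_real \<xi>))"])
      fix z :: complex and \<xi> :: real assume *: "z \<in> ball 0 x0" "\<xi> \<in> cbox x0 1"
      then have "of_real \<xi> - z \<notin> \<real>\<^sub>\<le>\<^sub>0"
        using Re_diff[of z \<xi>] by (auto simp: complex_nonpos_Reals_iff cbox_interval)
      then have "((\<lambda>z. (of_real \<xi> - z) powr (\<beta> - 1)) has_field_derivative
          - ((\<beta> - 1) * (of_real \<xi> - z) powr (\<beta> - 2))) (at z within ball 0 x0)"
        by (auto intro!: derivative_eq_intros)
      then show "((\<lambda>z. (of_real \<xi> - z) powr (\<beta> - 1) * (of_real (1 - \<xi>) powr (a - 1) * g (of_real \<xi>)))
         has_field_derivative - ((\<beta> - 1) * (of_real \<xi> - z) powr (\<beta> - 2)) *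
          (of_real (1 - \<xi>) powr (a - 1) * g (of_real \<xi>))) (at z within ball 0 x0)"
        by (rule DERIV_cmult_right)
    next
      fix z :: complex assume z: "z \<in> ball 0 x0"
      have "continuous_on {x0..1} (\<lambda>\<xi>::real. (of_real \<xi> - z) powr (\<beta> - 1) * (of_real (1 - \<xi>) powr (a - 1) * g (of_real \<xi>)))"
        by (intro continuous_on_mult[OF _ wcont] continuous_intros)
          (use Re_diff[OF z] in \<open>force simp: complex_nonpos_Reals_iff\<close>)+
      then show "(\<lambda>\<xi>::real. (of_real \<xi> - z) powr (\<beta> - 1) * (of_real (1 - \<xi>) powr (a - 1) * g (of_real \<xi>))) integrable_on cbox x0 1"
        unfolding cbox_interval by (rule integrable_continuous_real)
    next
      have "continuous_on (ball 0 x0 \<times> {x0..1}) (\<lambda>p. (of_real (snd p) - fst p) powr (\<beta> - 2) :: complex)"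
      proof -
        have Re: "Re (fst p) < snd p" if "p \<in> ball 0 x0 \<times> {x0..1}" for p
          using Re_diff[of "fst p" "snd p"] that by auto
        show ?thesis
          by (intro continuous_on_powr_complex continuous_intros) (auto dest!: Re simp: complex_eq_iff)
      qed
      then show "continuous_on (ball 0 x0 \<times> cbox x0 1) (\<lambda>(z, \<xi>). - ((\<beta> - 1) * (of_real \<xi> - z) powr (\<beta> - 2)) *
          (of_real (1 - \<xi>) powr (a - 1) * g (of_real \<xi>)))"
        unfolding cbox_interval case_prod_unfold
        by (intro continuous_on_mult[OF _ continuous_on_compose2[OF wcont]] continuous_on_minus continuous_on_const
            continuous_on_mult continuous_on_snd continuous_on_id) auto
    qed (rule convex_ball)
    then show ?thesis
      by (simp only: Q_def[abs_def] cbox_interval)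
  qed

  define h0' where "h0' = (\<lambda>z. (\<Sum>k\<in>K. eval_fps (R (s k) (H k)) z) + eval_fps (R 0 H0) z + Q z)"
  have h0'_hol: "h0' holomorphic_on ball 0 x1"
    unfolding h0'_def
    by (intro holomorphic_on_add holomorphic_on_sum hol holomorphic_on_subset[OF Q])
      (use int rad rad0 x1 in auto)
  have fint: "(\<lambda>\<xi>::real. of_real (\<xi> - z) powr (\<beta> - 1) * (of_real \<xi> powr s * (\<Sum>m. fps_nth F m * of_real \<xi> ^ m)))
      integrable_on {z..x0}"
    if "ereal x0 < fps_conv_radius F" "0 < z" "z < x0" for s z and F :: "complex fps"
  proof -
    have "continuous_on {z..x0} (\<lambda>\<xi>::real. eval_fps F (of_real \<xi>))"
    proof (rule continuous_on_compose2[OF continuous_on_eval_fps[of F]])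
      have "complex_of_real \<xi> \<in> eball 0 (fps_conv_radius F)" if "\<xi> \<in> {z..x0}" for \<xi>
      proof -
        have "ereal (norm (complex_of_real \<xi>)) \<le> ereal x0"
          using that \<open>0 < z\<close> by auto
        then have "ereal (norm (complex_of_real \<xi>)) < fps_conv_radius F"
          using \<open>ereal x0 < fps_conv_radius F\<close> by (rule le_less_trans)
        then show ?thesis
          by (simp add: dist_norm)
      qed
      then show "complex_of_real ` {z..x0} \<subseteq> eball 0 (fps_conv_radius F)"
        by blast
    qed (intro continuous_intros)
    moreover have "continuous_on {z..x0} (\<lambda>\<xi>::real. of_real \<xi> powr s)"
      using that by (intro continuous_intros) (auto simp: complex_nonpos_Reals_iff)
    moreover have "continuous_on {z..x0} (\<lambda>\<xi>::real. of_real (\<xi> - z) powr (\<beta> - 1))"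
      by (intro continuous_on_compose2[OF continuous_on_of_real_powr] continuous_intros) (use ab in auto)
    ultimately have "continuous_on {z..x0} (\<lambda>\<xi>::real. of_real (\<xi> - z) powr (\<beta> - 1) * (of_real \<xi> powr s * eval_fps F (of_real \<xi>)))"
      by (intro continuous_on_mult)
    then show ?thesis
      unfolding eval_fps_def by (rule integrable_continuous_real)
  qed
  have real: "(1 - of_real z) powr (a + \<beta> - 1) * rl_integral a \<beta> g (of_real z) =
      (\<Sum>k\<in>K. of_real z powr (s k + \<beta>) * (Gamma \<beta> * eval_fps (M (s k) (H k)) (of_real z))) + h0' (of_real z)"
    if z: "0 < z" "z < x1" for z
  proof -
    have z': "z < x0" "z < 1" using z x1 x0 by auto
    let ?F = "\<lambda>\<xi>::real. of_real (\<xi> - z) powr (\<beta> - 1) * (of_real (1 - \<xi>) powr (a - 1) * g (of_real \<xi>))"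
    have Fint: "?F integrable_on {z..1}"
      by (intro integrable_continuous_real continuous_intros continuous_on_compose2[OF continuous_on_of_real_powr]
          continuous_on_compose2[OF holomorphic_on_imp_continuous_on[OF g]])
        (use ab z z' unit_interval_subset in auto)
    have "(1 - of_real z) powr (a + \<beta> - 1) * rl_integral a \<beta> g (of_real z) = integral {z..1} ?F"
      using rl_integral_real[OF ab g z(1) z'(2)] by (simp only: of_real_diff of_real_1)
    also have "\<dots> = integral {z..x0} ?F + integral {x0..1} ?F"
      by (rule Henstock_Kurzweil_Integration.integral_combine[symmetric]) (use z' x0 Fint in auto)
    also have "integral {x0..1} ?F = Q (of_real z)"
      by (simp add: Q_def)
    also have "integral {z..x0} ?F = integral {z..x0} (\<lambda>\<xi>. 
       (\<Sum>k\<in>K. of_real (\<xi> - z) powr (\<beta> - 1) * (of_real \<xi> powr s k * (\<Sum>m. fps_nth (H k) m * of_real \<xi> ^ m))) +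
       of_real (\<xi> - z) powr (\<beta> - 1) * (of_real \<xi> powr 0 * (\<Sum>m. fps_nth H0 m * of_real \<xi> ^ m)))"
    proof (rule integral_cong)
      fix \<xi> assume "\<xi> \<in> {z..x0}"
      then have \<xi>: "0 < \<xi>" "\<xi> \<le> x0" using z by auto
      have "(1 - of_real \<xi>) powr (a - 1) * g (of_real \<xi>) =
          (\<Sum>k\<in>K. of_real \<xi> powr s k * eval_fps (H k) (of_real \<xi>)) + eval_fps H0 (of_real \<xi>)"
        using e(2)[OF x0D[OF \<xi>]] by blast
      then show "?F \<xi> = (\<Sum>k\<in>K. of_real (\<xi> - z) powr (\<beta> - 1) * (of_real \<xi> powr s k * (\<Sum>m. fps_nth (H k) m * of_real \<xi> ^ m))) +
       of_real (\<xi> - z) powr (\<beta> - 1) * (of_real \<xi> powr 0 * (\<Sum>m. fps_nth H0 m * of_real \<xi> ^ m))"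
        using \<xi> by (simp add: eval_fps_def sum_distrib_left distrib_left)
    qed
    also have "\<dots> = (\<Sum>k\<in>K. T (s k) (H k) z) + T 0 H0 z"
    proof -
      note i0 = fint[OF rad0 z(1) z'(1), of 0]
      have ik: "(\<lambda>\<xi>::real. of_real (\<xi> - z) powr (\<beta> - 1) * (of_real \<xi> powr s k * (\<Sum>m. fps_nth (H k) m * of_real \<xi> ^ m)))
          integrable_on {z..x0}" if "k \<in> K" for k
        by (rule fint[OF rad[OF that] z(1) z'(1)])
      show ?thesis
        unfolding T_def
        by (rule trans[OF integral_add[OF integrable_sum[OF K ik] i0]]) (simp_all only: integral_sum[OF K ik])
    qed
    also have "(\<Sum>k\<in>K. T (s k) (H k) z) = (\<Sum>k\<in>K. Gamma \<beta> * (of_real z powr (s k + \<beta>) *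
         eval_fps (M (s k) (H k)) (of_real z)) + eval_fps (R (s k) (H k)) (of_real z))"
      by (intro sum.cong T int rad z z' refl)
    also have "T 0 H0 z = eval_fps (R 0 H0) (of_real z)"
      using T[of 0 H0 z] int rad0 z z' M0 by simp
    finally show ?thesis
      by (simp add: h0'_def sum.distrib algebra_simps)
  qed
  have eq: "(1 - z) powr (a + \<beta> - 1) * rl_integral a \<beta> g z =
      (\<Sum>k\<in>K. z powr (s k + \<beta>) * (Gamma \<beta> * eval_fps (M (s k) (H k)) z)) + h0' z"
    if z: "z \<in> D \<inter> ball 0 x1" for z
  proof (rule holomorphic_eq_from_real_interval[of "\<lambda>z. (1 - z) powr (a + \<beta> - 1) * rl_integral a \<beta> g z" "D \<inter> ball 0 x1"
        "\<lambda>z. (\<Sum>k\<in>K. z powr (s k + \<beta>) * (Gamma \<beta> * eval_fps (M (s k) (H k)) z)) + h0' z" 0 x1])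
    show "open (D \<inter> ball 0 x1)" "connected (D \<inter> ball 0 x1)"
      by (auto intro!: open_Int open_D convex_connected convex_Int convex_D)
    have "1 - z \<notin> \<real>\<^sub>\<le>\<^sub>0" if "z \<in> D \<inter> ball 0 x1" for z
      using that x1 x0 complex_Re_le_cmod[of z] by (auto simp: complex_nonpos_Reals_iff)
    then show "(\<lambda>z. (1 - z) powr (a + \<beta> - 1) * rl_integral a \<beta> g z) holomorphic_on D \<inter> ball 0 x1"
      by (intro holomorphic_on_mult holomorphic_on_powr holomorphic_intros
          holomorphic_on_subset[OF rl_integral_holomorphic[OF ab g]]) auto
    show "(\<lambda>z. (\<Sum>k\<in>K. z powr (s k + \<beta>) * (Gamma \<beta> * eval_fps (M (s k) (H k)) z)) + h0' z) holomorphic_on D \<inter> ball 0 x1"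
      by (intro holomorphic_on_add holomorphic_on_sum holomorphic_on_mult holomorphic_on_powr holomorphic_on_const
          holomorphic_on_ident holomorphic_on_subset[OF hol(1)] holomorphic_on_subset[OF h0'_hol])
        (use int rad in auto)
  qed (use z x1 x0 x0D real in auto)
  show ?thesis
    unfolding expands_mod_hol_def
  proof (intro exI conjI ballI)
    show "(\<lambda>z. Gamma \<beta> * eval_fps (M (s k) (H k)) z) has_fps_expansion
        Abs_fps (\<lambda>m. Gamma \<beta> * (rl_mult (s k) \<beta> m * fps_nth (H k) m))" if "k \<in> K" for k
    proof -
      have "(\<lambda>z. Gamma \<beta> * eval_fps (M (s k) (H k)) z) has_fps_expansion fps_const (Gamma \<beta>) * M (s k) (H k)"
        by (intro fps_expansion_intros eval_fps_has_fps_expansion pos int rad that)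
      moreover have "fps_const (Gamma \<beta>) * M (s k) (H k) =
          Abs_fps (\<lambda>m. Gamma \<beta> * (rl_mult (s k) \<beta> m * fps_nth (H k) m))"
        by (simp add: fps_eq_iff M_def)
      ultimately show ?thesis by simp
    qed
    show "h0' analytic_on {0}"
      using h0'_hol x1(1) analytic_at by (metis centre_in_ball open_ball)
    have "\<forall>\<^sub>F z in at 0 within D. z \<in> D \<inter> ball 0 x1"
      using x1(1) by (auto simp: eventually_at intro!: exI[of _ x1])
    then show "\<forall>\<^sub>F z in at 0 within D. (1 - z) powr (a + \<beta> - 1) * rl_integral a \<beta> g z =
      (\<Sum>k\<in>K. z powr (s k + \<beta>) * (Gamma \<beta> * eval_fps (M (s k) (H k)) z)) + h0' z"
      by eventually_elim (rule eq)
  qed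
qed

section \<open>Operations on expansions modulo holomorphic functions\<close>

lemma expands_mod_hol_cong:
  assumes "expands_mod_hol D f K s H" "\<forall>\<^sub>F z in at 0 within D. f z = f' z"
    "\<And>k. k \<in> K \<Longrightarrow> s k = s' k" "\<And>k. k \<in> K \<Longrightarrow> H k = H' k"
  shows "expands_mod_hol D f' K s' H'"
proof -
  obtain h h0 where h: "\<forall>k\<in>K. h k has_fps_expansion H k" and h0: "h0 analytic_on {0}"
    and ev: "\<forall>\<^sub>F z in at 0 within D. f z = (\<Sum>k\<in>K. z powr s k * h k z) + h0 z"
    using assms(1) unfolding expands_mod_hol_def by blast
  from assms(2) ev have "\<forall>\<^sub>F z in at 0 within D. f' z = (\<Sum>k\<in>K. z powr s' k * h k z) + h0 z"
    by eventually_elim (use assms in auto)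
  with h h0 assms(4) show ?thesis
    unfolding expands_mod_hol_def by (intro exI[of _ h] exI[of _ h0]) auto
qed

lemma expands_mod_hol_add_analytic:
  assumes "expands_mod_hol D f K s H" "h1 analytic_on {0}"
  shows "expands_mod_hol D (\<lambda>z. f z + h1 z) K s H"
proof -
  obtain h h0 where h: "\<forall>k\<in>K. h k has_fps_expansion H k" and h0: "h0 analytic_on {0}"
    and ev: "\<forall>\<^sub>F z in at 0 within D. f z = (\<Sum>k\<in>K. z powr s k * h k z) + h0 z"
    using assms(1) unfolding expands_mod_hol_def by blast
  have "\<forall>\<^sub>F z in at 0 within D. f z + h1 z = (\<Sum>k\<in>K. z powr s k * h k z) + (h0 z + h1 z)"
    using ev by eventually_elim simp
  with h analytic_on_add[OF h0 assms(2)] show ?thesis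
    unfolding expands_mod_hol_def by (intro exI[of _ h] exI[of _ "\<lambda>z. h0 z + h1 z"]) auto
qed

lemma expands_mod_hol_cmult:
  assumes "expands_mod_hol D f K s H"
  shows "expands_mod_hol D (\<lambda>z. c * f z) K s (\<lambda>k. fps_const c * H k)"
proof -
  obtain h h0 where h: "\<forall>k\<in>K. h k has_fps_expansion H k" and h0: "h0 analytic_on {0}"
    and ev: "\<forall>\<^sub>F z in at 0 within D. f z = (\<Sum>k\<in>K. z powr s k * h k z) + h0 z"
    using assms(1) unfolding expands_mod_hol_def by blast
  have "\<forall>\<^sub>F z in at 0 within D. c * f z = (\<Sum>k\<in>K. z powr s k * (c * h k z)) + c * h0 z"
    using ev by eventually_elim (simp add: distrib_left sum_distrib_left mult_ac)
  moreover have "\<forall>k\<in>K. (\<lambda>z. c * h k z) has_fps_expansion fps_const c * H k"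
    using h by (auto intro!: fps_expansion_intros)
  moreover have "(\<lambda>z. c * h0 z) analytic_on {0}"
    by (intro analytic_intros h0)
  ultimately show ?thesis
    unfolding expands_mod_hol_def by (intro exI[of _ "\<lambda>k z. c * h k z"] exI[of _ "\<lambda>z. c * h0 z"]) auto
qed

text \<open>An equation valid near \<open>0\<close> in the open set \<open>D\<close> is valid in a
  neighbourhood of each nearby point of \<open>D\<close>, and can therefore be differentiated
  there.\<close>

lemma deriv_expansion_mod_hol:
  assumes K: "finite K" and h: "\<And>k. k \<in> K \<Longrightarrow> h k has_fps_expansion H k" and h0: "h0 analytic_on {0}"
    and ev: "\<forall>\<^sub>F z in at 0 within D. f z = (\<Sum>k\<in>K. z powr s k * h k z) + h0 z"
  shows "\<forall>\<^sub>F z in at 0 within D. deriv f z = (\<Sum>k\<in>K. z powr (s k - 1) * euler (s k) (h k) z) + deriv h0 z"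
proof -
  obtain H0 where H0: "h0 has_fps_expansion H0"
    using h0 analytic_at_imp_has_fps_expansion_0 by blast
  have "\<forall>\<^sub>F z in nhds 0. z \<in> D \<longrightarrow> f z = (\<Sum>k\<in>K. z powr s k * h k z) + h0 z"
    using ev Re_pos[of 0] unfolding eventually_at_filter by (auto elim!: eventually_mono)
  then have "\<forall>\<^sub>F y in nhds 0. \<forall>\<^sub>F z in nhds y. z \<in> D \<longrightarrow> f z = (\<Sum>k\<in>K. z powr s k * h k z) + h0 z"
    by (simp add: eventually_eventually)
  moreover have "\<forall>\<^sub>F y in nhds 0. \<forall>k\<in>K. h k field_differentiable at y"
    by (intro eventually_ball_finite K ballI) (rule has_fps_expansion_differentiable_near[OF h])
  moreover have "\<forall>\<^sub>F y in nhds 0. h0 field_differentiable at y"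
    by (rule has_fps_expansion_differentiable_near[OF H0])
  ultimately have "\<forall>\<^sub>F y in nhds 0. y \<noteq> 0 \<longrightarrow> y \<in> D \<longrightarrow> deriv f y =
      (\<Sum>k\<in>K. y powr (s k - 1) * euler (s k) (h k) y) + deriv h0 y"
  proof eventually_elim
    case (elim y)
    show ?case
    proof (intro impI)
      assume y: "y \<noteq> 0" "y \<in> D"
      have "\<forall>\<^sub>F z in nhds y. z \<in> D"
        using y open_D by (intro eventually_nhds_in_open)
      with elim(1) have "\<forall>\<^sub>F z in nhds y. f z = (\<Sum>k\<in>K. z powr s k * h k z) + h0 z"
        by eventually_elim auto
      then have "deriv f y = deriv (\<lambda>z. (\<Sum>k\<in>K. z powr s k * h k z) + h0 z) y"
        by (intro deriv_cong_ev) auto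
      also have "\<dots> = (\<Sum>k\<in>K. y powr (s k - 1) * euler (s k) (h k) y) + deriv h0 y"
      proof (intro DERIV_imp_deriv DERIV_add DERIV_sum)
        fix k assume k: "k \<in> K"
        have "(h k has_field_derivative deriv (h k) y) (at y)"
          using elim(2) k field_differentiable_derivI by blast
        moreover have "((\<lambda>z. z powr s k) has_field_derivative s k * y powr (s k - 1)) (at y)"
          using y by (auto intro!: derivative_eq_intros)
        ultimately have "((\<lambda>z. z powr s k * h k z) has_field_derivative
            s k * y powr (s k - 1) * h k y + deriv (h k) y * y powr s k) (at y)"
          by (intro DERIV_mult)
        then show "((\<lambda>z. z powr s k * h k z) has_field_derivative
            y powr (s k - 1) * euler (s k) (h k) y) (at y)"
          by (rule DERIV_cong) (use y in \<open>simp add: powr_diff euler_def field_simps\<close>)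
      next
        show "(h0 has_field_derivative deriv h0 y) (at y)"
          using elim(3) field_differentiable_derivI by blast
      qed
      finally show "deriv f y = (\<Sum>k\<in>K. y powr (s k - 1) * euler (s k) (h k) y) + deriv h0 y" .
    qed
  qed
  then show "\<forall>\<^sub>F y in at 0 within D. deriv f y =
      (\<Sum>k\<in>K. y powr (s k - 1) * euler (s k) (h k) y) + deriv h0 y"
    unfolding eventually_at_filter by eventually_elim auto
qed

lemma expands_mod_hol_deriv:
  assumes ex: "expands_mod_hol D f K s H" and K: "finite K" 
  shows "expands_mod_hol D (deriv f) K (\<lambda>k. s k - 1) (\<lambda>k. Abs_fps (\<lambda>m. (s k + of_nat m) * fps_nth (H k) m))"
proof -
  obtain h h0 where h: "\<And>k. k \<in> K \<Longrightarrow> h k has_fps_expansion H k" and h0: "h0 analytic_on {0}"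
    and ev: "\<forall>\<^sub>F z in at 0 within D. f z = (\<Sum>k\<in>K. z powr s k * h k z) + h0 z"
    using ex unfolding expands_mod_hol_def by blast
  have "euler (s k) (h k) has_fps_expansion Abs_fps (\<lambda>m. (s k + of_nat m) * fps_nth (H k) m)" if "k \<in> K" for k
  proof -
    have "euler (s k) (h k) has_fps_expansion fps_const (s k) * H k + fps_X * fps_deriv (H k)"
      unfolding euler_def[abs_def] by (intro fps_expansion_intros h that)
    moreover have "fps_const (s k) * H k + fps_X * fps_deriv (H k) = Abs_fps (\<lambda>m. (s k + of_nat m) * fps_nth (H k) m)"
      by (simp add: fps_eq_iff distrib_right flip: of_nat_Suc)
    ultimately show ?thesis by simp
  qed
  moreover have "deriv h0 analytic_on {0}"
    by (intro analytic_intros h0)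
  ultimately show ?thesis
    unfolding expands_mod_hol_def using deriv_expansion_mod_hol[OF K h h0 ev]
    by (intro exI[of _ "\<lambda>k. euler (s k) (h k)"] exI[of _ "deriv h0"]) auto
qed

text \<open>Supplies the frequent vanishing from which a formal series is concluded to be zero;
  \<open>D\<close> accumulates at \<open>0\<close> along the reals.\<close>

lemma eventually_frequently_at_0:
  assumes "eventually R (at 0 within D)"
  shows "\<exists>\<^sub>F z in at 0. R z"
proof -
  have "(0::real) islimpt {0<..<1}"
    by (simp add: islimpt_greaterThanLessThan1)
  then have "(0::complex) islimpt of_real ` {0<..<1}"
    using islimpt_of_real_image by fastforce
  then have "0 islimpt D"
    by (rule islimpt_subset) (auto intro: unit_interval_subset)
  then have "\<exists>\<^sub>F z in at 0 within D. R z"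
    using assms by (intro eventually_frequently) (auto simp: trivial_limit_within)
  then show ?thesis
    unfolding frequently_def using filter_leD[OF at_le[OF subset_UNIV]] by blast
qed

text \<open>
  \<open>(1 - z)\<^sup>b\<^sup>-\<^sup>1 g'\<close> stands for the fractional integral of order \<open>b - a\<close> of \<open>(1 - z)\<^sup>a\<^sup>-\<^sup>1 g\<close> based at \<open>1\<close>.
  The integral converges only for large \<open>Re a\<close> and
  \<open>Re (b - a)\<close>, so the transform is characterised by its effect on the expansions at \<open>1\<close> and \<open>0\<close>.
\<close>

definition rl_pair :: "complex \<Rightarrow> complex \<Rightarrow> (complex \<Rightarrow> complex) \<Rightarrow> (complex \<Rightarrow> complex) \<Rightarrow> bool" where
  "rl_pair a b g g' \<longleftrightarrow> g' holomorphic_on D \<and>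
     (\<forall>G. (\<lambda>x. g (1 - x)) has_fps_expansion G \<longrightarrow>
       (\<lambda>x. g' (1 - x)) has_fps_expansion Abs_fps (\<lambda>m. Gamma (a + of_nat m) * rGamma (b + of_nat m) * fps_nth G m)) \<and>
     (\<forall>(K :: (nat \<times> nat) set) s H. finite K \<longrightarrow> (\<forall>k\<in>K. s k + (b - a) \<notin> \<int>) \<longrightarrow>
       expands_mod_hol D (\<lambda>z. (1 - z) powr (a - 1) * g z) K s H \<longrightarrow>
       expands_mod_hol D (\<lambda>z. (1 - z) powr (b - 1) * g' z) K (\<lambda>k. s k + (b - a))
         (\<lambda>k. Abs_fps (\<lambda>m. rl_mult (s k) (b - a) m * fps_nth (H k) m)))"

section \<open>Continuation of the transform in its parameters\<close>

lemma rl_pair_expands: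
  fixes K :: "(nat \<times> nat) set"
  assumes "rl_pair a b g g'" "finite K" "\<And>k. k \<in> K \<Longrightarrow> s k + (b - a) \<notin> \<int>"
    and "expands_mod_hol D (\<lambda>z. (1 - z) powr (a - 1) * g z) K s H"
  shows "expands_mod_hol D (\<lambda>z. (1 - z) powr (b - 1) * g' z) K (\<lambda>k. s k + (b - a))
    (\<lambda>k. Abs_fps (\<lambda>m. rl_mult (s k) (b - a) m * fps_nth (H k) m))"
  using assms(1)[unfolded rl_pair_def, THEN conjunct2, THEN conjunct2, rule_format, OF assms(2) _ assms(4)] assms(3)
  by simp

lemma rl_pair_base:
  assumes "1 < Re a" "1 < Re (b - a)" "b - a \<notin> \<int>" and g: "g holomorphic_on D"
  shows "rl_pair a b g (\<lambda>z. inverse (Gamma (b - a)) * rl_integral a (b - a) g z)"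
  unfolding rl_pair_def
proof (intro conjI allI impI)
  have nz: "Gamma (b - a) \<noteq> 0"
    using assms(3) nonpos_Ints_Int by (auto simp: Gamma_eq_zero_iff)
  show "(\<lambda>z. inverse (Gamma (b - a)) * rl_integral a (b - a) g z) holomorphic_on D"
    by (intro holomorphic_intros rl_integral_holomorphic assms)
  show "(\<lambda>x. inverse (Gamma (b - a)) * rl_integral a (b - a) g (1 - x)) has_fps_expansion
      Abs_fps (\<lambda>m. Gamma (a + of_nat m) * rGamma (b + of_nat m) * fps_nth G m)"
    if "(\<lambda>x. g (1 - x)) has_fps_expansion G" for G
    by (rule has_fps_expansion_schematicI[OF has_fps_expansion_cmult_left[OF
          rl_integral_has_fps_expansion[OF assms(1,2) g that]]])
      (use nz in \<open>simp add: fps_eq_iff\<close>)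
  fix K :: "(nat \<times> nat) set" and s :: "nat \<times> nat \<Rightarrow> complex" and H
  assume *: "finite K" "\<forall>k\<in>K. s k + (b - a) \<notin> \<int>"
    "expands_mod_hol D (\<lambda>z. (1 - z) powr (a - 1) * g z) K s H"
  have "expands_mod_hol D (\<lambda>z. (1 - z) powr (a + (b - a) - 1) * rl_integral a (b - a) g z) K (\<lambda>k. s k + (b - a))
    (\<lambda>k. Abs_fps (\<lambda>m. Gamma (b - a) * (rl_mult (s k) (b - a) m * fps_nth (H k) m)))"
    by (rule rl_integral_expands) (use assms * in auto)
  from expands_mod_hol_cmult[OF this, of "inverse (Gamma (b - a))"]
  show "expands_mod_hol D (\<lambda>z. (1 - z) powr (b - 1) * (inverse (Gamma (b - a)) * rl_integral a (b - a) g z)) K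
      (\<lambda>k. s k + (b - a)) (\<lambda>k. Abs_fps (\<lambda>m. rl_mult (s k) (b - a) m * fps_nth (H k) m))"
    by (rule expands_mod_hol_cong) (use nz in \<open>auto simp: fps_eq_iff\<close>)
qed

text \<open>The fractional integral of order \<open>b - a\<close> is minus the derivative of the one
  of order \<open>b + 1 - a\<close>. Differentiating \<open>(1 - z)^b g1\<close> produces the factor
  \<open>(1 - z)^(b - 1)\<close> and the combination of \<open>g1\<close> and
  \<open>deriv g1\<close> in the statement.\<close>

lemma rl_pair_lower_order:
  assumes "rl_pair a (b + 1) g g1"
  shows "rl_pair a b g (\<lambda>z. b * g1 z - (1 - z) * deriv g1 z)"
  unfolding rl_pair_def
proof (intro conjI allI impI)
  have g1: "g1 holomorphic_on D"
    using assms by (simp add: rl_pair_def)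
  show "(\<lambda>z. b * g1 z - (1 - z) * deriv g1 z) holomorphic_on D"
    by (intro holomorphic_intros g1 open_D)
  show "(\<lambda>x. b * g1 (1 - x) - (1 - (1 - x)) * deriv g1 (1 - x)) has_fps_expansion
      Abs_fps (\<lambda>m. Gamma (a + of_nat m) * rGamma (b + of_nat m) * fps_nth G m)"
    if G: "(\<lambda>x. g (1 - x)) has_fps_expansion G" for G
  proof -
    define G1 where "G1 = Abs_fps (\<lambda>m. Gamma (a + of_nat m) * rGamma (b + 1 + of_nat m) * fps_nth G m)"
    have G1: "(\<lambda>x. g1 (1 - x)) has_fps_expansion G1"
      using assms G unfolding rl_pair_def G1_def by blast
    then have "(\<lambda>x. b * g1 (1 - x) + x * deriv (\<lambda>x. g1 (1 - x)) x) has_fps_expansion fps_const b * G1 + fps_X * fps_deriv G1"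
      by (intro fps_expansion_intros)
    moreover have ev: "\<forall>\<^sub>F x in nhds 0. b * g1 (1 - x) + x * deriv (\<lambda>x. g1 (1 - x)) x =
        b * g1 (1 - x) - (1 - (1 - x)) * deriv g1 (1 - x)"
    proof -
      have "\<forall>\<^sub>F x in nhds (0::complex). x \<in> (\<lambda>x. 1 - x) -` D"
        using open_D one_in_D by (intro eventually_nhds_in_open open_vimage) (auto intro!: continuous_intros)
      then show ?thesis
      proof eventually_elim
        case (elim x)
        have "(g1 has_field_derivative deriv g1 (1 - x)) (at (1 - x))"
          by (rule holomorphic_derivI[OF g1 open_D]) (use elim in auto)
        then have "((\<lambda>x. g1 (1 - x)) has_field_derivative deriv g1 (1 - x) * (- 1)) (at x)"
          by (rule DERIV_chain2) (auto intro!: derivative_eq_intros)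
        then show ?case
          by (simp add: DERIV_imp_deriv)
      qed
    qed
    moreover have eq: "fps_const b * G1 + fps_X * fps_deriv G1 =
        Abs_fps (\<lambda>m. Gamma (a + of_nat m) * rGamma (b + of_nat m) * fps_nth G m)"
    proof (rule fps_ext)
      fix m
      have "rGamma (b + of_nat m) = (b + of_nat m) * rGamma (b + 1 + of_nat m)"
        using rGamma_plus1[of "b + of_nat m"] by (simp add: add_ac)
      moreover have "fps_nth (fps_const b * G1 + fps_X * fps_deriv G1) m = (b + of_nat m) * fps_nth G1 m"
        by (simp add: distrib_right flip: of_nat_Suc)
      ultimately show "fps_nth (fps_const b * G1 + fps_X * fps_deriv G1) m =
          fps_nth (Abs_fps (\<lambda>m. Gamma (a + of_nat m) * rGamma (b + of_nat m) * fps_nth G m)) m"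
        by (simp add: G1_def mult_ac)
    qed
    ultimately show ?thesis
      using has_fps_expansion_cong[OF ev eq] by blast
  qed
  fix K :: "(nat \<times> nat) set" and s :: "nat \<times> nat \<Rightarrow> complex" and H
  assume *: "finite K" "\<forall>k\<in>K. s k + (b - a) \<notin> \<int>"
    "expands_mod_hol D (\<lambda>z. (1 - z) powr (a - 1) * g z) K s H"
  have int: "\<forall>k\<in>K. s k + (b + 1 - a) \<notin> \<int>"
  proof
    fix k assume "k \<in> K"
    then have "s k + (b - a) \<notin> \<int>" using * by auto
    then show "s k + (b + 1 - a) \<notin> \<int>"
      using not_Ints_add_of_nat_iff(1)[of "s k + (b - a)" 1] by (simp add: algebra_simps)
  qed
  have "expands_mod_hol D (\<lambda>z. (1 - z) powr (b + 1 - 1) * g1 z) K (\<lambda>k. s k + (b + 1 - a))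
      (\<lambda>k. Abs_fps (\<lambda>m. rl_mult (s k) (b + 1 - a) m * fps_nth (H k) m))"
    using assms * int unfolding rl_pair_def by blast
  from expands_mod_hol_cmult[OF expands_mod_hol_deriv[OF this *(1)], of "-1"]
  have "expands_mod_hol D (\<lambda>z. - 1 * deriv (\<lambda>z. (1 - z) powr (b + 1 - 1) * g1 z) z) K (\<lambda>k. s k + (b + 1 - a) - 1)
      (\<lambda>k. fps_const (-1) * Abs_fps (\<lambda>m. (s k + (b + 1 - a) + of_nat m) *
         fps_nth (Abs_fps (\<lambda>m. rl_mult (s k) (b + 1 - a) m * fps_nth (H k) m)) m))" .
  then show "expands_mod_hol D (\<lambda>z. (1 - z) powr (b - 1) * (b * g1 z - (1 - z) * deriv g1 z)) K (\<lambda>k. s k + (b - a))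
         (\<lambda>k. Abs_fps (\<lambda>m. rl_mult (s k) (b - a) m * fps_nth (H k) m))"
  proof (rule expands_mod_hol_cong)
    have "\<forall>\<^sub>F z in at 0 within D. z \<in> D \<and> norm z < 1"
      by (auto simp: eventually_at intro!: exI[of _ 1])
    then show "\<forall>\<^sub>F z in at 0 within D. - 1 * deriv (\<lambda>z. (1 - z) powr (b + 1 - 1) * g1 z) z =
        (1 - z) powr (b - 1) * (b * g1 z - (1 - z) * deriv g1 z)"
    proof eventually_elim
      case (elim z)
      have z: "1 - z \<notin> \<real>\<^sub>\<le>\<^sub>0" "1 - z \<noteq> 0"
        using elim complex_Re_le_cmod[of z] by (auto simp: complex_nonpos_Reals_iff)
      have "(g1 has_field_derivative deriv g1 z) (at z)"
        by (rule holomorphic_derivI[OF g1 open_D]) (use elim in auto)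
      moreover have "((\<lambda>z. (1 - z) powr b) has_field_derivative - (b * (1 - z) powr (b - 1))) (at z)"
        using z by (auto intro!: derivative_eq_intros)
      ultimately have "((\<lambda>z. (1 - z) powr b * g1 z) has_field_derivative
         - (b * (1 - z) powr (b - 1)) * g1 z + deriv g1 z * (1 - z) powr b) (at z)"
        by (intro DERIV_mult)
      from DERIV_imp_deriv[OF this] show ?case
        using z by (simp add: powr_diff field_simps)
    qed
    show "s k + (b + 1 - a) - 1 = s k + (b - a)" for k
      by simp
    show "fps_const (-1) * Abs_fps (\<lambda>m. (s k + (b + 1 - a) + of_nat m) *
         fps_nth (Abs_fps (\<lambda>m. rl_mult (s k) (b + 1 - a) m * fps_nth (H k) m)) m) =
       Abs_fps (\<lambda>m. rl_mult (s k) (b - a) m * fps_nth (H k) m)" if "k \<in> K" for k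
    proof (rule fps_ext)
      fix m
      have "- s k - (b + 1 - a) - of_nat m \<notin> \<int>\<^sub>\<le>\<^sub>0"
        by (rule neg_shift_not_nonpos_Ints) (use int that in blast)
      from Gamma_plus1[OF this] have G: "Gamma (- s k - (b - a) - of_nat m) =
          (- s k - (b + 1 - a) - of_nat m) * Gamma (- s k - (b + 1 - a) - of_nat m)"
        by (simp add: algebra_simps)
      have "- (s k + (b + 1 - a) + of_nat m) * rl_mult (s k) (b + 1 - a) m = rl_mult (s k) (b - a) m"
        unfolding rl_mult_def G by (simp add: algebra_simps)
      then show "fps_nth (fps_const (-1) * Abs_fps (\<lambda>m. (s k + (b + 1 - a) + of_nat m) *
         fps_nth (Abs_fps (\<lambda>m. rl_mult (s k) (b + 1 - a) m * fps_nth (H k) m)) m)) m =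
       fps_nth (Abs_fps (\<lambda>m. rl_mult (s k) (b - a) m * fps_nth (H k) m)) m"
        by (simp flip: mult.assoc)
    qed
  qed
qed

text \<open>Split off the value at \<open>1\<close>: \<open>g = g(1) + (1 - z) \<psi>\<close>. The
  second term raises \<open>a\<close> and \<open>b\<close> by one and so leaves the order
  \<open>b - a\<close> alone; the constant is transformed by its Gamma quotient. Near
  \<open>0\<close> the constant contributes only powers of \<open>1 - z\<close>, before and after
  the transform, and these are holomorphic there.\<close>

lemma rl_pair_lower_base:
  assumes a: "a \<notin> \<int>" and g: "g holomorphic_on D"
    and IH: "\<And>g. g holomorphic_on D \<Longrightarrow> \<exists>g'. rl_pair (a + 1) (b + 1) g g'"
  shows "\<exists>g'. rl_pair a b g g'"
proof -
  \<comment> \<open>The difference quotient completed by its limit at \<open>1\<close>, so that the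
    singularity is removable.\<close>
  define \<psi> where "\<psi> = (\<lambda>z. if z = 1 then - deriv g 1 else (g z - g 1) / (1 - z))"
  have \<psi>: "\<psi> holomorphic_on D"
  proof -
    have "(\<lambda>z. if z = 1 then deriv g 1 else g z / (z - 1) - g 1 / (z - 1)) holomorphic_on D"
      by (rule pole_theorem_open[OF g open_D]) auto
    then have "(\<lambda>z. - (if z = 1 then deriv g 1 else g z / (z - 1) - g 1 / (z - 1))) holomorphic_on D"
      by (rule holomorphic_on_minus)
    then show ?thesis
      by (rule holomorphic_transform) (auto simp: \<psi>_def minus_divide_right simp flip: diff_divide_distrib)
  qed
  have g_eq: "g z = g 1 + (1 - z) * \<psi> z" for z
    by (auto simp: \<psi>_def)
  obtain \<psi>' where \<psi>': "rl_pair (a + 1) (b + 1) \<psi> \<psi>'"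
    using IH[OF \<psi>] by blast
  define g' where "g' = (\<lambda>z. g 1 * (Gamma a * rGamma b) + (1 - z) * \<psi>' z)"
  have "rl_pair a b g g'"
    unfolding rl_pair_def
  proof (intro conjI allI impI)
    have "\<psi>' holomorphic_on D"
      using \<psi>' by (simp add: rl_pair_def)
    then show "g' holomorphic_on D"
      unfolding g'_def by (intro holomorphic_intros)
    show "(\<lambda>x. g' (1 - x)) has_fps_expansion
        Abs_fps (\<lambda>m. Gamma (a + of_nat m) * rGamma (b + of_nat m) * fps_nth G m)"
      if G: "(\<lambda>x. g (1 - x)) has_fps_expansion G" for G
    proof -
      have "(\<lambda>x. \<psi> (1 - x)) analytic_on {0}"
      proof -
        have "\<psi> \<circ> (\<lambda>x. 1 - x) analytic_on {0}"
          by (intro analytic_on_compose_gen[where T = "{1}"] analytic_intros)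
            (use \<psi> open_D one_in_D analytic_at in auto)
        then show ?thesis by (simp add: o_def)
      qed
      then obtain F where F: "(\<lambda>x. \<psi> (1 - x)) has_fps_expansion F"
        using analytic_at_imp_has_fps_expansion_0 by blast
      have "(\<lambda>x. g 1 + x * \<psi> (1 - x)) has_fps_expansion fps_const (g 1) + fps_X * F"
        by (intro fps_expansion_intros F)
      moreover have "(\<lambda>x. g 1 + x * \<psi> (1 - x)) = (\<lambda>x. g (1 - x))"
        by (rule ext) (simp add: g_eq[of "1 - _"])
      ultimately have "(\<lambda>x. g (1 - x)) has_fps_expansion fps_const (g 1) + fps_X * F"
        by (simp only:)
      from fps_expansion_unique_complex[OF G this] have GF: "G = fps_const (g 1) + fps_X * F" .
      define F' where "F' = Abs_fps (\<lambda>m. Gamma (a + 1 + of_nat m) * rGamma (b + 1 + of_nat m) * fps_nth F m)"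
      have "(\<lambda>x. \<psi>' (1 - x)) has_fps_expansion F'"
        using \<psi>' F unfolding rl_pair_def F'_def by blast
      then have "(\<lambda>x. g 1 * (Gamma a * rGamma b) + x * \<psi>' (1 - x)) has_fps_expansion
          fps_const (g 1 * (Gamma a * rGamma b)) + fps_X * F'"
        by (intro fps_expansion_intros)
      moreover have "fps_const (g 1 * (Gamma a * rGamma b)) + fps_X * F' =
          Abs_fps (\<lambda>m. Gamma (a + of_nat m) * rGamma (b + of_nat m) * fps_nth G m)"
      proof (rule fps_ext)
        fix m show "fps_nth (fps_const (g 1 * (Gamma a * rGamma b)) + fps_X * F') m =
          fps_nth (Abs_fps (\<lambda>m. Gamma (a + of_nat m) * rGamma (b + of_nat m) * fps_nth G m)) m"
          by (cases m) (simp_all add: GF F'_def add_ac)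
      qed
      ultimately show ?thesis
        by (simp add: g'_def)
    qed
    fix K :: "(nat \<times> nat) set" and s :: "nat \<times> nat \<Rightarrow> complex" and H
    assume *: "finite K" "\<forall>k\<in>K. s k + (b - a) \<notin> \<int>"
      "expands_mod_hol D (\<lambda>z. (1 - z) powr (a - 1) * g z) K s H"
    have an: "(\<lambda>z. c * (1 - z) powr e) analytic_on {0}" for c e :: complex
      by (intro analytic_intros) (auto simp: complex_nonpos_Reals_iff)
    have pw: "(1 - z) powr (e + 1 - 1) = (1 - z) powr (e - 1) * (1 - z)" for e z :: complex
      by (cases "z = 1") (auto simp: powr_diff)
    have "expands_mod_hol D (\<lambda>z. (1 - z) powr (a + 1 - 1) * \<psi> z) K s H"
    proof (rule expands_mod_hol_cong[OF expands_mod_hol_add_analytic[OF *(3) an[of "- g 1" "a - 1"]]])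
      have "(1 - z) powr (a - 1) * g z + - g 1 * (1 - z) powr (a - 1) = (1 - z) powr (a + 1 - 1) * \<psi> z" for z
        unfolding pw by (subst g_eq[of z]) (simp add: algebra_simps)
      then show "\<forall>\<^sub>F z in at 0 within D. (1 - z) powr (a - 1) * g z + - g 1 * (1 - z) powr (a - 1) =
          (1 - z) powr (a + 1 - 1) * \<psi> z"
        by (intro always_eventually allI)
    qed auto
    then have "expands_mod_hol D (\<lambda>z. (1 - z) powr (b + 1 - 1) * \<psi>' z) K (\<lambda>k. s k + (b + 1 - (a + 1)))
         (\<lambda>k. Abs_fps (\<lambda>m. rl_mult (s k) (b + 1 - (a + 1)) m * fps_nth (H k) m))"
      using \<psi>' * unfolding rl_pair_def by simp
    from expands_mod_hol_add_analytic[OF this an[of "g 1 * (Gamma a * rGamma b)" "b - 1"]]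
    show "expands_mod_hol D (\<lambda>z. (1 - z) powr (b - 1) * g' z) K (\<lambda>k. s k + (b - a))
         (\<lambda>k. Abs_fps (\<lambda>m. rl_mult (s k) (b - a) m * fps_nth (H k) m))"
      by (rule expands_mod_hol_cong) (simp_all only: pw g'_def, simp_all add: algebra_simps)
  qed
  then show ?thesis by (rule exI[of "rl_pair a b g" g'])
qed

text \<open>Two inductions: with \<open>Re a > 1\<close> the order \<open>b - a\<close> is lowered,
  then \<open>a\<close> is lowered at constant order. The integral itself serves only as the start,
  where both real parts are large.\<close>

theorem rl_pair_exists:
  assumes "a \<notin> \<int>" "b - a \<notin> \<int>" "g holomorphic_on D"
  shows "\<exists>g'. rl_pair a b g g'"
proof -
  have 1: "\<exists>g'. rl_pair a b g g'"
    if "1 < Re a" "1 - of_nat N < Re (b - a)" "b - a \<notin> \<int>" "g holomorphic_on D" for N a b g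
    using that
  proof (induction N arbitrary: b)
    case 0
    then show ?case using rl_pair_base by auto
  next
    case (Suc N)
    have "b + 1 - a \<notin> \<int>"
      using Suc.prems(3) not_Ints_add_of_nat_iff(1)[of "b - a" 1] by (simp add: algebra_simps)
    then have "\<exists>g'. rl_pair a (b + 1) g g'"
      using Suc.prems by (intro Suc.IH) auto
    then show ?case
      using rl_pair_lower_order by blast
  qed
  have 2: "\<exists>g'. rl_pair a b g g'"
    if "1 - of_nat N < Re a" "a \<notin> \<int>" "b - a \<notin> \<int>" "g holomorphic_on D" for N a b g
    using that
  proof (induction N arbitrary: a b g)
    case 0
    obtain N :: nat where "1 - Re (b - a) < of_nat N"
      using reals_Archimedean2 by blast
    then show ?case using 1[of a N b g] 0 by (simp add: algebra_simps)
  next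
    case (Suc N)
    have "a + 1 \<notin> \<int>"
      using Suc.prems(2) not_Ints_add_of_nat_iff(1)[of a 1] by simp
    then have "\<exists>g'. rl_pair (a + 1) (b + 1) g g'" if "g holomorphic_on D" for g
      using Suc.prems that by (intro Suc.IH) auto
    then show ?case
      using rl_pair_lower_base Suc.prems by blast
  qed
  obtain N :: nat where "1 - Re a < of_nat N"
    using reals_Archimedean2 by blast
  then show ?thesis
    using 2[of N a b g] assms by (simp add: algebra_simps)
qed

end

section \<open>Systems of the first and second order\<close>

lemma has_fps_expansion_frequently_zero:
  fixes f :: "complex \<Rightarrow> complex"
  assumes "f has_fps_expansion F" "\<exists>\<^sub>F z in at 0. f z = 0"
  shows "F = 0"
  using has_fps_expansion_to_laurent[of f F] assms has_laurent_expansion_frequently_zero_iff[of f 0 "fps_to_fls F"]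
  by simp

definition fps_euler :: "complex \<Rightarrow> complex fps \<Rightarrow> complex fps" where
  "fps_euler e F = fps_const e * F + fps_X * fps_deriv F"

lemma fps_euler_nth [simp]: "fps_nth (fps_euler e F) m = (e + of_nat m) * fps_nth F m"
  by (cases m) (simp_all add: fps_euler_def distrib_right)

lemma has_fps_expansion_euler [fps_expansion_intros]:
  "h has_fps_expansion H \<Longrightarrow> euler e h has_fps_expansion fps_euler e H"
  unfolding euler_def[abs_def] fps_euler_def by (intro fps_expansion_intros)

lemma euler_holomorphic: "h holomorphic_on S \<Longrightarrow> open S \<Longrightarrow> euler e h holomorphic_on S"
  unfolding euler_def[abs_def] by (intro holomorphic_intros)

lemma DERIV_powr_mult_euler:
  assumes "x \<notin> \<real>\<^sub>\<le>\<^sub>0" "h field_differentiable at x"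
  shows "((\<lambda>x. x powr e * h x) has_field_derivative x powr (e - 1) * euler e h x) (at x)"
proof -
  have "x \<noteq> 0" using assms(1) by auto
  have "((\<lambda>x. x powr e) has_field_derivative e * x powr (e - 1)) (at x)"
    using assms(1) by (auto intro!: derivative_eq_intros)
  from DERIV_mult[OF this field_differentiable_derivI[OF assms(2)]] show ?thesis
    by (rule DERIV_cong) (use \<open>x \<noteq> 0\<close> in \<open>simp add: euler_def powr_diff field_simps\<close>)
qed

text \<open>With \<open>\<theta> = x d/dx\<close> these are \<open>\<theta>\<close> and
  \<open>x^2 (d/dx)^2 = \<theta> (\<theta> - 1)\<close>, each conjugated by
  \<open>x^e\<close>.\<close>

lemma deriv_powr_mult:
  assumes S: "open S" "x \<in> S" and nn: "\<And>x. x \<in> S \<Longrightarrow> x \<notin> \<real>\<^sub>\<le>\<^sub>0" and h: "h holomorphic_on S"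
    and u: "\<And>x. x \<in> S \<Longrightarrow> u x = x powr e * h x"
  shows "x * deriv u x = x powr e * euler e h x"
    and "x\<^sup>2 * deriv (deriv u) x = x powr e * (euler e (euler e h) x - euler e h x)"
proof -
  have ev: "\<forall>\<^sub>F y in nhds y. y \<in> S" if "y \<in> S" for y
    using S(1) that by (rule eventually_nhds_in_open)
  have hd: "h field_differentiable at y" if "y \<in> S" for y
    using h S(1) that holomorphic_on_imp_differentiable_at by blast
  have d1: "deriv u y = y powr (e - 1) * euler e h y" if "y \<in> S" for y
  proof -
    have "deriv u y = deriv (\<lambda>x. x powr e * h x) y"
      by (rule deriv_cong_ev[OF eventually_mono[OF ev[OF that]]]) (use u in auto)
    then show ?thesis
      using DERIV_imp_deriv[OF DERIV_powr_mult_euler[OF nn hd]] that by simp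
  qed
  have x: "x \<noteq> 0" using nn[OF S(2)] by auto
  show "x * deriv u x = x powr e * euler e h x"
    using x by (simp add: d1[OF S(2)] powr_diff)
  have kd: "euler e h field_differentiable at x"
    using euler_holomorphic[OF h S(1)] S holomorphic_on_imp_differentiable_at by blast
  have "deriv (deriv u) x = deriv (\<lambda>x. x powr (e - 1) * euler e h x) x"
    by (rule deriv_cong_ev[OF eventually_mono[OF ev[OF S(2)]]]) (use d1 in auto)
  also have "\<dots> = x powr (e - 1 - 1) * euler (e - 1) (euler e h) x"
    by (rule DERIV_imp_deriv[OF DERIV_powr_mult_euler[OF nn[OF S(2)] kd]])
  finally show "x\<^sup>2 * deriv (deriv u) x = x powr e * (euler e (euler e h) x - euler e h x)"
    using x by (simp add: powr_diff power2_eq_square euler_def field_simps)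
qed

text \<open>
  The matrix \<open>A\<close> is diagonalised by \<open>P\<close> with inverse \<open>Q\<close>, and \<open>B = A diag(\<sigma>)\<close>.  The systems
  \<open>(z - \<sigma>\<^sub>l)(\<theta> + p) f\<^sub>l + q z f\<^sub>l = \<Sum>\<^sub>m B\<^sub>l\<^sub>m f\<^sub>m\<close>, with \<open>\<theta> = z d/dz\<close>, are written for the
  coefficients of \<open>f = x\<^sup>e g(x)\<close>, \<open>x = 1 - z\<close> (\<open>first_one\<close>) and of \<open>f = z\<^sup>s h(z)\<close> (\<open>first_zero\<close>).
  Likewise \<open>second_one\<close> and \<open>second_zero\<close> are
  \<open>z(z - \<sigma>\<^sub>l)u\<^sub>l'' + ((1 - \<rho>\<^sub>1 - \<rho>\<^sub>2)z + (\<rho>\<^sub>1 + \<rho>\<^sub>2)\<sigma>\<^sub>l)u\<^sub>l' - \<Sum>\<^sub>m B\<^sub>l\<^sub>m u\<^sub>m' + \<rho>\<^sub>1\<rho>\<^sub>2u\<^sub>l = 0\<close>.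
\<close>

locale okubo =
  fixes n :: nat and \<sigma> :: "nat \<Rightarrow> complex" and A P Q :: "nat \<Rightarrow> nat \<Rightarrow> complex" and \<mu> :: "nat \<Rightarrow> complex"
    and \<rho>1 \<rho>2 :: complex
  assumes \<sigma>_nz: "\<And>l. l < n \<Longrightarrow> \<sigma> l \<noteq> 0"
    and QA: "\<And>j m. j < n \<Longrightarrow> m < n \<Longrightarrow> (\<Sum>l<n. Q j l * A l m) = \<mu> j * Q j m"
    and PQ: "\<And>l m. l < n \<Longrightarrow> m < n \<Longrightarrow> (\<Sum>j<n. P l j * Q j m) = (if l = m then 1 else 0)"
    and QP: "\<And>j k. j < n \<Longrightarrow> k < n \<Longrightarrow> (\<Sum>l<n. Q j l * P l k) = (if j = k then 1 else 0)"
    and \<mu>_nonint: "\<And>j. j < n \<Longrightarrow> \<mu> j \<notin> \<int>"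
    and \<rho>2_nonint: "\<rho>2 \<notin> \<int>"
begin

definition B :: "nat \<Rightarrow> nat \<Rightarrow> complex" where "B l m = A l m * \<sigma> m"

definition first_one :: "complex \<Rightarrow> complex \<Rightarrow> complex \<Rightarrow> (nat \<Rightarrow> complex fps) \<Rightarrow> nat \<Rightarrow> complex fps" where
  "first_one p q e F l = fps_X * (fps_const (2 - \<sigma> l) * fps_euler e (F l) + fps_const ((1 - \<sigma> l) * p + q) * F l
      - (\<Sum>m<n. fps_const (B l m) * F m))
    - fps_const (1 - \<sigma> l) * fps_euler e (F l) - fps_X ^ 2 * (fps_euler e (F l) + fps_const (p + q) * F l)"

definition first_zero :: "complex \<Rightarrow> complex \<Rightarrow> complex \<Rightarrow> (nat \<Rightarrow> complex fps) \<Rightarrow> nat \<Rightarrow> complex fps" where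
  "first_zero p q s H l = fps_X * (fps_euler s (H l) + fps_const (p + q) * H l)
    - fps_const (\<sigma> l) * (fps_euler s (H l) + fps_const p * H l) - (\<Sum>m<n. fps_const (B l m) * H m)"

definition second_one :: "complex \<Rightarrow> (nat \<Rightarrow> complex fps) \<Rightarrow> nat \<Rightarrow> complex fps" where
  "second_one e F l = fps_const (1 - \<sigma> l) * (fps_euler e (fps_euler e (F l)) - fps_euler e (F l))
    - fps_X * (fps_const (2 - \<sigma> l) * (fps_euler e (fps_euler e (F l)) - fps_euler e (F l))
        + fps_const (1 - \<rho>1 - \<rho>2 + (\<rho>1 + \<rho>2) * \<sigma> l) * fps_euler e (F l) - (\<Sum>m<n. fps_const (B l m) * fps_euler e (F m)))
    + fps_X ^ 2 * (fps_euler e (fps_euler e (F l)) - fps_euler e (F l) + fps_const (1 - \<rho>1 - \<rho>2) * fps_euler e (F l)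
        + fps_const (\<rho>1 * \<rho>2) * F l)"

definition second_zero :: "complex \<Rightarrow> (nat \<Rightarrow> complex fps) \<Rightarrow> nat \<Rightarrow> complex fps" where
  "second_zero s H l = fps_X * (fps_euler s (fps_euler s (H l)) - fps_const (\<rho>1 + \<rho>2) * fps_euler s (H l) + fps_const (\<rho>1 * \<rho>2) * H l)
    - fps_const (\<sigma> l) * (fps_euler s (fps_euler s (H l)) - fps_const (1 + \<rho>1 + \<rho>2) * fps_euler s (H l))
    - (\<Sum>m<n. fps_const (B l m) * fps_euler s (H m))"

lemma Q_inj:
  assumes "\<And>j. j < n \<Longrightarrow> (\<Sum>l<n. Q j l * f l) = 0" and "l < n"
  shows "f l = 0"
proof -
  have "f l = (\<Sum>m<n. (if l = m then 1 else 0) * f m)"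
    using assms(2) by (simp add: if_distrib[of "\<lambda>a. a * _"] cong: if_cong)
  also have "\<dots> = (\<Sum>m<n. (\<Sum>j<n. P l j * Q j m) * f m)"
    by (intro sum.cong refl) (use PQ assms(2) in auto)
  also have "\<dots> = (\<Sum>m<n. \<Sum>j<n. P l j * (Q j m * f m))"
    by (simp add: sum_distrib_right mult.assoc)
  also have "\<dots> = (\<Sum>j<n. P l j * (\<Sum>m<n. Q j m * f m))"
    by (subst sum.swap) (simp add: sum_distrib_left)
  also have "\<dots> = 0"
    using assms(1) by simp
  finally show ?thesis .
qed

lemma Q_A:
  assumes "j < n"
  shows "(\<Sum>l<n. Q j l * (\<Sum>m<n. A l m * f m)) = \<mu> j * (\<Sum>m<n. Q j m * f m)"
proof -
  have "(\<Sum>l<n. Q j l * (\<Sum>m<n. A l m * f m)) = (\<Sum>m<n. (\<Sum>l<n. Q j l * A l m) * f m)"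
    unfolding sum_distrib_left sum_distrib_right by (subst sum.swap) (simp add: mult.assoc)
  also have "\<dots> = (\<Sum>m<n. \<mu> j * (Q j m * f m))"
    by (intro sum.cong refl) (use QA assms in auto)
  finally show ?thesis
    by (simp add: sum_distrib_left)
qed

lemma Q_B: "j < n \<Longrightarrow> (\<Sum>l<n. Q j l * (\<Sum>m<n. B l m * f m)) = \<mu> j * (\<Sum>m<n. Q j m * (\<sigma> m * f m))"
  using Q_A[of j "\<lambda>m. \<sigma> m * f m"] by (simp add: B_def mult.assoc)

lemma Q_P:
  assumes "j < n"
  shows "(\<Sum>l<n. Q j l * (\<Sum>k<n. P l k * v k)) = v j"
proof -
  have "(\<Sum>l<n. Q j l * (\<Sum>k<n. P l k * v k)) = (\<Sum>k<n. (\<Sum>l<n. Q j l * P l k) * v k)"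
    unfolding sum_distrib_left sum_distrib_right by (subst sum.swap) (simp add: mult.assoc)
  also have "\<dots> = (\<Sum>k<n. (if j = k then 1 else 0) * v k)"
    by (intro sum.cong refl) (use QP assms in auto)
  finally show ?thesis
    using assms by (simp add: if_distrib[of "\<lambda>a. a * _"] cong: if_cong)
qed

text \<open>Since \<open>B f = A (\<sigma> f)\<close>, the hypothesis says that \<open>c + A\<close>
  annihilates \<open>\<sigma> f\<close>. In the coordinates given by \<open>Q\<close> this matrix is
  multiplication by \<open>c + \<mu> j\<close>.\<close>

lemma eigen_zero:
  assumes "\<And>l. l < n \<Longrightarrow> c * (\<sigma> l * f l) + (\<Sum>m<n. B l m * f m) = 0"
    and "\<And>j. j < n \<Longrightarrow> c + \<mu> j \<noteq> 0" and "l < n"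
  shows "f l = 0"
proof -
  have "(\<Sum>l<n. Q j l * (\<sigma> l * f l)) = 0" if j: "j < n" for j
  proof -
    have "0 = (\<Sum>l<n. Q j l * (c * (\<sigma> l * f l) + (\<Sum>m<n. B l m * f m)))"
      using assms(1) by simp
    also have "\<dots> = c * (\<Sum>l<n. Q j l * (\<sigma> l * f l)) + (\<Sum>l<n. Q j l * (\<Sum>m<n. B l m * f m))"
      by (simp add: distrib_left sum.distrib sum_distrib_left mult_ac)
    also have "\<dots> = (c + \<mu> j) * (\<Sum>l<n. Q j l * (\<sigma> l * f l))"
      by (simp add: Q_B[OF j] distrib_right)
    finally show ?thesis
      using assms(2)[OF j] by simp
  qed
  from Q_inj[OF this assms(3)] show ?thesis
    using \<sigma>_nz assms(3) by simp
qed

section \<open>Coefficient recursions of the four systems\<close>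

lemma nth_first_one:
  "fps_nth (first_one p q e F l) 0 = - ((1 - \<sigma> l) * (e * fps_nth (F l) 0))"
  "fps_nth (first_one p q e F l) (Suc N) =
     ((2 - \<sigma> l) * (e + of_nat N) + (1 - \<sigma> l) * p + q) * fps_nth (F l) N - (\<Sum>m<n. B l m * fps_nth (F m) N)
     - (1 - \<sigma> l) * ((e + of_nat (Suc N)) * fps_nth (F l) (Suc N))
     - (if N = 0 then 0 else (e + of_nat (N - 1) + p + q) * fps_nth (F l) (N - 1))"
proof -
  show "fps_nth (first_one p q e F l) 0 = - ((1 - \<sigma> l) * (e * fps_nth (F l) 0))"
    by (simp add: first_one_def power2_eq_square mult.assoc)
  have "fps_nth (fps_X ^ 2 * G) (Suc N) = (if N = 0 then 0 else fps_nth G (N - 1))" for G :: "complex fps"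
    by (cases N) (simp_all add: power2_eq_square mult.assoc)
  then show "fps_nth (first_one p q e F l) (Suc N) =
     ((2 - \<sigma> l) * (e + of_nat N) + (1 - \<sigma> l) * p + q) * fps_nth (F l) N - (\<Sum>m<n. B l m * fps_nth (F m) N)
     - (1 - \<sigma> l) * ((e + of_nat (Suc N)) * fps_nth (F l) (Suc N))
     - (if N = 0 then 0 else (e + of_nat (N - 1) + p + q) * fps_nth (F l) (N - 1))"
    by (simp add: first_one_def fps_sum_nth distrib_right)
qed

lemma nth_first_zero:
  "fps_nth (first_zero p q s H l) N =
    (if N = 0 then 0 else (s + of_nat (N - 1) + p + q) * fps_nth (H l) (N - 1))
    - \<sigma> l * ((s + of_nat N + p) * fps_nth (H l) N) - (\<Sum>m<n. B l m * fps_nth (H m) N)"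
  by (cases N) (simp_all add: first_zero_def fps_sum_nth distrib_right)

lemma nth_second_one:
  "fps_nth (second_one e F l) 0 = (1 - \<sigma> l) * (e * (e - 1) * fps_nth (F l) 0)"
  "fps_nth (second_one e F l) (Suc N) =
     (1 - \<sigma> l) * ((e + of_nat (Suc N)) * (e + of_nat N) * fps_nth (F l) (Suc N))
     - (e + of_nat N) * (((2 - \<sigma> l) * (e + of_nat N - 1) + 1 - \<rho>1 - \<rho>2 + (\<rho>1 + \<rho>2) * \<sigma> l) * fps_nth (F l) N
         - (\<Sum>m<n. B l m * fps_nth (F m) N))
     + (if N = 0 then 0 else (e + of_nat N - 1 - \<rho>1) * (e + of_nat N - 1 - \<rho>2) * fps_nth (F l) (N - 1))"
proof -
  show "fps_nth (second_one e F l) 0 = (1 - \<sigma> l) * (e * (e - 1) * fps_nth (F l) 0)"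
    by (simp add: second_one_def power2_eq_square mult.assoc algebra_simps)
  have "fps_nth (fps_X ^ 2 * G) (Suc N) = (if N = 0 then 0 else fps_nth G (N - 1))" for G :: "complex fps"
    by (cases N) (simp_all add: power2_eq_square mult.assoc)
  moreover have "(\<Sum>m<n. B l m * ((e + of_nat N) * fps_nth (F m) N)) = (e + of_nat N) * (\<Sum>m<n. B l m * fps_nth (F m) N)"
    by (simp add: sum_distrib_left mult_ac)
  ultimately show "fps_nth (second_one e F l) (Suc N) =
     (1 - \<sigma> l) * ((e + of_nat (Suc N)) * (e + of_nat N) * fps_nth (F l) (Suc N))
     - (e + of_nat N) * (((2 - \<sigma> l) * (e + of_nat N - 1) + 1 - \<rho>1 - \<rho>2 + (\<rho>1 + \<rho>2) * \<sigma> l) * fps_nth (F l) N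
         - (\<Sum>m<n. B l m * fps_nth (F m) N))
     + (if N = 0 then 0 else (e + of_nat N - 1 - \<rho>1) * (e + of_nat N - 1 - \<rho>2) * fps_nth (F l) (N - 1))"
    by (cases N; simp add: second_one_def fps_sum_nth; simp add: algebra_simps)
qed

lemma nth_second_zero:
  "fps_nth (second_zero s H l) N =
    (if N = 0 then 0 else (s + of_nat N - 1 - \<rho>1) * (s + of_nat N - 1 - \<rho>2) * fps_nth (H l) (N - 1))
    - (s + of_nat N) * (\<sigma> l * ((s + of_nat N - 1 - \<rho>1 - \<rho>2) * fps_nth (H l) N) + (\<Sum>m<n. B l m * fps_nth (H m) N))"
proof -
  have "(\<Sum>m<n. B l m * ((s + of_nat N) * fps_nth (H m) N)) = (s + of_nat N) * (\<Sum>m<n. B l m * fps_nth (H m) N)"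
    by (simp add: sum_distrib_left mult_ac)
  then show ?thesis
    by (cases N) (simp_all add: second_zero_def fps_sum_nth algebra_simps)
qed

section \<open>Effect of the transforms on the recursions\<close>

lemma gamma_ratio_Suc:
  fixes a b :: complex
  assumes "a \<notin> \<int>"
  shows "(b + of_nat m) * (Gamma (a + of_nat (Suc m)) * rGamma (b + of_nat (Suc m))) =
    (a + of_nat m) * (Gamma (a + of_nat m) * rGamma (b + of_nat m))"
proof -
  have "a + of_nat m \<notin> \<int>\<^sub>\<le>\<^sub>0"
    using assms nonpos_Ints_Int by (metis not_Ints_add_of_nat_iff(1))
  from Gamma_plus1[OF this] rGamma_plus1[of "b + of_nat m"] show ?thesis
    by (simp add: add_ac mult_ac)
qed

text \<open>Counterpart at \<open>0\<close> of \<open>gamma_ratio_Suc\<close>. These two recursions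
  are all that the next four lemmas use about the multipliers.\<close>

lemma rl_mult_Suc:
  assumes "s + b \<notin> \<int>"
  shows "(s + b + of_nat (Suc m)) * rl_mult s b (Suc m) = (s + of_nat (Suc m)) * rl_mult s b m"
proof -
  have e: "- s - b - of_nat m = (- s - b - of_nat (Suc m)) + 1"
    by simp
  have 1: "Gamma (- s - b - of_nat m) = (- s - b - of_nat (Suc m)) * Gamma (- s - b - of_nat (Suc m))"
    unfolding e by (rule Gamma_plus1[OF neg_shift_not_nonpos_Ints[OF assms]])
  have 2: "rGamma (- s - of_nat (Suc m)) = (- s - of_nat (Suc m)) * rGamma (- s - of_nat m)"
    using rGamma_plus1[of "- s - of_nat (Suc m)"] by (simp add: algebra_simps)
  show ?thesis
    unfolding rl_mult_def 1 2 by (simp add: algebra_simps)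
qed

text \<open>The inner transform, of order \<open>- 1 - \<rho>2\<close>: the exponent
  \<open>\<nu>\<close> is \<open>a - 1\<close> with \<open>a = \<nu> + 1\<close>, and it becomes
  \<open>b - 1\<close> with \<open>b = \<nu> - \<rho>2\<close>. The recursion couples three
  consecutive coefficients; \<open>gamma_ratio_Suc\<close> expresses the two neighbouring
  multipliers by \<open>?R M\<close>, and the new equation becomes \<open>?R M\<close> times the old
  one.\<close>

lemma first_one_rl:
  assumes a: "\<nu> \<notin> \<int>" and F: "first_one (- \<rho>2) 0 \<nu> F l = 0"
  shows "first_one 1 (1 + \<rho>2) (\<nu> - \<rho>2 - 1)
    (\<lambda>l. Abs_fps (\<lambda>m. Gamma (\<nu> + 1 + of_nat m) * rGamma (\<nu> - \<rho>2 + of_nat m) * fps_nth (F l) m)) l = 0"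
    (is "first_one _ _ _ (\<lambda>l. Abs_fps (\<lambda>m. ?R m * _)) l = 0")
proof (rule fps_ext)
  fix N
  have a1: "\<nu> + 1 \<notin> \<int>"
    using a not_Ints_add_of_nat_iff(1)[of \<nu> 1] by simp
  show "fps_nth (first_one 1 (1 + \<rho>2) (\<nu> - \<rho>2 - 1) (\<lambda>l. Abs_fps (\<lambda>m. ?R m * fps_nth (F l) m)) l) N = fps_nth 0 N"
  proof (cases N)
    case 0
    have "\<nu> \<noteq> 0" using a by auto
    then have "(1 - \<sigma> l) * fps_nth (F l) 0 = 0"
      using nth_first_one(1)[of "- \<rho>2" 0 \<nu> F l] F by auto
    then show ?thesis
      using 0 by (auto simp: nth_first_one)
  next
    case (Suc M)
    have e: "((2 - \<sigma> l) * (\<nu> + of_nat M) + (1 - \<sigma> l) * (- \<rho>2)) * fps_nth (F l) M - (\<Sum>m<n. B l m * fps_nth (F m) M)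
       - (1 - \<sigma> l) * ((\<nu> + of_nat (Suc M)) * fps_nth (F l) (Suc M))
       - (if M = 0 then 0 else (\<nu> + of_nat (M - 1) - \<rho>2) * fps_nth (F l) (M - 1)) = 0"
      using nth_first_one(2)[of "- \<rho>2" 0 \<nu> F l M] F by simp
    have R1: "(\<nu> - \<rho>2 - 1 + of_nat (Suc M)) * ?R (Suc M) = (\<nu> + of_nat (Suc M)) * ?R M"
      using gamma_ratio_Suc[OF a1, of "\<nu> - \<rho>2" M] by (simp add: algebra_simps)
    have R0: "(\<nu> - \<rho>2 - 1 + of_nat (M - 1) + 1 + (1 + \<rho>2)) * ?R (M - 1) = (\<nu> + of_nat (M - 1) - \<rho>2) * ?R M" if "M \<noteq> 0"
      using gamma_ratio_Suc[OF a1, of "\<nu> - \<rho>2" "M - 1"] that by (simp add: algebra_simps)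
    have S: "(\<Sum>m<n. B l m * (?R M * fps_nth (F m) M)) = ?R M * (\<Sum>m<n. B l m * fps_nth (F m) M)"
      by (simp add: sum_distrib_left mult_ac)
    have "fps_nth (first_one 1 (1 + \<rho>2) (\<nu> - \<rho>2 - 1) (\<lambda>l. Abs_fps (\<lambda>m. ?R m * fps_nth (F l) m)) l) (Suc M) =
       ((2 - \<sigma> l) * (\<nu> - \<rho>2 - 1 + of_nat M) + (1 - \<sigma> l) * 1 + (1 + \<rho>2)) * (?R M * fps_nth (F l) M)
         - ?R M * (\<Sum>m<n. B l m * fps_nth (F m) M)
       - (1 - \<sigma> l) * ((\<nu> - \<rho>2 - 1 + of_nat (Suc M)) * ?R (Suc M) * fps_nth (F l) (Suc M))
       - (if M = 0 then 0 else (\<nu> - \<rho>2 - 1 + of_nat (M - 1) + 1 + (1 + \<rho>2)) * ?R (M - 1) * fps_nth (F l) (M - 1))"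
      unfolding nth_first_one(2) fps_nth_Abs_fps S by (simp only: mult.assoc)
    also have "\<dots> = ?R M * (((2 - \<sigma> l) * (\<nu> + of_nat M) + (1 - \<sigma> l) * (- \<rho>2)) * fps_nth (F l) M - (\<Sum>m<n. B l m * fps_nth (F m) M)
       - (1 - \<sigma> l) * ((\<nu> + of_nat (Suc M)) * fps_nth (F l) (Suc M))
       - (if M = 0 then 0 else (\<nu> + of_nat (M - 1) - \<rho>2) * fps_nth (F l) (M - 1)))"
    proof (cases "M = 0")
      case True
      then show ?thesis unfolding R1 by (simp add: algebra_simps)
    next
      case False
      then show ?thesis unfolding R1 R0[OF False] if_not_P[OF False] by (simp add: algebra_simps)
    qed
    finally show ?thesis
      unfolding e Suc by simp
  qed
qed

text \<open>The outer transform returns from exponent \<open>\<nu> - \<rho>2 - 1\<close> to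
  \<open>\<nu>\<close>. Reducing the multipliers to \<open>?R M\<close> now leaves an additional
  factor \<open>\<nu> + M\<close>, in accordance with the passage from a first order to a second
  order system.\<close>

lemma second_one_rl:
  assumes a: "\<nu> \<notin> \<int>" "\<nu> - \<rho>2 \<notin> \<int>" and F: "first_one (- \<rho>1) (1 + \<rho>2) (\<nu> - \<rho>2 - 1) F l = 0"
  shows "second_one \<nu>
    (\<lambda>l. Abs_fps (\<lambda>m. Gamma (\<nu> - \<rho>2 + of_nat m) * rGamma (\<nu> + 1 + of_nat m) * fps_nth (F l) m)) l = 0"
    (is "second_one _ (\<lambda>l. Abs_fps (\<lambda>m. ?R m * _)) l = 0")
proof (rule fps_ext)
  fix N
  show "fps_nth (second_one \<nu> (\<lambda>l. Abs_fps (\<lambda>m. ?R m * fps_nth (F l) m)) l) N = fps_nth 0 N"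
  proof (cases N)
    case 0
    have "\<nu> - \<rho>2 - 1 \<noteq> 0"
      using a(2) by (metis Ints_1 eq_iff_diff_eq_0)
    then have "(1 - \<sigma> l) * fps_nth (F l) 0 = 0"
      using nth_first_one(1)[of "- \<rho>1" "1 + \<rho>2" "\<nu> - \<rho>2 - 1" F l] F by auto
    then show ?thesis
      using 0 by (auto simp: nth_second_one)
  next
    case (Suc M)
    let ?e = "\<nu> - \<rho>2 - 1"
    have e: "((2 - \<sigma> l) * (?e + of_nat M) + (1 - \<sigma> l) * (- \<rho>1) + (1 + \<rho>2)) * fps_nth (F l) M - (\<Sum>m<n. B l m * fps_nth (F m) M)
       - (1 - \<sigma> l) * ((?e + of_nat (Suc M)) * fps_nth (F l) (Suc M))
       - (if M = 0 then 0 else (?e + of_nat (M - 1) + - \<rho>1 + (1 + \<rho>2)) * fps_nth (F l) (M - 1)) = 0"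
      using nth_first_one(2)[of "- \<rho>1" "1 + \<rho>2" ?e F l M] F by (simp only: fps_zero_nth)
    have R1: "(\<nu> + of_nat (Suc M)) * ?R (Suc M) = (?e + of_nat (Suc M)) * ?R M"
      using gamma_ratio_Suc[OF a(2), of "\<nu> + 1" M] by (simp add: algebra_simps)
    have R0: "(\<nu> + of_nat M - 1 - \<rho>2) * ?R (M - 1) = (\<nu> + of_nat M) * ?R M" if "M \<noteq> 0"
      using gamma_ratio_Suc[OF a(2), of "\<nu> + 1" "M - 1"] that by (simp add: algebra_simps of_nat_diff)
    have S: "(\<Sum>m<n. B l m * (?R M * fps_nth (F m) M)) = ?R M * (\<Sum>m<n. B l m * fps_nth (F m) M)"
      by (simp add: sum_distrib_left mult_ac)
    have "fps_nth (second_one \<nu> (\<lambda>l. Abs_fps (\<lambda>m. ?R m * fps_nth (F l) m)) l) (Suc M) =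
     (1 - \<sigma> l) * ((\<nu> + of_nat M) * ((\<nu> + of_nat (Suc M)) * ?R (Suc M)) * fps_nth (F l) (Suc M))
     - (\<nu> + of_nat M) * (((2 - \<sigma> l) * (\<nu> + of_nat M - 1) + 1 - \<rho>1 - \<rho>2 + (\<rho>1 + \<rho>2) * \<sigma> l) * (?R M * fps_nth (F l) M)
         - ?R M * (\<Sum>m<n. B l m * fps_nth (F m) M))
     + (if M = 0 then 0 else (\<nu> + of_nat M - 1 - \<rho>1) * ((\<nu> + of_nat M - 1 - \<rho>2) * ?R (M - 1)) * fps_nth (F l) (M - 1))"
      by (simp only: nth_second_one(2) fps_nth_Abs_fps S) (simp only: mult_ac)
    also have "\<dots> = - (\<nu> + of_nat M) * ?R M * (((2 - \<sigma> l) * (?e + of_nat M) + (1 - \<sigma> l) * (- \<rho>1) + (1 + \<rho>2)) * fps_nth (F l) M - (\<Sum>m<n. B l m * fps_nth (F m) M)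
       - (1 - \<sigma> l) * ((?e + of_nat (Suc M)) * fps_nth (F l) (Suc M))
       - (if M = 0 then 0 else (?e + of_nat (M - 1) + - \<rho>1 + (1 + \<rho>2)) * fps_nth (F l) (M - 1)))"
    proof (cases "M = 0")
      case True
      then show ?thesis unfolding R1 by (simp add: algebra_simps)
    next
      case False
      then have "complex_of_nat (M - 1) = of_nat M - 1" by (simp add: of_nat_diff)
      with False show ?thesis unfolding R1 R0[OF False] if_not_P[OF False] by (simp add: algebra_simps)
    qed
    finally show ?thesis
      unfolding e Suc by simp
  qed
qed

text \<open>At \<open>0\<close> the factor \<open>z^\<rho>2\<close> changes the exponent from
  \<open>- m'\<close> to \<open>\<rho>2 - m'\<close> but not the series. Hence \<open>Y\<close>
  still satisfies the recursion of the underlying system, while the multiplier is taken at the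
  shifted exponent.\<close>

lemma first_zero_rl:
  assumes m: "m' \<notin> \<int>" and Y: "first_zero 0 0 (- m') Y l = 0"
  shows "first_zero 1 (1 + \<rho>2) (- 1 - m') (\<lambda>l. Abs_fps (\<lambda>m. rl_mult (\<rho>2 - m') (- 1 - \<rho>2) m * fps_nth (Y l) m)) l = 0"
    (is "first_zero _ _ _ (\<lambda>l. Abs_fps (\<lambda>m. ?r m * _)) l = 0")
proof (rule fps_ext)
  fix N
  have int: "\<rho>2 - m' + (- 1 - \<rho>2) \<notin> \<int>"
  proof
    assume "\<rho>2 - m' + (- 1 - \<rho>2) \<in> \<int>"
    then have "- (m' + of_nat 1) \<in> \<int>" by (simp add: algebra_simps)
    then show False using m by (simp only: minus_in_Ints_iff not_Ints_add_of_nat_iff)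
  qed
  have e: "(if N = 0 then 0 else (- m' + of_nat (N - 1)) * fps_nth (Y l) (N - 1))
    - \<sigma> l * ((- m' + of_nat N) * fps_nth (Y l) N) - (\<Sum>m<n. B l m * fps_nth (Y m) N) = 0"
    using nth_first_zero[of 0 0 "- m'" Y l N] Y by (simp only: fps_zero_nth add_0_right)
  have R: "(- 1 - m' + of_nat (N - 1) + 1 + (1 + \<rho>2)) * ?r (N - 1) = (- m' + of_nat (N - 1)) * ?r N" if "N \<noteq> 0"
    using rl_mult_Suc[OF int, of "N - 1"] that by (simp add: algebra_simps of_nat_diff)
  have S: "(\<Sum>m<n. B l m * (?r N * fps_nth (Y m) N)) = ?r N * (\<Sum>m<n. B l m * fps_nth (Y m) N)"
    by (simp add: sum_distrib_left mult_ac)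
  have "fps_nth (first_zero 1 (1 + \<rho>2) (- 1 - m') (\<lambda>l. Abs_fps (\<lambda>m. ?r m * fps_nth (Y l) m)) l) N =
     (if N = 0 then 0 else (- 1 - m' + of_nat (N - 1) + 1 + (1 + \<rho>2)) * ?r (N - 1) * fps_nth (Y l) (N - 1))
    - \<sigma> l * ((- 1 - m' + of_nat N + 1) * (?r N * fps_nth (Y l) N)) - ?r N * (\<Sum>m<n. B l m * fps_nth (Y m) N)"
    by (simp only: nth_first_zero fps_nth_Abs_fps S mult.assoc)
  also have "\<dots> = ?r N * ((if N = 0 then 0 else (- m' + of_nat (N - 1)) * fps_nth (Y l) (N - 1))
    - \<sigma> l * ((- m' + of_nat N) * fps_nth (Y l) N) - (\<Sum>m<n. B l m * fps_nth (Y m) N))"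
  proof (cases "N = 0")
    case False
    then show ?thesis unfolding R[OF False] if_not_P[OF False] by (simp add: algebra_simps)
  qed (simp add: algebra_simps)
  finally show "fps_nth (first_zero 1 (1 + \<rho>2) (- 1 - m') (\<lambda>l. Abs_fps (\<lambda>m. ?r m * fps_nth (Y l) m)) l) N = fps_nth 0 N"
    unfolding e by simp
qed

text \<open>The exponent obtained is \<open>\<rho>1 + \<rho>2 - m' + 1\<close>. It is written as
  \<open>\<rho>1 + \<rho>2 - m'\<close> with a series divisible by \<open>fps_X\<close>, because
  this is the exponent of the solutions at \<open>t_(p+1)\<close>, whose upper components start one
  power later.\<close>

lemma second_zero_rl:
  assumes int: "\<rho>1 - m' + (1 + \<rho>2) \<notin> \<int>" and H: "first_zero 1 (1 + \<rho>2) (- 1 - m') H l = 0"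
  shows "second_zero (\<rho>1 + \<rho>2 - m') (\<lambda>l. fps_X * Abs_fps (\<lambda>m. rl_mult (\<rho>1 - m') (1 + \<rho>2) m * fps_nth (H l) m)) l = 0"
    (is "second_zero ?e (\<lambda>l. fps_X * Abs_fps (\<lambda>m. ?r m * _)) l = 0")
proof (rule fps_ext)
  fix N show "fps_nth (second_zero ?e (\<lambda>l. fps_X * Abs_fps (\<lambda>m. ?r m * fps_nth (H l) m)) l) N = fps_nth 0 N"
  proof (cases N)
    case (Suc M)
    have e: "(if M = 0 then 0 else (- 1 - m' + of_nat (M - 1) + 1 + (1 + \<rho>2)) * fps_nth (H l) (M - 1))
      - \<sigma> l * ((- 1 - m' + of_nat M + 1) * fps_nth (H l) M) - (\<Sum>m<n. B l m * fps_nth (H m) M) = 0"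
      using nth_first_zero[of 1 "1 + \<rho>2" "- 1 - m'" H l M] H by (simp only: fps_zero_nth)
    have R: "(?e + of_nat M - \<rho>2) * ?r (M - 1) = (?e + of_nat M + 1) * ?r M" if "M \<noteq> 0"
      using rl_mult_Suc[OF int, of "M - 1"] that by (simp add: algebra_simps of_nat_diff)
    have S: "(\<Sum>m<n. B l m * (?r M * fps_nth (H m) M)) = ?r M * (\<Sum>m<n. B l m * fps_nth (H m) M)"
      by (simp add: sum_distrib_left mult_ac)
    have XH: "fps_nth (fps_X * F) (Suc M) = fps_nth F M" "fps_nth (fps_X * F) M = (if M = 0 then 0 else fps_nth F (M - 1))"
      for F :: "complex fps" by simp_all
    have "fps_nth (second_zero ?e (\<lambda>l. fps_X * Abs_fps (\<lambda>m. ?r m * fps_nth (H l) m)) l) (Suc M) =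
      (if M = 0 then 0 else (?e + of_nat M - \<rho>1) * ((?e + of_nat M - \<rho>2) * ?r (M - 1)) * fps_nth (H l) (M - 1))
      - (?e + of_nat M + 1) * (\<sigma> l * ((?e + of_nat M - \<rho>1 - \<rho>2) * (?r M * fps_nth (H l) M)) + ?r M * (\<Sum>m<n. B l m * fps_nth (H m) M))"
      by (simp only: nth_second_zero XH fps_nth_Abs_fps S nat.distinct if_False diff_Suc_1) (simp add: algebra_simps)
    also have "\<dots> = (?e + of_nat M + 1) * ?r M * ((if M = 0 then 0 else (- 1 - m' + of_nat (M - 1) + 1 + (1 + \<rho>2)) * fps_nth (H l) (M - 1))
      - \<sigma> l * ((- 1 - m' + of_nat M + 1) * fps_nth (H l) M) - (\<Sum>m<n. B l m * fps_nth (H m) M))"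
    proof (cases "M = 0")
      case False
      then have "complex_of_nat (M - 1) = of_nat M - 1" by (simp add: of_nat_diff)
      with False show ?thesis unfolding R[OF False] if_not_P[OF False] by (simp add: algebra_simps)
    qed (simp add: algebra_simps)
    finally show ?thesis
      unfolding e Suc by simp
  qed (simp add: nth_second_zero)
qed

end

context okubo
begin

section \<open>From differential equations on an open set to recursions\<close>

definition first_one_fun :: "complex \<Rightarrow> complex \<Rightarrow> complex \<Rightarrow> (nat \<Rightarrow> complex \<Rightarrow> complex) \<Rightarrow> nat \<Rightarrow> complex \<Rightarrow> complex" where
  "first_one_fun p q e g l x = x * ((2 - \<sigma> l) * euler e (g l) x + ((1 - \<sigma> l) * p + q) * g l x - (\<Sum>m<n. B l m * g m x))
    - (1 - \<sigma> l) * euler e (g l) x - x ^ 2 * (euler e (g l) x + (p + q) * g l x)"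

definition first_zero_fun :: "complex \<Rightarrow> complex \<Rightarrow> complex \<Rightarrow> (nat \<Rightarrow> complex \<Rightarrow> complex) \<Rightarrow> nat \<Rightarrow> complex \<Rightarrow> complex" where
  "first_zero_fun p q s h l z = z * (euler s (h l) z + (p + q) * h l z)
    - \<sigma> l * (euler s (h l) z + p * h l z) - (\<Sum>m<n. B l m * h m z)"

definition second_one_fun :: "complex \<Rightarrow> (nat \<Rightarrow> complex \<Rightarrow> complex) \<Rightarrow> nat \<Rightarrow> complex \<Rightarrow> complex" where
  "second_one_fun e g l x = (1 - \<sigma> l) * (euler e (euler e (g l)) x - euler e (g l) x)
    - x * ((2 - \<sigma> l) * (euler e (euler e (g l)) x - euler e (g l) x)
        + (1 - \<rho>1 - \<rho>2 + (\<rho>1 + \<rho>2) * \<sigma> l) * euler e (g l) x - (\<Sum>m<n. B l m * euler e (g m) x))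
    + x ^ 2 * (euler e (euler e (g l)) x - euler e (g l) x + (1 - \<rho>1 - \<rho>2) * euler e (g l) x + (\<rho>1 * \<rho>2) * g l x)"

definition second_zero_fun :: "complex \<Rightarrow> (nat \<Rightarrow> complex \<Rightarrow> complex) \<Rightarrow> nat \<Rightarrow> complex \<Rightarrow> complex" where
  "second_zero_fun s h l z = z * (euler s (euler s (h l)) z - (\<rho>1 + \<rho>2) * euler s (h l) z + (\<rho>1 * \<rho>2) * h l z)
    - \<sigma> l * (euler s (euler s (h l)) z - (1 + \<rho>1 + \<rho>2) * euler s (h l) z)
    - (\<Sum>m<n. B l m * euler s (h m) z)"

lemma
  assumes "\<And>l. l < n \<Longrightarrow> g l has_fps_expansion G l" and "l < n"
  shows first_one_expansion: "first_one_fun p q e g l has_fps_expansion first_one p q e G l"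
    and first_zero_expansion: "first_zero_fun p q e g l has_fps_expansion first_zero p q e G l"
    and second_one_expansion: "second_one_fun e g l has_fps_expansion second_one e G l"
    and second_zero_expansion: "second_zero_fun e g l has_fps_expansion second_zero e G l"
  unfolding first_one_fun_def[abs_def] first_one_def first_zero_fun_def[abs_def] first_zero_def
    second_one_fun_def[abs_def] second_one_def second_zero_fun_def[abs_def] second_zero_def
  by (intro fps_expansion_intros has_fps_expansion_sum assms; simp add: assms)+

lemma branch_cancel:
  fixes x :: complex
  assumes "x \<notin> \<real>\<^sub>\<le>\<^sub>0" "x powr e * F = c * (0 :: complex)"
  shows "F = 0"
  using assms by auto

text \<open>The variable is \<open>x = 1 - z\<close>, so that \<open>z d/dz\<close> appears as
  \<open>- (1 - x) d/dx\<close>. The equation holds only on a set accumulating at \<open>0\<close>.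
  After the branch factor has been cancelled, an expression analytic at \<open>0\<close> remains
  which vanishes on this set, and so its series is zero.\<close>

lemma first_one_eq_0:
  assumes S: "open S" "\<And>x. x \<in> S \<Longrightarrow> x \<notin> \<real>\<^sub>\<le>\<^sub>0" "\<exists>\<^sub>F x in at 0. x \<in> S"
    and g: "\<And>l. l < n \<Longrightarrow> g l holomorphic_on S" "\<And>l. l < n \<Longrightarrow> g l has_fps_expansion G l"
    and u: "\<And>l x. l < n \<Longrightarrow> x \<in> S \<Longrightarrow> u l x = x powr e * g l x"
    and ode: "\<And>l x. l < n \<Longrightarrow> x \<in> S \<Longrightarrow>
      (1 - x - \<sigma> l) * (- (1 - x) * deriv (u l) x + p * u l x) + q * (1 - x) * u l x = (\<Sum>m<n. B l m * u m x)"
    and l: "l < n"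
  shows "first_one p q e G l = 0"
proof (rule has_fps_expansion_frequently_zero[OF first_one_expansion[where g = g, OF g(2) l]])
  show "\<exists>\<^sub>F x in at 0. first_one_fun p q e g l x = 0"
    using S(3)
  proof (rule frequently_elim1)
    fix x assume x: "x \<in> S"
    have d: "x * deriv (u l) x = x powr e * euler e (g l) x"
      by (rule deriv_powr_mult(1)[OF S(1) x S(2) g(1)[OF l] u[OF l]])
    have s: "(\<Sum>m<n. B l m * u m x) = x powr e * (\<Sum>m<n. B l m * g m x)"
      using u x by (simp add: sum_distrib_left mult_ac)
    have "x powr e * first_one_fun p q e g l x =
        x * ((2 - \<sigma> l) * (x powr e * euler e (g l) x) + ((1 - \<sigma> l) * p + q) * u l x - (\<Sum>m<n. B l m * u m x))
        - (1 - \<sigma> l) * (x powr e * euler e (g l) x) - x ^ 2 * ((x powr e * euler e (g l) x) + (p + q) * u l x)"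
      unfolding first_one_fun_def s u[OF l x] by (simp add: algebra_simps)
    also have "\<dots> = x * (((1 - x - \<sigma> l) * (- (1 - x) * deriv (u l) x + p * u l x) + q * (1 - x) * u l x) - (\<Sum>m<n. B l m * u m x))"
      unfolding d[symmetric] by (simp add: algebra_simps power2_eq_square)
    also have "\<dots> = x * 0"
      using ode[OF l x] by simp
    finally show "first_one_fun p q e g l x = 0"
      by (rule branch_cancel[OF S(2)[OF x]])
  qed
qed

lemma first_zero_eq_0:
  assumes S: "open S" "\<And>x. x \<in> S \<Longrightarrow> x \<notin> \<real>\<^sub>\<le>\<^sub>0" "\<exists>\<^sub>F x in at 0. x \<in> S"
    and g: "\<And>l. l < n \<Longrightarrow> g l holomorphic_on S" "\<And>l. l < n \<Longrightarrow> g l has_fps_expansion G l"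
    and u: "\<And>l x. l < n \<Longrightarrow> x \<in> S \<Longrightarrow> u l x = x powr e * g l x"
    and ode: "\<And>l x. l < n \<Longrightarrow> x \<in> S \<Longrightarrow>
      (x - \<sigma> l) * (x * deriv (u l) x + p * u l x) + q * x * u l x = (\<Sum>m<n. B l m * u m x)"
    and l: "l < n"
  shows "first_zero p q e G l = 0"
proof (rule has_fps_expansion_frequently_zero[OF first_zero_expansion[where g = g, OF g(2) l]])
  show "\<exists>\<^sub>F x in at 0. first_zero_fun p q e g l x = 0"
    using S(3)
  proof (rule frequently_elim1)
    fix x assume x: "x \<in> S"
    have d: "x * deriv (u l) x = x powr e * euler e (g l) x"
      by (rule deriv_powr_mult(1)[OF S(1) x S(2) g(1)[OF l] u[OF l]])
    have s: "(\<Sum>m<n. B l m * u m x) = x powr e * (\<Sum>m<n. B l m * g m x)"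
      using u x by (simp add: sum_distrib_left mult_ac)
    have "x powr e * first_zero_fun p q e g l x =
       ((x - \<sigma> l) * ((x powr e * euler e (g l) x) + p * u l x) + q * x * u l x) - (\<Sum>m<n. B l m * u m x)"
      unfolding first_zero_fun_def s u[OF l x] by (simp add: algebra_simps)
    also have "\<dots> = 1 * 0"
      unfolding d[symmetric] using ode[OF l x] by simp
    finally show "first_zero_fun p q e g l x = 0"
      by (rule branch_cancel[OF S(2)[OF x]])
  qed
qed

lemma second_one_eq_0:
  assumes S: "open S" "\<And>x. x \<in> S \<Longrightarrow> x \<notin> \<real>\<^sub>\<le>\<^sub>0" "\<exists>\<^sub>F x in at 0. x \<in> S"
    and g: "\<And>l. l < n \<Longrightarrow> g l holomorphic_on S" "\<And>l. l < n \<Longrightarrow> g l has_fps_expansion G l"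
    and u: "\<And>l x. l < n \<Longrightarrow> x \<in> S \<Longrightarrow> u l x = x powr e * g l x"
    and ode: "\<And>l x. l < n \<Longrightarrow> x \<in> S \<Longrightarrow>
      (1 - x) * (1 - x - \<sigma> l) * deriv (deriv (u l)) x - ((1 - \<rho>1 - \<rho>2) * (1 - x) + (\<rho>1 + \<rho>2) * \<sigma> l) * deriv (u l) x
      + (\<Sum>m<n. B l m * deriv (u m) x) + \<rho>1 * \<rho>2 * u l x = 0"
    and l: "l < n"
  shows "second_one e G l = 0"
proof (rule has_fps_expansion_frequently_zero[OF second_one_expansion[where g = g, OF g(2) l]])
  show "\<exists>\<^sub>F x in at 0. second_one_fun e g l x = 0"
    using S(3)
  proof (rule frequently_elim1)
    fix x assume x: "x \<in> S"
    have d: "x powr e * euler e (g m) x = x * deriv (u m) x" if "m < n" for m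
      by (rule deriv_powr_mult(1)[OF S(1) x S(2) g(1)[OF that] u[OF that], symmetric])
    have d2: "x powr e * (euler e (euler e (g l)) x - euler e (g l) x) = x\<^sup>2 * deriv (deriv (u l)) x"
      by (rule deriv_powr_mult(2)[OF S(1) x S(2) g(1)[OF l] u[OF l], symmetric])
    have s: "x powr e * (\<Sum>m<n. B l m * euler e (g m) x) = x * (\<Sum>m<n. B l m * deriv (u m) x)"
      unfolding sum_distrib_left by (intro sum.cong refl) (metis d lessThan_iff mult.left_commute)
    have "x powr e * second_one_fun e g l x =
      (1 - \<sigma> l) * (x powr e * (euler e (euler e (g l)) x - euler e (g l) x))
      - x * ((2 - \<sigma> l) * (x powr e * (euler e (euler e (g l)) x - euler e (g l) x))
        + (1 - \<rho>1 - \<rho>2 + (\<rho>1 + \<rho>2) * \<sigma> l) * (x powr e * euler e (g l) x) - (x powr e * (\<Sum>m<n. B l m * euler e (g m) x)))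
      + x ^ 2 * (x powr e * (euler e (euler e (g l)) x - euler e (g l) x) + (1 - \<rho>1 - \<rho>2) * (x powr e * euler e (g l) x) + (\<rho>1 * \<rho>2) * (x powr e * g l x))"
      unfolding second_one_fun_def by (simp only: algebra_simps)
    also have "\<dots> = x\<^sup>2 * ((1 - x) * (1 - x - \<sigma> l) * deriv (deriv (u l)) x - ((1 - \<rho>1 - \<rho>2) * (1 - x) + (\<rho>1 + \<rho>2) * \<sigma> l) * deriv (u l) x
      + (\<Sum>m<n. B l m * deriv (u m) x) + \<rho>1 * \<rho>2 * u l x)"
      unfolding d[OF l] d2 s u[OF l x, symmetric] by (simp add: algebra_simps power2_eq_square)
    also have "\<dots> = x\<^sup>2 * 0"
      using ode[OF l x] by simp
    finally show "second_one_fun e g l x = 0"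
      by (rule branch_cancel[OF S(2)[OF x]])
  qed
qed

lemma second_zero_eq_0:
  assumes S: "open S" "\<And>x. x \<in> S \<Longrightarrow> x \<notin> \<real>\<^sub>\<le>\<^sub>0" "\<exists>\<^sub>F x in at 0. x \<in> S"
    and g: "\<And>l. l < n \<Longrightarrow> g l holomorphic_on S" "\<And>l. l < n \<Longrightarrow> g l has_fps_expansion G l"
    and u: "\<And>l x. l < n \<Longrightarrow> x \<in> S \<Longrightarrow> u l x = x powr e * g l x"
    and ode: "\<And>l x. l < n \<Longrightarrow> x \<in> S \<Longrightarrow>
      x * (x - \<sigma> l) * deriv (deriv (u l)) x + ((1 - \<rho>1 - \<rho>2) * x + (\<rho>1 + \<rho>2) * \<sigma> l) * deriv (u l) x
      - (\<Sum>m<n. B l m * deriv (u m) x) + \<rho>1 * \<rho>2 * u l x = 0"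
    and l: "l < n"
  shows "second_zero e G l = 0"
proof (rule has_fps_expansion_frequently_zero[OF second_zero_expansion[where g = g, OF g(2) l]])
  show "\<exists>\<^sub>F x in at 0. second_zero_fun e g l x = 0"
    using S(3)
  proof (rule frequently_elim1)
    fix x assume x: "x \<in> S"
    have d: "x powr e * euler e (g m) x = x * deriv (u m) x" if "m < n" for m
      by (rule deriv_powr_mult(1)[OF S(1) x S(2) g(1)[OF that] u[OF that], symmetric])
    have "x powr e * euler e (euler e (g l)) x - x powr e * euler e (g l) x = x\<^sup>2 * deriv (deriv (u l)) x"
      using deriv_powr_mult(2)[OF S(1) x S(2) g(1)[OF l] u[OF l]] by (simp add: right_diff_distrib)
    then have d2: "x powr e * euler e (euler e (g l)) x = x\<^sup>2 * deriv (deriv (u l)) x + x * deriv (u l) x"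
      using d[OF l] by (simp add: algebra_simps)
    have s: "x powr e * (\<Sum>m<n. B l m * euler e (g m) x) = x * (\<Sum>m<n. B l m * deriv (u m) x)"
      unfolding sum_distrib_left by (intro sum.cong refl) (metis d lessThan_iff mult.left_commute)
    have "x powr e * second_zero_fun e g l x =
      x * (x powr e * euler e (euler e (g l)) x - (\<rho>1 + \<rho>2) * (x powr e * euler e (g l) x) + (\<rho>1 * \<rho>2) * (x powr e * g l x))
      - \<sigma> l * (x powr e * euler e (euler e (g l)) x - (1 + \<rho>1 + \<rho>2) * (x powr e * euler e (g l) x))
      - x powr e * (\<Sum>m<n. B l m * euler e (g m) x)"
      unfolding second_zero_fun_def by (simp only: algebra_simps)
    also have "\<dots> = x * (x * (x - \<sigma> l) * deriv (deriv (u l)) x + ((1 - \<rho>1 - \<rho>2) * x + (\<rho>1 + \<rho>2) * \<sigma> l) * deriv (u l) x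
      - (\<Sum>m<n. B l m * deriv (u m) x) + \<rho>1 * \<rho>2 * u l x)"
      unfolding d[OF l] d2 s u[OF l x, symmetric] by (simp add: algebra_simps power2_eq_square)
    also have "\<dots> = x * 0"
      using ode[OF l x] by simp
    finally show "second_zero_fun e g l x = 0"
      by (rule branch_cancel[OF S(2)[OF x]])
  qed
qed

text \<open>Differentiate the upper equation and multiply it by \<open>z\<close>. The lower equation
  then removes the derivative of \<open>v\<close>, and the upper equation itself removes
  \<open>v\<close>. The computation takes place after application of \<open>Q\<close>, which turns
  \<open>A\<close> into multiplication by \<open>\<mu> j\<close> and \<open>P\<close> into the
  identity.\<close>

lemma second_order_of_system:
  assumes S: "open S" and u: "\<And>l. l < n \<Longrightarrow> u l holomorphic_on S" and v: "\<And>j. j < n \<Longrightarrow> v j holomorphic_on S"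
    and eq_u: "\<And>l z. l < n \<Longrightarrow> z \<in> S \<Longrightarrow>
      (z - \<sigma> l) * deriv (u l) z = (\<Sum>m<n. A l m * u m z) + (\<Sum>j<n. P l j * v j z)"
    and eq_v: "\<And>j z. j < n \<Longrightarrow> z \<in> S \<Longrightarrow>
      z * deriv (v j) z = (\<rho>1 + \<rho>2 - \<mu> j) * v j z - (\<mu> j - \<rho>1) * (\<mu> j - \<rho>2) * (\<Sum>l<n. Q j l * u l z)"
    and l: "l < n" and z: "z \<in> S"
  shows "z * (z - \<sigma> l) * deriv (deriv (u l)) z + ((1 - \<rho>1 - \<rho>2) * z + (\<rho>1 + \<rho>2) * \<sigma> l) * deriv (u l) z
      - (\<Sum>m<n. B l m * deriv (u m) z) + \<rho>1 * \<rho>2 * u l z = 0"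
proof (rule Q_inj[OF _ l])
  have du: "(u l has_field_derivative deriv (u l) z) (at z)" if "l < n" for l
    by (rule holomorphic_derivI[OF u[OF that] S z])
  have ddu: "(deriv (u l) has_field_derivative deriv (deriv (u l)) z) (at z)" if "l < n" for l
    by (rule holomorphic_derivI[OF holomorphic_deriv[OF u[OF that] S] S z])
  have dv: "(v j has_field_derivative deriv (v j) z) (at z)" if "j < n" for j
    by (rule holomorphic_derivI[OF v[OF that] S z])
  have ev: "\<forall>\<^sub>F z in nhds z. z \<in> S"
    using S z by (rule eventually_nhds_in_open)
  have eq': "(z - \<sigma> l) * deriv (deriv (u l)) z + deriv (u l) z =
      (\<Sum>m<n. A l m * deriv (u m) z) + (\<Sum>j<n. P l j * deriv (v j) z)" if l: "l < n" for l
  proof -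
    have "deriv (\<lambda>z. (z - \<sigma> l) * deriv (u l) z) z = (z - \<sigma> l) * deriv (deriv (u l)) z + deriv (u l) z"
      by (rule DERIV_imp_deriv) (auto intro!: derivative_eq_intros ddu l)
    moreover have "deriv (\<lambda>z. (\<Sum>m<n. A l m * u m z) + (\<Sum>j<n. P l j * v j z)) z =
        (\<Sum>m<n. A l m * deriv (u m) z) + (\<Sum>j<n. P l j * deriv (v j) z)"
      by (rule DERIV_imp_deriv, intro DERIV_add DERIV_sum DERIV_cmult) (auto intro: du dv)
    moreover have "deriv (\<lambda>z. (z - \<sigma> l) * deriv (u l) z) z =
        deriv (\<lambda>z. (\<Sum>m<n. A l m * u m z) + (\<Sum>j<n. P l j * v j z)) z"
      by (rule deriv_cong_ev[OF eventually_mono[OF ev]]) (use eq_u l in auto)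
    ultimately show ?thesis by simp
  qed
  fix j assume j: "j < n"
  define a where "a = (\<Sum>l<n. Q j l * u l z)"
  define b where "b = (\<Sum>l<n. Q j l * deriv (u l) z)"
  define b' where "b' = (\<Sum>l<n. Q j l * (\<sigma> l * deriv (u l) z))"
  define c where "c = (\<Sum>l<n. Q j l * ((z - \<sigma> l) * deriv (deriv (u l)) z))"
  have 1: "z * b - b' = \<mu> j * a + v j z"
  proof -
    have "z * b - b' = (\<Sum>l<n. Q j l * ((z - \<sigma> l) * deriv (u l) z))"
      by (simp add: b_def b'_def sum_distrib_left sum_subtractf[symmetric] algebra_simps)
    also have "\<dots> = (\<Sum>l<n. Q j l * ((\<Sum>m<n. A l m * u m z) + (\<Sum>j<n. P l j * v j z)))"
      using eq_u z by simp
    also have "\<dots> = \<mu> j * a + v j z"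
      unfolding distrib_left sum.distrib by (simp add: Q_A[OF j] Q_P[OF j] a_def)
    finally show ?thesis .
  qed
  have 2: "c + b = \<mu> j * b + deriv (v j) z"
  proof -
    have "c + b = (\<Sum>l<n. Q j l * ((z - \<sigma> l) * deriv (deriv (u l)) z + deriv (u l) z))"
      by (simp add: b_def c_def distrib_left sum.distrib)
    also have "\<dots> = (\<Sum>l<n. Q j l * ((\<Sum>m<n. A l m * deriv (u m) z) + (\<Sum>j<n. P l j * deriv (v j) z)))"
      using eq' by simp
    also have "\<dots> = \<mu> j * b + deriv (v j) z"
      unfolding distrib_left sum.distrib by (simp add: Q_A[OF j] Q_P[OF j] b_def)
    finally show ?thesis .
  qed
  have 3: "z * deriv (v j) z = (\<rho>1 + \<rho>2 - \<mu> j) * v j z - (\<mu> j - \<rho>1) * (\<mu> j - \<rho>2) * a"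
    using eq_v[OF j z] by (simp add: a_def)
  have "(\<Sum>l<n. Q j l * (z * (z - \<sigma> l) * deriv (deriv (u l)) z + ((1 - \<rho>1 - \<rho>2) * z + (\<rho>1 + \<rho>2) * \<sigma> l) * deriv (u l) z
      - (\<Sum>m<n. B l m * deriv (u m) z) + \<rho>1 * \<rho>2 * u l z)) =
      z * c + (1 - \<rho>1 - \<rho>2) * z * b + (\<rho>1 + \<rho>2) * b' - (\<Sum>l<n. Q j l * (\<Sum>m<n. B l m * deriv (u m) z)) + \<rho>1 * \<rho>2 * a"
    unfolding a_def b_def b'_def c_def sum_distrib_left[of _ _ "{..<n}"] sum_subtractf[symmetric] sum.distrib[symmetric]
    by (intro sum.cong refl) (simp add: algebra_simps sum_distrib_left)
  also have "\<dots> = z * c + (1 - \<rho>1 - \<rho>2) * z * b + (\<rho>1 + \<rho>2) * b' - \<mu> j * b' + \<rho>1 * \<rho>2 * a"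
    by (simp add: Q_B[OF j] b'_def)
  also have "\<dots> = z * deriv (v j) z - ((\<rho>1 + \<rho>2 - \<mu> j) * v j z - (\<mu> j - \<rho>1) * (\<mu> j - \<rho>2) * a)"
  proof -
    have b': "b' = z * b - \<mu> j * a - v j z" and c: "c = \<mu> j * b + deriv (v j) z - b"
      using 1 2 by (simp_all add: algebra_simps)
    show ?thesis
      unfolding b' c by (simp add: algebra_simps)
  qed
  also have "\<dots> = 0"
    using 3 by simp
  finally show "(\<Sum>l<n. Q j l * (z * (z - \<sigma> l) * deriv (deriv (u l)) z + ((1 - \<rho>1 - \<rho>2) * z + (\<rho>1 + \<rho>2) * \<sigma> l) * deriv (u l) z
      - (\<Sum>m<n. B l m * deriv (u m) z) + \<rho>1 * \<rho>2 * u l z)) = 0" .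
qed

lemma second_one_diff: "second_one e (\<lambda>l. F l - fps_const c * G l) l = second_one e F l - fps_const c * second_one e G l"
proof (rule fps_ext)
  fix N
  have "(\<Sum>m<n. B l m * (f m - c * g m)) = (\<Sum>m<n. B l m * f m) - c * (\<Sum>m<n. B l m * g m)" for f g :: "nat \<Rightarrow> complex"
    by (simp add: right_diff_distrib sum_subtractf sum_distrib_left mult.left_commute)
  then show "fps_nth (second_one e (\<lambda>l. F l - fps_const c * G l) l) N = fps_nth (second_one e F l - fps_const c * second_one e G l) N"
    by (cases N; simp only: nth_second_one fps_sub_nth fps_mult_left_const_nth; simp add: algebra_simps)
qed

lemma second_zero_diff: "second_zero e (\<lambda>l. F l - fps_const c * G l) l = second_zero e F l - fps_const c * second_zero e G l"
proof (rule fps_ext)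
  fix N
  have "(\<Sum>m<n. B l m * (f m - c * g m)) = (\<Sum>m<n. B l m * f m) - c * (\<Sum>m<n. B l m * g m)" for f g :: "nat \<Rightarrow> complex"
    by (simp add: right_diff_distrib sum_subtractf sum_distrib_left mult.left_commute)
  then show "fps_nth (second_zero e (\<lambda>l. F l - fps_const c * G l) l) N = fps_nth (second_zero e F l - fps_const c * second_zero e G l) N"
    by (simp only: nth_second_zero fps_sub_nth fps_mult_left_const_nth; simp add: algebra_simps)
qed

text \<open>For \<open>\<sigma> l \<noteq> 1\<close> the equation of index \<open>N\<close>
  determines the coefficient of index \<open>N\<close>, with factor
  \<open>(1 - \<sigma> l) (e + N) (e + N - 1)\<close>. For \<open>\<sigma> l = 1\<close> this factor
  is zero and the equation of index \<open>N + 1\<close> takes over, with factor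
  \<open>(e + N) (e + N - A l l)\<close>; the rows with \<open>\<sigma> l = 1\<close> decouple
  because their block of \<open>A\<close> is diagonal.\<close>

lemma second_one_unique:
  assumes D: "\<And>l. l < n \<Longrightarrow> second_one e D l = 0" and D0: "\<And>l. l < n \<Longrightarrow> fps_nth (D l) 0 = 0"
    and e: "e \<notin> \<int>"
    and A0: "\<And>l m. l < n \<Longrightarrow> m < n \<Longrightarrow> \<sigma> l = 1 \<Longrightarrow> \<sigma> m = 1 \<Longrightarrow> l \<noteq> m \<Longrightarrow> A l m = 0"
    and A1: "\<And>l N. l < n \<Longrightarrow> \<sigma> l = 1 \<Longrightarrow> 0 < N \<Longrightarrow> e + of_nat N \<noteq> A l l"
    and l: "l < n"
  shows "D l = 0"
proof -
  have enz: "e + of_nat N \<noteq> 0" for N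
    using e by (metis Ints_0 not_Ints_add_of_nat_iff(1))
  have "\<forall>l<n. fps_nth (D l) N = 0" for N
  proof (induction N rule: less_induct)
    case (less N)
    show ?case
    proof (cases N)
      case (Suc M)
      have prev: "fps_nth (D l) k = 0" if "l < n" "k < Suc M" for l k
        using less that Suc by auto
      have off: "fps_nth (D l) (Suc M) = 0" if l: "l < n" "\<sigma> l \<noteq> 1" for l
      proof -
        have "0 = (1 - \<sigma> l) * ((e + of_nat (Suc M)) * (e + of_nat M) * fps_nth (D l) (Suc M))"
          using nth_second_one(2)[of e D l M] D[OF l(1)] prev l by (cases "M = 0") auto
        then show ?thesis
          using l enz[of M] enz[of "Suc M"] by simp
      qed
      have "fps_nth (D l) (Suc M) = 0" if l: "l < n" "\<sigma> l = 1" for l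
      proof -
        have S: "(\<Sum>m<n. B l m * fps_nth (D m) (Suc M)) = A l l * fps_nth (D l) (Suc M)"
        proof -
          have "(\<Sum>m<n. B l m * fps_nth (D m) (Suc M)) = (\<Sum>m<n. if m = l then A l l * fps_nth (D l) (Suc M) else 0)"
            by (intro sum.cong refl) (use off A0 l in \<open>auto simp: B_def\<close>)
          then show ?thesis using l by simp
        qed
        have "0 = (e + of_nat (Suc M)) * ((e + of_nat (Suc M) - A l l) * fps_nth (D l) (Suc M))"
          using nth_second_one(2)[of e D l "Suc M"] D[OF l(1)] prev l by (simp add: S) (auto simp: algebra_simps)
        then show ?thesis
          using enz[of "Suc M"] A1[OF l, of "Suc M"] by simp
      qed
      with off show ?thesis
        using Suc by blast
    qed (use D0 in auto)
  qed
  then show ?thesis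
    using l by (simp add: fps_eq_iff)
qed

text \<open>In the coordinates of \<open>Q\<close> the coefficient of index \<open>N\<close> is
  multiplied by \<open>s + N - 1 - \<rho>1 - \<rho>2 + \<mu> j\<close>. For the exponent
  \<open>s = \<rho>1 + \<rho>2 - m k\<close> of the application this is
  \<open>N - 1 + \<mu> j - m k\<close>, which is zero at \<open>N = 1\<close> if
  \<open>\<mu> j = m k\<close>. The coefficient of index 1 is thus free and has to be
  prescribed.\<close>

lemma second_zero_unique:
  assumes D: "\<And>l. l < n \<Longrightarrow> second_zero s D l = 0"
    and D0: "\<And>l. l < n \<Longrightarrow> fps_nth (D l) 0 = 0" "\<And>l. l < n \<Longrightarrow> fps_nth (D l) 1 = 0"
    and s: "s \<notin> \<int>" and nz: "\<And>j N. j < n \<Longrightarrow> 2 \<le> N \<Longrightarrow> s + of_nat N - 1 - \<rho>1 - \<rho>2 + \<mu> j \<noteq> 0"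
    and l: "l < n"
  shows "D l = 0"
proof -
  have "\<forall>l<n. fps_nth (D l) N = 0" for N
  proof (induction N rule: less_induct)
    case (less N)
    show ?case
    proof (cases "2 \<le> N")
      case True
      have "s + of_nat N \<noteq> 0"
        using s by (metis Ints_0 not_Ints_add_of_nat_iff(1))
      moreover have "(s + of_nat N) * (\<sigma> l * ((s + of_nat N - 1 - \<rho>1 - \<rho>2) * fps_nth (D l) N) + (\<Sum>m<n. B l m * fps_nth (D m) N)) = 0"
        if "l < n" for l
        using nth_second_zero[of s D l N] D[OF that] less[of "N - 1"] that True by simp
      ultimately have "(s + of_nat N - 1 - \<rho>1 - \<rho>2) * (\<sigma> l * fps_nth (D l) N) + (\<Sum>m<n. B l m * fps_nth (D m) N) = 0"
        if "l < n" for l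
        using that by (simp add: mult.left_commute)
      from eigen_zero[OF this nz[OF _ True]] show ?thesis
        by blast
    next
      case False
      then have "N = 0 \<or> N = 1" by auto
      then show ?thesis using D0 by auto
    qed
  qed
  then show ?thesis
    using l by (simp add: fps_eq_iff)
qed

end

section \<open>Composing two transforms\<close>

locale okubo_rl = okubo n \<sigma> A P Q \<mu> \<rho>1 \<rho>2 + rl_domain D
  for n \<sigma> A P Q \<mu> \<rho>1 \<rho>2 D
begin

lemma reflect_D: "open ((\<lambda>x. 1 - x) -` D)" "connected ((\<lambda>x::complex. 1 - x) -` D)" "0 \<in> (\<lambda>x. 1 - x) -` D"
proof -
  show "open ((\<lambda>x. 1 - x) -` D)"
    by (intro open_vimage open_D continuous_intros)
  have "(\<lambda>x. 1 - x) -` D = (\<lambda>x. 1 - x) ` D"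
    by (force simp: image_iff)
  moreover have "continuous_on D (\<lambda>x. 1 - x)"
    by (intro continuous_intros)
  ultimately show "connected ((\<lambda>x::complex. 1 - x) -` D)"
    using connected_continuous_image convex_connected[OF convex_D] by metis
qed (use one_in_D in auto)

lemma reflect_holomorphic:
  assumes "g holomorphic_on D"
  shows "(\<lambda>x. g (1 - x)) holomorphic_on (\<lambda>x. 1 - x) -` D"
proof -
  have "g \<circ> (\<lambda>x. 1 - x) holomorphic_on (\<lambda>x. 1 - x) -` D"
    by (intro holomorphic_on_compose_gen[OF _ assms] holomorphic_intros) auto
  then show ?thesis by (simp add: o_def)
qed

lemma reflect_expansion:
  assumes "g holomorphic_on D"
  obtains G where "(\<lambda>x. g (1 - x)) has_fps_expansion G"
  using analytic_at_imp_has_fps_expansion_0[of "\<lambda>x. g (1 - x)"] reflect_holomorphic[OF assms] reflect_D analytic_at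
  by blast

text \<open>Applied to \<open>z^(-r) f\<close>, the operator \<open>\<theta> + p\<close> gives
  \<open>z^(-r) (\<theta> + p - r) f\<close>. At \<open>z = 1\<close> the factor \<open>z^r\<close>
  is holomorphic and nonzero, so the exponent \<open>e\<close> is unchanged.\<close>

lemma first_one_powr:
  assumes g: "\<And>l. l < n \<Longrightarrow> g l holomorphic_on D" and G: "\<And>l. l < n \<Longrightarrow> (\<lambda>x. g l (1 - x)) has_fps_expansion G l"
    and G': "\<And>l. l < n \<Longrightarrow> (\<lambda>x. (1 - x) powr r * g l (1 - x)) has_fps_expansion G' l"
    and F: "\<And>l. l < n \<Longrightarrow> first_one p q e G l = 0" and l: "l < n"
  shows "first_one (p - r) q e G' l = 0"
proof -
  let ?h = "\<lambda>l x. g l (1 - x)" and ?h' = "\<lambda>l x. (1 - x) powr r * g l (1 - x)"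
  have "first_one_fun p q e ?h l has_fps_expansion 0"
    using first_one_expansion[where g = ?h and p = p and q = q and e = e, OF G l] F[OF l] by simp
  then have "\<forall>\<^sub>F x in nhds 0. first_one_fun p q e ?h l x = 0"
    by (auto simp: has_fps_expansion_def elim: eventually_mono)
  moreover have "\<forall>\<^sub>F x in nhds 0. x \<in> (\<lambda>x. 1 - x) -` D"
    by (intro eventually_nhds_in_open reflect_D)
  ultimately have "\<forall>\<^sub>F x in nhds 0. first_one_fun (p - r) q e ?h' l x = 0"
  proof eventually_elim
    case (elim x)
    have nn: "1 - x \<notin> \<real>\<^sub>\<le>\<^sub>0" using elim(2) by simp
    then have nz: "1 - x \<noteq> 0" by auto
    have d: "(?h l has_field_derivative deriv (?h l) x) (at x)"
      by (rule holomorphic_derivI[OF reflect_holomorphic[OF g[OF l]] reflect_D(1) elim(2)])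
    have "((\<lambda>x. (1 - x) powr r) has_field_derivative - (r * (1 - x) powr (r - 1))) (at x)"
      using nn by (auto intro!: derivative_eq_intros)
    from DERIV_imp_deriv[OF DERIV_mult[OF this d]]
    have e: "deriv (?h' l) x = - (r * (1 - x) powr (r - 1)) * ?h l x + deriv (?h l) x * (1 - x) powr r" .
    have pr: "(1 - x) powr r = (1 - x) powr (r - 1) * (1 - x)"
      using nz by (simp add: powr_diff)
    have "(1 - x) * euler e (?h' l) x = (1 - x) powr r * ((1 - x) * euler e (?h l) x - r * x * ?h l x)"
      unfolding euler_def e pr by (simp add: algebra_simps)
    then have eu: "(1 - x) powr r * ((1 - x) * euler e (?h l) x) = (1 - x) * euler e (?h' l) x + r * x * ?h' l x"
      by (simp add: algebra_simps)
    have s: "(\<Sum>m<n. B l m * ?h' m x) = (1 - x) powr r * (\<Sum>m<n. B l m * ?h m x)"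
      by (simp add: sum_distrib_left mult_ac)
    have expand: "first_one_fun p q e h l x = (1 - x - \<sigma> l) * (p * x * h l x - (1 - x) * euler e (h l) x)
        + q * (1 - x) * x * h l x - x * (\<Sum>m<n. B l m * h m x)" for p h
      by (simp add: first_one_fun_def algebra_simps power2_eq_square)
    have "first_one_fun (p - r) q e ?h' l x = (1 - x) powr r * first_one_fun p q e ?h l x"
    proof -
      have "(1 - x) powr r * first_one_fun p q e ?h l x =
          (1 - x - \<sigma> l) * (p * x * ?h' l x - (1 - x) powr r * ((1 - x) * euler e (?h l) x))
          + q * (1 - x) * x * ?h' l x - x * ((1 - x) powr r * (\<Sum>m<n. B l m * ?h m x))"
        unfolding expand by (simp add: algebra_simps)
      then show ?thesis
        unfolding expand s eu by (simp add: algebra_simps)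
    qed
    then show ?case
      using elim(1) by simp
  qed
  then have freq: "\<exists>\<^sub>F x in at 0. first_one_fun (p - r) q e ?h' l x = 0"
    by (intro eventually_frequently) (auto simp: eventually_at_filter elim: eventually_mono)
  have "first_one_fun (p - r) q e ?h' l has_fps_expansion first_one (p - r) q e G' l"
    by (rule first_one_expansion[where g = ?h']) (use G' l in auto)
  from has_fps_expansion_frequently_zero[OF this freq] show ?thesis .
qed

text \<open>A series identity at \<open>1\<close> means that a function holomorphic on the reflected
  domain vanishes near \<open>0\<close>, hence everywhere, since that domain is connected. This
  carries the equation from \<open>1\<close> to the vicinity of \<open>0\<close>; there
  \<open>norm z < 1\<close> keeps \<open>1 - z\<close> off the cut of the power.\<close>

lemma first_order_near_0:
  assumes g: "\<And>l. l < n \<Longrightarrow> g l holomorphic_on D" and G: "\<And>l. l < n \<Longrightarrow> (\<lambda>x. g l (1 - x)) has_fps_expansion G l"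
    and F: "\<And>l. l < n \<Longrightarrow> first_one p q e G l = 0" and l: "l < n" and z: "z \<in> D" "norm z < 1"
    and f: "\<And>l z. f l z = (1 - z) powr e * g l z"
  shows "(z - \<sigma> l) * (z * deriv (f l) z + p * f l z) + q * z * f l z = (\<Sum>m<n. B l m * f m z)"
proof -
  let ?h = "\<lambda>l x. g l (1 - x)"
  define x where "x = 1 - z"
  have x: "x \<notin> \<real>\<^sub>\<le>\<^sub>0" "x \<in> (\<lambda>x. 1 - x) -` D" and zx: "z = 1 - x"
    using z complex_Re_le_cmod[of z] by (auto simp: x_def complex_nonpos_Reals_iff)
  then have xnz: "x \<noteq> 0" by auto
  have "first_one_fun p q e ?h l has_fps_expansion 0"
    using first_one_expansion[where g = ?h and p = p and q = q and e = e, OF G l] F[OF l] by simp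
  moreover have "first_one_fun p q e ?h l holomorphic_on (\<lambda>x. 1 - x) -` D"
    unfolding first_one_fun_def[abs_def]
    by (intro holomorphic_intros euler_holomorphic reflect_holomorphic g reflect_D l) auto
  ultimately have 0: "first_one_fun p q e ?h l x = 0"
    by (rule has_fps_expansion_0_analytic_continuation) (use reflect_D x in auto)
  have hd: "?h l field_differentiable at x"
    using reflect_holomorphic[OF g[OF l]] reflect_D(1) x(2) holomorphic_on_imp_differentiable_at by blast
  have "((\<lambda>x. x powr e * ?h l x) has_field_derivative x powr (e - 1) * euler e (?h l) x) (at (1 - z))"
    using DERIV_powr_mult_euler[OF x(1) hd, of e] by (simp add: x_def)
  then have "((\<lambda>z. (1 - z) powr e * ?h l (1 - z)) has_field_derivative x powr (e - 1) * euler e (?h l) x * (- 1)) (at z)"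
    by (rule DERIV_chain2) (auto intro!: derivative_eq_intros)
  then have d: "x * deriv (f l) z = - (x powr e * euler e (?h l) x)"
    using xnz by (subst DERIV_imp_deriv) (auto simp: f[abs_def] powr_diff)
  have f': "f m z = x powr e * ?h m x" for m
    by (simp add: f x_def)
  have s: "(\<Sum>m<n. B l m * f m z) = x powr e * (\<Sum>m<n. B l m * ?h m x)"
    by (simp add: f' sum_distrib_left mult_ac)
  have "x * ((z - \<sigma> l) * (z * deriv (f l) z + p * f l z) + q * z * f l z - (\<Sum>m<n. B l m * f m z)) =
      (z - \<sigma> l) * (z * (x * deriv (f l) z) + x * p * f l z) + q * z * x * f l z - x * (\<Sum>m<n. B l m * f m z)"
    by (simp add: algebra_simps)
  also have "\<dots> = x powr e * first_one_fun p q e ?h l x"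
    unfolding s unfolding d f' unfolding zx first_one_fun_def by (simp add: algebra_simps power2_eq_square)
  finally show ?thesis
    using 0 xnz by simp
qed

text \<open>The holomorphic part splits off as a solution of its own, and \<open>\<theta> + 1\<close> has no
  holomorphic solutions because no \<open>\<mu>\<^sub>j\<close> is an integer.\<close>

lemma holomorphic_part_zero:
  assumes K: "finite (K :: 'k set)"
    and h: "\<And>k l. k \<in> K \<Longrightarrow> l < n \<Longrightarrow> h k l has_fps_expansion H k l"
    and h0: "\<And>l. l < n \<Longrightarrow> h0 l analytic_on {0}"
    and ev: "\<And>l. l < n \<Longrightarrow> \<forall>\<^sub>F z in at 0 within D. f l z = (\<Sum>k\<in>K. z powr s k * h k l z) + h0 l z"
    and H: "\<And>k l. k \<in> K \<Longrightarrow> l < n \<Longrightarrow> first_zero 1 q (s k) (H k) l = 0"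
    and ode: "\<And>l z. l < n \<Longrightarrow> z \<in> D \<Longrightarrow> norm z < 1 \<Longrightarrow>
      (z - \<sigma> l) * (z * deriv (f l) z + f l z) + q * z * f l z = (\<Sum>m<n. B l m * f m z)"
    and l: "l < n"
  shows "\<forall>\<^sub>F z in nhds 0. h0 l z = 0"
proof -
  define H0 where "H0 = (\<lambda>l. fps_expansion (h0 l) 0)"
  have H0: "h0 l has_fps_expansion H0 l" if "l < n" for l
    unfolding H0_def by (rule analytic_at_imp_has_fps_expansion_0[OF h0[OF that]])
  have z0: "\<forall>\<^sub>F z in at 0 within D. first_zero_fun 1 q (s k) (h k) l z = 0" if "k \<in> K" "l < n" for k l
  proof -
    have "first_zero_fun 1 q (s k) (h k) l has_fps_expansion 0"
      using first_zero_expansion[where g = "h k" and G = "H k" and p = 1 and q = q and e = "s k", OF h[OF that(1)] that(2)] H[OF that] by simp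
    then have "\<forall>\<^sub>F z in nhds 0. first_zero_fun 1 q (s k) (h k) l z = 0"
      by (auto simp: has_fps_expansion_def elim: eventually_mono)
    then show ?thesis
      by (rule filter_leD[OF at_within_le_nhds])
  qed
  have "\<forall>\<^sub>F z in at 0 within D. first_zero_fun 1 q 0 h0 l z = 0" if l: "l < n" for l
  proof -
    have "\<forall>\<^sub>F z in at 0 within D. \<forall>k\<in>K. first_zero_fun 1 q (s k) (h k) l z = 0"
      by (intro eventually_ball_finite K ballI z0 l)
    moreover have "\<forall>\<^sub>F z in at 0 within D. \<forall>m\<in>{..<n}. f m z = (\<Sum>k\<in>K. z powr s k * h k m z) + h0 m z"
      by (intro eventually_ball_finite ballI ev) auto
    moreover have "\<forall>\<^sub>F z in at 0 within D. deriv (f l) z = (\<Sum>k\<in>K. z powr (s k - 1) * euler (s k) (h k l) z) + deriv (h0 l) z"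
      by (rule deriv_expansion_mod_hol[OF K h h0 ev]) (use l in auto)
    moreover have "\<forall>\<^sub>F z in at 0 within D. z \<in> D \<and> norm z < 1"
      by (auto simp: eventually_at intro!: exI[of _ 1])
    ultimately show ?thesis
    proof eventually_elim
      case (elim z)
      have znz: "z \<noteq> 0" using elim(4) Re_pos[of 0] by auto
      have fm: "f m z = (\<Sum>k\<in>K. z powr s k * h k m z) + h0 m z" if "m < n" for m
        using elim(2) that by simp
      have d: "z * deriv (f l) z = (\<Sum>k\<in>K. z powr s k * euler (s k) (h k l) z) + euler 0 (h0 l) z"
        using znz by (simp add: elim(3) euler_def[of 0] distrib_left sum_distrib_left powr_diff)
      have s: "(\<Sum>m<n. B l m * f m z) = (\<Sum>k\<in>K. z powr s k * (\<Sum>m<n. B l m * h k m z)) + (\<Sum>m<n. B l m * h0 m z)"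
      proof -
        have "(\<Sum>m<n. B l m * f m z) = (\<Sum>m<n. \<Sum>k\<in>K. z powr s k * (B l m * h k m z)) + (\<Sum>m<n. B l m * h0 m z)"
          unfolding sum.distrib[symmetric]
          by (intro sum.cong refl) (simp add: fm distrib_left sum_distrib_left mult_ac)
        also have "(\<Sum>m<n. \<Sum>k\<in>K. z powr s k * (B l m * h k m z)) = (\<Sum>k\<in>K. z powr s k * (\<Sum>m<n. B l m * h k m z))"
          by (subst sum.swap) (simp add: sum_distrib_left)
        finally show ?thesis .
      qed
      have "0 = (z - \<sigma> l) * (z * deriv (f l) z + f l z) + q * z * f l z - (\<Sum>m<n. B l m * f m z)"
        using ode[OF l] elim(4) by simp
      also have "\<dots> = (\<Sum>k\<in>K. z powr s k * ((z - \<sigma> l) * (euler (s k) (h k l) z + h k l z) + q * z * h k l z - (\<Sum>m<n. B l m * h k m z)))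
          + ((z - \<sigma> l) * (euler 0 (h0 l) z + h0 l z) + q * z * h0 l z - (\<Sum>m<n. B l m * h0 m z))"
        unfolding d s fm[OF l]
        by (simp add: algebra_simps sum.distrib sum_subtractf sum_distrib_left)
      also have "(\<Sum>k\<in>K. z powr s k * ((z - \<sigma> l) * (euler (s k) (h k l) z + h k l z) + q * z * h k l z - (\<Sum>m<n. B l m * h k m z)))
          = (\<Sum>k\<in>K. z powr s k * first_zero_fun 1 q (s k) (h k) l z)"
        by (intro sum.cong refl) (simp add: first_zero_fun_def algebra_simps)
      also have "\<dots> = 0"
        using elim(1) by simp
      finally show ?case
        by (simp add: first_zero_fun_def algebra_simps)
    qed
  qed
  then have F0: "first_zero 1 q 0 H0 l = 0" if "l < n" for l
    using that by (intro has_fps_expansion_frequently_zero[OF first_zero_expansion[where g = h0, OF H0]]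
        eventually_frequently_at_0)
  have "\<forall>l<n. fps_nth (H0 l) N = 0" for N
  proof (induction N rule: less_induct)
    case (less N)
    have "of_nat (Suc N) * (\<sigma> l * fps_nth (H0 l) N) + (\<Sum>m<n. B l m * fps_nth (H0 m) N) = 0" if "l < n" for l
      using nth_first_zero[of 1 q 0 H0 l N] F0[OF that] less[of "N - 1"] that
      by (cases "N = 0") (auto simp: algebra_simps add_eq_0_iff)
    moreover have "of_nat (Suc N) + \<mu> j \<noteq> 0" if "j < n" for j
      using \<mu>_nonint[OF that] by (metis Ints_0 not_Ints_add_of_nat_iff(2))
    ultimately show ?case
      using eigen_zero[of "of_nat (Suc N)" "\<lambda>l. fps_nth (H0 l) N"] by blast
  qed
  then have "H0 l = 0"
    using l by (simp add: fps_eq_iff)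
  then show ?thesis
    using H0[OF l] by (auto simp: has_fps_expansion_def elim: eventually_mono)
qed

text \<open>Four steps produce \<open>g0\<close> to \<open>g3\<close>: the factor
  \<open>z^\<rho>2\<close>, the transform of order \<open>- 1 - \<rho>2\<close>, the factor
  \<open>z^(\<rho>1 + 1)\<close> and the transform of order \<open>1 + \<rho>2\<close>. Their
  exponents at \<open>1\<close> are \<open>\<nu>\<close>, \<open>\<nu> - \<rho>2 - 1\<close>,
  \<open>\<nu> - \<rho>2 - 1\<close> and \<open>\<nu>\<close>. The two Gamma quotients of the
  leading coefficient are inverse to each other, so the value at \<open>1\<close> is
  preserved.\<close>

lemma second_order_continuation:
  fixes K :: "(nat \<times> nat) set" and \<nu> :: complex and m :: "nat \<times> nat \<Rightarrow> complex"
  assumes \<nu>: "\<nu> \<notin> \<int>" "\<nu> - \<rho>2 \<notin> \<int>" and K: "finite K"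
    and m: "\<And>k. k \<in> K \<Longrightarrow> m k \<notin> \<int>" "\<And>k. k \<in> K \<Longrightarrow> \<rho>1 + \<rho>2 - m k \<notin> \<int>"
    and g: "\<And>l. l < n \<Longrightarrow> g l holomorphic_on D"
    and G: "\<And>l. l < n \<Longrightarrow> (\<lambda>x. g l (1 - x)) has_fps_expansion G l"
    and F: "\<And>l. l < n \<Longrightarrow> first_one 0 0 \<nu> G l = 0"
    and h: "\<And>k l. k \<in> K \<Longrightarrow> l < n \<Longrightarrow> h k l has_fps_expansion Y k l"
    and Y: "\<And>k l. k \<in> K \<Longrightarrow> l < n \<Longrightarrow> first_zero 0 0 (- m k) (Y k) l = 0"
    and ev: "\<And>l. l < n \<Longrightarrow> \<forall>\<^sub>F z in at 0 within D. (1 - z) powr \<nu> * g l z = (\<Sum>k\<in>K. z powr (- m k) * h k l z)"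
  defines "H \<equiv> \<lambda>k l. Abs_fps (\<lambda>N. rl_mult (\<rho>1 - m k) (1 + \<rho>2) N * (rl_mult (\<rho>2 - m k) (- 1 - \<rho>2) N * fps_nth (Y k l) N))"
  shows "\<exists>g' G'. (\<forall>l<n. g' l holomorphic_on D \<and> (\<lambda>x. g' l (1 - x)) has_fps_expansion G' l \<and>
      fps_nth (G' l) 0 = fps_nth (G l) 0 \<and> second_one \<nu> G' l = 0 \<and>
      expands_mod_hol D (\<lambda>z. (1 - z) powr \<nu> * g' l z) K (\<lambda>k. \<rho>1 + \<rho>2 - m k + 1) (\<lambda>k. H k l) \<and>
      (\<forall>k\<in>K. second_zero (\<rho>1 + \<rho>2 - m k) (\<lambda>l. fps_X * H k l) l = 0))"
proof -
  define g0 where "g0 = (\<lambda>l z. z powr \<rho>2 * g l z)"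
  have g0: "g0 l holomorphic_on D" if "l < n" for l
    unfolding g0_def by (intro holomorphic_intros g that) auto
  define G0 where "G0 = (\<lambda>l. fps_expansion (\<lambda>x. g0 l (1 - x)) 0)"
  have exp: "(\<lambda>x. f (1 - x)) has_fps_expansion fps_expansion (\<lambda>x. f (1 - x)) 0" if "f holomorphic_on D" for f
    using reflect_expansion[OF that] analytic_at_imp_has_fps_expansion_0 has_fps_expansion_imp_analytic_0 by metis
  have G0: "(\<lambda>x. g0 l (1 - x)) has_fps_expansion G0 l" if "l < n" for l
    unfolding G0_def by (rule exp[OF g0[OF that]])
  have F0: "first_one (- \<rho>2) 0 \<nu> G0 l = 0" if "l < n" for l
    using first_one_powr[of g G \<rho>2 G0 0 0 \<nu> l] g G F G0 that by (simp add: g0_def)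
  have int1: "\<nu> + 1 \<notin> \<int>" "\<nu> - \<rho>2 - (\<nu> + 1) \<notin> \<int>" "\<nu> + 1 - (\<nu> - \<rho>2) \<notin> \<int>"
    using \<nu>(1) \<rho>2_nonint not_Ints_add_of_nat_iff(1)[of \<nu> 1] not_Ints_add_of_nat_iff(1)[of \<rho>2 1] minus_in_Ints_iff[of "\<rho>2 + 1"]
    by (simp_all add: algebra_simps)
  have "\<exists>g'. rl_pair (\<nu> + 1) (\<nu> - \<rho>2) (g0 l) g'" if "l < n" for l
    by (rule rl_pair_exists[OF int1(1,2) g0[OF that]])
  then obtain g1 where g1p: "\<And>l. l < n \<Longrightarrow> rl_pair (\<nu> + 1) (\<nu> - \<rho>2) (g0 l) (g1 l)"
    by metis
  then have g1: "g1 l holomorphic_on D" if "l < n" for l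
    using that unfolding rl_pair_def by blast
  define G1 where "G1 = (\<lambda>l. Abs_fps (\<lambda>N. Gamma (\<nu> + 1 + of_nat N) * rGamma (\<nu> - \<rho>2 + of_nat N) * fps_nth (G0 l) N))"
  have G1: "(\<lambda>x. g1 l (1 - x)) has_fps_expansion G1 l" if "l < n" for l
    using g1p[OF that] G0[OF that] unfolding rl_pair_def G1_def by blast
  have F1: "first_one 1 (1 + \<rho>2) (\<nu> - \<rho>2 - 1) G1 l = 0" if "l < n" for l
    unfolding G1_def by (rule first_one_rl[OF \<nu>(1) F0[OF that]])
  define f1 where "f1 = (\<lambda>l z. (1 - z) powr (\<nu> - \<rho>2 - 1) * g1 l z)"
  have ode1: "(z - \<sigma> l) * (z * deriv (f1 l) z + f1 l z) + (1 + \<rho>2) * z * f1 l z = (\<Sum>m<n. B l m * f1 m z)"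
    if "l < n" "z \<in> D" "norm z < 1" for l z
    using first_order_near_0[OF g1 G1 F1 that, of f1] by (simp add: f1_def)
  define H1 where "H1 = (\<lambda>k l. Abs_fps (\<lambda>N. rl_mult (\<rho>2 - m k) (- 1 - \<rho>2) N * fps_nth (Y k l) N))"
  have F1z: "first_zero 1 (1 + \<rho>2) (- 1 - m k) (H1 k) l = 0" if "k \<in> K" "l < n" for k l
    unfolding H1_def by (rule first_zero_rl[OF m(1)[OF that(1)] Y[OF that]])
  have ex0: "expands_mod_hol D (\<lambda>z. (1 - z) powr (\<nu> + 1 - 1) * g0 l z) K (\<lambda>k. \<rho>2 - m k) (\<lambda>k. Y k l)" if l: "l < n" for l
    unfolding expands_mod_hol_def
  proof (intro exI[of _ "\<lambda>k. h k l"] exI[of _ "\<lambda>_. 0"] conjI ballI h l analytic_on_const)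
    have "\<forall>\<^sub>F z in at 0 within D. z \<in> D"
      by (simp add: eventually_at_filter)
    with ev[OF l] show "\<forall>\<^sub>F z in at 0 within D. (1 - z) powr (\<nu> + 1 - 1) * g0 l z = (\<Sum>k\<in>K. z powr (\<rho>2 - m k) * h k l z) + 0"
    proof eventually_elim
      case (elim z)
      have "(1 - z) powr (\<nu> + 1 - 1) * g0 l z = z powr \<rho>2 * (\<Sum>k\<in>K. z powr (- m k) * h k l z)"
        using elim(1) by (simp add: g0_def mult_ac)
      also have "\<dots> = (\<Sum>k\<in>K. z powr (\<rho>2 - m k) * h k l z)"
        unfolding sum_distrib_left
        by (intro sum.cong refl) (simp add: powr_add[symmetric] mult.assoc[symmetric])
      finally show ?case by simp
    qed
  qed
  have int_m: "\<rho>2 - m k + (\<nu> - \<rho>2 - (\<nu> + 1)) \<notin> \<int>" if "k \<in> K" for k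
    using m(1)[OF that] not_Ints_add_of_nat_iff(1)[of "m k" 1] minus_in_Ints_iff[of "m k + 1"] by (simp add: algebra_simps)
  have ex1: "expands_mod_hol D (f1 l) K (\<lambda>k. - 1 - m k) (\<lambda>k. H1 k l)" if l: "l < n" for l
  proof -
    have "expands_mod_hol D (\<lambda>z. (1 - z) powr (\<nu> - \<rho>2 - 1) * g1 l z) K (\<lambda>k. \<rho>2 - m k + (\<nu> - \<rho>2 - (\<nu> + 1)))
        (\<lambda>k. Abs_fps (\<lambda>N. rl_mult (\<rho>2 - m k) (\<nu> - \<rho>2 - (\<nu> + 1)) N * fps_nth (Y k l) N))"
      by (rule rl_pair_expands[OF g1p[OF l] K int_m ex0[OF l]])
    then show ?thesis
      by (rule expands_mod_hol_cong) (simp_all add: f1_def H1_def minus_diff_commute)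
  qed
  then have "\<forall>l. \<exists>h1 h0. l < n \<longrightarrow> (\<forall>k\<in>K. h1 k has_fps_expansion H1 k l) \<and> h0 analytic_on {0} \<and>
       (\<forall>\<^sub>F z in at 0 within D. f1 l z = (\<Sum>k\<in>K. z powr (- 1 - m k) * h1 k z) + h0 z)"
    unfolding expands_mod_hol_def by blast
  from choice[OF this] obtain h1 where "\<forall>l. \<exists>h0. l < n \<longrightarrow> (\<forall>k\<in>K. h1 l k has_fps_expansion H1 k l) \<and> h0 analytic_on {0} \<and>
       (\<forall>\<^sub>F z in at 0 within D. f1 l z = (\<Sum>k\<in>K. z powr (- 1 - m k) * h1 l k z) + h0 z)"
    by (elim exE)
  from choice[OF this] obtain h0 where h01: "\<forall>l. l < n \<longrightarrow> (\<forall>k\<in>K. h1 l k has_fps_expansion H1 k l) \<and> h0 l analytic_on {0} \<and>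
       (\<forall>\<^sub>F z in at 0 within D. f1 l z = (\<Sum>k\<in>K. z powr (- 1 - m k) * h1 l k z) + h0 l z)"
    by (elim exE)
  then have h1: "\<And>k l. l < n \<Longrightarrow> k \<in> K \<Longrightarrow> h1 l k has_fps_expansion H1 k l"
    and h0: "\<And>l. l < n \<Longrightarrow> h0 l analytic_on {0}"
    and ev1: "\<And>l. l < n \<Longrightarrow> \<forall>\<^sub>F z in at 0 within D. f1 l z = (\<Sum>k\<in>K. z powr (- 1 - m k) * h1 l k z) + h0 l z"
    by auto
  \<comment> \<open>An exact zero is required here. Multiplied by \<open>z^(\<rho>1 + 1)\<close>, a
    holomorphic remainder would become a non-integral power, which the outer transform does not
    discard.\<close>
  have h0_0: "\<forall>\<^sub>F z in nhds 0. h0 l z = 0" if "l < n" for l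
    by (rule holomorphic_part_zero[of K "\<lambda>k l. h1 l k" H1 h0 f1 "\<lambda>k. - 1 - m k" "1 + \<rho>2"])
      (use K h1 h0 ev1 F1z ode1 that in auto)
  define g2 where "g2 = (\<lambda>l z. z powr (\<rho>1 + 1) * g1 l z)"
  have g2: "g2 l holomorphic_on D" if "l < n" for l
    unfolding g2_def by (intro holomorphic_intros g1 that) auto
  define G2 where "G2 = (\<lambda>l. fps_expansion (\<lambda>x. g2 l (1 - x)) 0)"
  have G2: "(\<lambda>x. g2 l (1 - x)) has_fps_expansion G2 l" if "l < n" for l
    unfolding G2_def by (rule exp[OF g2[OF that]])
  have F2: "first_one (- \<rho>1) (1 + \<rho>2) (\<nu> - \<rho>2 - 1) G2 l = 0" if "l < n" for l
    using first_one_powr[of g1 G1 "\<rho>1 + 1" G2 1 "1 + \<rho>2" "\<nu> - \<rho>2 - 1" l] g1 G1 F1 G2 that by (simp add: g2_def)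
  have ex2: "expands_mod_hol D (\<lambda>z. (1 - z) powr (\<nu> - \<rho>2 - 1) * g2 l z) K (\<lambda>k. \<rho>1 - m k) (\<lambda>k. H1 k l)" if l: "l < n" for l
    unfolding expands_mod_hol_def
  proof (intro exI[of _ "h1 l"] exI[of _ "\<lambda>_. 0"] conjI ballI h1 l analytic_on_const)
    have "\<forall>\<^sub>F z in at 0 within D. h0 l z = 0"
      by (rule filter_leD[OF at_within_le_nhds h0_0[OF l]])
    with ev1[OF l] show "\<forall>\<^sub>F z in at 0 within D. (1 - z) powr (\<nu> - \<rho>2 - 1) * g2 l z = (\<Sum>k\<in>K. z powr (\<rho>1 - m k) * h1 l k z) + 0"
    proof eventually_elim
      case (elim z)
      have "(1 - z) powr (\<nu> - \<rho>2 - 1) * g2 l z = z powr (\<rho>1 + 1) * (\<Sum>k\<in>K. z powr (- 1 - m k) * h1 l k z)"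
        using elim by (simp add: g2_def f1_def mult_ac)
      also have "\<dots> = (\<Sum>k\<in>K. z powr (\<rho>1 - m k) * h1 l k z)"
        unfolding sum_distrib_left
        by (intro sum.cong refl) (simp add: powr_add[symmetric] mult.assoc[symmetric])
      finally show ?case by simp
    qed
  qed
  have "\<exists>g'. rl_pair (\<nu> - \<rho>2) (\<nu> + 1) (g2 l) g'" if "l < n" for l
    by (rule rl_pair_exists[OF \<nu>(2) int1(3) g2[OF that]])
  then obtain g3 where g3p: "\<And>l. l < n \<Longrightarrow> rl_pair (\<nu> - \<rho>2) (\<nu> + 1) (g2 l) (g3 l)"
    by metis
  define G3 where "G3 = (\<lambda>l. Abs_fps (\<lambda>N. Gamma (\<nu> - \<rho>2 + of_nat N) * rGamma (\<nu> + 1 + of_nat N) * fps_nth (G2 l) N))"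
  show ?thesis
  proof (intro exI[of _ g3] exI[of _ G3] allI impI conjI ballI)
    fix l assume l: "l < n"
    show "g3 l holomorphic_on D"
      using g3p[OF l] unfolding rl_pair_def by blast
    show "(\<lambda>x. g3 l (1 - x)) has_fps_expansion G3 l"
      using g3p[OF l] G2[OF l] unfolding rl_pair_def G3_def by blast
    have nz: "Gamma (\<nu> - \<rho>2) \<noteq> 0" "Gamma (\<nu> + 1) \<noteq> 0"
      using \<nu>(2) int1(1) nonpos_Ints_Int by (auto simp: Gamma_eq_zero_iff)
    have 0: "fps_nth F 0 = f 1" if "(\<lambda>x. f (1 - x)) has_fps_expansion F" for f :: "complex \<Rightarrow> complex" and F
      using has_fps_expansion_imp_0_eq_fps_nth_0[OF that] by simp
    show "fps_nth (G3 l) 0 = fps_nth (G l) 0"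
      using nz 0[OF G2[OF l]] 0[OF G1[OF l]] 0[OF G0[OF l]] 0[OF G[OF l]]
      by (simp add: G3_def G1_def g2_def g0_def Gamma_def field_simps)
    show "second_one \<nu> G3 l = 0"
      unfolding G3_def by (rule second_one_rl[OF \<nu> F2[OF l]])
    have int2: "\<rho>1 - m k + (\<nu> + 1 - (\<nu> - \<rho>2)) \<notin> \<int>" if "k \<in> K" for k
      using m(2)[OF that] not_Ints_add_of_nat_iff(1)[of "\<rho>1 + \<rho>2 - m k" 1] by (simp add: algebra_simps)
    have "expands_mod_hol D (\<lambda>z. (1 - z) powr (\<nu> + 1 - 1) * g3 l z) K (\<lambda>k. \<rho>1 - m k + (\<nu> + 1 - (\<nu> - \<rho>2)))
        (\<lambda>k. Abs_fps (\<lambda>N. rl_mult (\<rho>1 - m k) (\<nu> + 1 - (\<nu> - \<rho>2)) N * fps_nth (H1 k l) N))"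
      by (rule rl_pair_expands[OF g3p[OF l] K int2 ex2[OF l]])
    then show "expands_mod_hol D (\<lambda>z. (1 - z) powr \<nu> * g3 l z) K (\<lambda>k. \<rho>1 + \<rho>2 - m k + 1) (\<lambda>k. H k l)"
      by (rule expands_mod_hol_cong) (simp_all add: H_def H1_def)
    show "second_zero (\<rho>1 + \<rho>2 - m k) (\<lambda>l. fps_X * H k l) l = 0" if k: "k \<in> K" for k
    proof -
      have "\<rho>1 - m k + (1 + \<rho>2) \<notin> \<int>"
        using int2[OF k] by (simp add: algebra_simps)
      from second_zero_rl[OF this F1z[OF k l]] show ?thesis
        by (simp add: H_def H1_def)
    qed
  qed
qed

end

lemma deriv_reflect:
  fixes f :: "complex \<Rightarrow> complex"
  assumes "f holomorphic_on S" "open S" "1 - x \<in> S"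
  shows "deriv (\<lambda>x. f (1 - x)) x = - deriv f (1 - x)"
    and "deriv (deriv (\<lambda>x. f (1 - x))) x = deriv (deriv f) (1 - x)"
proof -
  have d: "((\<lambda>x. f (1 - x)) has_field_derivative - deriv f (1 - x)) (at x)"
    if "f holomorphic_on S" "1 - x \<in> S" for f x
  proof -
    have "(f has_field_derivative deriv f (1 - x)) (at (1 - x))"
      by (rule holomorphic_derivI[OF that(1) assms(2) that(2)])
    then have "((\<lambda>x. f (1 - x)) has_field_derivative deriv f (1 - x) * (- 1)) (at x)"
      by (rule DERIV_chain2) (auto intro!: derivative_eq_intros)
    then show ?thesis by simp
  qed
  show "deriv (\<lambda>x. f (1 - x)) x = - deriv f (1 - x)"
    by (rule DERIV_imp_deriv[OF d[OF assms(1,3)]])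
  have "\<forall>\<^sub>F y in nhds x. y \<in> (\<lambda>x. 1 - x) -` S"
    using assms by (intro eventually_nhds_in_open open_vimage continuous_intros) auto
  then have "\<forall>\<^sub>F y in nhds x. deriv (\<lambda>x. f (1 - x)) y = - deriv f (1 - y)"
    by (rule eventually_mono) (auto intro: DERIV_imp_deriv d assms)
  then have "deriv (deriv (\<lambda>x. f (1 - x))) x = deriv (\<lambda>x. - deriv f (1 - x)) x"
    by (rule deriv_cong_ev) simp
  also have "\<dots> = - (- deriv (deriv f) (1 - x))"
    by (rule DERIV_imp_deriv[OF DERIV_minus[OF d[OF holomorphic_deriv[OF assms(1,2)] assms(3)]]])
  finally show "deriv (deriv (\<lambda>x. f (1 - x))) x = deriv (deriv f) (1 - x)"
    by simp
qed

lemma has_fps_expansion_eqD: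
  assumes "f has_fps_expansion F" "g has_fps_expansion F"
  shows "\<forall>\<^sub>F z in nhds 0. f z = g z"
  using assms unfolding has_fps_expansion_def
  by (elim conjE) (auto elim: eventually_elim2)

text \<open>Provides an open set that still accumulates at \<open>a\<close> and on which a local
  form holds throughout. Such a set is what \<open>second_one_eq_0\<close> and
  \<open>second_zero_eq_0\<close> work on.\<close>

lemma eventually_within_open_imp_subset:
  fixes R :: "complex \<Rightarrow> bool"
  assumes "eventually R (at a within S)" "a islimpt S" "open S" "a \<notin> S" "0 < d"
  shows "\<exists>S'. open S' \<and> S' \<subseteq> S \<inter> ball a d \<and> a islimpt S' \<and> S' \<noteq> {} \<and> (\<forall>z\<in>S'. R z)"
proof -
  obtain e where e: "e > 0" "\<And>z. z \<in> S \<Longrightarrow> z \<noteq> a \<Longrightarrow> dist z a < e \<Longrightarrow> R z"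
    using assms(1) unfolding eventually_at by blast
  show ?thesis
  proof (intro exI[of _ "S \<inter> ball a (min e d)"] conjI ballI)
    show "a islimpt S \<inter> ball a (min e d)"
      unfolding islimpt_approachable
    proof (intro allI impI)
      fix e' :: real assume "0 < e'"
      then have "0 < min e' (min e d)" using e(1) assms(5) by simp
      then obtain x where "x \<in> S" "x \<noteq> a" "dist x a < min e' (min e d)"
        using assms(2) unfolding islimpt_approachable by blast
      then show "\<exists>x'\<in>S \<inter> ball a (min e d). x' \<noteq> a \<and> dist x' a < e'"
        by (intro bexI[of _ x]) (auto simp: dist_commute)
    qed
    then show "S \<inter> ball a (min e d) \<noteq> {}"
      by (metis islimpt_EMPTY)
    show "R z" if "z \<in> S \<inter> ball a (min e d)" for z
      by (rule e(2)) (use that assms(4) in \<open>auto simp: dist_commute\<close>)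
  qed (use assms in auto)
qed

context okubo_rl
begin

text \<open>At \<open>1\<close> the series of \<open>u\<close> is \<open>\<kappa>\<close> times that
  of the constructed solution, by \<open>second_one_unique\<close>, and continuation along the
  connected set \<open>S\<close> makes the functions agree. At \<open>0\<close> each singular part
  of the constructed solution is identified with a multiple of \<open>Vu k\<close>, by
  \<open>second_zero_unique\<close>. The lower components are recovered at the end from the upper
  equation.\<close>

lemma connection_normalised:
  fixes K :: "(nat \<times> nat) set" and m :: "nat \<times> nat \<Rightarrow> complex"
  assumes \<nu>: "\<nu> \<notin> \<int>" "\<nu> - \<rho>2 \<notin> \<int>" and K: "finite K"
    and m: "\<And>k. k \<in> K \<Longrightarrow> m k \<notin> \<int>" "\<And>k. k \<in> K \<Longrightarrow> \<rho>1 + \<rho>2 - m k \<notin> \<int>"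
    and A0: "\<And>l m. l < n \<Longrightarrow> m < n \<Longrightarrow> \<sigma> l = 1 \<Longrightarrow> \<sigma> m = 1 \<Longrightarrow> l \<noteq> m \<Longrightarrow> A l m = 0"
    and A1: "\<And>l N. l < n \<Longrightarrow> \<sigma> l = 1 \<Longrightarrow> 0 < N \<Longrightarrow> \<nu> + of_nat N \<noteq> A l l"
    and \<mu>m: "\<And>j k. j < n \<Longrightarrow> k \<in> K \<Longrightarrow> \<mu> j - m k \<notin> \<int> \<or> \<mu> j = m k"
    and g: "\<And>l. l < n \<Longrightarrow> g l holomorphic_on D"
    and G: "\<And>l. l < n \<Longrightarrow> (\<lambda>x. g l (1 - x)) has_fps_expansion G l"
    and F: "\<And>l. l < n \<Longrightarrow> first_one 0 0 \<nu> G l = 0"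
    and h: "\<And>k l. k \<in> K \<Longrightarrow> l < n \<Longrightarrow> h k l has_fps_expansion Y k l"
    and Y: "\<And>k l. k \<in> K \<Longrightarrow> l < n \<Longrightarrow> first_zero 0 0 (- m k) (Y k) l = 0"
    and ev: "\<And>l. l < n \<Longrightarrow> \<forall>\<^sub>F z in at 0 within D. (1 - z) powr \<nu> * g l z = (\<Sum>k\<in>K. z powr (- m k) * h k l z)"
    and S: "open S" "connected S" "S \<subseteq> D" "\<And>z. z \<in> S \<Longrightarrow> 1 - z \<notin> \<real>\<^sub>\<le>\<^sub>0" "0 islimpt S" "1 islimpt S"
    and U: "\<And>l. l < n \<Longrightarrow> u l holomorphic_on S" "\<And>j. j < n \<Longrightarrow> v j holomorphic_on S"
      "\<And>l z. l < n \<Longrightarrow> z \<in> S \<Longrightarrow> (z - \<sigma> l) * deriv (u l) z = (\<Sum>m<n. A l m * u m z) + (\<Sum>j<n. P l j * v j z)"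
      "\<And>j z. j < n \<Longrightarrow> z \<in> S \<Longrightarrow>
        z * deriv (v j) z = (\<rho>1 + \<rho>2 - \<mu> j) * v j z - (\<mu> j - \<rho>1) * (\<mu> j - \<rho>2) * (\<Sum>l<n. Q j l * u l z)"
    and gU: "\<And>l. l < n \<Longrightarrow> (\<lambda>x. gU l (1 - x)) has_fps_expansion GU l"
      "\<And>l. l < n \<Longrightarrow> \<forall>\<^sub>F z in at 1 within S. u l z = (1 - z) powr \<nu> * gU l z"
      "\<And>l. l < n \<Longrightarrow> fps_nth (GU l) 0 = \<kappa> * fps_nth (G l) 0"
    and V: "\<And>k l. k \<in> K0 \<Longrightarrow> l < n \<Longrightarrow> Vu k l holomorphic_on S" "\<And>k j. k \<in> K0 \<Longrightarrow> j < n \<Longrightarrow> Vv k j holomorphic_on S"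
      "\<And>k l z. k \<in> K0 \<Longrightarrow> l < n \<Longrightarrow> z \<in> S \<Longrightarrow>
        (z - \<sigma> l) * deriv (Vu k l) z = (\<Sum>m<n. A l m * Vu k m z) + (\<Sum>j<n. P l j * Vv k j z)"
      "\<And>k j z. k \<in> K0 \<Longrightarrow> j < n \<Longrightarrow> z \<in> S \<Longrightarrow>
        z * deriv (Vv k j) z = (\<rho>1 + \<rho>2 - \<mu> j) * Vv k j z - (\<mu> j - \<rho>1) * (\<mu> j - \<rho>2) * (\<Sum>l<n. Q j l * Vu k l z)"
    and hV: "\<And>k l. k \<in> K0 \<Longrightarrow> l < n \<Longrightarrow> hV k l has_fps_expansion HV k l"
      "\<And>k l. k \<in> K0 \<Longrightarrow> l < n \<Longrightarrow> \<forall>\<^sub>F z in at 0 within S. Vu k l z = z powr (\<rho>1 + \<rho>2 - m k) * hV k l z"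
      "\<And>k l. k \<in> K0 \<Longrightarrow> l < n \<Longrightarrow> fps_nth (HV k l) 0 = 0"
      "\<And>k l. k \<in> K0 \<Longrightarrow> l < n \<Longrightarrow> d k * fps_nth (HV k l) 1 =
        \<kappa> * (rl_mult (\<rho>1 - m k) (1 + \<rho>2) 0 * (rl_mult (\<rho>2 - m k) (- 1 - \<rho>2) 0 * fps_nth (Y k l) 0))"
    and K0: "K0 \<subseteq> K" "\<And>k. k \<in> K - K0 \<Longrightarrow> m k = \<rho>1 \<or> m k = \<rho>2"
  obtains hu hv where
    "\<And>l. l < n \<Longrightarrow> hu l analytic_on {0}" "\<And>j. j < n \<Longrightarrow> hv j analytic_on {0}"
    "\<And>l. l < n \<Longrightarrow> \<forall>\<^sub>F z in at 0 within S. u l z = (\<Sum>k\<in>K0. d k * Vu k l z) + hu l z"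
    "\<And>j. j < n \<Longrightarrow> \<forall>\<^sub>F z in at 0 within S. v j z = (\<Sum>k\<in>K0. d k * Vv k j z) + hv j z"
proof -
  define H where "H = (\<lambda>k l. Abs_fps (\<lambda>N. rl_mult (\<rho>1 - m k) (1 + \<rho>2) N * (rl_mult (\<rho>2 - m k) (- 1 - \<rho>2) N * fps_nth (Y k l) N)))"
  have "\<exists>g3 G3. \<forall>l<n. g3 l holomorphic_on D \<and> (\<lambda>x. g3 l (1 - x)) has_fps_expansion G3 l \<and>
      fps_nth (G3 l) 0 = fps_nth (G l) 0 \<and> second_one \<nu> G3 l = 0 \<and>
      expands_mod_hol D (\<lambda>z. (1 - z) powr \<nu> * g3 l z) K (\<lambda>k. \<rho>1 + \<rho>2 - m k + 1) (\<lambda>k. H k l) \<and>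
      (\<forall>k\<in>K. second_zero (\<rho>1 + \<rho>2 - m k) (\<lambda>l. fps_X * H k l) l = 0)"
    unfolding H_def by (rule second_order_continuation[where g = g and G = G and h = h]) fact+
  then obtain g3 G3 where all: "\<forall>l<n. g3 l holomorphic_on D \<and> (\<lambda>x. g3 l (1 - x)) has_fps_expansion G3 l \<and>
      fps_nth (G3 l) 0 = fps_nth (G l) 0 \<and> second_one \<nu> G3 l = 0 \<and>
      expands_mod_hol D (\<lambda>z. (1 - z) powr \<nu> * g3 l z) K (\<lambda>k. \<rho>1 + \<rho>2 - m k + 1) (\<lambda>k. H k l) \<and>
      (\<forall>k\<in>K. second_zero (\<rho>1 + \<rho>2 - m k) (\<lambda>l. fps_X * H k l) l = 0)"
    by (elim exE)
  have g3: "g3 l holomorphic_on D"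
    and G3: "(\<lambda>x. g3 l (1 - x)) has_fps_expansion G3 l" "fps_nth (G3 l) 0 = fps_nth (G l) 0" "second_one \<nu> G3 l = 0"
    and ex: "expands_mod_hol D (\<lambda>z. (1 - z) powr \<nu> * g3 l z) K (\<lambda>k. \<rho>1 + \<rho>2 - m k + 1) (\<lambda>k. H k l)"
    and HZ: "\<And>k. k \<in> K \<Longrightarrow> second_zero (\<rho>1 + \<rho>2 - m k) (\<lambda>l. fps_X * H k l) l = 0" if "l < n" for l
    using all that by simp_all
  have z0: "0 \<notin> S" "1 \<notin> S"
    using S(3) S(4)[of 1] Re_pos[of 0] by auto
  have finK0: "finite K0"
    using K K0(1) finite_subset by blast

  have u_eq: "u l z = \<kappa> * ((1 - z) powr \<nu> * g3 l z)" if l: "l < n" and z: "z \<in> S" for l z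
  proof -
    have GU3: "GU l = fps_const \<kappa> * G3 l" if l: "l < n" for l
    proof -
      have "\<forall>\<^sub>F x in nhds 0. \<forall>l\<in>{..<n}. (\<lambda>x. gU l (1 - x)) field_differentiable at x"
        by (intro eventually_ball_finite ballI has_fps_expansion_differentiable_near[OF gU(1)]) auto
      then obtain r where r: "r > 0" "\<And>x l. norm x < r \<Longrightarrow> l < n \<Longrightarrow> (\<lambda>x. gU l (1 - x)) field_differentiable at x"
        unfolding eventually_nhds_metric by (auto simp: dist_norm)
      have ev1: "\<forall>\<^sub>F z in at 1 within S. \<forall>l\<in>{..<n}. u l z = (1 - z) powr \<nu> * gU l z"
        by (intro eventually_ball_finite ballI gU(2)) auto
      obtain S1 where S1: "open S1" "S1 \<subseteq> S \<inter> ball 1 r" "1 islimpt S1"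
        "\<forall>z\<in>S1. \<forall>l\<in>{..<n}. u l z = (1 - z) powr \<nu> * gU l z"
        using eventually_within_open_imp_subset[OF ev1 S(6) S(1) z0(2) r(1)] by (elim exE conjE)
      have freq: "\<exists>\<^sub>F x in at 0. x \<in> (\<lambda>x. 1 - x) -` S1"
      proof -
        have "(\<lambda>z. 1 - z) 1 islimpt (\<lambda>z. 1 - z) ` S1"
          by (rule islimpt_isCont_image[OF S1(3)]) (auto intro!: continuous_intros simp: eventually_at_filter)
        then have "0 islimpt (\<lambda>z. 1 - z) ` S1" by simp
        then have "0 islimpt (\<lambda>x. 1 - x) -` S1"
          by (rule islimpt_subset) auto
        then show ?thesis
          by (simp add: islimpt_conv_frequently_at)
      qed
      have GU: "second_one \<nu> GU l = 0" if l: "l < n" for l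
      proof (rule second_one_eq_0[where g = "\<lambda>l x. gU l (1 - x)" and u = "\<lambda>l x. u l (1 - x)" and S = "(\<lambda>x. 1 - x) -` S1"])
        show "open ((\<lambda>x. 1 - x) -` S1)"
          by (intro open_vimage S1 continuous_intros)
        show "x \<notin> \<real>\<^sub>\<le>\<^sub>0" if "x \<in> (\<lambda>x. 1 - x) -` S1" for x
          using S(4)[of "1 - x"] S1(2) that by auto
        show "(\<lambda>x. gU l (1 - x)) holomorphic_on (\<lambda>x. 1 - x) -` S1" if "l < n" for l
        proof (rule holomorphic_onI)
          fix x assume "x \<in> (\<lambda>x. 1 - x) -` S1"
          then have "1 - x \<in> ball 1 r" using S1(2) by blast
          then have "norm x < r" by (simp add: dist_norm)
          from field_differentiable_at_within[OF r(2)[OF this that]]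
          show "(\<lambda>x. gU l (1 - x)) field_differentiable (at x within (\<lambda>x. 1 - x) -` S1)" .
        qed
        show "(1 - x) * (1 - x - \<sigma> l) * deriv (deriv (\<lambda>x. u l (1 - x))) x
            - ((1 - \<rho>1 - \<rho>2) * (1 - x) + (\<rho>1 + \<rho>2) * \<sigma> l) * deriv (\<lambda>x. u l (1 - x)) x
            + (\<Sum>m<n. B l m * deriv (\<lambda>x. u m (1 - x)) x) + \<rho>1 * \<rho>2 * u l (1 - x) = 0"
          if "l < n" "x \<in> (\<lambda>x. 1 - x) -` S1" for l x
        proof -
          have x: "1 - x \<in> S" using that S1(2) by auto
          have s: "(\<Sum>m<n. B l m * deriv (\<lambda>x. u m (1 - x)) x) = - (\<Sum>m<n. B l m * deriv (u m) (1 - x))"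
            unfolding sum_negf[symmetric]
            by (intro sum.cong refl) (use deriv_reflect(1)[OF U(1) S(1) x] in auto)
          have "(1 - x) * (1 - x - \<sigma> l) * deriv (deriv (u l)) (1 - x) + ((1 - \<rho>1 - \<rho>2) * (1 - x) + (\<rho>1 + \<rho>2) * \<sigma> l) * deriv (u l) (1 - x)
              - (\<Sum>m<n. B l m * deriv (u m) (1 - x)) + \<rho>1 * \<rho>2 * u l (1 - x) = 0"
            by (rule second_order_of_system[OF S(1) U that(1) x])
          then show ?thesis
            unfolding s deriv_reflect[OF U(1)[OF that(1)] S(1) x] by (simp add: algebra_simps)
        qed
      qed (use gU(1) S1(4) freq l in auto)
      have "GU l - fps_const \<kappa> * G3 l = 0"
      proof (rule second_one_unique[where e = \<nu> and D = "\<lambda>l. GU l - fps_const \<kappa> * G3 l"])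
        show "second_one \<nu> (\<lambda>l. GU l - fps_const \<kappa> * G3 l) l = 0" if "l < n" for l
          unfolding second_one_diff by (simp add: GU G3 that)
        show "fps_nth (GU l - fps_const \<kappa> * G3 l) 0 = 0" if "l < n" for l
          using gU(3)[OF that] G3(2)[OF that] by simp
      qed (use \<nu> A0 A1 l in auto)
      then show ?thesis by simp
    qed
    have "\<forall>\<^sub>F x in nhds 0. gU l (1 - x) = \<kappa> * g3 l (1 - x)"
      by (rule has_fps_expansion_eqD[OF gU(1)[OF l]]) (unfold GU3[OF l], intro fps_expansion_intros G3 l)
    then obtain r where r: "r > 0" "\<And>x. norm x < r \<Longrightarrow> gU l (1 - x) = \<kappa> * g3 l (1 - x)"
      unfolding eventually_nhds_metric by (auto simp: dist_norm)
    obtain S1 where S1: "open S1" "S1 \<subseteq> S \<inter> ball 1 r" "S1 \<noteq> {}" "\<forall>z\<in>S1. u l z = (1 - z) powr \<nu> * gU l z"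
      using eventually_within_open_imp_subset[OF gU(2)[OF l] S(6) S(1) z0(2) r(1)] by (elim exE conjE)
    show ?thesis
    proof (rule analytic_continuation_open[where f = "u l" and g = "\<lambda>z. \<kappa> * ((1 - z) powr \<nu> * g3 l z)", OF S1(1) S(1) S1(3) S(2)])
      show "S1 \<subseteq> S" using S1 by auto
      show "u l holomorphic_on S" by (rule U(1)[OF l])
      show "(\<lambda>z. \<kappa> * ((1 - z) powr \<nu> * g3 l z)) holomorphic_on S"
        by (intro holomorphic_intros holomorphic_on_subset[OF g3[OF l] S(3)]) (use S(4) in auto)
      show "u l z = \<kappa> * ((1 - z) powr \<nu> * g3 l z)" if "z \<in> S1" for z
      proof -
        have "z \<in> ball 1 r" using S1(2) that by blast
        then have "norm (1 - z) < r" by (simp add: dist_norm)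
        from r(2)[OF this] show ?thesis
          using S1(4) that by simp
      qed
    qed (rule z)
  qed

  have HV: "fps_const \<kappa> * (fps_X * H k l) = fps_const (d k) * HV k l" if k: "k \<in> K0" and l: "l < n" for k l
  proof -
    have "\<forall>\<^sub>F x in nhds 0. \<forall>l\<in>{..<n}. hV k l field_differentiable at x"
      by (intro eventually_ball_finite ballI has_fps_expansion_differentiable_near[OF hV(1)[OF k]]) auto
    then obtain r where r: "r > 0" "\<And>x l. norm x < r \<Longrightarrow> l < n \<Longrightarrow> hV k l field_differentiable at x"
      unfolding eventually_nhds_metric by (auto simp: dist_norm)
    have ev0: "\<forall>\<^sub>F z in at 0 within S. \<forall>l\<in>{..<n}. Vu k l z = z powr (\<rho>1 + \<rho>2 - m k) * hV k l z"
      by (intro eventually_ball_finite ballI hV(2)[OF k]) auto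
    obtain S1 where S1: "open S1" "S1 \<subseteq> S \<inter> ball 0 r" "0 islimpt S1"
      "\<forall>z\<in>S1. \<forall>l\<in>{..<n}. Vu k l z = z powr (\<rho>1 + \<rho>2 - m k) * hV k l z"
      using eventually_within_open_imp_subset[OF ev0 S(5) S(1) z0(1) r(1)] by (elim exE conjE)
    have Z: "second_zero (\<rho>1 + \<rho>2 - m k) (HV k) l = 0" if l: "l < n" for l
    proof (rule second_zero_eq_0[where g = "hV k" and u = "Vu k" and S = S1])
      show "x \<notin> \<real>\<^sub>\<le>\<^sub>0" if "x \<in> S1" for x
        using S(3) S1(2) that by auto
      show "\<exists>\<^sub>F x in at 0. x \<in> S1"
        using S1(3) by (simp add: islimpt_conv_frequently_at)
      show "hV k l holomorphic_on S1" if "l < n" for l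
      proof (rule holomorphic_onI)
        fix x assume "x \<in> S1"
        then have "x \<in> ball 0 r" using S1(2) by blast
        then have "norm x < r" by simp
        from field_differentiable_at_within[OF r(2)[OF this that]]
        show "hV k l field_differentiable (at x within S1)" .
      qed
      show "x * (x - \<sigma> l) * deriv (deriv (Vu k l)) x + ((1 - \<rho>1 - \<rho>2) * x + (\<rho>1 + \<rho>2) * \<sigma> l) * deriv (Vu k l) x
          - (\<Sum>m<n. B l m * deriv (Vu k m) x) + \<rho>1 * \<rho>2 * Vu k l x = 0" if "l < n" "x \<in> S1" for l x
        by (rule second_order_of_system[OF S(1) V(1,2,3,4)[OF k] that(1)]) (use S1(2) that in auto)
    qed (use S1 hV(1)[OF k] l in auto)
    have k': "k \<in> K" using k K0 by auto
    have lin: "second_zero s (\<lambda>l. fps_const c * F l) l = fps_const c * second_zero s F l" for s c F l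
      using second_zero_diff[of s "\<lambda>_. 0" "- c" F l] by (simp add: second_zero_def fps_euler_def flip: fps_const_neg)
    have "fps_const \<kappa> * (fps_X * H k l) - fps_const (d k) * HV k l = 0"
    proof (rule second_zero_unique[where s = "\<rho>1 + \<rho>2 - m k" and D = "\<lambda>l. fps_const \<kappa> * (fps_X * H k l) - fps_const (d k) * HV k l"])
      show "second_zero (\<rho>1 + \<rho>2 - m k) (\<lambda>l. fps_const \<kappa> * (fps_X * H k l) - fps_const (d k) * HV k l) l = 0" if "l < n" for l
        unfolding second_zero_diff lin by (simp add: Z HZ[OF that k'] that)
      show "fps_nth (fps_const \<kappa> * (fps_X * H k l) - fps_const (d k) * HV k l) 0 = 0" if "l < n" for l
        using hV(3)[OF k that] by simp
      show "fps_nth (fps_const \<kappa> * (fps_X * H k l) - fps_const (d k) * HV k l) 1 = 0" if "l < n" for l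
        using hV(4)[OF k that] by (simp add: H_def)
      \<comment> \<open>The factor is \<open>\<mu> j - m k + N - 1\<close>. If it vanished,
        \<open>\<mu> j - m k\<close> would be an integer and hence zero, forcing
        \<open>N = 1\<close>.\<close>
      show "\<rho>1 + \<rho>2 - m k + of_nat N - 1 - \<rho>1 - \<rho>2 + \<mu> j \<noteq> 0" if "j < n" "2 \<le> N" for j N
      proof
        assume "\<rho>1 + \<rho>2 - m k + of_nat N - 1 - \<rho>1 - \<rho>2 + \<mu> j = 0"
        then have e: "\<mu> j - m k = 1 - of_nat N" by (simp add: algebra_simps eq_neg_iff_add_eq_0)
        moreover have "1 - of_nat N \<in> (\<int> :: complex set)" by simp
        ultimately have "1 - of_nat N = (0 :: complex)"
          using \<mu>m[OF that(1) k'] by auto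
        then have "of_nat N = (of_nat 1 :: complex)" by simp
        then show False using that(2) by (simp only: of_nat_eq_iff)
      qed
    qed (use m k' l in auto)
    then show ?thesis by simp
  qed
  \<comment> \<open>Here \<open>\<rho>1 - m k\<close> or \<open>\<rho>2 - m k\<close> is
    \<open>0\<close>, and \<open>rl_mult 0\<close> vanishes at every index. These are the two blocks
    removed from the reducible system.\<close>
  have H0: "H k l = 0" if "k \<in> K - K0" for k l
  proof -
    have "- complex_of_nat N \<in> \<int>\<^sub>\<le>\<^sub>0" for N by simp
    then have "rl_mult 0 b N = 0" for b N
      by (simp add: rl_mult_def rGamma_eq_zero_iff)
    then show ?thesis
      using K0(2)[OF that] by (auto simp: H_def fps_eq_iff)
  qed

  have "\<exists>hu. hu analytic_on {0} \<and> (\<forall>\<^sub>F z in at 0 within S. u l z = (\<Sum>k\<in>K0. d k * Vu k l z) + hu z)" if l: "l < n" for l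
  proof -
    obtain h' h0 where h': "\<And>k. k \<in> K \<Longrightarrow> h' k has_fps_expansion H k l" and h0: "h0 analytic_on {0}"
      and ev: "\<forall>\<^sub>F z in at 0 within D. (1 - z) powr \<nu> * g3 l z = (\<Sum>k\<in>K. z powr (\<rho>1 + \<rho>2 - m k + 1) * h' k z) + h0 z"
      using ex[OF l] unfolding expands_mod_hol_def by blast
    have "\<forall>\<^sub>F z in nhds 0. \<forall>k\<in>K0. \<kappa> * (z * h' k z) = d k * hV k l z"
    proof (intro eventually_ball_finite finK0 ballI)
      fix k assume k: "k \<in> K0"
      have "(\<lambda>z. \<kappa> * (z * h' k z)) has_fps_expansion fps_const (d k) * HV k l"
        unfolding HV[OF k l, symmetric] by (intro fps_expansion_intros h') (use k K0 in auto)
      then show "\<forall>\<^sub>F z in nhds 0. \<kappa> * (z * h' k z) = d k * hV k l z"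
        by (rule has_fps_expansion_eqD) (intro fps_expansion_intros hV k l)
    qed
    then have 1: "\<forall>\<^sub>F z in at 0 within S. \<forall>k\<in>K0. \<kappa> * (z * h' k z) = d k * hV k l z"
      by (rule filter_leD[OF at_within_le_nhds])
    have "\<forall>\<^sub>F z in nhds 0. \<forall>k\<in>K-K0. h' k z = 0"
    proof (intro eventually_ball_finite ballI)
      fix k assume k: "k \<in> K - K0"
      show "\<forall>\<^sub>F z in nhds 0. h' k z = 0"
        using h'[of k] k H0[OF k, of l] by (auto simp: has_fps_expansion_def elim: eventually_mono)
    qed (use K in auto)
    then have 2: "\<forall>\<^sub>F z in at 0 within S. \<forall>k\<in>K-K0. h' k z = 0"
      by (rule filter_leD[OF at_within_le_nhds])
    have 3: "\<forall>\<^sub>F z in at 0 within S. \<forall>k\<in>K0. Vu k l z = z powr (\<rho>1 + \<rho>2 - m k) * hV k l z"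
      by (intro eventually_ball_finite finK0 ballI hV(2) l)
    have 4: "\<forall>\<^sub>F z in at 0 within S. (1 - z) powr \<nu> * g3 l z = (\<Sum>k\<in>K. z powr (\<rho>1 + \<rho>2 - m k + 1) * h' k z) + h0 z"
      by (rule filter_leD[OF at_le[OF S(3)] ev])
    have 5: "\<forall>\<^sub>F z in at 0 within S. z \<in> S"
      by (simp add: eventually_at_filter)
    have "\<forall>\<^sub>F z in at 0 within S. u l z = (\<Sum>k\<in>K0. d k * Vu k l z) + \<kappa> * h0 z"
      using 1 2 3 4 5
    proof eventually_elim
      case (elim z)
      have znz: "z \<noteq> 0" using elim(5) z0 by auto
      have "(\<Sum>k\<in>K. z powr (\<rho>1 + \<rho>2 - m k + 1) * h' k z) = (\<Sum>k\<in>K0. z powr (\<rho>1 + \<rho>2 - m k + 1) * h' k z)"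
        by (rule sum.mono_neutral_right[OF K K0(1)]) (use elim(2) in auto)
      then have "u l z = (\<Sum>k\<in>K0. \<kappa> * (z powr (\<rho>1 + \<rho>2 - m k + 1) * h' k z)) + \<kappa> * h0 z"
        using u_eq[OF l elim(5)] elim(4) by (simp add: distrib_left sum_distrib_left)
      also have "(\<Sum>k\<in>K0. \<kappa> * (z powr (\<rho>1 + \<rho>2 - m k + 1) * h' k z)) = (\<Sum>k\<in>K0. d k * Vu k l z)"
      proof (rule sum.cong[OF refl])
        fix k assume k: "k \<in> K0"
        have "\<kappa> * (z powr (\<rho>1 + \<rho>2 - m k + 1) * h' k z) = z powr (\<rho>1 + \<rho>2 - m k) * (\<kappa> * (z * h' k z))"
          using znz by (simp add: powr_add[of z "\<rho>1 + \<rho>2 - m k" 1])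
        also have "\<dots> = d k * Vu k l z"
          using elim(1,3) k by simp
        finally show "\<kappa> * (z powr (\<rho>1 + \<rho>2 - m k + 1) * h' k z) = d k * Vu k l z" .
      qed
      finally show ?case .
    qed
    moreover have "(\<lambda>z. \<kappa> * h0 z) analytic_on {0}"
      by (intro analytic_intros h0)
    ultimately show ?thesis by (intro exI[of _ "\<lambda>z. \<kappa> * h0 z"] conjI)
  qed
  then have "\<forall>l. \<exists>hu. l < n \<longrightarrow> hu analytic_on {0} \<and> (\<forall>\<^sub>F z in at 0 within S. u l z = (\<Sum>k\<in>K0. d k * Vu k l z) + hu z)"
    by blast
  from choice[OF this] obtain hu where
    "\<forall>l. l < n \<longrightarrow> hu l analytic_on {0} \<and> (\<forall>\<^sub>F z in at 0 within S. u l z = (\<Sum>k\<in>K0. d k * Vu k l z) + hu l z)"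
    by (elim exE)
  then have hu: "\<And>l. l < n \<Longrightarrow> hu l analytic_on {0}"
    "\<And>l. l < n \<Longrightarrow> \<forall>\<^sub>F z in at 0 within S. u l z = (\<Sum>k\<in>K0. d k * Vu k l z) + hu l z"
    by auto
  \<comment> \<open>Applying \<open>Q\<close> to \<open>(z - \<sigma>) u' - A u = P v\<close> solves
    for \<open>v\<close>. The same expression formed with the holomorphic parts \<open>hu\<close> is
    the holomorphic part of \<open>v\<close>.\<close>
  define hv where "hv = (\<lambda>j z. \<Sum>l<n. Q j l * ((z - \<sigma> l) * deriv (hu l) z - (\<Sum>m<n. A l m * hu m z)))"
  show ?thesis
  proof (rule that[of hu hv])
    show "hv j analytic_on {0}" if "j < n" for j
      unfolding hv_def by (intro analytic_intros hu) auto
    have "\<forall>\<^sub>F z in at 0 within S. \<forall>l\<in>{..<n}. u l z = (\<Sum>k\<in>K0. d k * Vu k l z) + hu l z"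
      by (intro eventually_ball_finite ballI hu(2)) auto
    then have "\<forall>\<^sub>F z in nhds 0. z \<in> S \<longrightarrow> (\<forall>l\<in>{..<n}. u l z = (\<Sum>k\<in>K0. d k * Vu k l z) + hu l z)"
      using z0(1) unfolding eventually_at_filter by (auto elim!: eventually_mono)
    then have "\<forall>\<^sub>F y in nhds 0. \<forall>\<^sub>F z in nhds y. z \<in> S \<longrightarrow> (\<forall>l\<in>{..<n}. u l z = (\<Sum>k\<in>K0. d k * Vu k l z) + hu l z)"
      by (simp add: eventually_eventually)
    moreover have "\<forall>\<^sub>F y in nhds 0. \<forall>l\<in>{..<n}. hu l field_differentiable at y"
      by (intro eventually_ball_finite ballI has_fps_expansion_differentiable_near[OF analytic_at_imp_has_fps_expansion_0[OF hu(1)]]) auto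
    ultimately have ev: "\<forall>\<^sub>F y in nhds 0. y \<in> S \<longrightarrow> (\<forall>j\<in>{..<n}. v j y = (\<Sum>k\<in>K0. d k * Vv k j y) + hv j y)"
    proof eventually_elim
      case (elim y)
      show ?case
      proof (intro impI ballI)
        fix j assume y: "y \<in> S" and "j \<in> {..<n}"
        then have j: "j < n" by simp
        have evS: "\<forall>\<^sub>F z in nhds y. z \<in> S"
          using y S(1) by (intro eventually_nhds_in_open)
        with elim(1) have evy: "\<forall>\<^sub>F z in nhds y. \<forall>l\<in>{..<n}. u l z = (\<Sum>k\<in>K0. d k * Vu k l z) + hu l z"
          by eventually_elim auto
        have hl: "hu l y = u l y - (\<Sum>k\<in>K0. d k * Vu k l y)" if "l < n" for l
          using eventually_nhds_x_imp_x[OF evy] that by simp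
        have dl: "deriv (hu l) y = deriv (u l) y - (\<Sum>k\<in>K0. d k * deriv (Vu k l) y)" if l: "l < n" for l
        proof -
          have du: "(hu l has_field_derivative deriv (hu l) y) (at y)"
            using elim(2) l field_differentiable_derivI by blast
          have dV: "(Vu k l has_field_derivative deriv (Vu k l) y) (at y)" if "k \<in> K0" for k
            by (rule holomorphic_derivI[OF V(1)[OF that l] S(1) y])
          have "deriv (u l) y = deriv (\<lambda>z. (\<Sum>k\<in>K0. d k * Vu k l z) + hu l z) y"
            by (rule deriv_cong_ev[OF eventually_mono[OF evy]]) (use l in auto)
          also have "\<dots> = (\<Sum>k\<in>K0. d k * deriv (Vu k l) y) + deriv (hu l) y"
            by (intro DERIV_imp_deriv DERIV_add DERIV_sum DERIV_cmult dV du)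
          finally show ?thesis by simp
        qed
        have "(y - \<sigma> l) * deriv (hu l) y - (\<Sum>m<n. A l m * hu m y) =
            (\<Sum>i<n. P l i * (v i y - (\<Sum>k\<in>K0. d k * Vv k i y)))" if l: "l < n" for l
        proof -
          have sA: "(\<Sum>m<n. A l m * hu m y) = (\<Sum>m<n. A l m * u m y) - (\<Sum>k\<in>K0. d k * (\<Sum>m<n. A l m * Vu k m y))"
          proof -
            have "(\<Sum>m<n. A l m * hu m y) = (\<Sum>m<n. A l m * u m y) - (\<Sum>m<n. \<Sum>k\<in>K0. d k * (A l m * Vu k m y))"
              unfolding sum_subtractf[symmetric]
              by (intro sum.cong refl) (simp add: hl right_diff_distrib sum_distrib_left mult.left_commute)
            then show ?thesis
              by (subst (asm) sum.swap) (simp add: sum_distrib_left)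
          qed
          have sP: "(\<Sum>i<n. P l i * (v i y - (\<Sum>k\<in>K0. d k * Vv k i y))) =
              (\<Sum>i<n. P l i * v i y) - (\<Sum>k\<in>K0. d k * (\<Sum>i<n. P l i * Vv k i y))"
          proof -
            have "(\<Sum>i<n. P l i * (v i y - (\<Sum>k\<in>K0. d k * Vv k i y))) =
                (\<Sum>i<n. P l i * v i y) - (\<Sum>i<n. \<Sum>k\<in>K0. d k * (P l i * Vv k i y))"
              unfolding sum_subtractf[symmetric]
              by (intro sum.cong refl) (simp add: right_diff_distrib sum_distrib_left mult.left_commute)
            then show ?thesis
              by (subst (asm) sum.swap) (simp add: sum_distrib_left)
          qed
          have "(y - \<sigma> l) * deriv (hu l) y = (y - \<sigma> l) * deriv (u l) y - (\<Sum>k\<in>K0. d k * ((y - \<sigma> l) * deriv (Vu k l) y))"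
            unfolding dl[OF l] by (simp add: right_diff_distrib sum_distrib_left mult.left_commute)
          also have "\<dots> = (\<Sum>m<n. A l m * u m y) + (\<Sum>i<n. P l i * v i y)
              - (\<Sum>k\<in>K0. d k * ((\<Sum>m<n. A l m * Vu k m y) + (\<Sum>i<n. P l i * Vv k i y)))"
            using U(3)[OF l y] V(3)[OF _ l y] by simp
          finally show ?thesis
            unfolding sA sP by (simp add: distrib_left sum.distrib)
        qed
        then have "hv j y = (\<Sum>l<n. Q j l * (\<Sum>i<n. P l i * (v i y - (\<Sum>k\<in>K0. d k * Vv k i y))))"
          unfolding hv_def by simp
        also have "\<dots> = v j y - (\<Sum>k\<in>K0. d k * Vv k j y)"
          by (rule Q_P[OF j])
        finally show "v j y = (\<Sum>k\<in>K0. d k * Vv k j y) + hv j y"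
          by simp
      qed
    qed
    then show "\<forall>\<^sub>F z in at 0 within S. v j z = (\<Sum>k\<in>K0. d k * Vv k j z) + hv j z" if "j < n" for j
      using that unfolding eventually_at_filter by (auto elim: eventually_mono)
  qed (use hu in auto)
qed

end

section \<open>The normalised connection problem\<close>

lemma has_field_derivative_moebius:
  fixes w :: "complex \<Rightarrow> complex"
  assumes w: "(w has_field_derivative d) (at (\<eta> + 1 / (t * z)))" and t: "t \<noteq> 0" and z: "z \<noteq> 0"
  shows "((\<lambda>z. w (\<eta> + 1 / (t * z)) / s) has_field_derivative - d / (t * z ^ 2 * s)) (at z)"
proof -
  have "((\<lambda>z. \<eta> + 1 / (t * z)) has_field_derivative - (1 / (t * z ^ 2))) (at z)"
    by (rule derivative_eq_intros refl | simp add: t z)+ (use t z in \<open>simp add: power2_eq_square field_simps\<close>)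
  from DERIV_cdivide[OF DERIV_chain2[OF w this], of s] show ?thesis
    by (simp add: field_simps)
qed

lemma holomorphic_at_0_has_fps_expansion:
  assumes "f holomorphic_on S" "open S" "0 \<in> S"
  shows "f has_fps_expansion fps_expansion f 0"
  using assms analytic_at analytic_at_imp_has_fps_expansion_0 by blast

lemma holomorphic_on_ball_scaled:
  assumes "\<phi> holomorphic_on ball 0 r" "f holomorphic_on S" "\<And>z. z \<in> S \<Longrightarrow> norm (f z) < r"
  shows "(\<lambda>z. \<phi> (f z :: complex)) holomorphic_on S"
proof -
  have "\<phi> \<circ> f holomorphic_on S"
    by (rule holomorphic_on_compose_gen[OF assms(2,1)]) (use assms(3) in auto)
  then show ?thesis by (simp add: o_def)
qed

context okubo_rl
begin

lemma frequently_in_D: "\<exists>\<^sub>F z in at 0. z \<in> D \<and> 1 - z \<notin> \<real>\<^sub>\<le>\<^sub>0 \<and> 1 - z \<in> D \<and> z \<notin> \<real>\<^sub>\<le>\<^sub>0 \<and> norm z < e" if "e > 0"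
  unfolding frequently_at
proof (intro allI impI)
  fix d :: real assume "d > 0"
  define x where "x = min (d / 2) (min (e / 2) (1 / 2))"
  have x: "0 < x" "x < d" "x < e" "x < 1"
    using \<open>d > 0\<close> that by (auto simp: x_def min_def)
  show "\<exists>z\<in>UNIV. z \<noteq> 0 \<and> dist z 0 < d \<and> z \<in> D \<and> 1 - z \<notin> \<real>\<^sub>\<le>\<^sub>0 \<and> 1 - z \<in> D \<and> z \<notin> \<real>\<^sub>\<le>\<^sub>0 \<and> norm z < e"
  proof (intro bexI[of _ "of_real x"] conjI)
    show "complex_of_real x \<in> D" using unit_interval_subset[of x] x by simp
    show "1 - complex_of_real x \<in> D" using unit_interval_subset[of "1 - x"] x by simp
  qed (use x in \<open>auto simp: complex_nonpos_Reals_iff\<close>)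
qed

text \<open>For \<open>\<zeta> = \<eta> + 1/(t z)\<close> one has
  \<open>\<zeta> - t'_l = (\<sigma> l - z) / (t z \<sigma> l)\<close> and
  \<open>d\<zeta>/dz = - 1/(t z^2)\<close>. Dividing the component \<open>l\<close> by
  \<open>\<sigma> l\<close> absorbs the remaining factor and turns \<open>A\<close> into
  \<open>B\<close>.\<close>

lemma moebius_ode:
  assumes t: "t \<noteq> 0" and l: "l < n" and z: "z \<noteq> 0"
    and ode: "(\<eta> + 1 / (t * z) - (\<eta> + 1 / (t * \<sigma> l))) * d = (\<Sum>m<n. A l m * w m)"
  shows "(z - \<sigma> l) * (z * (- d / (t * z ^ 2 * \<sigma> l))) = (\<Sum>m<n. B l m * (w m / \<sigma> m))"
proof -
  have "(\<Sum>m<n. B l m * (w m / \<sigma> m)) = (\<Sum>m<n. A l m * w m)"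
    by (intro sum.cong refl) (simp add: B_def \<sigma>_nz)
  also have "\<dots> = (\<eta> + 1 / (t * z) - (\<eta> + 1 / (t * \<sigma> l))) * d"
    by (rule ode[symmetric])
  also have "\<dots> = (z - \<sigma> l) * (z * (- d / (t * z ^ 2 * \<sigma> l)))"
    using t z \<sigma>_nz[OF l] by (simp add: field_simps power2_eq_square)
  finally show ?thesis ..
qed

text \<open>The quotient of the solution by \<open>(1 - z)^\<nu>\<close> is single-valued around
  \<open>1\<close>, but the solution is given only off the cut \<open>z \<ge> 1\<close>. Therefore
  \<open>g\<close> is read off from the local form at \<open>1\<close> where that converges, and
  from the quotient elsewhere; the assumption \<open>cut\<close> says that both regions together
  cover \<open>D\<close>.\<close>

lemma underlying_normalised:
  fixes K :: "'k set" and m c :: "'k \<Rightarrow> complex"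
  assumes L: "exp L = t" and r0: "r0 > 0" and r1: "r1 > 0" and K: "finite K"
    and D': "\<And>z. z \<in> D \<Longrightarrow> 1 - z \<notin> \<real>\<^sub>\<le>\<^sub>0 \<Longrightarrow> \<eta> + 1 / (t * z) \<in> D'"
    and cut: "\<And>z. z \<in> D \<Longrightarrow> 1 - z \<in> \<real>\<^sub>\<le>\<^sub>0 \<Longrightarrow> norm ((1 - z) / (t * z)) < r0"
    and w: "\<And>l \<zeta>. l < n \<Longrightarrow> \<zeta> \<in> D' \<Longrightarrow> (w l has_field_derivative dw l \<zeta>) (at \<zeta>)"
      "\<And>l \<zeta>. l < n \<Longrightarrow> \<zeta> \<in> D' \<Longrightarrow> (\<zeta> - (\<eta> + 1 / (t * \<sigma> l))) * dw l \<zeta> = (\<Sum>m<n. A l m * w m \<zeta>)"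
    and \<phi>: "\<And>l. l < n \<Longrightarrow> \<phi> l holomorphic_on ball 0 r0"
      "\<And>l z. l < n \<Longrightarrow> z \<in> D \<Longrightarrow> 1 - z \<notin> \<real>\<^sub>\<le>\<^sub>0 \<Longrightarrow> norm ((1 - z) / (t * z)) < r0 \<Longrightarrow>
        w l (\<eta> + 1 / (t * z)) = exp (- \<nu> * L) * (1 - z) powr \<nu> * z powr (- \<nu>) * \<phi> l ((1 - z) / (t * z))"
    and wi: "\<And>k l \<zeta>. k \<in> K \<Longrightarrow> l < n \<Longrightarrow> \<zeta> \<in> D' \<Longrightarrow> (wi k l has_field_derivative dwi k l \<zeta>) (at \<zeta>)"
      "\<And>k l \<zeta>. k \<in> K \<Longrightarrow> l < n \<Longrightarrow> \<zeta> \<in> D' \<Longrightarrow> (\<zeta> - (\<eta> + 1 / (t * \<sigma> l))) * dwi k l \<zeta> = (\<Sum>m<n. A l m * wi k m \<zeta>)"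
    and \<psi>: "\<And>k l. k \<in> K \<Longrightarrow> l < n \<Longrightarrow> \<psi> k l holomorphic_on ball 0 r1"
      "\<And>k l z. k \<in> K \<Longrightarrow> l < n \<Longrightarrow> z \<in> D \<Longrightarrow> 1 - z \<notin> \<real>\<^sub>\<le>\<^sub>0 \<Longrightarrow> norm (t * z) < r1 \<Longrightarrow>
        wi k l (\<eta> + 1 / (t * z)) = exp (- m k * L) * z powr (- m k) * \<psi> k l (t * z)"
    and conn: "\<And>l \<zeta>. l < n \<Longrightarrow> \<zeta> \<in> D' \<Longrightarrow> w l \<zeta> = (\<Sum>k\<in>K. c k * wi k l \<zeta>)"
  obtains g G h Y where
    "\<And>l. l < n \<Longrightarrow> g l holomorphic_on D" "\<And>l. l < n \<Longrightarrow> (\<lambda>x. g l (1 - x)) has_fps_expansion G l"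
    "\<And>l. l < n \<Longrightarrow> first_one 0 0 \<nu> G l = 0" "\<And>l. l < n \<Longrightarrow> fps_nth (G l) 0 = exp (- \<nu> * L) * \<phi> l 0 / \<sigma> l"
    "\<And>k l. k \<in> K \<Longrightarrow> l < n \<Longrightarrow> h k l has_fps_expansion Y k l"
    "\<And>k l. k \<in> K \<Longrightarrow> l < n \<Longrightarrow> first_zero 0 0 (- m k) (Y k) l = 0"
    "\<And>k l. k \<in> K \<Longrightarrow> l < n \<Longrightarrow> fps_nth (Y k l) 0 = c k * exp (- m k * L) * \<psi> k l 0 / \<sigma> l"
    "\<And>l. l < n \<Longrightarrow> \<forall>\<^sub>F z in at 0 within D. (1 - z) powr \<nu> * g l z = (\<Sum>k\<in>K. z powr (- m k) * h k l z)"
proof -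
  have t: "t \<noteq> 0" using L by auto
  have D0: "z \<noteq> 0" if "z \<in> D" for z using Re_pos[OF that] by auto
  define s where "s = (\<lambda>z. (1 - z) / (t * z))"
  define g1 where "g1 = (\<lambda>l z. exp (- \<nu> * L) * z powr (- \<nu>) * \<phi> l (s z) / \<sigma> l)"
  define y where "y = (\<lambda>l z. w l (\<eta> + 1 / (t * z)) / \<sigma> l)"
  define dy where "dy = (\<lambda>l z. - dw l (\<eta> + 1 / (t * z)) / (t * z ^ 2 * \<sigma> l))"
  define g where "g = (\<lambda>l z. if norm (s z) < r0 then g1 l z else y l z / (1 - z) powr \<nu>)"
  define h where "h = (\<lambda>k l z. c k * exp (- m k * L) * \<psi> k l (t * z) / \<sigma> l)"
  define D1 where "D1 = {z \<in> D. norm (s z) < r0}"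
  define D2 where "D2 = {z \<in> D. 1 - z \<notin> \<real>\<^sub>\<le>\<^sub>0}"
  have sh: "s holomorphic_on D"
    unfolding s_def using D0 t by (intro holomorphic_intros) auto
  have oD1: "open D1"
  proof -
    have "open (D \<inter> s -` ball 0 r0)"
      by (rule continuous_open_preimage[OF holomorphic_on_imp_continuous_on[OF sh] open_D]) simp
    also have "D \<inter> s -` ball 0 r0 = D1" by (auto simp: D1_def)
    finally show ?thesis .
  qed
  have oD2: "open D2"
  proof -
    have "open (D \<inter> (\<lambda>z. 1 - z) -` (- \<real>\<^sub>\<le>\<^sub>0))"
      by (intro open_Int open_D open_vimage continuous_intros) (simp add: open_Compl)
    also have "D \<inter> (\<lambda>z. 1 - z) -` (- \<real>\<^sub>\<le>\<^sub>0) = D2" by (auto simp: D2_def)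
    finally show ?thesis .
  qed
  have D12: "D = D1 \<union> D2"
    unfolding D1_def D2_def s_def using cut by auto
  have dyD: "(y l has_field_derivative dy l z) (at z)" if "l < n" "z \<in> D2" for l z
    unfolding y_def dy_def
    by (rule has_field_derivative_moebius[OF w(1) t]) (use that D' D0 in \<open>auto simp: D2_def\<close>)
  have y_ode: "(z - \<sigma> l) * (z * deriv (y l) z) = (\<Sum>m<n. B l m * y m z)" if l: "l < n" and z: "z \<in> D2" for l z
  proof -
    have zD: "z \<in> D" "1 - z \<notin> \<real>\<^sub>\<le>\<^sub>0" using z by (auto simp: D2_def)
    show ?thesis
      unfolding DERIV_imp_deriv[OF dyD[OF l z]] unfolding y_def dy_def
      by (rule moebius_ode[OF t l D0[OF zD(1)] w(2)[OF l D'[OF zD]]])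
  qed
  have yh: "y l holomorphic_on D2" if "l < n" for l
    using dyD[OF that] oD2 unfolding holomorphic_on_open[OF oD2] by blast
  have eq: "(1 - z) powr \<nu> * g l z = y l z" if "l < n" "z \<in> D2" for l z
  proof -
    have nz: "(1 - z) powr \<nu> \<noteq> 0" using that by (auto simp: D2_def)
    show ?thesis
    proof (cases "norm (s z) < r0")
      case True
      have "w l (\<eta> + 1 / (t * z)) = exp (- \<nu> * L) * (1 - z) powr \<nu> * z powr (- \<nu>) * \<phi> l ((1 - z) / (t * z))"
        by (rule \<phi>(2)) (use that True in \<open>auto simp: D2_def s_def\<close>)
      then show ?thesis using True by (simp add: g_def g1_def y_def s_def)
    next
      case False
      then show ?thesis using nz by (simp add: g_def)
    qed
  qed
  have gh: "g l holomorphic_on D" if l: "l < n" for l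
    unfolding D12
  proof (rule holomorphic_on_Un[OF _ _ oD1 oD2])
    have "g1 l holomorphic_on D1"
      unfolding g1_def
      by (intro holomorphic_intros holomorphic_on_ball_scaled[OF \<phi>(1)[OF l]] holomorphic_on_subset[OF sh])
        (use \<sigma>_nz l in \<open>auto simp: D1_def\<close>)
    then show "g l holomorphic_on D1"
      by (rule holomorphic_transform) (simp add: D1_def g_def)
    have "(\<lambda>z. y l z / (1 - z) powr \<nu>) holomorphic_on D2"
      by (intro holomorphic_intros yh l) (auto simp: D2_def)
    then show "g l holomorphic_on D2"
    proof (rule holomorphic_transform)
      fix z assume z: "z \<in> D2"
      then have "(1 - z) powr \<nu> \<noteq> 0" by (auto simp: D2_def)
      then show "y l z / (1 - z) powr \<nu> = g l z"
        using eq[OF l z] by (simp add: field_simps)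
    qed
  qed
  have Gx: "(\<lambda>x. g l (1 - x)) has_fps_expansion fps_expansion (\<lambda>x. g l (1 - x)) 0" if "l < n" for l
    by (rule holomorphic_at_0_has_fps_expansion[OF reflect_holomorphic[OF gh[OF that]] reflect_D(1,3)])
  let ?G = "\<lambda>l. fps_expansion (\<lambda>x. g l (1 - x)) 0"
  let ?S = "{x. 1 - x \<in> D2 \<and> x \<notin> \<real>\<^sub>\<le>\<^sub>0}"
  have oS: "open ?S"
  proof -
    have "open ((\<lambda>x. 1 - x) -` D2 \<inter> - \<real>\<^sub>\<le>\<^sub>0)"
      by (intro open_Int open_vimage oD2 continuous_intros) (simp add: open_Compl)
    then show ?thesis by (simp add: vimage_def Int_def)
  qed
  have F: "first_one 0 0 \<nu> ?G l = 0" if l: "l < n" for l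
  proof (rule first_one_eq_0[where S = ?S and g = "\<lambda>l x. g l (1 - x)" and u = "\<lambda>l x. y l (1 - x)"])
    show "\<exists>\<^sub>F x in at 0. x \<in> ?S"
      by (rule frequently_elim1[OF frequently_in_D[of 1]]) (auto simp: D2_def)
    fix l x assume l: "l < n"
    show "(\<lambda>x. g l (1 - x)) holomorphic_on ?S"
      by (rule holomorphic_on_subset[OF reflect_holomorphic[OF gh[OF l]]]) (auto simp: D2_def)
    assume x: "x \<in> ?S"
    show "y l (1 - x) = x powr \<nu> * g l (1 - x)"
      using eq[OF l, of "1 - x"] x by simp
    have "(1 - x - \<sigma> l) * ((1 - x) * deriv (y l) (1 - x)) = (\<Sum>m<n. B l m * y m (1 - x))"
      by (rule y_ode) (use l x in auto)
    then show "(1 - x - \<sigma> l) * (- (1 - x) * deriv (\<lambda>x. y l (1 - x)) x + 0 * y l (1 - x)) + 0 * (1 - x) * y l (1 - x) =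
        (\<Sum>m<n. B l m * y m (1 - x))"
      using deriv_reflect(1)[OF yh[OF l] oD2, of x] x by (simp add: algebra_simps)
  qed (use oS Gx l in auto)
  have hh: "h k l holomorphic_on ball 0 (r1 / norm t)" if "k \<in> K" "l < n" for k l
    unfolding h_def
    by (intro holomorphic_intros holomorphic_on_ball_scaled[OF \<psi>(1)[OF that]])
      (use \<sigma>_nz that t in \<open>auto simp: norm_mult pos_less_divide_eq mult.commute\<close>)
  have hx: "h k l has_fps_expansion fps_expansion (h k l) 0" if "k \<in> K" "l < n" for k l
    by (rule holomorphic_at_0_has_fps_expansion[OF hh[OF that]]) (use r1 t in auto)
  let ?S' = "{x. x \<in> D2 \<and> norm x < r1 / norm t}"
  have oS': "open ?S'"
  proof -
    have "open (D2 \<inter> ball 0 (r1 / norm t))" by (intro open_Int oD2 open_ball)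
    then show ?thesis by (simp add: Int_def)
  qed
  have Y: "first_zero 0 0 (- m k) (\<lambda>l. fps_expansion (h k l) 0) l = 0" if k: "k \<in> K" and l: "l < n" for k l
  proof (rule first_zero_eq_0[where S = ?S' and g = "h k" and u = "\<lambda>l z. c k * (wi k l (\<eta> + 1 / (t * z)) / \<sigma> l)"])
    show "\<exists>\<^sub>F x in at 0. x \<in> ?S'"
      by (rule frequently_elim1[OF frequently_in_D[of "r1 / norm t"]]) (use r1 t in \<open>auto simp: D2_def\<close>)
    fix l x assume l: "l < n"
    show "h k l holomorphic_on ?S'"
      by (rule holomorphic_on_subset[OF hh[OF k l]]) (auto simp: D2_def)
    assume x: "x \<in> ?S'"
    then have xD: "x \<in> D" "1 - x \<notin> \<real>\<^sub>\<le>\<^sub>0" by (auto simp: D2_def)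
    have "norm (t * x) < r1" using x t by (simp add: norm_mult pos_less_divide_eq mult.commute)
    from \<psi>(2)[OF k l xD this] show "c k * (wi k l (\<eta> + 1 / (t * x)) / \<sigma> l) = x powr - m k * h k l x"
      by (simp add: h_def)
    have d: "deriv (\<lambda>z. c k * (wi k l (\<eta> + 1 / (t * z)) / \<sigma> l)) x = c k * (- dwi k l (\<eta> + 1 / (t * x)) / (t * x ^ 2 * \<sigma> l))"
      by (rule DERIV_imp_deriv[OF DERIV_cmult[OF has_field_derivative_moebius[OF wi(1)[OF k l D'[OF xD]] t D0[OF xD(1)]]]])
    have "(x - \<sigma> l) * (x * (- dwi k l (\<eta> + 1 / (t * x)) / (t * x ^ 2 * \<sigma> l))) =
        (\<Sum>m<n. B l m * (wi k m (\<eta> + 1 / (t * x)) / \<sigma> m))"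
      by (rule moebius_ode[OF t l D0[OF xD(1)] wi(2)[OF k l D'[OF xD]]])
    then have "c k * ((x - \<sigma> l) * (x * (- dwi k l (\<eta> + 1 / (t * x)) / (t * x ^ 2 * \<sigma> l)))) =
        c k * (\<Sum>m<n. B l m * (wi k m (\<eta> + 1 / (t * x)) / \<sigma> m))"
      by simp
    then show "(x - \<sigma> l) * (x * deriv (\<lambda>z. c k * (wi k l (\<eta> + 1 / (t * z)) / \<sigma> l)) x + 0 * (c k * (wi k l (\<eta> + 1 / (t * x)) / \<sigma> l)))
        + 0 * x * (c k * (wi k l (\<eta> + 1 / (t * x)) / \<sigma> l)) = (\<Sum>ma<n. B l ma * (c k * (wi k ma (\<eta> + 1 / (t * x)) / \<sigma> ma)))"
      unfolding d by (simp add: sum_distrib_left mult_ac)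
  qed (use oS' hx k l in \<open>auto simp: D2_def\<close>)
  have ev: "\<forall>\<^sub>F z in at 0 within D. (1 - z) powr \<nu> * g l z = (\<Sum>k\<in>K. z powr (- m k) * h k l z)" if l: "l < n" for l
  proof -
    have "\<forall>\<^sub>F z in at 0 within D. z \<in> D" by (simp add: eventually_at_filter)
    moreover have "\<forall>\<^sub>F z in at 0 within D. z \<in> ball 0 (min 1 (r1 / norm t))"
      unfolding eventually_at by (rule exI[of _ "min 1 (r1 / norm t)"]) (use r1 t in \<open>auto simp: dist_commute\<close>)
    ultimately show ?thesis
    proof eventually_elim
      case (elim z)
      have z1: "1 - z \<notin> \<real>\<^sub>\<le>\<^sub>0"
        using elim(2) complex_Re_le_cmod[of z] by (auto simp: complex_nonpos_Reals_iff)
      have nz: "norm (t * z) < r1" using elim(2) t by (simp add: norm_mult pos_less_divide_eq mult.commute)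
      have "(1 - z) powr \<nu> * g l z = y l z"
        by (rule eq[OF l]) (use elim z1 in \<open>simp add: D2_def\<close>)
      also have "\<dots> = (\<Sum>k\<in>K. c k * wi k l (\<eta> + 1 / (t * z))) / \<sigma> l"
        unfolding y_def conn[OF l D'[OF elim(1) z1]] ..
      also have "\<dots> = (\<Sum>k\<in>K. c k * (exp (- m k * L) * z powr (- m k) * \<psi> k l (t * z))) / \<sigma> l"
        using \<psi>(2)[OF _ l elim(1) z1 nz] by simp
      also have "\<dots> = (\<Sum>k\<in>K. z powr (- m k) * h k l z)"
        unfolding sum_divide_distrib h_def by (intro sum.cong refl) simp
      finally show ?case .
    qed
  qed
  show ?thesis
  proof (rule that[of g ?G h "\<lambda>k l. fps_expansion (h k l) 0"])
    show "fps_nth (?G l) 0 = exp (- \<nu> * L) * \<phi> l 0 / \<sigma> l" for l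
      by (simp add: fps_expansion_def g_def g1_def s_def r0)
    show "fps_nth (fps_expansion (h k l) 0) 0 = c k * exp (- m k * L) * \<psi> k l 0 / \<sigma> l" for k l
      by (simp add: fps_expansion_def h_def)
  qed (use gh Gx F hx Y ev in auto)
qed

end

context okubo_rl
begin

text \<open>The upper components vanish at \<open>0\<close> to one order more than the lower ones.
  In the upper equation both \<open>A u\<close> and \<open>z u'\<close> are then of higher order,
  and the leading terms leave \<open>- \<sigma> u'\<close> against \<open>P v\<close>.\<close>

lemma leading_coeff_at_0:
  assumes S: "open S" "S \<subseteq> D" "0 islimpt S" and r: "0 < r"
    and hu: "\<And>l. l < n \<Longrightarrow> hu l holomorphic_on ball 0 r" "\<And>l. l < n \<Longrightarrow> hu l 0 = 0"
    and hv: "\<And>j. j < n \<Longrightarrow> hv j holomorphic_on ball 0 r"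
    and u: "\<And>l z. l < n \<Longrightarrow> z \<in> S \<Longrightarrow> norm z < r \<Longrightarrow> u l z = z powr e * hu l z"
    and v: "\<And>j z. j < n \<Longrightarrow> z \<in> S \<Longrightarrow> norm z < r \<Longrightarrow> v j z = z powr e * hv j z"
    and ode: "\<And>l z. l < n \<Longrightarrow> z \<in> S \<Longrightarrow> (z - \<sigma> l) * deriv (u l) z = (\<Sum>m<n. A l m * u m z) + (\<Sum>j<n. P l j * v j z)"
    and l: "l < n"
  shows "- \<sigma> l * ((e + 1) * fps_nth (fps_expansion (hu l) 0) 1) = (\<Sum>j<n. P l j * hv j 0)"
proof -
  let ?R = "S \<inter> ball 0 r"
  define Hu where "Hu = (\<lambda>l. fps_expansion (hu l) 0)"
  define Hv where "Hv = (\<lambda>j. fps_expansion (hv j) 0)"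
  have Hu: "hu l has_fps_expansion Hu l" if "l < n" for l
    unfolding Hu_def by (rule holomorphic_at_0_has_fps_expansion[OF hu(1)[OF that]]) (use r in auto)
  have Hv: "hv j has_fps_expansion Hv j" if "j < n" for j
    unfolding Hv_def by (rule holomorphic_at_0_has_fps_expansion[OF hv[OF that]]) (use r in auto)
  \<comment> \<open>The upper equation multiplied by \<open>z\<close> and divided by
    \<open>z^e\<close>; because of the multiplication its leading terms sit at index 1.\<close>
  define f where "f = (\<lambda>z. (z - \<sigma> l) * euler e (hu l) z - z * ((\<Sum>m<n. A l m * hu m z) + (\<Sum>j<n. P l j * hv j z)))"
  define F where "F = (fps_X - fps_const (\<sigma> l)) * fps_euler e (Hu l)
      - fps_X * ((\<Sum>m<n. fps_const (A l m) * Hu m) + (\<Sum>j<n. fps_const (P l j) * Hv j))"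
  have fF: "f has_fps_expansion F"
    unfolding f_def F_def by (intro fps_expansion_intros has_fps_expansion_euler Hu Hv l) auto
  have nS: "z \<notin> \<real>\<^sub>\<le>\<^sub>0" if "z \<in> S" for z
    using that S(2) by auto
  have "F = 0"
  proof (rule has_fps_expansion_frequently_zero[OF fF])
    have "\<exists>\<^sub>F z in at 0. z \<in> S"
      using S(3) by (simp add: islimpt_conv_frequently_at)
    moreover have "\<forall>\<^sub>F z in at 0. z \<in> ball (0::complex) r"
      unfolding eventually_at by (rule exI[of _ r]) (use r in \<open>auto simp: dist_commute\<close>)
    ultimately have "\<exists>\<^sub>F z in at 0. z \<in> ball 0 r \<and> z \<in> S"
      by (rule frequently_eventually_conj)
    then show "\<exists>\<^sub>F z in at 0. f z = 0"
    proof (rule frequently_elim1)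
      fix z assume "z \<in> ball 0 r \<and> z \<in> S"
      then have z: "z \<in> ?R" "z \<in> S" "norm z < r" by auto
      have d: "z * deriv (u l) z = z powr e * euler e (hu l) z"
        by (rule deriv_powr_mult(1)[where S = ?R])
          (use S(1) z nS l u in \<open>auto intro: holomorphic_on_subset[OF hu(1)]\<close>)
      have "z powr e * f z = (z - \<sigma> l) * (z powr e * euler e (hu l) z)
          - z * ((\<Sum>m<n. A l m * (z powr e * hu m z)) + (\<Sum>j<n. P l j * (z powr e * hv j z)))"
        unfolding f_def by (simp add: algebra_simps sum_distrib_left)
      also have "\<dots> = z * ((z - \<sigma> l) * deriv (u l) z - ((\<Sum>m<n. A l m * u m z) + (\<Sum>j<n. P l j * v j z)))"
        unfolding d[symmetric] using u[OF _ z(2,3)] v[OF _ z(2,3)] by (simp add: algebra_simps)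
      also have "\<dots> = z * 0" using ode[OF l z(2)] by simp
      finally show "f z = 0" by (rule branch_cancel[OF nS[OF z(2)]])
    qed
  qed
  have Hu0: "fps_nth (Hu m) 0 = 0" if "m < n" for m
    using hu(2)[OF that] by (simp add: Hu_def fps_expansion_def)
  have Hv0: "fps_nth (Hv j) 0 = hv j 0" for j
    by (simp add: Hv_def fps_expansion_def)
  have "fps_nth F 1 = - \<sigma> l * ((e + 1) * fps_nth (Hu l) 1) - (\<Sum>j<n. P l j * hv j 0)"
    unfolding F_def by (simp add: left_diff_distrib fps_sum_nth Hu0 Hv0 l)
  with \<open>F = 0\<close> show ?thesis unfolding Hu_def by simp
qed

text \<open>The product of the two multipliers contains
  \<open>Gamma (m - \<rho>1 - \<rho>2 - 1)\<close>. The factor \<open>- (e + 1)\<close> of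
  \<open>leading_coeff_at_0\<close>, at \<open>e = \<rho>1 + \<rho>2 - m\<close>, raises its
  argument by one.\<close>

lemma connection_factor:
  assumes "\<rho>1 + \<rho>2 - m \<notin> \<int>"
  shows "Gamma (m + 1) * Gamma (m - \<rho>1 - \<rho>2) / (Gamma (m - \<rho>1) * Gamma (m - \<rho>2)) =
    - (\<rho>1 + \<rho>2 - m + 1) * (rl_mult (\<rho>1 - m) (1 + \<rho>2) 0 * rl_mult (\<rho>2 - m) (- 1 - \<rho>2) 0)"
proof -
  have "m - \<rho>1 - \<rho>2 - 1 \<notin> \<int>"
  proof
    assume "m - \<rho>1 - \<rho>2 - 1 \<in> \<int>"
    then have "- (m - \<rho>1 - \<rho>2 - 1) - 1 \<in> \<int>" by (rule Ints_diff[OF Ints_minus Ints_1])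
    moreover have "- (m - \<rho>1 - \<rho>2 - 1) - 1 = \<rho>1 + \<rho>2 - m" by simp
    ultimately show False using assms by simp
  qed
  then have "m - \<rho>1 - \<rho>2 - 1 \<notin> \<int>\<^sub>\<le>\<^sub>0" using nonpos_Ints_subset_Ints by blast
  from Gamma_plus1[OF this] have G: "Gamma (m - \<rho>1 - \<rho>2) = (m - \<rho>1 - \<rho>2 - 1) * Gamma (m - \<rho>1 - \<rho>2 - 1)"
    by simp
  have e: "- (\<rho>1 - m) - of_nat 0 = m - \<rho>1" "- (\<rho>1 - m) - (1 + \<rho>2) - of_nat 0 = m - \<rho>1 - \<rho>2 - 1"
    "- (\<rho>2 - m) - of_nat 0 = m - \<rho>2" "- (\<rho>2 - m) - (- 1 - \<rho>2) - of_nat 0 = m + 1"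
    "- (\<rho>1 + \<rho>2 - m + 1) = m - \<rho>1 - \<rho>2 - 1"
    by (simp_all add: algebra_simps)
  show ?thesis
    unfolding rl_mult_def e G rGamma_inverse_Gamma by (simp add: field_simps)
qed

text \<open>Here the branch constants are put together. At \<open>1\<close> the solution
  \<open>u\<close> carries \<open>E exp (\<nu> L)\<close> and the underlying solution
  \<open>exp (- \<nu> L)\<close>, with quotient \<open>E exp (2 \<nu> L)\<close>. At
  \<open>0\<close> the quotient of \<open>exp (- m k L)\<close> by
  \<open>exp ((\<rho>1 + \<rho>2 - m k) L)\<close> is the same for all \<open>k\<close>.\<close>

lemma connection_thin_sector:
  fixes K K0 :: "(nat \<times> nat) set" and m c d :: "nat \<times> nat \<Rightarrow> complex"
  assumes \<nu>: "\<nu> \<notin> \<int>" "\<nu> - \<rho>2 \<notin> \<int>" and K: "finite K"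
    and m: "\<And>k. k \<in> K \<Longrightarrow> m k \<notin> \<int>" "\<And>k. k \<in> K \<Longrightarrow> \<rho>1 + \<rho>2 - m k \<notin> \<int>"
    and A0: "\<And>l m. l < n \<Longrightarrow> m < n \<Longrightarrow> \<sigma> l = 1 \<Longrightarrow> \<sigma> m = 1 \<Longrightarrow> l \<noteq> m \<Longrightarrow> A l m = 0"
    and A1: "\<And>l N. l < n \<Longrightarrow> \<sigma> l = 1 \<Longrightarrow> 0 < N \<Longrightarrow> \<nu> + of_nat N \<noteq> A l l"
    and \<mu>m: "\<And>j k. j < n \<Longrightarrow> k \<in> K \<Longrightarrow> \<mu> j - m k \<notin> \<int> \<or> \<mu> j = m k"
    and L: "exp L = t" and r0: "r0 > 0" and r1: "r1 > 0"
    and D': "\<And>z. z \<in> D \<Longrightarrow> 1 - z \<notin> \<real>\<^sub>\<le>\<^sub>0 \<Longrightarrow> \<eta> + 1 / (t * z) \<in> D'"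
    and cut: "\<And>z. z \<in> D \<Longrightarrow> 1 - z \<in> \<real>\<^sub>\<le>\<^sub>0 \<Longrightarrow> norm ((1 - z) / (t * z)) < r0"
    and w: "\<And>l \<zeta>. l < n \<Longrightarrow> \<zeta> \<in> D' \<Longrightarrow> (w l has_field_derivative dw l \<zeta>) (at \<zeta>)"
      "\<And>l \<zeta>. l < n \<Longrightarrow> \<zeta> \<in> D' \<Longrightarrow> (\<zeta> - (\<eta> + 1 / (t * \<sigma> l))) * dw l \<zeta> = (\<Sum>m<n. A l m * w m \<zeta>)"
    and \<phi>: "\<And>l. l < n \<Longrightarrow> \<phi> l holomorphic_on ball 0 r0"
      "\<And>l z. l < n \<Longrightarrow> z \<in> D \<Longrightarrow> 1 - z \<notin> \<real>\<^sub>\<le>\<^sub>0 \<Longrightarrow> norm ((1 - z) / (t * z)) < r0 \<Longrightarrow>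
        w l (\<eta> + 1 / (t * z)) = exp (- \<nu> * L) * (1 - z) powr \<nu> * z powr (- \<nu>) * \<phi> l ((1 - z) / (t * z))"
    and wi: "\<And>k l \<zeta>. k \<in> K \<Longrightarrow> l < n \<Longrightarrow> \<zeta> \<in> D' \<Longrightarrow> (wi k l has_field_derivative dwi k l \<zeta>) (at \<zeta>)"
      "\<And>k l \<zeta>. k \<in> K \<Longrightarrow> l < n \<Longrightarrow> \<zeta> \<in> D' \<Longrightarrow> (\<zeta> - (\<eta> + 1 / (t * \<sigma> l))) * dwi k l \<zeta> = (\<Sum>m<n. A l m * wi k m \<zeta>)"
    and \<psi>: "\<And>k l. k \<in> K \<Longrightarrow> l < n \<Longrightarrow> \<psi> k l holomorphic_on ball 0 r1"
      "\<And>k l z. k \<in> K \<Longrightarrow> l < n \<Longrightarrow> z \<in> D \<Longrightarrow> 1 - z \<notin> \<real>\<^sub>\<le>\<^sub>0 \<Longrightarrow> norm (t * z) < r1 \<Longrightarrow>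
        wi k l (\<eta> + 1 / (t * z)) = exp (- m k * L) * z powr (- m k) * \<psi> k l (t * z)"
    and conn: "\<And>l \<zeta>. l < n \<Longrightarrow> \<zeta> \<in> D' \<Longrightarrow> w l \<zeta> = (\<Sum>k\<in>K. c k * wi k l \<zeta>)"
    and S: "open S" "connected S" "S \<subseteq> D" "\<And>z. z \<in> S \<Longrightarrow> 1 - z \<notin> \<real>\<^sub>\<le>\<^sub>0" "0 islimpt S" "1 islimpt S"
    and U: "\<And>l. l < n \<Longrightarrow> u l holomorphic_on S" "\<And>j. j < n \<Longrightarrow> v j holomorphic_on S"
      "\<And>l z. l < n \<Longrightarrow> z \<in> S \<Longrightarrow> (z - \<sigma> l) * deriv (u l) z = (\<Sum>m<n. A l m * u m z) + (\<Sum>j<n. P l j * v j z)"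
      "\<And>j z. j < n \<Longrightarrow> z \<in> S \<Longrightarrow>
        z * deriv (v j) z = (\<rho>1 + \<rho>2 - \<mu> j) * v j z - (\<mu> j - \<rho>1) * (\<mu> j - \<rho>2) * (\<Sum>l<n. Q j l * u l z)"
    and r2: "r2 > 0" and r3: "r3 > 0"
    and \<phi>u: "\<And>l. l < n \<Longrightarrow> \<phi>u l holomorphic_on ball 0 r2"
      "\<And>l z. l < n \<Longrightarrow> z \<in> S \<Longrightarrow> norm (t * (z - 1)) < r2 \<Longrightarrow>
        u l z = E * exp (\<nu> * L) * (1 - z) powr \<nu> * \<phi>u l (t * (z - 1))"
      "\<And>l. l < n \<Longrightarrow> \<phi>u l 0 = \<phi> l 0" "\<And>l. l < n \<Longrightarrow> \<phi> l 0 \<noteq> 0 \<Longrightarrow> \<sigma> l = 1"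
    and V: "\<And>k l. k \<in> K0 \<Longrightarrow> l < n \<Longrightarrow> Vu k l holomorphic_on S" "\<And>k j. k \<in> K0 \<Longrightarrow> j < n \<Longrightarrow> Vv k j holomorphic_on S"
      "\<And>k l z. k \<in> K0 \<Longrightarrow> l < n \<Longrightarrow> z \<in> S \<Longrightarrow>
        (z - \<sigma> l) * deriv (Vu k l) z = (\<Sum>m<n. A l m * Vu k m z) + (\<Sum>j<n. P l j * Vv k j z)"
      "\<And>k j z. k \<in> K0 \<Longrightarrow> j < n \<Longrightarrow> z \<in> S \<Longrightarrow>
        z * deriv (Vv k j) z = (\<rho>1 + \<rho>2 - \<mu> j) * Vv k j z - (\<mu> j - \<rho>1) * (\<mu> j - \<rho>2) * (\<Sum>l<n. Q j l * Vu k l z)"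
    and \<psi>u: "\<And>k l. k \<in> K0 \<Longrightarrow> l < n \<Longrightarrow> \<psi>u k l holomorphic_on ball 0 r3"
      "\<And>k l z. k \<in> K0 \<Longrightarrow> l < n \<Longrightarrow> z \<in> S \<Longrightarrow> norm (t * z) < r3 \<Longrightarrow>
        Vu k l z = exp ((\<rho>1 + \<rho>2 - m k) * L) * z powr (\<rho>1 + \<rho>2 - m k) * \<psi>u k l (t * z)"
      "\<And>k l. k \<in> K0 \<Longrightarrow> l < n \<Longrightarrow> \<psi>u k l 0 = 0"
    and \<psi>v: "\<And>k j. k \<in> K0 \<Longrightarrow> j < n \<Longrightarrow> \<psi>v k j holomorphic_on ball 0 r3"
      "\<And>k j z. k \<in> K0 \<Longrightarrow> j < n \<Longrightarrow> z \<in> S \<Longrightarrow> norm (t * z) < r3 \<Longrightarrow>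
        Vv k j z = exp ((\<rho>1 + \<rho>2 - m k) * L) * z powr (\<rho>1 + \<rho>2 - m k) * \<psi>v k j (t * z)"
      "\<And>k l. k \<in> K0 \<Longrightarrow> l < n \<Longrightarrow> (\<Sum>j<n. P l j * \<psi>v k j 0) = \<psi> k l 0"
    and d: "\<And>k. k \<in> K0 \<Longrightarrow> d k = E * exp ((2 * \<nu> - \<rho>1 - \<rho>2) * L) *
      (Gamma (m k + 1) * Gamma (m k - \<rho>1 - \<rho>2) / (Gamma (m k - \<rho>1) * Gamma (m k - \<rho>2))) * c k"
    and K0: "K0 \<subseteq> K" "\<And>k. k \<in> K - K0 \<Longrightarrow> m k = \<rho>1 \<or> m k = \<rho>2"
  obtains hu hv where
    "\<And>l. l < n \<Longrightarrow> hu l analytic_on {0}" "\<And>j. j < n \<Longrightarrow> hv j analytic_on {0}"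
    "\<And>l. l < n \<Longrightarrow> \<forall>\<^sub>F z in at 0 within S. u l z = (\<Sum>k\<in>K0. d k * Vu k l z) + hu l z"
    "\<And>j. j < n \<Longrightarrow> \<forall>\<^sub>F z in at 0 within S. v j z = (\<Sum>k\<in>K0. d k * Vv k j z) + hv j z"
proof -
  have t: "t \<noteq> 0" using L by auto
  obtain g G h Y where
    g: "\<And>l. l < n \<Longrightarrow> g l holomorphic_on D" and G: "\<And>l. l < n \<Longrightarrow> (\<lambda>x. g l (1 - x)) has_fps_expansion G l"
    and F: "\<And>l. l < n \<Longrightarrow> first_one 0 0 \<nu> G l = 0" and G0: "\<And>l. l < n \<Longrightarrow> fps_nth (G l) 0 = exp (- \<nu> * L) * \<phi> l 0 / \<sigma> l"
    and h: "\<And>k l. k \<in> K \<Longrightarrow> l < n \<Longrightarrow> h k l has_fps_expansion Y k l"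
    and Y: "\<And>k l. k \<in> K \<Longrightarrow> l < n \<Longrightarrow> first_zero 0 0 (- m k) (Y k) l = 0"
    and Y0: "\<And>k l. k \<in> K \<Longrightarrow> l < n \<Longrightarrow> fps_nth (Y k l) 0 = c k * exp (- m k * L) * \<psi> k l 0 / \<sigma> l"
    and ev: "\<And>l. l < n \<Longrightarrow> \<forall>\<^sub>F z in at 0 within D. (1 - z) powr \<nu> * g l z = (\<Sum>k\<in>K. z powr (- m k) * h k l z)"
    by (rule underlying_normalised[where w = w and wi = wi and \<phi> = \<phi> and \<psi> = \<psi> and m = m and c = c and \<eta> = \<eta>,
        OF L r0 r1 K D' cut w(1) w(2) \<phi>(1) \<phi>(2) wi(1) wi(2) \<psi>(1) \<psi>(2) conn]; (assumption | blast))
  define \<kappa> where "\<kappa> = E * exp (2 * \<nu> * L)"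
  define e where "e = (\<lambda>k. \<rho>1 + \<rho>2 - m k)"
  define gU where "gU = (\<lambda>l z. E * exp (\<nu> * L) * \<phi>u l (t * (z - 1)))"
  define GU where "GU = (\<lambda>l. fps_expansion (\<lambda>x. gU l (1 - x)) 0)"
  define hV where "hV = (\<lambda>k l z. exp (e k * L) * \<psi>u k l (t * z))"
  define hW where "hW = (\<lambda>k j z. exp (e k * L) * \<psi>v k j (t * z))"
  define HV where "HV = (\<lambda>k l. fps_expansion (hV k l) 0)"
  have gU: "(\<lambda>x. gU l (1 - x)) has_fps_expansion GU l" if "l < n" for l
    unfolding GU_def
  proof (rule holomorphic_at_0_has_fps_expansion)
    show "(\<lambda>x. gU l (1 - x)) holomorphic_on ball 0 (r2 / norm t)"
      unfolding gU_def
      by (intro holomorphic_intros holomorphic_on_ball_scaled[OF \<phi>u(1)[OF that]])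
        (use t in \<open>auto simp: norm_mult pos_less_divide_eq mult.commute\<close>)
  qed (use t r2 in auto)
  have gU_ev: "\<forall>\<^sub>F z in at 1 within S. u l z = (1 - z) powr \<nu> * gU l z" if l: "l < n" for l
    unfolding eventually_at
  proof (intro exI[of _ "r2 / norm t"] conjI ballI impI)
    fix z assume z: "z \<in> S" and "z \<noteq> 1 \<and> dist z 1 < r2 / norm t"
    then have "norm (t * (z - 1)) < r2"
      using t by (simp add: dist_norm norm_mult pos_less_divide_eq mult.commute)
    from \<phi>u(2)[OF l z this] show "u l z = (1 - z) powr \<nu> * gU l z"
      by (simp add: gU_def mult_ac)
  qed (use r2 t in auto)
  have GU0: "fps_nth (GU l) 0 = \<kappa> * fps_nth (G l) 0" if l: "l < n" for l
  proof -
    have "fps_nth (GU l) 0 = E * exp (\<nu> * L) * \<phi> l 0"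
      by (simp add: GU_def fps_expansion_def gU_def \<phi>u(3) l)
    also have "exp (\<nu> * L) = exp (2 * \<nu> * L) * exp (- \<nu> * L)"
      by (simp flip: exp_add add: algebra_simps)
    \<comment> \<open>The leading vector is nonzero only in rows with \<open>\<sigma> l = 1\<close>,
      so the division by \<open>\<sigma> l\<close> introduced in the underlying system has no effect
      on it.\<close>
    also have "E * (exp (2 * \<nu> * L) * exp (- \<nu> * L)) * \<phi> l 0 = \<kappa> * (exp (- \<nu> * L) * \<phi> l 0 / \<sigma> l)"
      using \<phi>u(4)[OF l] by (cases "\<phi> l 0 = 0") (auto simp: \<kappa>_def)
    finally show ?thesis by (simp add: G0 l)
  qed
  have hVh: "hV k l holomorphic_on ball 0 (r3 / norm t)" if "k \<in> K0" "l < n" for k l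
    unfolding hV_def
    by (intro holomorphic_intros holomorphic_on_ball_scaled[OF \<psi>u(1)[OF that]])
      (use t in \<open>auto simp: norm_mult pos_less_divide_eq mult.commute\<close>)
  have hWh: "hW k l holomorphic_on ball 0 (r3 / norm t)" if "k \<in> K0" "l < n" for k l
    unfolding hW_def
    by (intro holomorphic_intros holomorphic_on_ball_scaled[OF \<psi>v(1)[OF that]])
      (use t in \<open>auto simp: norm_mult pos_less_divide_eq mult.commute\<close>)
  have hV: "hV k l has_fps_expansion HV k l" if "k \<in> K0" "l < n" for k l
    unfolding HV_def by (rule holomorphic_at_0_has_fps_expansion[OF hVh[OF that]]) (use t r3 in auto)
  have small: "norm (t * z) < r3" if "norm z < r3 / norm t" for z
    using that t by (simp add: norm_mult pos_less_divide_eq mult.commute)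
  have Vu_eq: "Vu k l z = z powr e k * hV k l z" if "k \<in> K0" "l < n" "z \<in> S" "norm z < r3 / norm t" for k l z
    using \<psi>u(2)[OF that(1-3) small[OF that(4)]] by (simp add: hV_def e_def mult_ac)
  have Vv_eq: "Vv k l z = z powr e k * hW k l z" if "k \<in> K0" "l < n" "z \<in> S" "norm z < r3 / norm t" for k l z
    using \<psi>v(2)[OF that(1-3) small[OF that(4)]] by (simp add: hW_def e_def mult_ac)
  have hV_ev: "\<forall>\<^sub>F z in at 0 within S. Vu k l z = z powr (\<rho>1 + \<rho>2 - m k) * hV k l z" if "k \<in> K0" "l < n" for k l
    unfolding eventually_at
    by (rule exI[of _ "r3 / norm t"]) (use Vu_eq[OF that] r3 t in \<open>auto simp: e_def\<close>)
  have HV0: "fps_nth (HV k l) 0 = 0" if "k \<in> K0" "l < n" for k l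
    using \<psi>u(3)[OF that] by (simp add: HV_def fps_expansion_def hV_def)
  have HV1: "d k * fps_nth (HV k l) 1 =
      \<kappa> * (rl_mult (\<rho>1 - m k) (1 + \<rho>2) 0 * (rl_mult (\<rho>2 - m k) (- 1 - \<rho>2) 0 * fps_nth (Y k l) 0))"
    if k: "k \<in> K0" and l: "l < n" for k l
  proof -
    have kK: "k \<in> K" using k K0 by auto
    let ?R = "rl_mult (\<rho>1 - m k) (1 + \<rho>2) 0 * rl_mult (\<rho>2 - m k) (- 1 - \<rho>2) 0"
    have "- \<sigma> l * ((e k + 1) * fps_nth (fps_expansion (hV k l) 0) 1) = (\<Sum>j<n. P l j * hW k j 0)"
      by (rule leading_coeff_at_0[where S = S and u = "Vu k" and v = "Vv k" and r = "r3 / norm t",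
          OF S(1,3,5) _ hVh[OF k] _ hWh[OF k] Vu_eq[OF k] Vv_eq[OF k] V(3)[OF k] l])
        (use r3 t \<psi>u(3)[OF k] in \<open>simp_all add: hV_def\<close>)
    also have "\<dots> = exp (e k * L) * (\<Sum>j<n. P l j * \<psi>v k j 0)"
      by (simp add: hW_def sum_distrib_left mult_ac)
    finally have main: "- \<sigma> l * ((e k + 1) * fps_nth (HV k l) 1) = exp (e k * L) * \<psi> k l 0"
      by (simp add: HV_def \<psi>v(3)[OF k l])
    have "exp (- m k * L) * exp ((2 * \<nu>) * L) = exp ((2 * \<nu> - \<rho>1 - \<rho>2) * L) * exp (e k * L)"
      by (simp flip: exp_add add: e_def algebra_simps)
    then have ex: "exp (- m k * L) * \<kappa> = E * exp ((2 * \<nu> - \<rho>1 - \<rho>2) * L) * exp (e k * L)"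
      by (simp add: \<kappa>_def mult_ac)
    have "\<sigma> l * (d k * fps_nth (HV k l) 1) = E * exp ((2 * \<nu> - \<rho>1 - \<rho>2) * L) * ?R * c k * (- \<sigma> l * ((e k + 1) * fps_nth (HV k l) 1))"
      unfolding d[OF k] connection_factor[OF m(2)[OF kK]] e_def by (simp add: algebra_simps)
    also have "\<dots> = (E * exp ((2 * \<nu> - \<rho>1 - \<rho>2) * L) * exp (e k * L)) * ?R * c k * \<psi> k l 0"
      unfolding main by (simp add: mult_ac)
    also have "\<dots> = \<sigma> l * (\<kappa> * (?R * fps_nth (Y k l) 0))"
      unfolding ex[symmetric] Y0[OF kK l] using \<sigma>_nz[OF l] by simp
    finally show ?thesis using \<sigma>_nz[OF l] by (simp add: mult.assoc)
  qed
  show ?thesis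
    by (rule connection_normalised[where g = g and G = G and h = h and Y = Y and u = u and v = v and gU = gU and GU = GU
        and Vu = Vu and Vv = Vv and hV = hV and HV = HV and d = d and m = m and \<kappa> = \<kappa>,
        OF \<nu> K m(1) m(2) A0 A1 \<mu>m g G F h Y ev S U(1) U(2) U(3) U(4) gU gU_ev GU0 V(1) V(2) V(3) V(4)
           hV hV_ev HV0 HV1 K0(1) K0(2) that]; (assumption | blast)?)
qed

end

section \<open>Block matrices, branches of powers and sectors\<close>

no_notation fps_nth (infixl "$" 75)
no_notation vec_nth (infixl "$" 90)

section \<open>Entries and indices of block scalar matrices\<close>

lemma block_scalar_0: "block_scalar 0 s c = 0\<^sub>m 0 0"
  by (simp add: block_scalar_def)

lemma block_scalar_Suc:
  "block_scalar (Suc r) s c = four_block_mat (block_scalar r s c)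
     (0\<^sub>m (dim_row (block_scalar r s c)) (s (Suc r))) (0\<^sub>m (s (Suc r)) (dim_col (block_scalar r s c))) (c (Suc r) \<cdot>\<^sub>m 1\<^sub>m (s (Suc r)))"
  by (simp add: block_scalar_def diag_block_mat_last Let_def)

lemma dim_block_scalar [simp]:
  "dim_row (block_scalar r s c) = (\<Sum>k=1..r. s k)" "dim_col (block_scalar r s c) = (\<Sum>k=1..r. s k)"
  by (induction r) (simp_all add: block_scalar_0 block_scalar_Suc)

lemma block_scalar_offdiag:
  "i < (\<Sum>k=1..r. s k) \<Longrightarrow> j < (\<Sum>k=1..r. s k) \<Longrightarrow> i \<noteq> j \<Longrightarrow> block_scalar r s c $$ (i, j) = 0"
  by (induction r) (auto simp: block_scalar_Suc)

lemma sum_before_less: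
  fixes s :: "nat \<Rightarrow> nat"
  assumes "k \<in> {1..r}" "h < s k"
  shows "(\<Sum>j=1..<k. s j) + h < (\<Sum>j=1..r. s j)"
proof -
  have "(\<Sum>j=1..<k. s j) + h < (\<Sum>j=1..k. s j)"
    using assms by (cases k) (auto simp: atLeastLessThanSuc_atLeastAtMost)
  also have "\<dots> \<le> (\<Sum>j=1..r. s j)"
    using assms by (intro sum_mono2) auto
  finally show ?thesis .
qed

lemma block_scalar_diag:
  assumes "k \<in> {1..r}" "h < s k"
  shows "block_scalar r s c $$ ((\<Sum>j=1..<k. s j) + h, (\<Sum>j=1..<k. s j) + h) = c k"
  using assms
proof (induction r)
  case (Suc r)
  show ?case
  proof (cases "k = Suc r")
    case True
    then show ?thesis using Suc.prems by (simp add: block_scalar_Suc atLeastLessThanSuc_atLeastAtMost)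
  next
    case False
    then have k: "k \<in> {1..r}" using Suc.prems by auto
    show ?thesis
      using Suc.IH[OF k Suc.prems(2)] sum_before_less[where s = s, OF k Suc.prems(2)] by (simp add: block_scalar_Suc)
  qed
qed simp

lemma block_index_exists:
  fixes s :: "nat \<Rightarrow> nat"
  assumes "i < (\<Sum>k=1..r. s k)"
  obtains k h where "k \<in> {1..r}" "h < s k" "i = (\<Sum>j=1..<k. s j) + h"
  using assms
proof (induction r arbitrary: thesis)
  case (Suc r)
  show ?case
  proof (cases "i < (\<Sum>k=1..r. s k)")
    case True
    show ?thesis
      by (rule Suc.IH[OF _ True], rule Suc.prems(1)) auto
  next
    case False
    show ?thesis
      by (rule Suc.prems(1)[of "Suc r" "i - (\<Sum>k=1..r. s k)"])
        (use False Suc.prems(2) in \<open>auto simp: atLeastLessThanSuc_atLeastAtMost\<close>)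
  qed
qed simp

section \<open>Branches of powers through logarithms\<close>

lemma arg_from_exp: "\<alpha> \<le> Im l \<Longrightarrow> Im l < \<alpha> + 2 * pi \<Longrightarrow> arg_from \<alpha> (exp l) = Im l"
proof -
  assume l: "\<alpha> \<le> Im l" "Im l < \<alpha> + 2 * pi"
  have "Arg2pi (exp l * cis (- \<alpha>)) = Im l - \<alpha>"
  proof (rule Arg2pi_unique[of "exp (Re l)"])
    have "of_real (exp (Re l)) * exp (\<i> * of_real (Im l - \<alpha>)) = exp (of_real (Re l) + \<i> * of_real (Im l - \<alpha>))"
      by (simp add: exp_add exp_of_real)
    also have "of_real (Re l) + \<i> * of_real (Im l - \<alpha>) = l + \<i> * of_real (- \<alpha>)"
      by (simp add: complex_eq_iff)
    finally show "of_real (exp (Re l)) * exp (\<i> * of_real (Im l - \<alpha>)) = exp l * cis (- \<alpha>)"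
      by (simp only: exp_add cis_conv_exp)
  qed (use l in auto)
  then show ?thesis by (simp add: arg_from_def)
qed

lemma pow_arg_exp: "pow_arg (Im l) (exp l) \<mu> = exp (\<mu> * l)"
proof -
  have "of_real (Re l) + \<i> * of_real (Im l) = l" by (simp add: complex_eq_iff)
  then show ?thesis by (simp add: pow_arg_def)
qed

text \<open>Every branch used later is determined by exhibiting a logarithm whose imaginary part
  lies in the prescribed window.\<close>

lemma pow_from_exp: "\<alpha> \<le> Im l \<Longrightarrow> Im l < \<alpha> + 2 * pi \<Longrightarrow> pow_from \<alpha> (exp l) \<mu> = exp (\<mu> * l)"
  by (simp add: pow_from_def arg_from_exp pow_arg_exp)

lemma pow_from_nonzero [simp]: "pow_from \<alpha> z \<mu> \<noteq> 0"
  by (simp add: pow_from_def pow_arg_def)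

text \<open>The separate bounds \<open>pi / 2\<close> and \<open>pi\<close> on the two arguments
  allow a difference of up to \<open>3 pi / 2\<close>. The imaginary part of
  \<open>(1 - z) / z\<close> has the sign opposite to that of \<open>Im z\<close>; this fixes the
  sign of the sine of the difference and excludes the excess.\<close>

lemma abs_Im_Ln_diff_less_pi:
  assumes z: "0 < Re z" "1 - z \<notin> \<real>\<^sub>\<le>\<^sub>0"
  shows "\<bar>Im (Ln (1 - z) - Ln z)\<bar> < pi"
proof -
  have nz: "z \<noteq> 0" "1 - z \<noteq> 0" using z by auto
  define x where "x = Im (Ln (1 - z) - Ln z)"
  define r where "r = exp (Re (Ln (1 - z) - Ln z))"
  have "Im ((1 - z) / z) = r * sin x"
    using nz Im_exp[of "Ln (1 - z) - Ln z"] by (simp add: exp_diff x_def r_def)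
  moreover have "Im ((1 - z) / z) = - (Im z / (norm z)\<^sup>2)"
    using nz by (simp add: Im_divide cmod_power2 algebra_simps)
  ultimately have eq: "r * sin x = - (Im z / (norm z)\<^sup>2)" by simp
  have r: "r > 0" by (simp add: r_def)
  have half: "\<bar>Im (Ln z)\<bar> < pi / 2" by (rule Re_Ln_pos_lt_imp[OF z(1)])
  have a: "- pi < Im (Ln (1 - z))" "Im (Ln (1 - z)) < pi"
    using mpi_less_Im_Ln[OF nz(2)] Im_Ln_less_pi[OF z(2)] by auto
  consider "Im z = 0" | "Im z > 0" | "Im z < 0" by linarith
  then show ?thesis
  proof cases
    case 1
    then have "Im (Ln z) = 0" "Im (Ln (1 - z)) = 0"
      using z nz by (auto simp: complex_nonpos_Reals_iff Im_Ln_eq_0)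
    then show ?thesis by simp
  next
    case 2
    have "sin x < 0"
    proof (rule ccontr)
      assume "\<not> sin x < 0"
      then have "0 \<le> r * sin x" using r by simp
      moreover have "Im z / (norm z)\<^sup>2 > 0" using 2 nz by simp
      ultimately show False using eq by linarith
    qed
    have "0 < Im (Ln z)" using Im_Ln_pos_lt[OF nz(1)] 2 by simp
    moreover have "Im (Ln (1 - z)) < 0"
      using Im_Ln_pos_le[OF nz(2)] a 2 by auto
    ultimately have x: "x < 0" "x > - (3 * pi / 2)"
      using half a by (auto simp: x_def)
    have "x > - pi"
    proof (rule ccontr)
      assume "\<not> x > - pi"
      then have "0 \<le> sin (- (x + pi))"
        using x by (intro sin_ge_zero) auto
      then show False using \<open>sin x < 0\<close> by simp
    qed
    then show ?thesis using x by (simp add: x_def)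
  next
    case 3
    have "sin x > 0"
    proof (rule ccontr)
      assume "\<not> sin x > 0"
      then have "r * sin x \<le> 0" using r by (simp add: mult_le_0_iff)
      moreover have "Im z / (norm z)\<^sup>2 < 0" using 3 nz by (simp add: divide_neg_pos)
      ultimately show False using eq by linarith
    qed
    have "Im (Ln z) < 0"
      using Im_Ln_pos_le[OF nz(1)] half 3 pi_gt_zero by (auto simp: not_le)
    moreover have "0 < Im (Ln (1 - z))" using Im_Ln_pos_lt[OF nz(2)] 3 by simp
    ultimately have x: "x > 0" "x < 3 * pi / 2"
      using half a by (auto simp: x_def)
    have "x < pi"
    proof (rule ccontr)
      assume "\<not> x < pi"
      then have "0 \<le> sin (x - pi)"
        using x by (intro sin_ge_zero) auto
      then show False using \<open>sin x > 0\<close> by simp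
    qed
    then show ?thesis using x by (simp add: x_def)
  qed
qed

text \<open>The series is known to converge only at points of \<open>D\<close>, which need not
  surround the point of expansion. One nonzero value \<open>z x0\<close> within the given radius
  suffices: its modulus is a radius of convergence for all components.\<close>

lemma local_form_obtains:
  fixes u :: "complex \<Rightarrow> complex vec" and z :: "complex \<Rightarrow> complex"
  assumes "local_form D z f v u" and f: "\<And>x. x \<in> D \<Longrightarrow> f x \<noteq> 0"
    and near: "\<And>e. e > 0 \<Longrightarrow> \<exists>x\<in>D. 0 < norm (z x) \<and> norm (z x) < e"
  obtains r \<phi> where "r > 0" "\<And>j. j < dim_vec v \<Longrightarrow> \<phi> j holomorphic_on ball 0 r"
    "\<And>j. j < dim_vec v \<Longrightarrow> \<phi> j 0 = v $ j"
    "\<And>j x. j < dim_vec v \<Longrightarrow> x \<in> D \<Longrightarrow> norm (z x) < r \<Longrightarrow> u x $ j = f x * \<phi> j (z x)"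
proof -
  obtain r G where r: "r > 0" "G 0 = v"
    and sums: "\<And>x j. x \<in> D \<Longrightarrow> norm (z x) < r \<Longrightarrow> j < dim_vec v \<Longrightarrow> (\<lambda>m. f x * (G m $ j * z x ^ m)) sums (u x $ j)"
    using assms(1) unfolding local_form_def by blast
  obtain x0 where x0: "x0 \<in> D" "0 < norm (z x0)" "norm (z x0) < r"
    using near[OF r(1)] by blast
  define \<phi> where "\<phi> = (\<lambda>j w. \<Sum>m. G m $ j * w ^ m)"
  have ps: "(\<lambda>m. G m $ j * w ^ m) sums \<phi> j w" if j: "j < dim_vec v" and w: "w \<in> ball 0 (norm (z x0))" for j w
  proof -
    have "summable (\<lambda>m. f x0 * (G m $ j * z x0 ^ m))"
      using sums[OF x0(1,3) j] by (rule sums_summable)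
    then have "summable (\<lambda>m. G m $ j * z x0 ^ m)"
      using f[OF x0(1)] by (simp add: summable_cmult_iff)
    then have "summable (\<lambda>m. G m $ j * w ^ m)"
      by (rule powser_inside) (use w in simp)
    then show ?thesis
      unfolding \<phi>_def by (rule summable_sums)
  qed
  show ?thesis
  proof (rule that[of "norm (z x0)" \<phi>])
    fix j assume j: "j < dim_vec v"
    show "\<phi> j holomorphic_on ball 0 (norm (z x0))"
    proof (rule power_series_holomorphic)
      fix w :: complex assume "w \<in> ball 0 (norm (z x0))"
      from ps[OF j this] show "(\<lambda>m. G m $ j * (w - 0) ^ m) sums \<phi> j w"
        by (simp only: diff_zero)
    qed
    show "\<phi> j 0 = v $ j"
      unfolding \<phi>_def by (simp add: powser_zero r(2))
    fix x assume x: "x \<in> D" "norm (z x) < norm (z x0)"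
    have "(\<lambda>m. f x * (G m $ j * z x ^ m)) sums (f x * \<phi> j (z x))"
      by (intro sums_mult ps j) (use x in auto)
    moreover have "(\<lambda>m. f x * (G m $ j * z x ^ m)) sums (u x $ j)"
      by (rule sums) (use x x0 j in auto)
    ultimately show "u x $ j = f x * \<phi> j (z x)" by (rule sums_unique2[symmetric])
  qed (use x0 in auto)
qed

lemma solves_systemD:
  fixes u :: "complex \<Rightarrow> complex vec"
  assumes "solves_system T A D u" and A: "A \<in> carrier_mat N N" and T: "T \<in> carrier_mat N N"
    and off: "\<And>i j. i < N \<Longrightarrow> j < N \<Longrightarrow> i \<noteq> j \<Longrightarrow> T $$ (i, j) = 0" and x: "x \<in> D" and j: "j < N"
  shows "((\<lambda>y. u y $ j) has_field_derivative deriv (\<lambda>y. u y $ j) x) (at x)"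
    and "(x - T $$ (j, j)) * deriv (\<lambda>y. u y $ j) x = (\<Sum>i<N. A $$ (j, i) * u x $ i)"
proof -
  obtain u' where ux: "u x \<in> carrier_vec N" and u': "u' \<in> carrier_vec N"
    and d: "\<And>j. j < N \<Longrightarrow> ((\<lambda>y. u y $ j) has_field_derivative u' $ j) (at x)"
    and eq: "(x \<cdot>\<^sub>m 1\<^sub>m N - T) *\<^sub>v u' = A *\<^sub>v u x"
    using assms(1) x A unfolding solves_system_def by auto
  have d': "deriv (\<lambda>y. u y $ j) x = u' $ j" by (rule DERIV_imp_deriv[OF d[OF j]])
  then show "((\<lambda>y. u y $ j) has_field_derivative deriv (\<lambda>y. u y $ j) x) (at x)"
    using d[OF j] by simp
  have "((x \<cdot>\<^sub>m 1\<^sub>m N - T) *\<^sub>v u') $ j = (\<Sum>i<N. (x * (if j = i then 1 else 0) - T $$ (j, i)) * u' $ i)"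
    using T u' j by (auto simp: scalar_prod_def lessThan_atLeast0 intro!: sum.cong)
  also have "\<dots> = (\<Sum>i<N. if j = i then (x - T $$ (j, j)) * u' $ j else 0)"
    by (intro sum.cong refl) (use off j in auto)
  also have "\<dots> = (x - T $$ (j, j)) * u' $ j" using j by simp
  finally have "(x - T $$ (j, j)) * u' $ j = (A *\<^sub>v u x) $ j" by (simp only: eq)
  also have "\<dots> = (\<Sum>i<N. A $$ (j, i) * u x $ i)"
    using A ux j by (auto simp: scalar_prod_def lessThan_atLeast0 intro!: sum.cong)
  finally show "(x - T $$ (j, j)) * deriv (\<lambda>y. u y $ j) x = (\<Sum>i<N. A $$ (j, i) * u x $ i)"
    by (simp only: d')
qed

text \<open>\<open>L\<close> is the chosen logarithm of \<open>a\<close>. In each case a logarithm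
  of the base is a combination of \<open>L\<close>, \<open>Ln z\<close> and
  \<open>Ln (1 - z)\<close>, and the hypotheses place it in the window. In the first case
  \<open>z - 1 = - (1 - z)\<close> costs half a turn, in the direction given by the sign of
  \<open>Im z\<close>; this is the source of the double sign.\<close>

lemma powr_exp_cases:
  assumes "exp L = (a::complex)"
  shows pow_from_at_one: "s \<in> {1, -1} \<Longrightarrow> 0 < s * Im z \<Longrightarrow>
      pow_from (Im L - pi) (a * (z - 1)) \<mu> = exp (of_real s * of_real pi * \<i> * \<mu>) * exp (\<mu> * L) * (1 - z) powr \<mu>"
    and pow_from_at_zero: "z \<noteq> 0 \<Longrightarrow> \<alpha> \<le> Im L + Im (Ln z) \<Longrightarrow> Im L + Im (Ln z) < \<alpha> + 2 * pi \<Longrightarrow>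
      pow_from \<alpha> (a * z) \<mu> = exp (\<mu> * L) * z powr \<mu>"
    and pow_from_moebius_one: "0 < Re z \<Longrightarrow> 1 - z \<notin> \<real>\<^sub>\<le>\<^sub>0 \<Longrightarrow>
      pow_from (- Im L - pi) ((1 - z) / (a * z)) \<mu> = exp (- \<mu> * L) * (1 - z) powr \<mu> * z powr (- \<mu>)"
    and pow_from_moebius_infinity: "z \<noteq> 0 \<Longrightarrow> \<alpha> \<le> - Im L - Im (Ln z) \<Longrightarrow> - Im L - Im (Ln z) < \<alpha> + 2 * pi \<Longrightarrow>
      pow_from \<alpha> (1 / (a * z)) \<mu> = exp (- \<mu> * L) * z powr (- \<mu>)"
proof -
  assume s: "s \<in> {1, -1}" "0 < s * Im z"
  have nz: "1 - z \<noteq> 0" using s by auto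
  have e: "a * (z - 1) = exp (L + Ln (1 - z) + of_real s * of_real pi * \<i>)"
  proof -
    have "exp (of_real s * of_real pi * \<i>) = (-1 :: complex)"
      using s(1) by (auto simp: exp_minus mult.commute)
    then show ?thesis using nz assms by (simp add: exp_add algebra_simps)
  qed
  have im: "Im (L + Ln (1 - z) + of_real s * of_real pi * \<i>) = Im L + Im (Ln (1 - z)) + s * pi" by simp
  have a: "- pi < Im (Ln (1 - z))" "Im (Ln (1 - z)) \<le> pi" using mpi_less_Im_Ln[OF nz] Im_Ln_le_pi[OF nz] by auto
  have b: "s = 1 \<and> Im (Ln (1 - z)) < 0 \<or> s = -1 \<and> 0 < Im (Ln (1 - z))"
    using s Im_Ln_pos_lt[OF nz] Im_Ln_pos_le[OF nz] a by auto
  show "pow_from (Im L - pi) (a * (z - 1)) \<mu> = exp (of_real s * of_real pi * \<i> * \<mu>) * exp (\<mu> * L) * (1 - z) powr \<mu>"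
    unfolding e by (subst pow_from_exp) (use a b im nz in \<open>auto simp: powr_def exp_add distrib_left mult_ac\<close>)
next
  assume z: "z \<noteq> 0" and im: "\<alpha> \<le> Im L + Im (Ln z)" "Im L + Im (Ln z) < \<alpha> + 2 * pi"
  have "a * z = exp (L + Ln z)" using z assms by (simp add: exp_add)
  then have "pow_from \<alpha> (a * z) \<mu> = exp (\<mu> * (L + Ln z))"
    using im by (simp add: pow_from_exp)
  then show "pow_from \<alpha> (a * z) \<mu> = exp (\<mu> * L) * z powr \<mu>"
    using z by (simp only: powr_def exp_add if_False distrib_left)
next
  assume z: "0 < Re z" "1 - z \<notin> \<real>\<^sub>\<le>\<^sub>0"
  then have nz: "z \<noteq> 0" "1 - z \<noteq> 0" by auto
  have "(1 - z) / (a * z) = exp (- L + (Ln (1 - z) - Ln z))"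
    using nz assms by (simp add: exp_add exp_diff exp_minus field_simps)
  moreover have "- Im L - pi \<le> Im (- L + (Ln (1 - z) - Ln z))" "Im (- L + (Ln (1 - z) - Ln z)) < - Im L - pi + 2 * pi"
    using abs_Im_Ln_diff_less_pi[OF z] by simp_all
  ultimately have "pow_from (- Im L - pi) ((1 - z) / (a * z)) \<mu> = exp (\<mu> * (- L + (Ln (1 - z) - Ln z)))"
    by (simp only: pow_from_exp)
  also have "\<mu> * (- L + (Ln (1 - z) - Ln z)) = - \<mu> * L + \<mu> * Ln (1 - z) + (- \<mu>) * Ln z"
    by (simp add: algebra_simps)
  finally show "pow_from (- Im L - pi) ((1 - z) / (a * z)) \<mu> = exp (- \<mu> * L) * (1 - z) powr \<mu> * z powr (- \<mu>)"
    using nz by (simp only: powr_def exp_add if_False)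
next
  assume z: "z \<noteq> 0" and im: "\<alpha> \<le> - Im L - Im (Ln z)" "- Im L - Im (Ln z) < \<alpha> + 2 * pi"
  have "1 / (a * z) = exp (- L - Ln z)" using z assms by (simp add: exp_diff exp_minus field_simps)
  then have "pow_from \<alpha> (1 / (a * z)) \<mu> = exp (\<mu> * (- L - Ln z))"
    using im by (simp add: pow_from_exp)
  also have "\<mu> * (- L - Ln z) = - \<mu> * L + (- \<mu>) * Ln z" by (simp add: algebra_simps)
  finally show "pow_from \<alpha> (1 / (a * z)) \<mu> = exp (- \<mu> * L) * z powr (- \<mu>)"
    using z by (simp only: powr_def exp_add if_False)
qed

text \<open>A narrow triangle with vertex \<open>0\<close> around the segment from \<open>0\<close>
  to \<open>1\<close>. Its far side lies beyond \<open>1\<close>, which makes \<open>1\<close> an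
  interior point, and its slope keeps the argument below \<open>\<kappa>\<close>.\<close>

definition thin :: "real \<Rightarrow> complex set" where
  "thin \<kappa> = {z. Re z < 1 + \<kappa> \<and> \<bar>Im z\<bar> < \<kappa> * Re z}"

lemma thin_pos: "0 < \<kappa> \<Longrightarrow> z \<in> thin \<kappa> \<Longrightarrow> 0 < Re z"
proof -
  assume "0 < \<kappa>" "z \<in> thin \<kappa>"
  then have "0 < \<kappa> * Re z" by (auto simp: thin_def)
  then show ?thesis using \<open>0 < \<kappa>\<close> by (simp add: zero_less_mult_iff)
qed

lemma thin_eq_Int: "thin \<kappa> = {z. Re z < 1 + \<kappa>} \<inter> ({z. Im z - \<kappa> * Re z < 0} \<inter> {z. - Im z - \<kappa> * Re z < 0})"
  by (auto simp: thin_def)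

lemma convex_halfplane_Re_Im: "convex {z. b * Im z + a * Re z < c}"
proof -
  have "{z. b * Im z + a * Re z < c} = {z. inner (Complex a b) z < c}"
    by (simp add: inner_complex_def algebra_simps)
  then show ?thesis by (simp add: convex_halfspace_lt)
qed

lemma rl_domain_thin: "0 < \<kappa> \<Longrightarrow> rl_domain (thin \<kappa>)"
proof
  assume k: "0 < \<kappa>"
  show "open (thin \<kappa>)"
    unfolding thin_eq_Int by (intro open_Int open_Collect_less continuous_intros)
  show "convex (thin \<kappa>)"
    unfolding thin_eq_Int using convex_halfplane_Re_Im[of 0 1] convex_halfplane_Re_Im[of 1 "- \<kappa>" 0] convex_halfplane_Re_Im[of "- 1" "- \<kappa>" 0]
    by (intro convex_Int) simp_all
qed (auto simp: thin_def zero_less_mult_iff intro: thin_pos)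

lemma thin_mono: "\<kappa> \<le> \<kappa>' \<Longrightarrow> 0 < \<kappa> \<Longrightarrow> thin \<kappa> \<subseteq> thin \<kappa>'"
proof
  fix z assume k: "\<kappa> \<le> \<kappa>'" "0 < \<kappa>" and z: "z \<in> thin \<kappa>"
  have "\<kappa> * Re z \<le> \<kappa>' * Re z" using k thin_pos[OF k(2) z] by (intro mult_right_mono) auto
  then show "z \<in> thin \<kappa>'" using z k by (auto simp: thin_def)
qed

lemma abs_Im_Ln_thin: "0 < \<kappa> \<Longrightarrow> z \<in> thin \<kappa> \<Longrightarrow> \<bar>Im (Ln z)\<bar> < \<kappa>"
proof -
  assume k: "0 < \<kappa>" and z: "z \<in> thin \<kappa>"
  have p: "0 < Re z" by (rule thin_pos[OF k z])
  then have "z \<noteq> 0" by auto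
  then have "Im (Ln z) = arctan (Im z / Re z)"
    using arg_conv_arctan[OF p] by (simp add: Arg_eq_Im_Ln)
  moreover have "\<bar>arctan x\<bar> \<le> \<bar>x\<bar>" for x :: real
    using arctan_le_self[of "\<bar>x\<bar>"] by (cases "x \<ge> 0") (auto simp: arctan_minus)
  moreover have "\<bar>Im z / Re z\<bar> < \<kappa>" using z p by (simp add: thin_def abs_divide divide_less_eq)
  ultimately show ?thesis by (metis le_less_trans)
qed

text \<open>On the cut \<open>z\<close> is real with \<open>1 \<le> z < 1 + \<kappa>\<close>, so the
  numerator has modulus less than \<open>\<kappa>\<close> and the denominator at least
  \<open>norm a\<close>.\<close>

lemma thin_cut:
  assumes "z \<in> thin \<kappa>" "1 - z \<in> \<real>\<^sub>\<le>\<^sub>0" "\<kappa> \<le> r * norm a" "a \<noteq> 0" "0 < r"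
  shows "norm ((1 - z) / (a * z)) < r"
proof -
  have z: "z = of_real (Re z)" "1 \<le> Re z" "Re z < 1 + \<kappa>"
    using assms by (auto simp: thin_def complex_nonpos_Reals_iff complex_eq_iff)
  have nz: "norm z = Re z" "norm (1 - z) = Re z - 1"
    using z(2) by (metis abs_of_nonneg norm_of_real order.trans zero_le_one z(1))
      (metis z abs_of_nonpos diff_le_0_iff_le minus_diff_eq norm_of_real of_real_1 of_real_diff)
  have "norm ((1 - z) / (a * z)) \<le> (Re z - 1) / norm a"
    unfolding norm_divide norm_mult nz using z(2) assms(4) by (intro divide_left_mono) auto
  also have "\<dots> < r" using z(3) assms(3,4) by (simp add: pos_divide_less_eq)
  finally show ?thesis .
qed

text \<open>The sign \<open>s\<close> selects the side of the real axis. It decides which of the two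
  sectors at \<open>t_i\<close> the points are mapped to, and keeps them away from the ray on which
  the branches at \<open>t_i\<close> jump.\<close>

definition half_thin :: "real \<Rightarrow> real \<Rightarrow> complex set" where
  "half_thin s \<kappa> = thin \<kappa> \<inter> {z. 0 < s * Im z}"

lemma half_thin:
  assumes k: "0 < \<kappa>" and s: "s \<in> {1, -1}"
  shows "open (half_thin s \<kappa>)" "connected (half_thin s \<kappa>)" "half_thin s \<kappa> \<subseteq> thin \<kappa>"
    "\<And>z. z \<in> half_thin s \<kappa> \<Longrightarrow> 1 - z \<notin> \<real>\<^sub>\<le>\<^sub>0" "\<And>x. 0 \<le> x \<Longrightarrow> x \<le> 1 \<Longrightarrow> of_real x islimpt half_thin s \<kappa>"
proof -
  interpret rl_domain "thin \<kappa>" by (rule rl_domain_thin[OF k])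
  show "open (half_thin s \<kappa>)"
    unfolding half_thin_def by (intro open_Int open_D open_Collect_less continuous_intros)
  have "convex {z. 0 < s * Im z}"
    using convex_halfplane_Re_Im[of "- s" 0 0] by simp
  then show "connected (half_thin s \<kappa>)"
    unfolding half_thin_def by (intro convex_connected convex_Int convex_D)
  show "half_thin s \<kappa> \<subseteq> thin \<kappa>" by (auto simp: half_thin_def)
  show "1 - z \<notin> \<real>\<^sub>\<le>\<^sub>0" if "z \<in> half_thin s \<kappa>" for z
    using that by (auto simp: half_thin_def complex_nonpos_Reals_iff)
  show "of_real x islimpt half_thin s \<kappa>" if x: "0 \<le> x" "x \<le> 1" for x
    unfolding islimpt_approachable
  proof (intro allI impI)
    fix e :: real assume e: "e > 0"
    \<comment> \<open>The witness is \<open>x + y\<close> moved off the axis by \<open>d\<close>.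
      The shift \<open>y\<close> leaves the vertex when \<open>x = 0\<close> and stays below
      \<open>\<kappa>\<close>, hence inside the far side, when \<open>x = 1\<close>;
      \<open>d\<close> respects the slope bound \<open>\<kappa> (x + y)\<close>.\<close>
    define y where "y = min (e / 4) (\<kappa> / 2)"
    define d where "d = y * min \<kappa> 1 / 2"
    have y: "0 < y" "y \<le> e / 4" "y < \<kappa>" using e k by (auto simp: y_def)
    have m: "0 < min \<kappa> 1" "min \<kappa> 1 \<le> 1" "min \<kappa> 1 \<le> \<kappa>" using k by auto
    have "y * min \<kappa> 1 \<le> y * 1" using y m by (intro mult_left_mono) auto
    moreover have "0 < y * min \<kappa> 1" using y m by simp
    ultimately have d: "0 < d" "d < e / 4" unfolding d_def using y by linarith+
    have "y * min \<kappa> 1 \<le> y * \<kappa>" using y m by (intro mult_left_mono) auto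
    moreover have "y * \<kappa> \<le> \<kappa> * (x + y)" using x k by (simp add: algebra_simps)
    ultimately have dk: "d < \<kappa> * (x + y)" unfolding d_def using \<open>0 < y * min \<kappa> 1\<close> by linarith
    have in_half: "Complex (x + y) (s * d) \<in> half_thin s \<kappa>"
      using s d dk x y by (auto simp: half_thin_def thin_def)
    have "dist (Complex (x + y) (s * d)) (of_real x) \<le> \<bar>y\<bar> + \<bar>s * d\<bar>"
      unfolding dist_norm using cmod_le[of "Complex (x + y) (s * d) - of_real x"] by simp
    also have "\<dots> < e" using s d y e by auto
    finally show "\<exists>x'\<in>half_thin s \<kappa>. x' \<noteq> of_real x \<and> dist x' (of_real x) < e"
      using in_half y by (intro bexI[of _ "Complex (x + y) (s * d)"]) (auto simp: complex_eq_iff)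
  qed
qed

text \<open>In logarithmic coordinates a sector is a horizontal strip, and its intersection with a
  disc around the vertex is a convex set. Openness and connectedness follow from this.\<close>

lemma sector_eq_exp: "sector c a b = (\<lambda>w. c + exp w) ` {w. a < Im w \<and> Im w < b}"
proof (intro equalityI subsetI)
  fix x assume "x \<in> sector c a b"
  then obtain r \<phi> where x: "x = c + rcis r \<phi>" "0 < r" "a < \<phi>" "\<phi> < b" by (auto simp: sector_def)
  have "x = c + exp (Complex (ln r) \<phi>)" using x(1,2) by (simp add: rcis_def exp_eq_polar flip: exp_of_real)
  then show "x \<in> (\<lambda>w. c + exp w) ` {w. a < Im w \<and> Im w < b}" using x by auto
next
  fix x assume "x \<in> (\<lambda>w. c + exp w) ` {w. a < Im w \<and> Im w < b}"
  then obtain w where w: "x = c + exp w" "a < Im w" "Im w < b" by auto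
  have "exp w = rcis (exp (Re w)) (Im w)" by (simp add: rcis_def exp_eq_polar)
  with w have "x = c + rcis (exp (Re w)) (Im w) \<and> 0 < exp (Re w) \<and> a < Im w \<and> Im w < b"
    by simp
  then show "x \<in> sector c a b"
    unfolding sector_def by blast
qed

lemma open_strip: "open {w. a < Im w \<and> Im w < b}"
  by (intro open_Collect_conj open_Collect_less continuous_intros)

lemma open_sector: "b \<le> a + 2 * pi \<Longrightarrow> open (sector c a b)"
  unfolding sector_eq_exp
proof (rule open_mapping_thm3)
  assume ab: "b \<le> a + 2 * pi"
  show "inj_on (\<lambda>w. c + exp w) {w. a < Im w \<and> Im w < b}"
    by (rule inj_onI, rule exp_complex_eqI) (use ab in \<open>auto simp: abs_if\<close>)
qed (intro holomorphic_intros open_strip)+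

lemma connected_sector_Int_ball: "0 < e \<Longrightarrow> connected (sector c a b \<inter> ball c e)"
proof -
  assume e: "0 < e"
  let ?R = "{w. a < Im w} \<inter> ({w. Im w < b} \<inter> {w. Re w < ln e})"
  have ln: "exp x < e \<longleftrightarrow> x < ln e" for x :: real
    using e by (metis exp_less_cancel_iff exp_ln)
  have "c + exp w \<in> ball c e \<longleftrightarrow> Re w < ln e" for w
    using ln[of "Re w"] by (simp add: dist_norm)
  then have "sector c a b \<inter> ball c e = (\<lambda>w. c + exp w) ` ?R"
    unfolding sector_eq_exp by blast
  moreover have "convex ?R"
    using convex_halfplane_Re_Im[of "-1" 0 "- a"] convex_halfplane_Re_Im[of 1 0 b] convex_halfplane_Re_Im[of 0 1 "ln e"]
    by (intro convex_Int) simp_all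
  ultimately show ?thesis
    by (simp only:) (intro connected_continuous_image convex_connected continuous_intros)
qed

text \<open>The equality with \<open>h\<close> is known only in a small part of the sector. The
  sector meets a small disc around \<open>c\<close> in a connected set, so the equality holds on all
  of it. Outside the disc the extension may be \<open>F\<close> itself, since holomorphy is claimed
  only at \<open>c\<close>.\<close>

lemma sector_holomorphic_extension:
  fixes F h :: "complex \<Rightarrow> complex"
  assumes F: "F holomorphic_on sector c \<alpha> \<beta>" and ab: "\<beta> \<le> \<alpha> + 2 * pi" and a: "a \<noteq> 0"
    and h: "h analytic_on {0}" and S: "open S" "0 islimpt S" "0 \<notin> S" "\<And>z. z \<in> S \<Longrightarrow> c + a * z \<in> sector c \<alpha> \<beta>"
    and ev: "\<forall>\<^sub>F z in at 0 within S. F (c + a * z) = h z"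
  shows "\<exists>H. H analytic_on {c} \<and> (\<forall>x\<in>sector c \<alpha> \<beta>. F x = H x)"
proof -
  obtain e where e: "e > 0" "h holomorphic_on ball 0 e"
    using h by (auto simp: analytic_on_def)
  define h' where "h' = (\<lambda>x. h ((x - c) / a))"
  define e' where "e' = e * norm a"
  have e': "e' > 0" using e a by (simp add: e'_def)
  have h': "h' holomorphic_on ball c e'"
    unfolding h'_def
    by (rule holomorphic_on_ball_scaled[OF e(2)])
      (use a in \<open>auto intro!: holomorphic_intros simp: norm_divide dist_norm norm_minus_commute pos_divide_less_eq e'_def\<close>)
  obtain S' where S': "open S'" "S' \<subseteq> S \<inter> ball 0 e" "S' \<noteq> {}" "\<forall>z\<in>S'. F (c + a * z) = h z"
    using eventually_within_open_imp_subset[OF ev S(2,1,3) e(1)] by blast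
  let ?W = "sector c \<alpha> \<beta> \<inter> ball c e'"
  have oW: "open ?W" by (intro open_Int open_sector ab open_ball)
  let ?S = "(\<lambda>z. c + a * z) ` S'"
  have oS: "open ?S"
    by (rule open_mapping_thm3[OF _ S'(1)]) (use a in \<open>auto intro!: holomorphic_intros inj_onI\<close>)
  have SW: "?S \<subseteq> ?W"
    using S' S(4) a by (auto simp: dist_norm norm_mult e'_def mult.commute)
  have eq: "F x = h' x" if "x \<in> ?W" for x
  proof (rule analytic_continuation_open[where f = F and g = h', OF oS oW _ connected_sector_Int_ball[OF e'] SW])
    show "F holomorphic_on ?W" by (rule holomorphic_on_subset[OF F]) auto
    show "h' holomorphic_on ?W" by (rule holomorphic_on_subset[OF h']) auto
    fix z assume "z \<in> ?S" then show "F z = h' z" using S'(4) a by (auto simp: h'_def)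
  qed (use S' that in auto)
  define H where "H = (\<lambda>x. if x \<in> ball c e' then h' x else F x)"
  have "H holomorphic_on ball c e'"
    by (rule holomorphic_transform[OF h']) (simp add: H_def)
  then have "H analytic_on {c}"
    using e' by (metis analytic_at open_ball centre_in_ball)
  moreover have "\<forall>x\<in>sector c \<alpha> \<beta>. F x = H x" using eq by (simp add: H_def)
  ultimately show ?thesis by blast
qed

section \<open>The block system in coordinates\<close>

lemma okubo_matrix_entries:
  fixes A P Q A' AP :: "complex mat"
  assumes A: "A \<in> carrier_mat n n" and P: "P \<in> carrier_mat n n" and Q: "Q \<in> carrier_mat n n" and A': "A' \<in> carrier_mat n n"
    and off: "\<And>i j. i < n \<Longrightarrow> j < n \<Longrightarrow> i \<noteq> j \<Longrightarrow> A' $$ (i, j) = 0"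
    and AP: "AP = four_block_mat A P (- ((A' - \<rho>1 \<cdot>\<^sub>m 1\<^sub>m n) * (A' - \<rho>2 \<cdot>\<^sub>m 1\<^sub>m n) * Q)) ((\<rho>1 + \<rho>2) \<cdot>\<^sub>m 1\<^sub>m n - A')"
    and ij: "i < n" "j < n"
  shows "AP $$ (i, j) = A $$ (i, j)" "AP $$ (i, n + j) = P $$ (i, j)"
    "AP $$ (n + i, j) = - ((A' $$ (i, i) - \<rho>1) * (A' $$ (i, i) - \<rho>2) * Q $$ (i, j))"
    "AP $$ (n + i, n + j) = (if i = j then \<rho>1 + \<rho>2 - A' $$ (i, i) else 0)"
proof -
  have d: "dim_row A = n" "dim_col A = n" "dim_row P = n" "dim_col P = n" "dim_row Q = n" "dim_col Q = n" "dim_row A' = n" "dim_col A' = n"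
    using A P Q A' by auto
  show "AP $$ (i, j) = A $$ (i, j)" "AP $$ (i, n + j) = P $$ (i, j)"
    "AP $$ (n + i, n + j) = (if i = j then \<rho>1 + \<rho>2 - A' $$ (i, i) else 0)"
    using ij off[of i j] by (auto simp: AP d)
  define X where "X = (A' - \<rho>1 \<cdot>\<^sub>m 1\<^sub>m n) * (A' - \<rho>2 \<cdot>\<^sub>m 1\<^sub>m n)"
  have X: "X $$ (i, k) = (if k = i then (A' $$ (i, i) - \<rho>1) * (A' $$ (i, i) - \<rho>2) else 0)" if k: "k < n" for k
  proof -
    have "X $$ (i, k) = (\<Sum>m<n. (A' $$ (i, m) - \<rho>1 * (if i = m then 1 else 0)) * (A' $$ (m, k) - \<rho>2 * (if m = k then 1 else 0)))"
      using ij k by (auto simp: X_def d scalar_prod_def lessThan_atLeast0 intro!: sum.cong)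
    also have "\<dots> = (\<Sum>m<n. if m = i then (if k = i then (A' $$ (i, i) - \<rho>1) * (A' $$ (i, i) - \<rho>2) else 0) else 0)"
      by (intro sum.cong refl) (use off ij k in auto)
    also have "\<dots> = (if k = i then (A' $$ (i, i) - \<rho>1) * (A' $$ (i, i) - \<rho>2) else 0)"
      using ij by simp
    finally show ?thesis .
  qed
  have "AP $$ (n + i, j) = - ((X * Q) $$ (i, j))"
    using ij by (simp add: AP d X_def)
  also have "(X * Q) $$ (i, j) = (\<Sum>m<n. X $$ (i, m) * Q $$ (m, j))"
    using ij by (auto simp: X_def d scalar_prod_def lessThan_atLeast0 intro!: sum.cong)
  also have "\<dots> = (\<Sum>m<n. if m = i then (A' $$ (i, i) - \<rho>1) * (A' $$ (i, i) - \<rho>2) * Q $$ (i, j) else 0)"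
    by (intro sum.cong refl) (use X in auto)
  also have "\<dots> = (A' $$ (i, i) - \<rho>1) * (A' $$ (i, i) - \<rho>2) * Q $$ (i, j)"
    using ij by simp
  finally show "AP $$ (n + i, j) = - ((A' $$ (i, i) - \<rho>1) * (A' $$ (i, i) - \<rho>2) * Q $$ (i, j))" .
qed

lemma mat_mult_sum:
  assumes "A \<in> carrier_mat n n" "B \<in> carrier_mat n n" "i < n" "j < n"
  shows "(A * B) $$ (i, j) = (\<Sum>l<n. A $$ (i, l) * B $$ (l, j))"
  using assms by (auto simp: scalar_prod_def lessThan_atLeast0 intro!: sum.cong)

lemma conjugate_diag_entries:
  fixes A P Q A' :: "complex mat"
  assumes A: "A \<in> carrier_mat n n" and P: "P \<in> carrier_mat n n" and Q: "Q \<in> carrier_mat n n"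
    and inv: "inverts_mat P Q" "inverts_mat Q P" and A': "A' = Q * A * P"
    and off: "\<And>i j. i < n \<Longrightarrow> j < n \<Longrightarrow> i \<noteq> j \<Longrightarrow> A' $$ (i, j) = 0"
    and ij: "i < n" "j < n"
  shows "(\<Sum>l<n. Q $$ (i, l) * A $$ (l, j)) = A' $$ (i, i) * Q $$ (i, j)"
    "(\<Sum>l<n. P $$ (i, l) * Q $$ (l, j)) = (if i = j then 1 else 0)"
    "(\<Sum>l<n. Q $$ (i, l) * P $$ (l, j)) = (if i = j then 1 else 0)"
proof -
  have PQ: "P * Q = 1\<^sub>m n" and QP: "Q * P = 1\<^sub>m n"
    using inv P Q by (auto simp: inverts_mat_def)
  have cA': "A' \<in> carrier_mat n n" using A P Q A' by auto
  have "A' * Q = Q * A * (P * Q)"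
    unfolding A' by (rule assoc_mult_mat) (use A P Q in auto)
  also have "\<dots> = Q * A" unfolding PQ by (rule right_mult_one_mat) (use A Q in auto)
  finally have "(Q * A) $$ (i, j) = (A' * Q) $$ (i, j)" by simp
  also have "\<dots> = (\<Sum>m<n. if m = i then A' $$ (i, i) * Q $$ (i, j) else 0)"
    unfolding mat_mult_sum[OF cA' Q ij] by (intro sum.cong refl) (use off ij in auto)
  finally show "(\<Sum>l<n. Q $$ (i, l) * A $$ (l, j)) = A' $$ (i, i) * Q $$ (i, j)"
    using ij by (simp add: mat_mult_sum[OF Q A ij])
  show "(\<Sum>l<n. P $$ (i, l) * Q $$ (l, j)) = (if i = j then 1 else 0)"
    "(\<Sum>l<n. Q $$ (i, l) * P $$ (l, j)) = (if i = j then 1 else 0)"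
    unfolding mat_mult_sum[OF P Q ij, symmetric] mat_mult_sum[OF Q P ij, symmetric] PQ QP using ij by auto
qed

lemma sum_lessThan_add:
  fixes f :: "nat \<Rightarrow> 'a::comm_monoid_add"
  shows "(\<Sum>i<n + k. f i) = (\<Sum>i<n. f i) + (\<Sum>i<k. f (n + i))"
  by (induction k) (simp_all add: add.assoc)

text \<open>The lower block of the reduced system has only \<open>n'\<close> rows. Padding
  \<open>v\<close> with zeros to length \<open>n\<close> restores the uniform shape: in the missing
  rows the coupling \<open>(\<mu> j - \<rho>1) (\<mu> j - \<rho>2)\<close> vanishes, and zero
  satisfies the equation.\<close>

lemma normalised_system:
  fixes u :: "complex \<Rightarrow> complex vec" and Tm Am :: "complex mat"
  assumes sol: "solves_system Tm Am X u" and T: "Tm \<in> carrier_mat N N" and Am: "Am \<in> carrier_mat N N"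
    and off: "\<And>i j. i < N \<Longrightarrow> j < N \<Longrightarrow> i \<noteq> j \<Longrightarrow> Tm $$ (i, j) = 0" and N: "N = n + n'" "n' \<le> n" and a: "a \<noteq> 0"
    and Tl: "\<And>l. l < n \<Longrightarrow> Tm $$ (l, l) = c + a * \<sigma> l" "\<And>j. j < n' \<Longrightarrow> Tm $$ (n + j, n + j) = c"
    and e: "\<And>l m. l < n \<Longrightarrow> m < n \<Longrightarrow> Am $$ (l, m) = A l m" "\<And>l j. l < n \<Longrightarrow> j < n' \<Longrightarrow> Am $$ (l, n + j) = P l j"
      "\<And>j l. j < n' \<Longrightarrow> l < n \<Longrightarrow> Am $$ (n + j, l) = - ((\<mu> j - \<rho>1) * (\<mu> j - \<rho>2) * Q j l)"
      "\<And>j k. j < n' \<Longrightarrow> k < n' \<Longrightarrow> Am $$ (n + j, n + k) = (if j = k then \<rho>1 + \<rho>2 - \<mu> j else 0)"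
    and van: "\<And>j. n' \<le> j \<Longrightarrow> j < n \<Longrightarrow> (\<mu> j - \<rho>1) * (\<mu> j - \<rho>2) = 0"
    and S: "open S" "\<And>z. z \<in> S \<Longrightarrow> c + a * z \<in> X"
  defines "ul \<equiv> \<lambda>l z. u (c + a * z) $ l" and "v \<equiv> \<lambda>j z. if j < n' then u (c + a * z) $ (n + j) else 0"
  shows "\<And>l. l < n \<Longrightarrow> ul l holomorphic_on S" "\<And>j. j < n \<Longrightarrow> v j holomorphic_on S"
    "\<And>l z. l < n \<Longrightarrow> z \<in> S \<Longrightarrow> (z - \<sigma> l) * deriv (ul l) z = (\<Sum>m<n. A l m * ul m z) + (\<Sum>j<n. P l j * v j z)"
    "\<And>j z. j < n \<Longrightarrow> z \<in> S \<Longrightarrow>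
      z * deriv (v j) z = (\<rho>1 + \<rho>2 - \<mu> j) * v j z - (\<mu> j - \<rho>1) * (\<mu> j - \<rho>2) * (\<Sum>l<n. Q j l * ul l z)"
proof -
  have D: "((\<lambda>z. u (c + a * z) $ i) has_field_derivative deriv (\<lambda>x. u x $ i) (c + a * z) * a) (at z)"
    if "i < N" "z \<in> S" for i z
  proof -
    have "((\<lambda>z. c + a * z) has_field_derivative a) (at z)"
      by (auto intro!: derivative_eq_intros)
    from DERIV_chain2[OF solves_systemD(1)[OF sol Am T off S(2)[OF that(2)] that(1)] this] show ?thesis .
  qed
  have eq: "(c + a * z - Tm $$ (i, i)) * deriv (\<lambda>x. u x $ i) (c + a * z) =
      (\<Sum>m<n. Am $$ (i, m) * ul m z) + (\<Sum>j<n'. Am $$ (i, n + j) * v j z)" if "i < N" "z \<in> S" for i z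
    using solves_systemD(2)[OF sol Am T off S(2)[OF that(2)] that(1)]
    by (simp add: N(1) sum_lessThan_add ul_def v_def)
  have dul: "(ul l has_field_derivative deriv (\<lambda>x. u x $ l) (c + a * z) * a) (at z)" if "l < n" "z \<in> S" for l z
    unfolding ul_def using D[of l z] that N by simp
  have dv: "(v j has_field_derivative deriv (\<lambda>x. u x $ (n + j)) (c + a * z) * a) (at z)" if "j < n'" "z \<in> S" for j z
    unfolding v_def using D[of "n + j" z] that N by simp
  have v0: "v j = (\<lambda>_. 0)" if "n' \<le> j" for j using that by (auto simp: v_def)
  show "ul l holomorphic_on S" if "l < n" for l
    unfolding holomorphic_on_open[OF S(1)] using dul[OF that] by blast
  show "v j holomorphic_on S" if "j < n" for j
  proof (cases "j < n'")
    case True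
    then show ?thesis unfolding holomorphic_on_open[OF S(1)] using dv by blast
  next
    case False
    then show ?thesis by (simp add: v0)
  qed
  show "(z - \<sigma> l) * deriv (ul l) z = (\<Sum>m<n. A l m * ul m z) + (\<Sum>j<n. P l j * v j z)" if l: "l < n" and z: "z \<in> S" for l z
  proof -
    have "(z - \<sigma> l) * deriv (ul l) z = (c + a * z - Tm $$ (l, l)) * deriv (\<lambda>x. u x $ l) (c + a * z)"
      unfolding DERIV_imp_deriv[OF dul[OF l z]] Tl(1)[OF l] by (simp add: algebra_simps)
    also have "\<dots> = (\<Sum>m<n. A l m * ul m z) + (\<Sum>j<n'. P l j * v j z)"
      using eq[of l z] l z N e by simp
    also have "(\<Sum>j<n'. P l j * v j z) = (\<Sum>j<n. P l j * v j z)"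
      by (rule sum.mono_neutral_left) (use N v0 in auto)
    finally show ?thesis .
  qed
  show "z * deriv (v j) z = (\<rho>1 + \<rho>2 - \<mu> j) * v j z - (\<mu> j - \<rho>1) * (\<mu> j - \<rho>2) * (\<Sum>l<n. Q j l * ul l z)"
    if j: "j < n" and z: "z \<in> S" for j z
  proof (cases "j < n'")
    case True
    have "z * deriv (v j) z = (c + a * z - Tm $$ (n + j, n + j)) * deriv (\<lambda>x. u x $ (n + j)) (c + a * z)"
      unfolding DERIV_imp_deriv[OF dv[OF True z]] Tl(2)[OF True] by (simp add: algebra_simps)
    also have "\<dots> = (\<Sum>m<n. - ((\<mu> j - \<rho>1) * (\<mu> j - \<rho>2) * Q j m) * ul m z) + (\<Sum>k<n'. (if j = k then \<rho>1 + \<rho>2 - \<mu> j else 0) * v k z)"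
      using eq[of "n + j" z] True z N e by simp
    also have "(\<Sum>m<n. - ((\<mu> j - \<rho>1) * (\<mu> j - \<rho>2) * Q j m) * ul m z) = - ((\<mu> j - \<rho>1) * (\<mu> j - \<rho>2) * (\<Sum>l<n. Q j l * ul l z))"
      by (simp add: sum_distrib_left sum_negf mult.assoc)
    also have "(\<Sum>k<n'. (if j = k then \<rho>1 + \<rho>2 - \<mu> j else 0) * v k z) = (\<rho>1 + \<rho>2 - \<mu> j) * v j z"
      using True by (simp add: if_distrib[of "\<lambda>x. x * _"] cong: if_cong)
    finally show ?thesis by simp
  next
    case False
    then show ?thesis using van[of j] j by (simp add: v0)
  qed
qed

lemma local_form_family:
  fixes u :: "'k \<Rightarrow> complex \<Rightarrow> complex vec" and z :: "complex \<Rightarrow> complex"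
  assumes K: "finite K" and loc: "\<And>k. k \<in> K \<Longrightarrow> local_form D z (f k) (v k) (u k)"
    and f: "\<And>k x. k \<in> K \<Longrightarrow> x \<in> D \<Longrightarrow> f k x \<noteq> 0" and dim: "\<And>k. k \<in> K \<Longrightarrow> dim_vec (v k) = N"
    and near: "\<And>e. e > 0 \<Longrightarrow> \<exists>x\<in>D. 0 < norm (z x) \<and> norm (z x) < e"
  obtains r \<phi> where "r > 0" "\<And>k j. k \<in> K \<Longrightarrow> j < N \<Longrightarrow> \<phi> k j holomorphic_on ball 0 r"
    "\<And>k j. k \<in> K \<Longrightarrow> j < N \<Longrightarrow> \<phi> k j 0 = v k $ j"
    "\<And>k j x. k \<in> K \<Longrightarrow> j < N \<Longrightarrow> x \<in> D \<Longrightarrow> norm (z x) < r \<Longrightarrow> u k x $ j = f k x * \<phi> k j (z x)"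
proof -
  have "\<forall>k\<in>K. \<exists>p. fst p > 0 \<and> (\<forall>j<N. snd p j holomorphic_on ball 0 (fst p) \<and> snd p j 0 = v k $ j \<and>
      (\<forall>x\<in>D. norm (z x) < fst p \<longrightarrow> u k x $ j = f k x * snd p j (z x)))"
  proof
    fix k assume k: "k \<in> K"
    obtain r \<phi> where "r > 0" "\<And>j. j < dim_vec (v k) \<Longrightarrow> \<phi> j holomorphic_on ball 0 r"
      "\<And>j. j < dim_vec (v k) \<Longrightarrow> \<phi> j 0 = v k $ j"
      "\<And>j x. j < dim_vec (v k) \<Longrightarrow> x \<in> D \<Longrightarrow> norm (z x) < r \<Longrightarrow> u k x $ j = f k x * \<phi> j (z x)"
      using local_form_obtains[OF loc[OF k] f[OF k] near] by metis
    then show "\<exists>p. fst p > 0 \<and> (\<forall>j<N. snd p j holomorphic_on ball 0 (fst p) \<and> snd p j 0 = v k $ j \<and>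
        (\<forall>x\<in>D. norm (z x) < fst p \<longrightarrow> u k x $ j = f k x * snd p j (z x)))"
      by (intro exI[of _ "(r, \<phi>)"]) (simp add: dim[OF k])
  qed
  from bchoice[OF this] obtain p where
    p: "\<And>k. k \<in> K \<Longrightarrow> fst (p k) > 0 \<and> (\<forall>j<N. snd (p k) j holomorphic_on ball 0 (fst (p k)) \<and> snd (p k) j 0 = v k $ j \<and>
      (\<forall>x\<in>D. norm (z x) < fst (p k) \<longrightarrow> u k x $ j = f k x * snd (p k) j (z x)))"
    by (elim exE) auto
  \<comment> \<open>The element \<open>1\<close> keeps the minimum well defined for an empty family,
    which occurs at \<open>t_(p+1)\<close> when \<open>q = 2\<close>.\<close>
  define r where "r = Min (insert 1 ((\<lambda>k. fst (p k)) ` K))"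
  have r: "r \<le> fst (p k)" if "k \<in> K" for k
    unfolding r_def by (rule Min_le) (use K that in auto)
  show ?thesis
  proof (rule that[of r "\<lambda>k. snd (p k)"])
    show "r > 0" unfolding r_def using K p by auto
    fix k j assume kj: "k \<in> K" "j < N"
    have "snd (p k) j holomorphic_on ball 0 (fst (p k))" using p[OF kj(1)] kj(2) by blast
    then show "snd (p k) j holomorphic_on ball 0 r"
      by (rule holomorphic_on_subset) (rule subset_ball[OF r[OF kj(1)]])
    show "snd (p k) j 0 = v k $ j" using p kj by blast
    fix x assume "x \<in> D" "norm (z x) < r"
    then show "u k x $ j = f k x * snd (p k) j (z x)"
      using p[OF kj(1)] kj(2) r[OF kj(1)] by auto
  qed
qed

text \<open>Replacing \<open>d\<close> by the smaller of its modulus and the complement to a full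
  turn does not change the cosine and brings it to \<open>[0, pi]\<close>, where the cosine is
  strictly decreasing.\<close>

lemma cis_angle_ne:
  fixes x d :: real
  assumes "\<bar>x\<bar> < \<kappa>" "\<kappa> < \<bar>d\<bar>" "\<bar>d\<bar> < 2 * pi - \<kappa>" "\<kappa> \<le> pi"
  shows "cis d \<noteq> cis x"
proof
  assume "cis d = cis x"
  then have "cos d = cos x" by (metis cis.sel(1))
  moreover have "cos d = cos (min \<bar>d\<bar> (2 * pi - \<bar>d\<bar>))"
    by (auto simp: min_def abs_if cos_diff)
  moreover have "cos (min \<bar>d\<bar> (2 * pi - \<bar>d\<bar>)) < cos \<bar>x\<bar>"
    by (rule cos_monotone_0_pi) (use assms in auto)
  ultimately show False by simp
qed

text \<open>The cut towards \<open>\<eta> + 1 / tt i\<close> corresponds to \<open>z \<in> [1, \<infinity>[\<close>; all other cuts make an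
  angle of at least \<open>\<kappa>\<close> with it.\<close>

lemma moebius_in_cut_plane:
  fixes \<theta> :: "nat \<Rightarrow> real" and tt :: "nat \<Rightarrow> complex"
  assumes tt: "\<And>j. j \<in> {1..p} \<Longrightarrow> tt j = rcis (norm (tt j)) (\<theta> j)" "\<And>j. j \<in> {1..p} \<Longrightarrow> tt j \<noteq> 0"
    and i: "i \<in> {1..p}"
    and gap: "\<And>j. j \<in> {1..p+1} \<Longrightarrow> j \<noteq> i \<Longrightarrow> \<kappa> < \<bar>\<theta> j - \<theta> i\<bar> \<and> \<bar>\<theta> j - \<theta> i\<bar> < 2 * pi - \<kappa>" and k: "\<kappa> \<le> pi"
    and z: "z \<noteq> 0" "\<bar>Im (Ln z)\<bar> < \<kappa>" "1 - z \<notin> \<real>\<^sub>\<le>\<^sub>0"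
  shows "\<eta> + 1 / (tt i * z) \<in> UNIV - ((\<Union>j\<in>{1..p}. closed_segment \<eta> (\<eta> + 1 / tt j)) \<union> {\<eta> + of_real s * cis (- \<theta> (p + 1)) | s. s \<ge> 0})"
proof -
  have zc: "z = of_real (norm z) * cis (Im (Ln z))"
  proof -
    have "z = exp (Ln z)" using z by simp
    also have "\<dots> = of_real (exp (Re (Ln z))) * cis (Im (Ln z))" by (rule exp_eq_polar)
    finally show ?thesis using z by (simp add: Re_Ln)
  qed
  have az: "tt i * z = of_real (norm (tt i) * norm z) * cis (\<theta> i + Im (Ln z))"
    by (subst zc, subst tt(1)[OF i]) (simp add: rcis_def cis_mult[symmetric] mult_ac)
  have pos: "norm (tt i) * norm z > 0" using tt(2)[OF i] z by simp
  have no: "of_real x * cis (\<theta> j) \<noteq> tt i * z" if "0 < x" "j \<in> {1..p+1}" "j \<noteq> i" for x j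
  proof
    assume eq: "of_real x * cis (\<theta> j) = tt i * z"
    then have "norm (of_real x * cis (\<theta> j)) = norm (tt i * z)" by simp
    then have "x = norm (tt i) * norm z" using that(1) by (simp add: norm_mult)
    then have "cis (\<theta> j) = cis (\<theta> i + Im (Ln z))" using eq pos az tt(2)[OF i] z(1) by simp
    then have "cis (\<theta> j - \<theta> i) = cis (Im (Ln z))"
      by (metis add_diff_cancel_left' cis_divide)
    then show False using cis_angle_ne[OF z(2) _ _ k] gap[OF that(2,3)] by blast
  qed
  have nz: "tt i * z \<noteq> 0" using tt(2)[OF i] z by simp
  have "\<eta> + 1 / (tt i * z) \<notin> closed_segment \<eta> (\<eta> + 1 / tt j)" if j: "j \<in> {1..p}" for j
  proof
    assume "\<eta> + 1 / (tt i * z) \<in> closed_segment \<eta> (\<eta> + 1 / tt j)"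
    then obtain s where s: "0 \<le> s" "s \<le> 1" "\<eta> + 1 / (tt i * z) = (1 - s) *\<^sub>R \<eta> + s *\<^sub>R (\<eta> + 1 / tt j)"
      by (auto simp: in_segment)
    then have e: "1 / (tt i * z) = of_real s / tt j" by (simp add: scaleR_conv_of_real algebra_simps)
    then have s0: "s \<noteq> 0" using nz by auto
    have e': "tt j = of_real s * (tt i * z)" using e nz tt(2)[OF j] by (simp add: field_simps)
    show False
    proof (cases "j = i")
      case True
      then have "of_real s * z = 1" using e' tt(2)[OF i] by simp
      then have "z = of_real (1 / s)" using s0 by (simp add: field_simps)
      then have "1 - z = of_real (1 - 1 / s)" by simp
      moreover have "1 - 1 / s \<le> 0" using s s0 by (simp add: field_simps)
      ultimately show False using z(3) by (metis nonpos_Reals_of_real_iff)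
    next
      case False
      have "of_real (norm (tt j) / s) * cis (\<theta> j) = tt j / of_real s"
        by (subst (2) tt(1)[OF j]) (simp add: rcis_def)
      also have "\<dots> = tt i * z" using e' s0 by simp
      finally show False using no[of "norm (tt j) / s" j] False j s s0 tt(2)[OF j] by simp
    qed
  qed
  moreover have "\<eta> + 1 / (tt i * z) \<noteq> \<eta> + of_real s * cis (- \<theta> (p + 1))" if "s \<ge> 0" for s
  proof
    assume "\<eta> + 1 / (tt i * z) = \<eta> + of_real s * cis (- \<theta> (p + 1))"
    then have e: "1 / (tt i * z) = of_real s * cis (- \<theta> (p + 1))" by simp
    then have s0: "s \<noteq> 0" using nz by auto
    have "tt i * z = 1 / (1 / (tt i * z))" by simp
    also have "\<dots> = 1 / (of_real s * cis (- \<theta> (p + 1)))" unfolding e ..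
    also have "\<dots> = of_real (inverse s) * cis (\<theta> (p + 1))"
      by (simp add: divide_inverse cis_inverse)
    finally have "of_real (inverse s) * cis (\<theta> (p + 1)) = tt i * z" ..
    then show False using no[of "inverse s" "p + 1"] i that s0 by auto
  qed
  ultimately show ?thesis by auto
qed

section \<open>The connection formula\<close>

theorem theorem7p18:
  fixes p q n N :: nat
    and nn r m :: "nat \<Rightarrow> nat" and ell :: "nat \<Rightarrow> nat \<Rightarrow> nat"
    and t t' :: "nat \<Rightarrow> complex" and \<eta>0 :: complex
    and lam :: "nat \<Rightarrow> nat \<Rightarrow> complex" and mu :: "nat \<Rightarrow> complex"
    and \<theta> :: "nat \<Rightarrow> real" and \<delta> :: real
    and T A A' P Pinv AP A'' T'' T' :: "complex mat"
    and Sp Sm :: "nat \<Rightarrow> complex set" and D' :: "complex set"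
    and U :: "nat \<Rightarrow> nat \<Rightarrow> nat \<Rightarrow> complex \<Rightarrow> complex vec"
    and V :: "nat \<Rightarrow> nat \<Rightarrow> complex \<Rightarrow> complex vec"
    and w :: "nat \<Rightarrow> nat \<Rightarrow> nat \<Rightarrow> complex \<Rightarrow> complex vec"
    and winf :: "nat \<Rightarrow> nat \<Rightarrow> complex \<Rightarrow> complex vec"
    and c :: "nat \<Rightarrow> nat \<Rightarrow> nat \<Rightarrow> nat \<Rightarrow> nat \<Rightarrow> complex"
    and C :: "real \<Rightarrow> nat \<Rightarrow> nat \<Rightarrow> nat \<Rightarrow> nat \<Rightarrow> nat \<Rightarrow> complex"
  \<comment> \<open>block sizes\<close>
  assumes p: "p \<ge> 1" and q: "q \<ge> 2"
    and sizes_pos: "\<And>i. i \<in> {1..p} \<Longrightarrow> nn i > 0"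
      "\<And>i k. i \<in> {1..p} \<Longrightarrow> k \<in> {1..r i} \<Longrightarrow> ell i k > 0"
      "\<And>k. k \<in> {1..q} \<Longrightarrow> m k > 0"
    and n_sum: "n = (\<Sum>i=1..p. nn i)"
    and ell_sum: "\<And>i. i \<in> {1..p} \<Longrightarrow> (\<Sum>k=1..r i. ell i k) = nn i"
    and m_sum: "(\<Sum>k=1..q. m k) = n"
    and N: "N = 2 * n - m (q - 1) - m q"
  \<comment> \<open>singular points\<close>
    and t_distinct: "inj_on t {1..p+1}"
    and t_noncollinear: "\<And>i j k. i \<in> {1..p+1} \<Longrightarrow> j \<in> {1..p+1} \<Longrightarrow> k \<in> {1..p+1} \<Longrightarrow>
      i \<noteq> j \<Longrightarrow> j \<noteq> k \<Longrightarrow> i \<noteq> k \<Longrightarrow> \<not> collinear {t i, t j, t k}"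
  \<comment> \<open>the matrices\<close>
    and T: "T = block_scalar p nn t"
    and A: "A \<in> carrier_mat n n"
      "\<And>i. i \<in> {1..p} \<Longrightarrow>
         diag_subblock A (\<Sum>j=1..<i. nn j) (nn i) = block_scalar (r i) (ell i) (lam i)"
    and P: "P \<in> carrier_mat n n" "Pinv \<in> carrier_mat n n" "inverts_mat P Pinv" "inverts_mat Pinv P"
    and A': "A' = Pinv * A * P" "A' = block_scalar q m mu"
    and AP: "AP = four_block_mat A P
      (- ((A' - mu (q - 1) \<cdot>\<^sub>m 1\<^sub>m n) * (A' - mu q \<cdot>\<^sub>m 1\<^sub>m n) * Pinv))
      ((mu (q - 1) + mu q) \<cdot>\<^sub>m 1\<^sub>m n - A')"
    and A'': "A'' = diag_subblock AP 0 N"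
    and T'': "T'' = diag_block_mat [T, t (p + 1) \<cdot>\<^sub>m 1\<^sub>m (n - m (q - 1) - m q)]"
  \<comment> \<open>nothing is an integer\<close>
    and lam_nonint: "\<And>i k. i \<in> {1..p} \<Longrightarrow> k \<in> {1..r i} \<Longrightarrow> lam i k \<notin> \<int>"
    and lam_diff_nonint: "\<And>i k h. i \<in> {1..p} \<Longrightarrow> k \<in> {1..r i} \<Longrightarrow> h \<in> {1..r i} \<Longrightarrow> k \<noteq> h \<Longrightarrow>
      lam i k - lam i h \<notin> \<int>"
    and mu_nonint: "\<And>k. k \<in> {1..q} \<Longrightarrow> mu k \<notin> \<int>"
    and mu_diff_nonint: "\<And>k h. k \<in> {1..q} \<Longrightarrow> h \<in> {1..q} \<Longrightarrow> k \<noteq> h \<Longrightarrow> mu k - mu h \<notin> \<int>"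
    and lam_mu_nonint: "\<And>i k h. i \<in> {1..p} \<Longrightarrow> k \<in> {1..r i} \<Longrightarrow> h \<in> {1..q} \<Longrightarrow> lam i k - mu h \<notin> \<int>"
    \<comment> \<open>implicit in the uniqueness of the solutions at \<open>t (p + 1)\<close> and the finiteness of
      \<open>\<Gamma>(mu k - mu (q - 1) - mu q)\<close>\<close>
    and exponent_nonint: "\<And>k. k \<in> {1..q-2} \<Longrightarrow> mu (q - 1) + mu q - mu k \<notin> \<int>"
  \<comment> \<open>arguments and sectors\<close>
    and \<theta>_arg: "\<And>i. i \<in> {1..p} \<Longrightarrow> t i - t (p + 1) = rcis (norm (t i - t (p + 1))) (\<theta> i)"
    and \<theta>_mono: "strict_mono_on {1..p} \<theta>"
    and \<theta>_last: "\<theta> p < \<theta> (p + 1)" "\<theta> (p + 1) < \<theta> 1 + 2 * pi"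
    and \<theta>_0: "\<theta> 0 = \<theta> (p + 1) - 2 * pi"
    and \<delta>: "\<delta> > 0" "\<And>i. i \<in> {0..p} \<Longrightarrow> \<delta> < \<theta> (i + 1) - \<theta> i"
    and Sp: "\<And>i. i \<in> {1..p} \<Longrightarrow>
      Sp i = sector (t (p + 1)) (\<theta> i) (min (\<theta> (i + 1) - \<delta>) (\<theta> i + pi))"
    and Sm: "\<And>i. i \<in> {1..p} \<Longrightarrow>
      Sm i = sector (t (p + 1)) (max (\<theta> (i - 1) + \<delta>) (\<theta> i - pi)) (\<theta> i)"
  \<comment> \<open>local solutions\<close>
    and U: "\<And>i k h. i \<in> {1..p} \<Longrightarrow> k \<in> {1..r i} \<Longrightarrow> h \<in> {1..ell i k} \<Longrightarrow>
      solves_system T'' A'' (Sp i \<union> Sm i) (U i k h) \<and>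
      local_form (Sp i \<union> Sm i) (\<lambda>x. x - t i) (\<lambda>x. pow_from (\<theta> i - pi) (x - t i) (lam i k))
        (eps N ((\<Sum>j=1..<i. nn j) + (\<Sum>j=1..<k. ell i j) + h)) (U i k h)"
    and V: "\<And>k h. k \<in> {1..q-2} \<Longrightarrow> h \<in> {1..m k} \<Longrightarrow>
      solves_system T'' A'' (\<Union>i\<in>{1..p}. Sp i \<union> Sm i) (V k h) \<and>
      local_form (\<Union>i\<in>{1..p}. Sp i \<union> Sm i) (\<lambda>x. x - t (p + 1))
        (\<lambda>x. pow_from (\<theta> 0) (x - t (p + 1)) (mu (q - 1) + mu q - mu k))
        (eps N (n + (\<Sum>j=1..<k. m j) + h)) (V k h)"
  \<comment> \<open>the underlying system\<close>
    and t': "\<And>i. i \<in> {1..p} \<Longrightarrow> t' i = \<eta>0 + 1 / (t i - t (p + 1))"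
    and T': "T' = block_scalar p nn t'"
    and D': "D' = UNIV - ((\<Union>i\<in>{1..p}. closed_segment \<eta>0 (t' i)) \<union>
      {\<eta>0 + of_real s * cis (- \<theta> (p + 1)) | s. s \<ge> 0})"
    and w: "\<And>i k h. i \<in> {1..p} \<Longrightarrow> k \<in> {1..r i} \<Longrightarrow> h \<in> {1..ell i k} \<Longrightarrow>
      solves_system T' A D' (w i k h) \<and>
      local_form D' (\<lambda>z. z - t' i) (\<lambda>z. pow_from (- \<theta> i - pi) (z - t' i) (lam i k))
        (eps n ((\<Sum>j=1..<i. nn j) + (\<Sum>j=1..<k. ell i j) + h)) (w i k h)"
    and winf: "\<And>k h. k \<in> {1..q} \<Longrightarrow> h \<in> {1..m k} \<Longrightarrow>
      solves_system T' A D' (winf k h) \<and>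
      local_form D' (\<lambda>z. 1 / (z - \<eta>0)) (\<lambda>z. pow_from (- \<theta> (p + 1)) (z - \<eta>0) (mu k))
        (P *\<^sub>v eps n ((\<Sum>j=1..<k. m j) + h)) (winf k h)"
    and c: "\<And>i k h z j. i \<in> {1..p} \<Longrightarrow> k \<in> {1..r i} \<Longrightarrow> h \<in> {1..ell i k} \<Longrightarrow> z \<in> D' \<Longrightarrow> j < n \<Longrightarrow>
      w i k h z $ j = (\<Sum>k'=1..q. \<Sum>h'=1..m k'. c k' h' i k h * winf k' h' z $ j)"
  \<comment> \<open>the coefficients; the first argument is the sign\<close>
    and C: "\<And>s k' h' i k h. C s k' h' i k h =
      exp (of_real s * of_real pi * \<i> * lam i k) *
      pow_arg (\<theta> i) (t i - t (p + 1)) (2 * lam i k - mu (q - 1) - mu q) *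
      (Gamma (mu k' + 1) * Gamma (mu k' - mu (q - 1) - mu q) /
        (Gamma (mu k' - mu (q - 1)) * Gamma (mu k' - mu q))) *
      c k' h' i k h"
  shows "\<forall>i\<in>{1..p}. \<forall>k\<in>{1..r i}. \<forall>h\<in>{1..ell i k}.
    (\<exists>H :: complex \<Rightarrow> complex vec.
       (\<forall>j<N. (\<lambda>x. H x $ j) analytic_on {t (p + 1)}) \<and>
       (\<forall>x\<in>Sp i. \<forall>j<N. U i k h x $ j =
          (\<Sum>k'=1..q-2. \<Sum>h'=1..m k'. C 1 k' h' i k h * V k' h' x $ j) + H x $ j)) \<and>
    (\<exists>H :: complex \<Rightarrow> complex vec.
       (\<forall>j<N. (\<lambda>x. H x $ j) analytic_on {t (p + 1)}) \<and>
       (\<forall>x\<in>Sm i. \<forall>j<N. U i k h x $ j =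
          (\<Sum>k'=1..q-2. \<Sum>h'=1..m k'. C (-1) k' h' i k h * V k' h' x $ j) + H x $ j))"
proof (intro ballI)
  fix i k h
  assume i: "i \<in> {1..p}" and k: "k \<in> {1..r i}" and h: "h \<in> {1..ell i k}"
  define c0 where "c0 = t (p + 1)"
  define a where "a = t i - c0"
  \<comment> \<open>The logarithm of \<open>a\<close> with the prescribed argument
    \<open>\<theta> i\<close>. All powers of \<open>a\<close> below are exponentials of multiples of
    it.\<close>
  define L where "L = Complex (ln (norm a)) (\<theta> i)"
  define \<rho>1 where "\<rho>1 = mu (q - 1)"
  define \<rho>2 where "\<rho>2 = mu q"
  define n' where "n' = n - m (q - 1) - m q"
  define \<sigma> where "\<sigma> = (\<lambda>l. (T $$ (l, l) - c0) / a)"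
  define Af where "Af = (\<lambda>l j. A $$ (l, j))"
  define Pf where "Pf = (\<lambda>l j. P $$ (l, j))"
  define Qf where "Qf = (\<lambda>l j. Pinv $$ (l, j))"
  define \<mu> where "\<mu> = (\<lambda>j. A' $$ (j, j))"
  define \<nu> where "\<nu> = lam i k"
  \<comment> \<open>Pairs of a block and a position in it. \<open>K0\<close> leaves out the blocks
    of \<open>\<rho>1\<close> and \<open>\<rho>2\<close>.\<close>
  define K where "K = Sigma {1..q} (\<lambda>k. {1..m k})"
  define K0 where "K0 = Sigma {1..q-2} (\<lambda>k. {1..m k})"
  define mk where "mk = (\<lambda>kh :: nat \<times> nat. mu (fst kh))"
  \<comment> \<open>Positions in the blocks run from 1, indices of vectors from 0; the subtraction
    is genuine since positions in \<open>K\<close> are positive.\<close>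
  define idx where "idx = (\<lambda>kh :: nat \<times> nat. (\<Sum>j=1..<fst kh. m j) + snd kh - 1)"
  define ix where "ix = (\<Sum>j=1..<i. nn j) + ((\<Sum>j=1..<k. ell i j) + h - 1)"

  have a: "a \<noteq> 0"
    using t_distinct i unfolding a_def c0_def inj_on_def by force
  have eL: "exp L = a"
    using \<theta>_arg[OF i] a by (simp add: L_def exp_eq_polar rcis_def a_def c0_def)
  have imL: "Im L = \<theta> i" by (simp add: L_def)

  \<comment> \<open>Blocks, eigenvalues and exponents\<close>
  have msum: "n = (\<Sum>k=1..<q-1. m k) + m (q - 1) + m q"
  proof -
    have "{1..q} = insert q (insert (q - 1) {1..<q-1})" using q by auto
    moreover have "q \<notin> insert (q - 1) {1..<q-1}" "q - 1 \<notin> {1..<q-1}" using q by auto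
    ultimately show ?thesis unfolding m_sum[symmetric] by simp
  qed
  have n': "n' = (\<Sum>k=1..<q-1. m k)" "n' \<le> n" "N = n + n'"
    using msum by (simp_all add: n'_def N)
  have K: "finite K" "finite K0" "K0 \<subseteq> K" unfolding K_def K0_def by auto
  have idx: "idx kh < n" "mk kh = \<mu> (idx kh)" if kK: "kh \<in> K" for kh
  proof -
    obtain k h where kh: "kh = (k, h)" "k \<in> {1..q}" "h \<in> {1..m k}" using kK unfolding K_def by blast
    then have e: "idx kh = (\<Sum>j=1..<k. m j) + (h - 1)" "h - 1 < m k" by (auto simp: idx_def)
    show "idx kh < n" unfolding e m_sum[symmetric] by (rule sum_before_less[where s = m, OF kh(2) e(2)])
    have "A' $$ (idx kh, idx kh) = mu k"
      unfolding A'(2) e by (rule block_scalar_diag[where s = m, OF kh(2) e(2)])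
    then show "mk kh = \<mu> (idx kh)" by (simp add: mk_def \<mu>_def kh(1))
  qed
  have idx0: "idx kh < n'" if kK: "kh \<in> K0" for kh
  proof -
    obtain k h where kh: "kh = (k, h)" "k \<in> {1..q-2}" "h \<in> {1..m k}" using kK unfolding K0_def by blast
    then have e: "idx kh = (\<Sum>j=1..<k. m j) + (h - 1)" "h - 1 < m k" by (auto simp: idx_def)
    have "{1..q-2} = {1..<q-1}" using q by auto
    then show ?thesis using sum_before_less[where s = m, OF kh(2) e(2)] by (simp add: e n'(1))
  qed
  have A'c: "A' \<in> carrier_mat n n" using A(1) P(1,2) by (simp add: A'(1))
  have A'off: "A' $$ (x, y) = 0" if "x < n" "y < n" "x \<noteq> y" for x y
    using that m_sum by (simp add: A'(2) block_scalar_offdiag)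
  have \<mu>blk: "\<exists>k\<in>{1..q}. \<mu> j = mu k \<and> (n' \<le> j \<longrightarrow> q - 1 \<le> k)" if "j < n" for j
  proof -
    have "j < (\<Sum>k=1..q. m k)" using that m_sum by simp
    then obtain k h where kh: "k \<in> {1..q}" "h < m k" "j = (\<Sum>j=1..<k. m j) + h"
      by (rule block_index_exists)
    have "\<mu> j = mu k" using block_scalar_diag[where s = m and c = mu, OF kh(1,2)] by (simp add: \<mu>_def A'(2) kh(3))
    moreover have "q - 1 \<le> k" if "n' \<le> j"
    proof (rule ccontr)
      assume "\<not> q - 1 \<le> k"
      then have kq: "k \<in> {1..q-2}" "{1..q-2} = {1..<q-1}" using kh(1) by auto
      show False using sum_before_less[where s = m, OF kq(1) kh(2)] that unfolding kq(2) n'(1) kh(3) by simp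
    qed
    ultimately show ?thesis using kh(1) by blast
  qed
  have van: "(\<mu> j - \<rho>1) * (\<mu> j - \<rho>2) = 0" if j: "n' \<le> j" "j < n" for j
  proof -
    obtain k where k: "k \<in> {1..q}" "\<mu> j = mu k" "q - 1 \<le> k" using \<mu>blk[OF j(2)] j(1) by blast
    then have "k = q - 1 \<or> k = q" by auto
    then show ?thesis using k(2) by (auto simp: \<rho>1_def \<rho>2_def)
  qed

  have Tblk: "\<exists>i'\<in>{1..p}. T $$ (l, l) = t i' \<and> T' $$ (l, l) = t' i' \<and> (\<exists>h'<nn i'. l = (\<Sum>j=1..<i'. nn j) + h')" if "l < n" for l
  proof -
    have "l < (\<Sum>j=1..p. nn j)" using that n_sum by simp
    then obtain i' h' where "i' \<in> {1..p}" "h' < nn i'" "l = (\<Sum>j=1..<i'. nn j) + h'"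
      by (rule block_index_exists)
    then show ?thesis unfolding T T' using block_scalar_diag[where s = nn] by blast
  qed
  have Toff: "T $$ (x, y) = 0" "T' $$ (x, y) = 0" if "x < n" "y < n" "x \<noteq> y" for x y
    using that n_sum by (simp_all add: T T' block_scalar_offdiag)
  have Tc: "T \<in> carrier_mat n n" "T' \<in> carrier_mat n n" by (intro carrier_matI; simp add: T T' n_sum)+
  have t_ne: "t i' \<noteq> c0" if "i' \<in> {1..p}" for i'
    using t_distinct that unfolding c0_def inj_on_def by force
  have T\<sigma>: "T $$ (l, l) = c0 + a * \<sigma> l" for l using a by (simp add: \<sigma>_def)
  have \<sigma>nz: "\<sigma> l \<noteq> 0" if l: "l < n" for l
  proof -
    obtain i' where "i' \<in> {1..p}" "T $$ (l, l) = t i'"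
      using Tblk[OF l] by blast
    then show ?thesis using t_ne[of i'] a by (simp add: \<sigma>_def)
  qed
  have T'\<sigma>: "T' $$ (l, l) = \<eta>0 + 1 / (a * \<sigma> l)" if l: "l < n" for l
  proof -
    obtain i' where i': "i' \<in> {1..p}" "T $$ (l, l) = t i'" "T' $$ (l, l) = t' i'"
      using Tblk[OF l] by blast
    have "a * \<sigma> l = t i' - c0" using a by (simp add: \<sigma>_def i'(2))
    then show ?thesis using t'[OF i'(1)] i'(3) by (simp add: c0_def)
  qed
  have \<sigma>1: "\<exists>h'<nn i. l = (\<Sum>j=1..<i. nn j) + h'" if l: "l < n" and "\<sigma> l = 1" for l
  proof -
    obtain i' h' where i': "i' \<in> {1..p}" "T $$ (l, l) = t i'" "h' < nn i'" "l = (\<Sum>j=1..<i'. nn j) + h'"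
      using Tblk[OF l] by blast
    have "t i' = t i" using that(2) T\<sigma>[of l] i'(2) by (simp add: a_def)
    then have "i' = i" using t_distinct i i'(1) unfolding inj_on_def by force
    then show ?thesis using i' by blast
  qed
  have elli: "(\<Sum>j=1..<k. ell i j) + h - 1 < nn i"
    using sum_before_less[where s = "ell i" and h = "h - 1", OF k] h ell_sum[OF i] by auto
  have \<sigma>ix: "\<sigma> ix = 1" "ix < n"
  proof -
    have "T $$ (ix, ix) = t i" unfolding T ix_def by (rule block_scalar_diag[where s = nn, OF i elli])
    then show "\<sigma> ix = 1" using a by (simp add: \<sigma>_def a_def)
    show "ix < n" unfolding ix_def n_sum by (rule sum_before_less[where s = nn, OF i elli])
  qed
  have Aii: "Af ((\<Sum>j=1..<i. nn j) + x) ((\<Sum>j=1..<i. nn j) + y) = block_scalar (r i) (ell i) (lam i) $$ (x, y)"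
    if "x < nn i" "y < nn i" for x y
    unfolding A(2)[OF i, symmetric] using that by (simp add: Af_def diag_subblock_def)
  have A0: "Af l j = 0" if lj: "l < n" "j < n" "\<sigma> l = 1" "\<sigma> j = 1" "l \<noteq> j" for l j
  proof -
    obtain x y where xy: "x < nn i" "l = (\<Sum>j=1..<i. nn j) + x" "y < nn i" "j = (\<Sum>j=1..<i. nn j) + y"
      using \<sigma>1[OF lj(1,3)] \<sigma>1[OF lj(2,4)] by blast
    show ?thesis unfolding xy(2,4) Aii[OF xy(1,3)]
      by (rule block_scalar_offdiag) (use xy lj ell_sum[OF i] in auto)
  qed
  \<comment> \<open>The diagonal entries of \<open>A\<close> in block \<open>i\<close> are the
    \<open>lam i k'\<close>, so equality would make a difference of two of them a positive
    integer.\<close>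
  have A1: "\<nu> + of_nat M \<noteq> Af l l" if l: "l < n" "\<sigma> l = 1" "0 < M" for l M
  proof
    assume eq: "\<nu> + of_nat M = Af l l"
    obtain x where x: "x < nn i" "l = (\<Sum>j=1..<i. nn j) + x"
      using \<sigma>1[OF l(1,2)] by blast
    have "x < (\<Sum>j=1..r i. ell i j)" using x ell_sum[OF i] by simp
    then obtain k' h' where k': "k' \<in> {1..r i}" "h' < ell i k'" "x = (\<Sum>j=1..<k'. ell i j) + h'"
      by (rule block_index_exists)
    have "Af l l = block_scalar (r i) (ell i) (lam i) $$ (x, x)" unfolding x(2) by (rule Aii[OF x(1,1)])
    also have "\<dots> = lam i k'" unfolding k'(3) by (rule block_scalar_diag[where s = "ell i", OF k'(1,2)])
    finally have "Af l l = lam i k'" .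
    then have "lam i k' = lam i k + of_nat M" using eq by (simp add: \<nu>_def)
    then have "lam i k' - lam i k = of_nat M" by simp
    then have "lam i k' - lam i k \<in> \<int>" by simp
    then have "k' = k" using lam_diff_nonint[OF i k'(1) k] by blast
    then show False using eq \<open>Af l l = lam i k'\<close> l(3) by (simp add: \<nu>_def)
  qed
  have \<mu>m: "\<mu> j - mk kh \<notin> \<int> \<or> \<mu> j = mk kh" if j: "j < n" "kh \<in> K" for j kh
  proof -
    obtain k1 where k1: "k1 \<in> {1..q}" "\<mu> j = mu k1" using \<mu>blk[OF j(1)] by blast
    moreover have "fst kh \<in> {1..q}" using j(2) by (auto simp: K_def)
    ultimately show ?thesis using mu_diff_nonint[of k1 "fst kh"] by (cases "k1 = fst kh") (auto simp: mk_def)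
  qed
  have mk1: "mk kh \<notin> \<int>" if "kh \<in> K" for kh
    using that mu_nonint by (auto simp: K_def mk_def)
  \<comment> \<open>For the last two blocks the expression reduces to \<open>mu q\<close> or
    \<open>mu (q - 1)\<close>.\<close>
  have mk2: "\<rho>1 + \<rho>2 - mk kh \<notin> \<int>" if "kh \<in> K" for kh
  proof -
    have "fst kh \<in> {1..q-2} \<or> fst kh = q - 1 \<or> fst kh = q" using that by (auto simp: K_def)
    then show ?thesis
      using exponent_nonint[of "fst kh"] mu_nonint[of q] mu_nonint[of "q - 1"] q by (auto simp: \<rho>1_def \<rho>2_def mk_def)
  qed
  have mk3: "mk kh = \<rho>1 \<or> mk kh = \<rho>2" if "kh \<in> K - K0" for kh
  proof -
    have "fst kh = q - 1 \<or> fst kh = q" using that by (auto simp: K_def K0_def)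
    then show ?thesis by (auto simp: \<rho>1_def \<rho>2_def mk_def)
  qed
  have \<nu>1: "\<nu> \<notin> \<int>" "\<nu> - \<rho>2 \<notin> \<int>"
    using lam_nonint[OF i k] lam_mu_nonint[OF i k, of q] q by (auto simp: \<nu>_def \<rho>2_def)

  \<comment> \<open>Angles, cuts and points near the singularities\<close>
  have \<theta>_less: "\<theta> x < \<theta> y" if "x < y" "y \<le> p + 1" for x y
  proof -
    have mid: "\<theta> x < \<theta> y" if "1 \<le> x" "x < y" "y \<le> p" for x y
      using \<theta>_mono that by (auto simp: strict_mono_on_def)
    have le: "\<theta> 1 \<le> \<theta> y \<and> \<theta> y \<le> \<theta> p" if "1 \<le> y" "y \<le> p" for y
      using mid[of 1 y] mid[of y p] that by (cases "y = 1"; cases "y = p") auto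
    show ?thesis
      using mid[of x y] le[of x] le[of y] that \<theta>_last \<theta>_0 p
      by (cases "x = 0"; cases "y = p + 1") (auto simp: Suc_le_eq)
  qed
  \<comment> \<open>Angular clearance of the ray through \<open>t i\<close>: a deviation below
    \<open>\<kappa>1\<close> stays within the \<open>\<delta>\<close> margins towards both
    neighbouring rays. The bound \<open>1\<close> is a convenient value below
    \<open>pi\<close>.\<close>
  define \<kappa>1 where "\<kappa>1 = min 1 (min (\<theta> (i + 1) - \<delta> - \<theta> i) (\<theta> i - \<theta> (i - 1) - \<delta>))"
  have \<kappa>1: "0 < \<kappa>1" "\<kappa>1 \<le> 1" "\<kappa>1 \<le> \<theta> (i + 1) - \<delta> - \<theta> i" "\<kappa>1 \<le> \<theta> i - \<theta> (i - 1) - \<delta>"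
    using \<delta>(2)[of i] \<delta>(2)[of "i - 1"] i by (auto simp: \<kappa>1_def)
  have pi3: "3 < pi" using pi_gt3 by simp
  have \<theta>_le: "\<theta> x \<le> \<theta> y" if "x \<le> y" "y \<le> p + 1" for x y
    using \<theta>_less[of x y] that by (cases "x = y") auto
  \<comment> \<open>The angles \<open>\<theta> 0\<close> and \<open>\<theta> (p + 1)\<close> belong
    to the same ray, and this bounds the distances from above as well as from below.\<close>
  have gap: "\<kappa>1 < \<bar>\<theta> j - \<theta> i\<bar> \<and> \<bar>\<theta> j - \<theta> i\<bar> < 2 * pi - \<kappa>1" if j: "j \<in> {1..p+1}" "j \<noteq> i" for j
  proof (cases "j < i")
    case True
    have "\<theta> j \<le> \<theta> (i - 1)" "\<theta> 0 < \<theta> j" "\<theta> (i + 1) \<le> \<theta> (p + 1)"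
      using True j i by (auto intro!: \<theta>_le \<theta>_less)
    then show ?thesis using \<kappa>1 \<delta>(1) \<theta>_0 by auto
  next
    case False
    have "\<theta> (i + 1) \<le> \<theta> j" "\<theta> j \<le> \<theta> (p + 1)" "\<theta> 0 \<le> \<theta> (i - 1)"
      using False j i by (auto intro!: \<theta>_le)
    then show ?thesis using \<kappa>1 \<delta>(1) \<theta>_0 by auto
  qed
  have D'_mem: "\<eta>0 + 1 / (a * z) \<in> D'" if "z \<noteq> 0" "\<bar>Im (Ln z)\<bar> < \<kappa>1" "1 - z \<notin> \<real>\<^sub>\<le>\<^sub>0" for z
  proof -
    have tt: "t j - t (p + 1) = rcis (norm (t j - t (p + 1))) (\<theta> j)" "t j - t (p + 1) \<noteq> 0" if "j \<in> {1..p}" for j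
      using \<theta>_arg[OF that] t_ne[OF that] by (auto simp: c0_def)
    have "\<eta>0 + 1 / (a * z) \<in> UNIV - ((\<Union>j\<in>{1..p}. closed_segment \<eta>0 (\<eta>0 + 1 / (t j - t (p + 1)))) \<union>
        {\<eta>0 + of_real s * cis (- \<theta> (p + 1)) | s. s \<ge> 0})"
      using moebius_in_cut_plane[where tt = "\<lambda>j. t j - t (p + 1)", OF tt i gap _ that, of \<eta>0] \<kappa>1(2) pi3
      unfolding a_def c0_def by simp
    then show ?thesis unfolding D' using t' by simp
  qed
  have zeta: "\<eta>0 + 1 / (a * z) - t' i = (1 - z) / (a * z)" if "z \<noteq> 0" for z
  proof -
    have "t' i = \<eta>0 + 1 / a" using t'[OF i] by (simp add: a_def c0_def)
    show ?thesis unfolding \<open>t' i = _\<close> using a that by (simp add: field_simps)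
  qed
  \<comment> \<open>Real \<open>z\<close> slightly below \<open>1\<close> correspond to points of
    \<open>D'\<close> close to \<open>t' i\<close>.\<close>
  have nearw: "\<exists>x\<in>D'. 0 < norm (x - t' i) \<and> norm (x - t' i) < e" if e: "e > 0" for e
  proof -
    define y where "y = min (1 / 2) (e * norm a / 4)"
    have y: "0 < y" "y \<le> 1 / 2" "y \<le> e * norm a / 4" using e a by (auto simp: y_def)
    define z where "z = complex_of_real (1 - y)"
    have z: "z \<noteq> 0" "Im (Ln z) = 0" "1 - z = of_real y" using y Ln_of_real[of "1 - y"] by (auto simp: z_def simp del: of_real_diff) simp
    have nz: "norm z = 1 - y" using y by (simp add: z_def del: of_real_diff)
    have "norm ((1 - z) / (a * z)) = y / (norm a * (1 - y))" using y nz z(3) by (simp add: norm_divide norm_mult)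
    also have "\<dots> < e"
    proof -
      have "e * norm a * (1 / 2) \<le> e * norm a * (1 - y)" using y e a by (intro mult_left_mono) auto
      moreover have "0 < e * norm a" using e a by simp
      ultimately have "y < e * norm a * (1 - y)" using y by linarith
      then show ?thesis using y a by (simp add: pos_divide_less_eq mult.assoc)
    qed
    finally show ?thesis
      using D'_mem[of z] z y a zeta[OF z(1)] \<kappa>1 by (intro bexI[of _ "\<eta>0 + 1 / (a * z)"]) (auto simp: complex_nonpos_Reals_iff)
  qed
  have nearinf: "\<exists>x\<in>D'. 0 < norm (1 / (x - \<eta>0)) \<and> norm (1 / (x - \<eta>0)) < e" if e: "e > 0" for e
  proof -
    define y where "y = min (1 / 2) (e / norm a / 2)"
    have y: "0 < y" "y \<le> 1 / 2" "y \<le> e / norm a / 2" using e a by (auto simp: y_def)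
    define z where "z = complex_of_real y"
    have z: "z \<noteq> 0" "Im (Ln z) = 0" "1 - z = of_real (1 - y)" using y by (auto simp: z_def Ln_of_real)
    have "norm (a * z) < e"
    proof -
      have "y < e / norm a" using y e a by (auto simp: field_simps)
      then show ?thesis using y a by (simp add: norm_mult z_def field_simps)
    qed
    then show ?thesis
      using D'_mem[of z] z y a \<kappa>1 by (intro bexI[of _ "\<eta>0 + 1 / (a * z)"]) (auto simp: complex_nonpos_Reals_iff simp del: of_real_diff)
  qed
  have wsol: "solves_system T' A D' (w i k h)"
    and wloc: "local_form D' (\<lambda>z. z - t' i) (\<lambda>z. pow_from (- \<theta> i - pi) (z - t' i) (lam i k)) (eps n (ix + 1)) (w i k h)"
  proof -
    have "(\<Sum>j=1..<i. nn j) + (\<Sum>j=1..<k. ell i j) + h = ix + 1" using h by (auto simp: ix_def)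
    then show "solves_system T' A D' (w i k h)"
      "local_form D' (\<lambda>z. z - t' i) (\<lambda>z. pow_from (- \<theta> i - pi) (z - t' i) (lam i k)) (eps n (ix + 1)) (w i k h)"
      using w[OF i k h] by auto
  qed
  obtain r0 \<phi> where r0: "r0 > 0" and \<phi>: "\<And>l. l < n \<Longrightarrow> \<phi> l holomorphic_on ball 0 r0"
    "\<And>l. l < n \<Longrightarrow> \<phi> l 0 = eps n (ix + 1) $ l"
    "\<And>l x. l < n \<Longrightarrow> x \<in> D' \<Longrightarrow> norm (x - t' i) < r0 \<Longrightarrow> w i k h x $ l = pow_from (- \<theta> i - pi) (x - t' i) (lam i k) * \<phi> l (x - t' i)"
    by (rule local_form_obtains[OF wloc _ nearw]) (auto simp: eps_def)
  define wi where "wi = (\<lambda>kh :: nat \<times> nat. winf (fst kh) (snd kh))"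
  have winf': "solves_system T' A D' (wi kh)"
    "local_form D' (\<lambda>z. 1 / (z - \<eta>0)) (\<lambda>z. pow_from (- \<theta> (p + 1)) (z - \<eta>0) (mk kh)) (P *\<^sub>v eps n (idx kh + 1)) (wi kh)" if kK: "kh \<in> K" for kh
  proof -
    obtain k h where kh: "kh = (k, h)" "k \<in> {1..q}" "h \<in> {1..m k}" using kK unfolding K_def by blast
    have "(\<Sum>j=1..<k. m j) + h = idx kh + 1" using kh by (auto simp: idx_def)
    then show "solves_system T' A D' (wi kh)"
      "local_form D' (\<lambda>z. 1 / (z - \<eta>0)) (\<lambda>z. pow_from (- \<theta> (p + 1)) (z - \<eta>0) (mk kh)) (P *\<^sub>v eps n (idx kh + 1)) (wi kh)"
      using winf[OF kh(2,3)] by (auto simp: wi_def mk_def kh(1))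
  qed
  obtain r1 \<psi> where r1: "r1 > 0" and \<psi>: "\<And>kh l. kh \<in> K \<Longrightarrow> l < n \<Longrightarrow> \<psi> kh l holomorphic_on ball 0 r1"
    "\<And>kh l. kh \<in> K \<Longrightarrow> l < n \<Longrightarrow> \<psi> kh l 0 = (P *\<^sub>v eps n (idx kh + 1)) $ l"
    "\<And>kh l x. kh \<in> K \<Longrightarrow> l < n \<Longrightarrow> x \<in> D' \<Longrightarrow> norm (1 / (x - \<eta>0)) < r1 \<Longrightarrow>
      wi kh x $ l = pow_from (- \<theta> (p + 1)) (x - \<eta>0) (mk kh) * \<psi> kh l (1 / (x - \<eta>0))"
    by (rule local_form_family[where u = wi, OF K(1) winf'(2) _ _ nearinf, of n]) (use P(1) in auto)
  have \<psi>0: "\<psi> kh l 0 = Pf l (idx kh)" if "kh \<in> K" "l < n" for kh l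
    using \<psi>(2)[OF that] that P(1) idx[OF that(1)] by (simp add: eps_def Pf_def scalar_prod_right_unit)

  \<comment> \<open>\<open>\<kappa>1\<close> keeps the other cuts away. The second bound places the
    part of the thin region on the cut \<open>z \<ge> 1\<close> inside the disc of convergence at
    \<open>t' i\<close>, by \<open>thin_cut\<close>.\<close>
  define \<kappa> where "\<kappa> = min \<kappa>1 (r0 * norm a)"
  have \<kappa>: "0 < \<kappa>" "\<kappa> \<le> \<kappa>1" "\<kappa> \<le> r0 * norm a" using \<kappa>1 r0 a by (auto simp: \<kappa>_def)
  interpret okubo_rl n \<sigma> Af Pf Qf \<mu> \<rho>1 \<rho>2 "thin \<kappa>"
  proof (intro okubo_rl.intro rl_domain_thin \<kappa>, unfold_locales)
    show "\<mu> j \<notin> \<int>" if "j < n" for j using \<mu>blk[OF that] mu_nonint by auto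
    show "\<rho>2 \<notin> \<int>" using mu_nonint[of q] q by (simp add: \<rho>2_def)
  qed (use \<sigma>nz conjugate_diag_entries[OF A(1) P(1-4) A'(1) A'off] in \<open>auto simp: Af_def Pf_def Qf_def \<mu>_def\<close>)
  have thin1: "z \<noteq> 0" "0 < Re z" "\<bar>Im (Ln z)\<bar> < \<kappa>1" if "z \<in> thin \<kappa>" for z
    using abs_Im_Ln_thin[OF \<kappa>(1) that] \<kappa>(2) thin_pos[OF \<kappa>(1) that] by auto
  have D'_thin: "\<eta>0 + 1 / (a * z) \<in> D'" if "z \<in> thin \<kappa>" "1 - z \<notin> \<real>\<^sub>\<le>\<^sub>0" for z
    by (rule D'_mem[OF thin1(1,3)]) fact+
  have \<phi>': "w i k h (\<eta>0 + 1 / (a * z)) $ l = exp (- \<nu> * L) * (1 - z) powr \<nu> * z powr (- \<nu>) * \<phi> l ((1 - z) / (a * z))"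
    if "l < n" "z \<in> thin \<kappa>" "1 - z \<notin> \<real>\<^sub>\<le>\<^sub>0" "norm ((1 - z) / (a * z)) < r0" for l z
  proof -
    have "pow_from (- \<theta> i - pi) ((1 - z) / (a * z)) \<nu> = exp (- \<nu> * L) * (1 - z) powr \<nu> * z powr (- \<nu>)"
      unfolding imL[symmetric] by (rule pow_from_moebius_one[OF eL thin1(2)[OF that(2)] that(3)])
    then show ?thesis
      using \<phi>(3)[OF that(1) D'_thin[OF that(2,3)]] that(4) unfolding zeta[OF thin1(1)[OF that(2)]] by (simp add: \<nu>_def)
  qed
  have \<psi>': "wi kh (\<eta>0 + 1 / (a * z)) $ l = exp (- mk kh * L) * z powr (- mk kh) * \<psi> kh l (a * z)"
    if "kh \<in> K" "l < n" "z \<in> thin \<kappa>" "1 - z \<notin> \<real>\<^sub>\<le>\<^sub>0" "norm (a * z) < r1" for kh l z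
  proof -
    have "\<theta> 0 \<le> \<theta> (i - 1)" "\<theta> (i + 1) \<le> \<theta> (p + 1)" using i by (auto intro!: \<theta>_le)
    then have "pow_from (- \<theta> (p + 1)) (1 / (a * z)) (mk kh) = exp (- mk kh * L) * z powr (- mk kh)"
      by (intro pow_from_moebius_infinity[OF eL thin1(1)[OF that(3)]])
        (use imL thin1(3)[OF that(3)] \<kappa>1 \<delta>(1) \<theta>_0 in auto)
    then show ?thesis
      using \<psi>(3)[OF that(1,2) D'_thin[OF that(3,4)]] that(5) by simp
  qed
  have wode: "((\<lambda>x. v x $ l) has_field_derivative deriv (\<lambda>x. v x $ l) \<zeta>) (at \<zeta>)"
    "(\<zeta> - (\<eta>0 + 1 / (a * \<sigma> l))) * deriv (\<lambda>x. v x $ l) \<zeta> = (\<Sum>j<n. Af l j * v \<zeta> $ j)"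
    if "solves_system T' A D' v" "l < n" "\<zeta> \<in> D'" for v :: "complex \<Rightarrow> complex vec" and l \<zeta>
    using solves_systemD[OF that(1) A(1) Tc(2) Toff(2) that(3,2)] by (simp_all add: T'\<sigma>[OF that(2)] Af_def)
  define cc where "cc = (\<lambda>kh :: nat \<times> nat. c (fst kh) (snd kh) i k h)"
  have conn: "w i k h \<zeta> $ l = (\<Sum>kh\<in>K. cc kh * wi kh \<zeta> $ l)" if "l < n" "\<zeta> \<in> D'" for l \<zeta>
    unfolding c[OF i k h that(2,1)] K_def cc_def wi_def by (simp add: sum.Sigma split_def)

  \<comment> \<open>Entries of the reduced system\<close>
  have AP_e: "AP $$ (x, y) = Af x y" "AP $$ (x, n + y) = Pf x y"
    "AP $$ (n + x, y) = - ((\<mu> x - \<rho>1) * (\<mu> x - \<rho>2) * Qf x y)"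
    "AP $$ (n + x, n + y) = (if x = y then \<rho>1 + \<rho>2 - \<mu> x else 0)" if "x < n" "y < n" for x y
    using okubo_matrix_entries[OF A(1) P(1,2) A'c A'off AP that] by (auto simp: Af_def Pf_def Qf_def \<mu>_def \<rho>1_def \<rho>2_def)
  have A''e: "A'' $$ (x, y) = AP $$ (x, y)" if "x < N" "y < N" for x y
    using that by (simp add: A'' diag_subblock_def)
  have A''c: "A'' \<in> carrier_mat N N" by (simp add: A'' diag_subblock_def)
  have T''eq: "T'' = four_block_mat T (0\<^sub>m n n') (0\<^sub>m n' n) (c0 \<cdot>\<^sub>m 1\<^sub>m n')"
  proof -
    have "T'' = diag_block_mat ([T] @ [c0 \<cdot>\<^sub>m 1\<^sub>m n'])" by (simp only: T'' c0_def n'_def append.simps)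
    then show ?thesis using Tc(1) by (simp only: diag_block_mat_last diag_block_mat_singleton Let_def) simp
  qed
  have T''c: "T'' \<in> carrier_mat N N" using Tc(1) by (simp add: T''eq n'(3))
  have T''e: "T'' $$ (x, y) = (if x = y then if x < n then T $$ (x, x) else c0 else 0)" if "x < N" "y < N" for x y
    using that Tc(1) Toff(1)[of x y] by (auto simp: T''eq n'(3))

  have T''off: "T'' $$ (x, y) = 0" if "x < N" "y < N" "x \<noteq> y" for x y
    using T''e[OF that(1,2)] that(3) by simp
  have T''l: "T'' $$ (l, l) = c0 + a * \<sigma> l" if "l < n" for l
    using T''e[of l l] that n'(3) T\<sigma>[of l] by simp
  have T''j: "T'' $$ (n + j, n + j) = c0" if "j < n'" for j
    using T''e[of "n + j" "n + j"] that n'(3) by simp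
  have A''1: "A'' $$ (l, j) = Af l j" if "l < n" "j < n" for l j
    using A''e[of l j] AP_e(1)[OF that] that n'(3) by simp
  have A''2: "A'' $$ (l, n + j) = Pf l j" if "l < n" "j < n'" for l j
    using A''e[of l "n + j"] AP_e(2)[of l j] that n'(2,3) by simp
  have A''3: "A'' $$ (n + j, l) = - ((\<mu> j - \<rho>1) * (\<mu> j - \<rho>2) * Qf j l)" if "j < n'" "l < n" for j l
    using A''e[of "n + j" l] AP_e(3)[of j l] that n'(2,3) by simp
  have A''4: "A'' $$ (n + j, n + x) = (if j = x then \<rho>1 + \<rho>2 - \<mu> j else 0)" if "j < n'" "x < n'" for j x
    using A''e[of "n + j" "n + x"] AP_e(4)[of j x] that n'(2,3) by simp
  \<comment> \<open>The sector is a parameter so that one argument serves both signs. It has to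
    carry the solutions and to contain the image of the half of the thin region belonging to
    \<open>s\<close>.\<close>
  have main: "\<exists>H :: complex \<Rightarrow> complex vec. (\<forall>j<N. (\<lambda>x. H x $ j) analytic_on {c0}) \<and>
      (\<forall>x\<in>sector c0 \<alpha> \<beta>. \<forall>j<N. U i k h x $ j =
        (\<Sum>k'=1..q-2. \<Sum>h'=1..m k'. C s k' h' i k h * V k' h' x $ j) + H x $ j)"
    if s: "s \<in> {1, -1}" and sec: "sector c0 \<alpha> \<beta> \<subseteq> Sp i \<union> Sm i" and ab: "\<beta> \<le> \<alpha> + 2 * pi"
      and half: "\<And>z. z \<in> half_thin s \<kappa>1 \<Longrightarrow> c0 + a * z \<in> sector c0 \<alpha> \<beta>" for s \<alpha> \<beta>
  proof -
    define S where "S = half_thin s \<kappa>"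
    define dd where "dd = (\<lambda>kh :: nat \<times> nat. C s (fst kh) (snd kh) i k h)"
    define VV where "VV = (\<lambda>kh :: nat \<times> nat. V (fst kh) (snd kh))"
    define E where "E = exp (of_real s * of_real pi * \<i> * \<nu>)"
    let ?X = "Sp i \<union> Sm i" and ?Y = "\<Union>i\<in>{1..p}. Sp i \<union> Sm i"
    have XY: "?X \<subseteq> ?Y" using i by auto
    note S = half_thin[OF \<kappa>(1) s, folded S_def]
    have lim: "0 islimpt S" "1 islimpt S" using S(5)[of 0] S(5)[of 1] by simp_all
    have S0: "0 \<notin> S" by (auto simp: S_def half_thin_def)
    have SD: "c0 + a * z \<in> sector c0 \<alpha> \<beta>" if "z \<in> S" for z
      using half that thin_mono[OF \<kappa>(2,1)] by (auto simp: S_def half_thin_def)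
    have SX: "c0 + a * z \<in> ?X" "c0 + a * z \<in> ?Y" if "z \<in> S" for z
      using SD[OF that] sec XY by blast+
    have ti: "c0 + a * z - t i = a * (z - 1)" for z by (simp add: a_def algebra_simps)
    have tc: "c0 + a * z - t (p + 1) = a * z" for z by (simp add: c0_def)
    have ixN: "(\<Sum>j=1..<i. nn j) + (\<Sum>j=1..<k. ell i j) + h = ix + 1" using h by (auto simp: ix_def)
    have Usol: "solves_system T'' A'' ?X (U i k h)"
      and Uloc: "local_form ?X (\<lambda>x. x - t i) (\<lambda>x. pow_from (\<theta> i - pi) (x - t i) (lam i k)) (eps N (ix + 1)) (U i k h)"
      using U[OF i k h] unfolding ixN by auto
    have Vs: "solves_system T'' A'' ?Y (VV kh)"
      "local_form ?Y (\<lambda>x. x - t (p + 1)) (\<lambda>x. pow_from (\<theta> 0) (x - t (p + 1)) (\<rho>1 + \<rho>2 - mk kh)) (eps N (n + idx kh + 1)) (VV kh)"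
      if kK: "kh \<in> K0" for kh
    proof -
      obtain k h where kh: "kh = (k, h)" "k \<in> {1..q-2}" "h \<in> {1..m k}" using kK unfolding K0_def by blast
      have e: "n + (\<Sum>j=1..<k. m j) + h = n + idx kh + 1" using kh by (auto simp: idx_def)
      show "solves_system T'' A'' ?Y (VV kh)"
        "local_form ?Y (\<lambda>x. x - t (p + 1)) (\<lambda>x. pow_from (\<theta> 0) (x - t (p + 1)) (\<rho>1 + \<rho>2 - mk kh)) (eps N (n + idx kh + 1)) (VV kh)"
        using V[OF kh(2,3)] unfolding e by (auto simp: VV_def mk_def kh(1) \<rho>1_def \<rho>2_def)
    qed
    have nearU: "\<exists>x\<in>?X. 0 < norm (x - t i) \<and> norm (x - t i) < e" if "e > 0" for e
    proof -
      have "0 < e / norm a" using that a by simp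
      then obtain z where z: "z \<in> S" "z \<noteq> 1" "dist z 1 < e / norm a"
        using lim(2) unfolding islimpt_approachable by blast
      then have "norm (a * (z - 1)) < e" using a by (simp add: dist_norm norm_mult pos_less_divide_eq mult.commute)
      then show ?thesis using SX(1)[OF z(1)] z(2) a ti[of z] by (intro bexI[of _ "c0 + a * z"]) auto
    qed
    have nearV: "\<exists>x\<in>?Y. 0 < norm (x - t (p + 1)) \<and> norm (x - t (p + 1)) < e" if "e > 0" for e
    proof -
      have "0 < e / norm a" using that a by simp
      then obtain z where z: "z \<in> S" "z \<noteq> 0" "dist z 0 < e / norm a"
        using lim(1) unfolding islimpt_approachable by blast
      then have "norm (a * z) < e" using a by (simp add: norm_mult pos_less_divide_eq mult.commute)
      then show ?thesis using SX(2)[OF z(1)] z(2) a tc[of z] by (intro bexI[of _ "c0 + a * z"]) auto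
    qed
    obtain r2 \<phi>u where r2: "r2 > 0" and \<phi>u: "\<And>l. l < N \<Longrightarrow> \<phi>u l holomorphic_on ball 0 r2"
      "\<And>l. l < N \<Longrightarrow> \<phi>u l 0 = eps N (ix + 1) $ l"
      "\<And>l x. l < N \<Longrightarrow> x \<in> ?X \<Longrightarrow> norm (x - t i) < r2 \<Longrightarrow> U i k h x $ l = pow_from (\<theta> i - pi) (x - t i) (lam i k) * \<phi>u l (x - t i)"
      by (rule local_form_obtains[OF Uloc _ nearU]) (auto simp: eps_def)
    obtain r3 \<psi>u where r3: "r3 > 0" and \<psi>u: "\<And>kh l. kh \<in> K0 \<Longrightarrow> l < N \<Longrightarrow> \<psi>u kh l holomorphic_on ball 0 r3"
      "\<And>kh l. kh \<in> K0 \<Longrightarrow> l < N \<Longrightarrow> \<psi>u kh l 0 = eps N (n + idx kh + 1) $ l"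
      "\<And>kh l x. kh \<in> K0 \<Longrightarrow> l < N \<Longrightarrow> x \<in> ?Y \<Longrightarrow> norm (x - t (p + 1)) < r3 \<Longrightarrow>
        VV kh x $ l = pow_from (\<theta> 0) (x - t (p + 1)) (\<rho>1 + \<rho>2 - mk kh) * \<psi>u kh l (x - t (p + 1))"
      by (rule local_form_family[where u = VV, OF K(2) Vs(2) _ _ nearV, of N]) (auto simp: eps_def)
    \<comment> \<open>The zero padding of \<open>normalised_system\<close>, now for the local forms
      of the lower block.\<close>
    define \<psi>v where "\<psi>v = (\<lambda>kh j. if j < n' then \<psi>u kh (n + j) else (\<lambda>_. 0))"
    let ?u = "\<lambda>v l z. v (c0 + a * z) $ l" and ?v = "\<lambda>v j z. if j < n' then v (c0 + a * z) $ (n + j) else 0"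
    have Udata: "U i k h (c0 + a * z) $ l = E * exp (\<nu> * L) * (1 - z) powr \<nu> * \<phi>u l (a * (z - 1))"
      if "l < N" "z \<in> S" "norm (a * (z - 1)) < r2" for l z
    proof -
      have "pow_from (\<theta> i - pi) (a * (z - 1)) \<nu> = E * exp (\<nu> * L) * (1 - z) powr \<nu>"
        unfolding E_def imL[symmetric] by (rule pow_from_at_one[OF eL s]) (use that(2) in \<open>simp add: S_def half_thin_def\<close>)
      then show ?thesis using \<phi>u(3)[OF that(1) SX(1)[OF that(2)]] that(3) unfolding ti \<nu>_def by simp
    qed
    have Vdata: "VV kh (c0 + a * z) $ l = exp ((\<rho>1 + \<rho>2 - mk kh) * L) * z powr (\<rho>1 + \<rho>2 - mk kh) * \<psi>u kh l (a * z)"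
      if "kh \<in> K0" "l < N" "z \<in> S" "norm (a * z) < r3" for kh l z
    proof -
      have z: "z \<in> thin \<kappa>" using that(3) S(3) by auto
      have "\<theta> 0 \<le> \<theta> (i - 1)" "\<theta> (i + 1) \<le> \<theta> (p + 1)" using i by (auto intro!: \<theta>_le)
      then have "pow_from (\<theta> 0) (a * z) (\<rho>1 + \<rho>2 - mk kh) = exp ((\<rho>1 + \<rho>2 - mk kh) * L) * z powr (\<rho>1 + \<rho>2 - mk kh)"
        by (intro pow_from_at_zero[OF eL thin1(1)[OF z]]) (use imL thin1(3)[OF z] \<kappa>1 \<delta>(1) \<theta>_0 in auto)
      then show ?thesis using \<psi>u(3)[OF that(1,2) SX(2)[OF that(3)]] that(4) unfolding tc by simp
    qed
    have sys: "\<And>l. l < n \<Longrightarrow> ?u v l holomorphic_on S" "\<And>j. j < n \<Longrightarrow> ?v v j holomorphic_on S"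
      "\<And>l z. l < n \<Longrightarrow> z \<in> S \<Longrightarrow> (z - \<sigma> l) * deriv (?u v l) z = (\<Sum>m<n. Af l m * ?u v m z) + (\<Sum>j<n. Pf l j * ?v v j z)"
      "\<And>j z. j < n \<Longrightarrow> z \<in> S \<Longrightarrow>
        z * deriv (?v v j) z = (\<rho>1 + \<rho>2 - \<mu> j) * ?v v j z - (\<mu> j - \<rho>1) * (\<mu> j - \<rho>2) * (\<Sum>l<n. Qf j l * ?u v l z)"
      if "solves_system T'' A'' X v" "\<And>z. z \<in> S \<Longrightarrow> c0 + a * z \<in> X" for v :: "complex \<Rightarrow> complex vec" and X
      by (rule normalised_system[OF that(1) T''c A''c T''off n'(3,2) a T''l T''j A''1 A''2 A''3 A''4 van S(1) that(2)]; assumption)+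
    have \<phi>0: "\<phi>u l 0 = \<phi> l 0" if "l < n" for l
      using that \<phi>(2) \<phi>u(2) n'(3) \<sigma>ix(2) by (simp add: eps_def)
    have \<phi>1: "\<sigma> l = 1" if "l < n" "\<phi> l 0 \<noteq> 0" for l
      using that \<phi>(2) \<sigma>ix by (auto simp: eps_def split: if_splits)
    have \<psi>u0: "\<psi>u kh l 0 = 0" if "kh \<in> K0" "l < n" for kh l
      using that \<psi>u(2) n'(3) idx0[OF that(1)] by (simp add: eps_def)
    \<comment> \<open>The leading vector of \<open>VV kh\<close> is a unit vector in the lower
      block, and \<open>P\<close> maps it to the leading vector of the corresponding solution of the
      underlying system at infinity.\<close>
    have \<psi>v0: "(\<Sum>j<n. Pf l j * \<psi>v kh j 0) = \<psi> kh l 0" if "kh \<in> K0" "l < n" for kh l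
    proof -
      have khK: "kh \<in> K" using K(3) that(1) by blast
      have "\<psi>v kh j 0 = (if j = idx kh then 1 else 0)" if "j < n" for j
        using \<psi>u(2)[OF \<open>kh \<in> K0\<close>, of "n + j"] idx0[OF \<open>kh \<in> K0\<close>] n'(3) by (auto simp: \<psi>v_def eps_def)
      then have "(\<Sum>j<n. Pf l j * \<psi>v kh j 0) = (\<Sum>j<n. if j = idx kh then Pf l j else 0)"
        by (intro sum.cong) auto
      also have "\<dots> = Pf l (idx kh)" using idx(1)[OF khK] by simp
      finally show ?thesis using \<psi>0[OF khK that(2)] by simp
    qed
    have dd: "dd kh = E * exp ((2 * \<nu> - \<rho>1 - \<rho>2) * L) *
      (Gamma (mk kh + 1) * Gamma (mk kh - \<rho>1 - \<rho>2) / (Gamma (mk kh - \<rho>1) * Gamma (mk kh - \<rho>2))) * cc kh" for kh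
    proof -
      have "pow_arg (\<theta> i) (t i - t (p + 1)) (2 * lam i k - mu (q - 1) - mu q) = exp ((2 * \<nu> - \<rho>1 - \<rho>2) * L)"
        using pow_arg_exp[of L] unfolding imL eL by (simp add: a_def c0_def \<nu>_def \<rho>1_def \<rho>2_def)
      then show ?thesis unfolding dd_def C by (simp add: E_def mk_def cc_def \<nu>_def \<rho>1_def \<rho>2_def)
    qed
    have cut: "norm ((1 - z) / (a * z)) < r0" if "z \<in> thin \<kappa>" "1 - z \<in> \<real>\<^sub>\<le>\<^sub>0" for z
      by (rule thin_cut[OF that \<kappa>(3) a r0])
    have \<phi>uh: "\<phi>u l holomorphic_on ball 0 r2" if "l < n" for l
      using \<phi>u(1) that n'(3) by simp
    have \<psi>uh: "\<psi>u kh l holomorphic_on ball 0 r3" if "kh \<in> K0" "l < n" for kh l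
      using \<psi>u(1) that n'(3) by simp
    have Udata': "U i k h (c0 + a * z) $ l = E * exp (\<nu> * L) * (1 - z) powr \<nu> * \<phi>u l (a * (z - 1))"
      if "l < n" "z \<in> S" "norm (a * (z - 1)) < r2" for l z
      using Udata that n'(3) by simp
    have Vdata': "VV kh (c0 + a * z) $ l = exp ((\<rho>1 + \<rho>2 - mk kh) * L) * z powr (\<rho>1 + \<rho>2 - mk kh) * \<psi>u kh l (a * z)"
      if "kh \<in> K0" "l < n" "z \<in> S" "norm (a * z) < r3" for kh l z
      using Vdata that n'(3) by simp
    have \<psi>vh: "\<psi>v kh j holomorphic_on ball 0 r3" if "kh \<in> K0" "j < n" for kh j
      unfolding \<psi>v_def using \<psi>u(1)[OF that(1), of "n + j"] n'(3) by simp
    have \<psi>vdata: "?v (VV kh) j z = exp ((\<rho>1 + \<rho>2 - mk kh) * L) * z powr (\<rho>1 + \<rho>2 - mk kh) * \<psi>v kh j (a * z)"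
      if "kh \<in> K0" "j < n" "z \<in> S" "norm (a * z) < r3" for kh j z
      using Vdata[OF that(1) _ that(3,4), of "n + j"] n'(3) by (simp add: \<psi>v_def)
    obtain hu hv where hu: "\<And>l. l < n \<Longrightarrow> hu l analytic_on {0}" "\<And>j. j < n \<Longrightarrow> hv j analytic_on {0}"
      "\<And>l. l < n \<Longrightarrow> \<forall>\<^sub>F z in at 0 within S. ?u (U i k h) l z = (\<Sum>kh\<in>K0. dd kh * ?u (VV kh) l z) + hu l z"
      "\<And>j. j < n \<Longrightarrow> \<forall>\<^sub>F z in at 0 within S. ?v (U i k h) j z = (\<Sum>kh\<in>K0. dd kh * ?v (VV kh) j z) + hv j z"
      by (rule connection_thin_sector[where K = K and ?K0.0 = K0 and m = mk and c = cc and d = dd and \<nu> = \<nu> and L = L and t = a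
        and E = E and ?r0.0 = r0 and ?r1.0 = r1 and ?r2.0 = r2 and ?r3.0 = r3 and \<eta> = \<eta>0 and D' = D' and S = S
        and w = "\<lambda>l x. w i k h x $ l" and dw = "\<lambda>l. deriv (\<lambda>x. w i k h x $ l)"
        and wi = "\<lambda>kh l x. wi kh x $ l" and dwi = "\<lambda>kh l. deriv (\<lambda>x. wi kh x $ l)"
        and \<phi> = \<phi> and \<psi> = \<psi> and \<phi>u = \<phi>u and \<psi>u = \<psi>u and \<psi>v = \<psi>v
        and u = "?u (U i k h)" and v = "?v (U i k h)" and Vu = "\<lambda>kh. ?u (VV kh)" and Vv = "\<lambda>kh. ?v (VV kh)",
        OF \<nu>1 K(1) mk1 mk2 A0 A1 \<mu>m eL r0 r1 D'_thin cut wode[OF wsol] \<phi>(1) \<phi>' wode[OF winf'(1)] \<psi>(1) \<psi>' conn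
          S(1-4) lim sys[OF Usol SX(1)] r2 r3 \<phi>uh Udata' \<phi>0 \<phi>1 sys[OF Vs(1) SX(2)] \<psi>uh Vdata' \<psi>u0 \<psi>vh \<psi>vdata \<psi>v0 dd K(3) mk3 that];
        assumption)
    \<comment> \<open>The expansions hold so far only near \<open>c0\<close> in the thin half. Each
      component is extended to the whole sector, with \<open>hu\<close> for indices below
      \<open>n\<close> and \<open>hv\<close> for the others.\<close>
    have "\<exists>H. H analytic_on {c0} \<and> (\<forall>x\<in>sector c0 \<alpha> \<beta>. U i k h x $ j - (\<Sum>kh\<in>K0. dd kh * VV kh x $ j) = H x)"
      if j: "j < N" for j
    proof -
      have hol: "(\<lambda>x. v x $ j) holomorphic_on sector c0 \<alpha> \<beta>" if "solves_system T'' A'' X v" "sector c0 \<alpha> \<beta> \<subseteq> X" for X v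
        unfolding holomorphic_on_open[OF open_sector[OF ab]]
        using solves_systemD(1)[OF that(1) A''c T''c _ _ j] T''e that(2) by (metis subsetD)
      have F: "(\<lambda>x. U i k h x $ j - (\<Sum>kh\<in>K0. dd kh * VV kh x $ j)) holomorphic_on sector c0 \<alpha> \<beta>"
        by (intro holomorphic_intros hol[OF Usol sec] hol[OF Vs(1)]) (use sec XY in auto)
      show ?thesis
      proof (cases "j < n")
        case True
        show ?thesis
          by (rule sector_holomorphic_extension[OF F ab a hu(1)[OF True] S(1) lim(1) S0 SD])
            (use hu(3)[OF True] in \<open>auto elim!: eventually_mono\<close>)
      next
        case False
        then have j': "j - n < n" "j - n < n'" "n + (j - n) = j" using j n' by auto
        show ?thesis
          by (rule sector_holomorphic_extension[OF F ab a hu(2)[OF j'(1)] S(1) lim(1) S0 SD])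
            (use hu(4)[OF j'(1)] j' in \<open>auto elim!: eventually_mono\<close>)
      qed
    qed
    then have "\<forall>j\<in>{..<N}. \<exists>H. H analytic_on {c0} \<and> (\<forall>x\<in>sector c0 \<alpha> \<beta>. U i k h x $ j - (\<Sum>kh\<in>K0. dd kh * VV kh x $ j) = H x)"
      by blast
    from bchoice[OF this] obtain H where H: "\<And>j. j < N \<Longrightarrow> H j analytic_on {c0}"
      "\<And>j x. j < N \<Longrightarrow> x \<in> sector c0 \<alpha> \<beta> \<Longrightarrow> U i k h x $ j - (\<Sum>kh\<in>K0. dd kh * VV kh x $ j) = H j x"
      by (elim exE) auto
    have sumK0: "(\<Sum>k'=1..q-2. \<Sum>h'=1..m k'. C s k' h' i k h * V k' h' x $ j) = (\<Sum>kh\<in>K0. dd kh * VV kh x $ j)" for x j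
      unfolding K0_def dd_def VV_def by (simp add: sum.Sigma split_def)
    show ?thesis
      unfolding sumK0
      by (rule exI[of _ "\<lambda>x. vec N (\<lambda>j. H j x)"]) (use H in \<open>auto simp: algebra_simps\<close>)
  qed
  \<comment> \<open>\<open>L + Ln z\<close> is a logarithm of \<open>a z\<close> whose imaginary
    part differs from \<open>\<theta> i\<close> by less than \<open>\<kappa>1\<close>, on the side
    given by the sign of \<open>Im z\<close>. This places the two halves in the two sectors.\<close>
  have cut_image: "c0 + a * z = c0 + exp (L + Ln z)" "\<bar>Im (Ln z)\<bar> < \<kappa>1" if "z \<in> thin \<kappa>1" for z
  proof -
    have "z \<noteq> 0" using thin_pos[OF \<kappa>1(1) that] by auto
    then show "c0 + a * z = c0 + exp (L + Ln z)" using eL by (simp add: exp_add)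
  qed (rule abs_Im_Ln_thin[OF \<kappa>1(1) that])
  show "(\<exists>H :: complex \<Rightarrow> complex vec.
       (\<forall>j<N. (\<lambda>x. H x $ j) analytic_on {t (p + 1)}) \<and>
       (\<forall>x\<in>Sp i. \<forall>j<N. U i k h x $ j =
          (\<Sum>k'=1..q-2. \<Sum>h'=1..m k'. C 1 k' h' i k h * V k' h' x $ j) + H x $ j)) \<and>
    (\<exists>H :: complex \<Rightarrow> complex vec.
       (\<forall>j<N. (\<lambda>x. H x $ j) analytic_on {t (p + 1)}) \<and>
       (\<forall>x\<in>Sm i. \<forall>j<N. U i k h x $ j =
          (\<Sum>k'=1..q-2. \<Sum>h'=1..m k'. C (-1) k' h' i k h * V k' h' x $ j) + H x $ j))"
    unfolding Sp[OF i] Sm[OF i] c0_def[symmetric]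
  proof (intro conjI main)
    show "sector c0 (\<theta> i) (min (\<theta> (i + 1) - \<delta>) (\<theta> i + pi)) \<subseteq> Sp i \<union> Sm i"
      "sector c0 (max (\<theta> (i - 1) + \<delta>) (\<theta> i - pi)) (\<theta> i) \<subseteq> Sp i \<union> Sm i"
      unfolding Sp[OF i] Sm[OF i] c0_def by auto
    show "c0 + a * z \<in> sector c0 (\<theta> i) (min (\<theta> (i + 1) - \<delta>) (\<theta> i + pi))" if "z \<in> half_thin 1 \<kappa>1" for z
    proof -
      have z: "z \<in> thin \<kappa>1" "0 < Im z" "z \<noteq> 0" using that by (auto simp: half_thin_def)
      have "0 < Im (Ln z)" using Im_Ln_pos_lt[OF z(3)] z(2) by simp
      then show ?thesis
        unfolding cut_image(1)[OF z(1)] sector_eq_exp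
        by (intro imageI) (use cut_image(2)[OF z(1)] \<kappa>1 pi3 imL in auto)
    qed
    show "c0 + a * z \<in> sector c0 (max (\<theta> (i - 1) + \<delta>) (\<theta> i - pi)) (\<theta> i)" if "z \<in> half_thin (- 1) \<kappa>1" for z
    proof -
      have z: "z \<in> thin \<kappa>1" "Im z < 0" "z \<noteq> 0" using that by (auto simp: half_thin_def)
      have "Im (Ln z) < 0" using Im_Ln_pos_le[OF z(3)] z(2) cut_image(2)[OF z(1)] \<kappa>1 pi3 by auto
      then show ?thesis
        unfolding cut_image(1)[OF z(1)] sector_eq_exp
        by (intro imageI) (use cut_image(2)[OF z(1)] \<kappa>1 pi3 imL in auto)
    qed
  qed (use pi3 in auto)
qed

end
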